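(* Let $\Omega\subset\mathbb{R}^d$ ($d=2,3$), the data, the finite element spaces $W_h,\boldsymbol V_h,\boldsymbol H_h$, the time partition $0=t_0<\dots<t_N=T$ with $I_n=(t_{n-1},t_n]$, and the forms $J_\delta,J_d,J_p$ be as in the context. Let $\{p_{\tau,h},\boldsymbol q_{\tau,h}\}\in\mathcal W^{r,s}_{\tau,h}\times\boldsymbol{\mathcal V}^{r,s}_{\tau,h}$, $\boldsymbol u_{\tau,h}\in\boldsymbol{\mathcal Z}^{r,s+1}_{\tau,h}$ denote the fully discrete (monolithic) space-time MFEM($s$)dG($s+1$)--dG($r$) approximation of the quasi-static Biot system, with coefficients $P^j_{n,h},\boldsymbol Q^j_{n,h},\boldsymbol U^j_{n,h}$ on $I_n$, and let $p^k_{\tau,h},\boldsymbol q^k_{\tau,h},\boldsymbol u^k_{\tau,h}$ be the iterates of the fully discrete splitting scheme with stabilization parameter $L$ and penalty parameters $\delta_e$, with coefficients $P^{j,k}_{n,h},\boldsymbol Q^{j,k}_{n,h},\boldsymbol U^{j,k}_{n,h}$ on $I_n$. For $n\in\{1,\dots,N\}$ put $$S_p^{i,k}=\sum_{j=0}^r\alpha_{ij}\,(P^{j,k}_{n,h}-P^{j}_{n,h})\in W_h,\qquad i=0,\dots,r .$$ If the parameter $L>0$ and the penalty function $\delta=(\delta_e)_e$ in $J_\delta$ are chosen sufficiently large (that is, there are thresholds $L_0>0$ and $\delta_0>0$ such that the following holds whenever $L\ge L_0$ and $\delta_e\ge\delta_0$ for all $e\in\mathcal E_h^{\mathrm{int}}$),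 then: (1) the sequence $\{S_p^{i,k}\}_{k}$ converges in $W_h$, for each $i=0,\dots,r$ (and each $n=1,\dots,N$); (2) $\{p^k_{\tau,h}(t_n^\pm),\boldsymbol q^k_{\tau,h}(t_n^\pm),\boldsymbol u^k_{\tau,h}(t_n^\pm)\}$ converges to $\{p_{\tau,h}(t_n^\pm),\boldsymbol q_{\tau,h}(t_n^\pm),\boldsymbol u_{\tau,h}(t_n^\pm)\}$ in $W_h\times\boldsymbol V_h\times\boldsymbol H_h$ as $k\to\infty$, for $n=1,\dots,N$ (for the one-sided value $t_n^+$ only $n\le N-1$ is meant); (3) for each $n=1,\dots,N$, as $k\to\infty$, $p^k_{\tau,h}\to p_{\tau,h}$ in $L^2(I_n;W)$, and $\boldsymbol q^k_{\tau,h}\to\boldsymbol q_{\tau,h}$, $\boldsymbol u^k_{\tau,h}\to\boldsymbol u_{\tau,h}$ in $L^2(I_n;\boldsymbol L^2(\Omega))$.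
   Context: **Continuous problem.** $\Omega\subset\mathbb{R}^d$, $d\in\{2,3\}$, is a bounded polyhedral Lipschitz domain, $I=(0,T]$. The quasi-static Biot system for displacement $\boldsymbol u$, pressure $p$ and flux $\boldsymbol q$ is $$-\nabla\cdot\big(2\mu\,\boldsymbol\varepsilon(\boldsymbol u)+\lambda\,(\nabla\cdot\boldsymbol u)\boldsymbol I-b\,p\,\boldsymbol I\big)=\rho_b\boldsymbol g,\qquad \partial_t\Big(\tfrac1M p+\nabla\cdot(b\boldsymbol u)\Big)+\nabla\cdot\boldsymbol q=f,\quad \boldsymbol q=-\boldsymbol K\nabla p$$ in $\Omega\times I$, with homogeneous initial and Dirichlet boundary conditions for $p$ and $\boldsymbol u$. Here $\boldsymbol\varepsilon(\boldsymbol u)=(\nabla\boldsymbol u+(\nabla\boldsymbol u)^\top)/2$; $\mu,\lambda,b,\rho_b,M$ are positive constants; $\boldsymbol K$ is symmetric and uniformly positive definite; $\boldsymbol g(0)=\boldsymbol 0$; $f$ and $\boldsymbol g$ are such that their values at the time nodes below make sense. Put $\boldsymbol\sigma(\boldsymbol u)=2\mu\boldsymbol\varepsilon(\boldsymbol u)+\lambda(\nabla\cdot\boldsymbol u)\boldsymbol I$, $W=L^2(\Omega)$, $\boldsymbol V=\boldsymbol H(\mathrm{div};\Omega)$, $\boldsymbol L^2(\Omega)=L^2(\Omega)^d$. $\langle\cdot,\cdot\rangle$, $\langle\cdot,\cdot\rangle_K$, $\langle\cdot,\cdot\rangle_e$ are the $L^2$ inner products on $\Omega$, on an element $K$ and on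 an edge/face $e$. **Space discretization.** $\mathcal T_h=\{K\}$ is a finite element decomposition of $\overline\Omega$ into closed quadrilaterals ($d=2$) or hexahedra ($d=3$), with invertible maps $T_K:\widehat K\to K$ from the reference cube; $\mathcal E_h^{\mathrm{int}}$ is the set of interior edges (faces if $d=3$), each $e$ having a fixed unit normal $\boldsymbol\nu^e$. $\mathbb Q_l$ denotes polynomials of degree at most $l$ in each variable. Fix $s\ge0$. - $W_h=W_h^s=\{w_h\in L^2(\Omega): w_h|_K\circ T_K\in\mathbb Q_s\ \forall K\in\mathcal T_h\}$. - $\boldsymbol V_h=\boldsymbol V_h^s\subset\boldsymbol V$ is the Raviart--Thomas ($d=2$), resp. Raviart--Thomas--Nédélec ($d=3$), space of order $s$ on $\mathcal T_h$, so that $(W_h^s,\boldsymbol V_h^s)$ is the corresponding inf-sup stable pair. - $\boldsymbol H_h=\boldsymbol H_h^{s+1}$, where $\boldsymbol H_h^{l}=\{\boldsymbol z_h\in \boldsymbol L^2(\Omega): \boldsymbol z_h|_K\circ T_K\in\mathbb Q_l^d\ \forall K,\ \boldsymbol z_h|_{\partial\Omega}=\boldsymbol 0\}$ (no inter-element continuity). For $e\in\mathcal E_h^{\mathrm{int}}$ shared by $K,K'$, with $\boldsymbol\nu^e$ pointing from $K$ to $K'$: $\{w\}=\frac12((w|_K)|_e+(w|_{K'})|_e)$, $[w]=(w|_K)|_e-(w|_{K'})|_e$. With penalty parameters $\delta_e>0$ (constant on each $e$), $|e|$ the Lebesgue measure of $e$, and a fixed power $\beta>0$ depending on $d$, $$J_\delta(\boldsymbol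 y_h,\boldsymbol z_h)=\sum_{e\in\mathcal E_h^{\mathrm{int}}}\frac{\delta_e}{|e|^\beta}\langle[\boldsymbol y_h],[\boldsymbol z_h]\rangle_e,\qquad J_p(w_h,\boldsymbol z_h)=\sum_{e\in\mathcal E_h^{\mathrm{int}}}\langle\{w_h\}\boldsymbol\nu^e,[\boldsymbol z_h]\rangle_e,$$ $$J_d(\boldsymbol y_h,\boldsymbol z_h)=\sum_{e\in\mathcal E_h^{\mathrm{int}}}\big(\langle\{\boldsymbol\sigma(\boldsymbol y_h)\boldsymbol\nu^e\},[\boldsymbol z_h]\rangle_e+\langle\{\boldsymbol\sigma(\boldsymbol z_h)\boldsymbol\nu^e\},[\boldsymbol y_h]\rangle_e\big).$$ **Time discretization.** $0=t_0<t_1<\dots<t_N=T$, $I_n=(t_{n-1},t_n]$, $\tau_n=t_n-t_{n-1}$. Fix $r\ge0$. $\mathcal P_r(I_n;X)$ is the space of $X$-valued polynomials in time of degree at most $r$ on $I_n$. $\mathcal W^{r,s}_{\tau,h}$ is the set of $w\in L^2(I;W)$ with $w|_{I_n}\in\mathcal P_r(I_n;W_h)$ for all $n$ and $w(0)\in W_h$; $\boldsymbol{\mathcal V}^{r,s}_{\tau,h}$ the set of $\boldsymbol v\in L^2(I;\boldsymbol V)$ with $\boldsymbol v|_{I_n}\in\mathcal P_r(I_n;\boldsymbol V_h)$ and $\boldsymbol v(0)\in\boldsymbol V_h$; $\boldsymbol{\mathcal Z}^{r,s+1}_{\tau,h}$ the set of $\boldsymbol z\in L^2(I;\boldsymbol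 L^2(\Omega))$ with $\boldsymbol z|_{I_n}\in\mathcal P_r(I_n;\boldsymbol H_h)$ and $\boldsymbol z(0)\in\boldsymbol H_h$. Functions may be discontinuous at the $t_n$; $t_n^\pm$ denote one-sided limits. Let $t_{n,0},\dots,t_{n,r}\in I_n$ be the nodes of the $(r+1)$-point Gauss quadrature formula on $I_n$ (exact for degree $\le 2r+1$) and $\varphi_{n,j}\in\mathcal P_r(I_n;\mathbb R)$ the associated Lagrange basis. Set $$\gamma_i=\varphi_{n,i}(t_{n-1}^+),\quad \alpha_{ij}=\int_{I_n}\varphi_{n,j}'(t)\varphi_{n,i}(t)\,dt+\gamma_i\gamma_j,\quad \beta_{ii}=\frac1{\tau_n}\int_{I_n}\varphi_{n,i}(t)^2\,dt .$$ **Splitting scheme (iteration index $k$, parameter $L>0$).** On each $I_n$ write $p^k_{\tau,h}=\sum_j P^{j,k}_{n,h}\varphi_{n,j}$, $\boldsymbol q^k_{\tau,h}=\sum_j\boldsymbol Q^{j,k}_{n,h}\varphi_{n,j}$, $\boldsymbol u^k_{\tau,h}=\sum_j\boldsymbol U^{j,k}_{n,h}\varphi_{n,j}$ with coefficients in $W_h,\boldsymbol V_h,\boldsymbol H_h$. For $n=1,\dots,N$ successively, starting from given coefficients for $k=0$, for $k=0,1,2,\dots$: *Flow:* find $P^{i,k+1}_{n,h}\in W_h$, $\boldsymbol Q^{i,k+1}_{n,h}\in\boldsymbol V_h$, $i=0,\dots,r$, such that for all $w_h\in W_h$, $\boldsymbol v_h\in\boldsymbol V_h$ and $i=0,\dots,r$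 $$\frac1M\sum_{j=0}^r\alpha_{ij}\langle P^{j,k+1}_{n,h},w_h\rangle+L\sum_{j=0}^r\alpha_{ij}\langle P^{j,k+1}_{n,h}-P^{j,k}_{n,h},w_h\rangle+\tau_n\beta_{ii}\langle\nabla\cdot\boldsymbol Q^{i,k+1}_{n,h},w_h\rangle$$ $$=\tau_n\beta_{ii}\langle f(t_{n,i}),w_h\rangle-b\sum_{j=0}^r\alpha_{ij}\sum_{K}\langle\nabla\cdot\boldsymbol U^{j,k}_{n,h},w_h\rangle_K+\frac{\gamma_i}{M}\langle p^\infty_{\tau,h}(t_{n-1}^-),w_h\rangle+\gamma_i b\sum_K\langle\nabla\cdot\boldsymbol u^\infty_{\tau,h}(t_{n-1}^-),w_h\rangle_K,$$ $$\langle\boldsymbol K^{-1}\boldsymbol Q^{i,k+1}_{n,h},\boldsymbol v_h\rangle-\langle P^{i,k+1}_{n,h},\nabla\cdot\boldsymbol v_h\rangle=0 .$$ *Mechanics:* find $\boldsymbol U^{i,k+1}_{n,h}\in\boldsymbol H_h$, $i=0,\dots,r$, such that for all $\boldsymbol z_h\in\boldsymbol H_h$ and $i=0,\dots,r$ $$\sum_K\langle\boldsymbol\sigma(\boldsymbol U^{i,k+1}_{n,h}),\boldsymbol\varepsilon(\boldsymbol z_h)\rangle_K+J_\delta(\boldsymbol U^{i,k+1}_{n,h},\boldsymbol z_h)-J_d(\boldsymbol U^{i,k+1}_{n,h},\boldsymbol z_h)$$ $$=\rho_b\langle\boldsymbol g(t_{n,i}),\boldsymbol z_h\rangle+b\sum_K\langle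 P^{i,k+1}_{n,h},\nabla\cdot\boldsymbol z_h\rangle_K-b\,J_p(P^{i,k+1}_{n,h},\boldsymbol z_h).$$ Here $p^\infty_{\tau,h}(t_0^-)=0$, $\boldsymbol u^\infty_{\tau,h}(t_0^-)=\boldsymbol 0$, and for $n>1$ $p^\infty_{\tau,h}(t_{n-1}^-)=\lim_{k\to\infty}p^k_{\tau,h}(t_{n-1}^-)$, $\boldsymbol u^\infty_{\tau,h}(t_{n-1}^-)=\lim_{k\to\infty}\boldsymbol u^k_{\tau,h}(t_{n-1}^-)$ (the limits of the iteration on the preceding interval, i.e. the values $p_{\tau,h}(t_{n-1}^-)$, $\boldsymbol u_{\tau,h}(t_{n-1}^-)$ of the monolithic solution defined next). **Monolithic approximation MFEM($s$)dG($s+1$)--dG($r$).** It is the system formally obtained from the scheme for $k\to\infty$: on each $I_n$, $p_{\tau,h}=\sum_jP^j_{n,h}\varphi_{n,j}$, $\boldsymbol q_{\tau,h}=\sum_j\boldsymbol Q^j_{n,h}\varphi_{n,j}$, $\boldsymbol u_{\tau,h}=\sum_j\boldsymbol U^j_{n,h}\varphi_{n,j}$, where the coefficients $P^i_{n,h}\in W_h$, $\boldsymbol Q^i_{n,h}\in\boldsymbol V_h$, $\boldsymbol U^i_{n,h}\in\boldsymbol H_h$, $i=0,\dots,r$, satisfy, for all $w_h\in W_h$, $\boldsymbol v_h\in\boldsymbol V_h$, $\boldsymbol z_h\in\boldsymbol H_h$ and $i=0,\dots,r$, $$\frac1M\sum_{j=0}^r\alpha_{ij}\langle P^{j}_{n,h},w_h\rangle+\tau_n\beta_{ii}\langle\nabla\cdot\boldsymbol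 Q^{i}_{n,h},w_h\rangle$$ $$=\tau_n\beta_{ii}\langle f(t_{n,i}),w_h\rangle-b\sum_{j=0}^r\alpha_{ij}\sum_{K}\langle\nabla\cdot\boldsymbol U^{j}_{n,h},w_h\rangle_K+\frac{\gamma_i}{M}\langle p_{\tau,h}(t_{n-1}^-),w_h\rangle+\gamma_i b\sum_K\langle\nabla\cdot\boldsymbol u_{\tau,h}(t_{n-1}^-),w_h\rangle_K,$$ $$\langle\boldsymbol K^{-1}\boldsymbol Q^{i}_{n,h},\boldsymbol v_h\rangle-\langle P^{i}_{n,h},\nabla\cdot\boldsymbol v_h\rangle=0,$$ $$\sum_K\langle\boldsymbol\sigma(\boldsymbol U^{i}_{n,h}),\boldsymbol\varepsilon(\boldsymbol z_h)\rangle_K+J_\delta(\boldsymbol U^{i}_{n,h},\boldsymbol z_h)-J_d(\boldsymbol U^{i}_{n,h},\boldsymbol z_h)$$ $$=\rho_b\langle\boldsymbol g(t_{n,i}),\boldsymbol z_h\rangle+b\sum_K\langle P^{i}_{n,h},\nabla\cdot\boldsymbol z_h\rangle_K-b\,J_p(P^{i}_{n,h},\boldsymbol z_h),$$ with $p_{\tau,h}(t_0^-)=0$ and $\boldsymbol u_{\tau,h}(t_0^-)=\boldsymbol 0$ (the $L$-term of the splitting scheme vanishes in the limit). *)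

theory Defs
  imports "HOL-Analysis.Analysis" "HOL-Computational_Algebra.Polynomial"
begin

section \<open>Lebesgue spaces, weak divergence, differential operators\<close>

text \<open>
  Elements of the function spaces are represented by functions on the whole of \<open>real ^ 'd\<close>; their
  values off the domain, and on the mesh skeleton (a null set), are irrelevant.
\<close>

definition ip :: "(real^'d) set \<Rightarrow> (real^'d \<Rightarrow> 'b::real_inner) \<Rightarrow> (real^'d \<Rightarrow> 'b) \<Rightarrow> real" where
  "ip A f g = (LINT x|lebesgue_on A. f x \<bullet> g x)"

definition L2norm :: "(real^'d) set \<Rightarrow> (real^'d \<Rightarrow> 'b::real_inner) \<Rightarrow> real" where
  "L2norm A f = sqrt (ip A f f)"

definition L2 :: "(real^'d) set \<Rightarrow> (real^'d \<Rightarrow> 'b::euclidean_space) set" where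
  "L2 A = {f \<in> borel_measurable (lebesgue_on A). integrable (lebesgue_on A) (\<lambda>x. (norm (f x))\<^sup>2)}"

definition Jac :: "(real^'d \<Rightarrow> real^'d) \<Rightarrow> real^'d \<Rightarrow> real^'d^'d" where
  "Jac u x = matrix (frechet_derivative u (at x))"

definition eps :: "(real^'d \<Rightarrow> real^'d) \<Rightarrow> real^'d \<Rightarrow> real^'d^'d" where
  "eps u x = (1/2) *\<^sub>R (Jac u x + transpose (Jac u x))"

definition dvg :: "(real^'d \<Rightarrow> real^'d) \<Rightarrow> real^'d \<Rightarrow> real" where
  "dvg u x = trace (Jac u x)"

definition grad :: "(real^'d \<Rightarrow> real) \<Rightarrow> real^'d \<Rightarrow> real^'d" where
  "grad \<phi> x = (\<chi> i. frechet_derivative \<phi> (at x) (axis i 1))"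

text \<open>Continuously differentiable test functions define the same weak divergence of square integrable
  fields as smooth ones, by mollification.\<close>

definition C1_compact :: "(real^'d) set \<Rightarrow> (real^'d \<Rightarrow> real) set" where
  "C1_compact A = {\<phi>. (\<forall>x. \<phi> differentiable (at x)) \<and> continuous_on UNIV (grad \<phi>) \<and>
     (\<exists>C. compact C \<and> C \<subseteq> A \<and> (\<forall>x. x \<notin> C \<longrightarrow> \<phi> x = 0))}"

definition is_weak_div :: "(real^'d) set \<Rightarrow> (real^'d \<Rightarrow> real^'d) \<Rightarrow> (real^'d \<Rightarrow> real) \<Rightarrow> bool" where
  "is_weak_div A v g \<longleftrightarrow> g \<in> L2 A \<and> (\<forall>\<phi>\<in>C1_compact A. ip A v (grad \<phi>) = - ip A g \<phi>)"

definition Hdiv :: "(real^'d) set \<Rightarrow> (real^'d \<Rightarrow> real^'d) set" where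
  "Hdiv A = {v \<in> L2 A. \<exists>g. is_weak_div A v g}"

text \<open>\<open>dvg\<close> is the classical, hence elementwise, divergence; \<open>wdiv\<close> is the divergence
  in \<open>H(div)\<close>, determined almost everywhere.\<close>

definition wdiv :: "(real^'d) set \<Rightarrow> (real^'d \<Rightarrow> real^'d) \<Rightarrow> real^'d \<Rightarrow> real" where
  "wdiv A v = (SOME g. is_weak_div A v g)"

definition Hdiv_norm :: "(real^'d) set \<Rightarrow> (real^'d \<Rightarrow> real^'d) \<Rightarrow> real" where
  "Hdiv_norm A v = sqrt ((L2norm A v)\<^sup>2 + (L2norm A (wdiv A v))\<^sup>2)"


section \<open>Domain and mesh\<close>

definition lipschitz_domain :: "(real^'d) set \<Rightarrow> bool" where
  "lipschitz_domain A \<longleftrightarrow> open A \<and> connected A \<and> bounded A \<and> A \<noteq> {} \<and>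
     (\<forall>x\<in>frontier A. \<exists>U n \<gamma> C. open U \<and> x \<in> U \<and> norm n = 1 \<and>
        C-lipschitz_on {y. n \<bullet> y = 0} \<gamma> \<and>
        A \<inter> U = {y \<in> U. n \<bullet> y < (\<gamma> (y - (n \<bullet> y) *\<^sub>R n) :: real)})"

definition polyhedral :: "(real^'d) set \<Rightarrow> bool" where
  "polyhedral A \<longleftrightarrow> (\<exists>\<P>. finite \<P> \<and> (\<forall>P\<in>\<P>. polytope P) \<and> closure A = \<Union>\<P>)"

definition ref_cube :: "(real^'d) set" where
  "ref_cube = cbox 0 1"

definition ref_Jac :: "(real^'d \<Rightarrow> real^'d) \<Rightarrow> real^'d \<Rightarrow> real^'d^'d" where
  "ref_Jac F y = matrix (frechet_derivative F (at y within ref_cube))"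

text \<open>Invertible maps onto an element are diffeomorphisms of class \<open>C\<^sup>1\<close> up to the boundary. A polytope
  that is such an image of the cube is a (convex) quadrilateral or a hexahedron with plane faces.\<close>

definition ref_diffeo :: "(real^'d \<Rightarrow> real^'d) \<Rightarrow> (real^'d) set \<Rightarrow> bool" where
  "ref_diffeo F K \<longleftrightarrow> bij_betw F ref_cube K \<and> F differentiable_on ref_cube \<and>
     continuous_on ref_cube (ref_Jac F) \<and> (\<forall>y\<in>ref_cube. det (ref_Jac F y) \<noteq> 0)"

record 'd mesh =
  region :: "(real^'d) set"
  cells :: "(real^'d) set set"
  refmap :: "(real^'d) set \<Rightarrow> real^'d \<Rightarrow> real^'d"
  nu :: "(real^'d) set \<Rightarrow> real^'d"

definition int_faces :: "('d::finite) mesh \<Rightarrow> (real^'d) set set" where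
  "int_faces X = {K \<inter> K' | K K'. K \<in> cells X \<and> K' \<in> cells X \<and> K \<noteq> K' \<and> (K \<inter> K') facet_of K}"

definition fe_mesh :: "('d::finite) mesh \<Rightarrow> bool" where
  "fe_mesh X \<longleftrightarrow> finite (cells X) \<and> \<Union>(cells X) = closure (region X) \<and>
     (\<forall>K\<in>cells X. polytope K \<and> ref_diffeo (refmap X K) K) \<and>
     (\<forall>K\<in>cells X. \<forall>K'\<in>cells X. K \<noteq> K' \<longrightarrow> (K \<inter> K') face_of K \<and> (K \<inter> K') face_of K') \<and>
     (\<forall>e\<in>int_faces X. norm (nu X e) = 1 \<and> (\<forall>x\<in>e. \<forall>y\<in>e. nu X e \<bullet> (x - y) = 0))"

text \<open>The two elements sharing the face \<open>e\<close>; the normal points from \<open>elem_from\<close> to \<open>elem_to\<close>.\<close>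

definition elem_from :: "('d::finite) mesh \<Rightarrow> (real^'d) set \<Rightarrow> (real^'d) set" where
  "elem_from X e = (THE K. K \<in> cells X \<and> e facet_of K \<and> (\<forall>x\<in>K. \<forall>y\<in>e. nu X e \<bullet> (x - y) \<le> 0))"

definition elem_to :: "('d::finite) mesh \<Rightarrow> (real^'d) set \<Rightarrow> (real^'d) set" where
  "elem_to X e = (THE K. K \<in> cells X \<and> e facet_of K \<and> (\<forall>x\<in>K. \<forall>y\<in>e. nu X e \<bullet> (x - y) \<ge> 0))"

text \<open>The value on the boundary of \<open>K\<close> of the restriction of \<open>w\<close> to \<open>K\<close>.\<close>

definition trace_from :: "(real^'d) set \<Rightarrow> (real^'d \<Rightarrow> 'b::t2_space) \<Rightarrow> real^'d \<Rightarrow> 'b" where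
  "trace_from K w x = Lim (at x within interior K) w"

definition avg :: "('d::finite) mesh \<Rightarrow> (real^'d) set \<Rightarrow> (real^'d \<Rightarrow> 'b::real_normed_vector) \<Rightarrow> real^'d \<Rightarrow> 'b" where
  "avg X e w x = (1/2) *\<^sub>R (trace_from (elem_from X e) w x + trace_from (elem_to X e) w x)"

definition jump :: "('d::finite) mesh \<Rightarrow> (real^'d) set \<Rightarrow> (real^'d \<Rightarrow> 'b::real_normed_vector) \<Rightarrow> real^'d \<Rightarrow> 'b" where
  "jump X e w x = trace_from (elem_from X e) w x - trace_from (elem_to X e) w x"

text \<open>
  Surface measure on a plane face \<open>e\<close> with unit normal \<open>n\<close>: by Fubini, the surface integral of a function over \<open>e\<close>
  is the volume integral, over the prism of height 1 with base \<open>e\<close>, of its extension that is constant in the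
  direction \<open>n\<close>. On the prism, the foot of the perpendicular is the closest point of \<open>e\<close>.
\<close>

definition prism :: "(real^'d) set \<Rightarrow> real^'d \<Rightarrow> (real^'d) set" where
  "prism e n = {x + h *\<^sub>R n | x h. x \<in> e \<and> 0 \<le> h \<and> h \<le> 1}"

definition face_measure :: "('d::finite) mesh \<Rightarrow> (real^'d) set \<Rightarrow> real" where
  "face_measure X e = measure lebesgue (prism e (nu X e))"

definition face_ip :: "('d::finite) mesh \<Rightarrow> (real^'d) set \<Rightarrow>
    (real^'d \<Rightarrow> 'b::real_inner) \<Rightarrow> (real^'d \<Rightarrow> 'b) \<Rightarrow> real" where
  "face_ip X e f g = ip (prism e (nu X e)) (\<lambda>y. f (closest_point e y)) (\<lambda>y. g (closest_point e y))"


section \<open>Finite element spaces\<close>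

text \<open>Polynomials of degree at most \<open>k i\<close> in the \<open>i\<close>-th variable.\<close>

definition Qpoly :: "('d \<Rightarrow> nat) \<Rightarrow> (real^'d \<Rightarrow> real) set" where
  "Qpoly k = {q. \<exists>c. q = (\<lambda>y. \<Sum>m | (\<forall>i. m i \<le> k i). c m * (\<Prod>i\<in>UNIV. (y $ i) ^ m i))}"

definition W_h :: "('d::finite) mesh \<Rightarrow> nat \<Rightarrow> (real^'d \<Rightarrow> real) set" where
  "W_h X s = {w \<in> L2 (region X). \<forall>K\<in>cells X. \<exists>q\<in>Qpoly (\<lambda>_. s).
     \<forall>y\<in>interior ref_cube. w (refmap X K y) = q y}"

text \<open>The Raviart--Thomas(--Nedelec) space on the cube, transported by the Piola map. The sign of the
  determinant is constant on the cube and does not affect the space.\<close>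

definition RT_ref :: "nat \<Rightarrow> (real^'d \<Rightarrow> real^'d) set" where
  "RT_ref s = {v. \<forall>i. (\<lambda>y. v y $ i) \<in> Qpoly (\<lambda>j. if j = i then s + 1 else s)}"

definition V_h :: "('d::finite) mesh \<Rightarrow> nat \<Rightarrow> (real^'d \<Rightarrow> real^'d) set" where
  "V_h X s = {v \<in> Hdiv (region X). \<forall>K\<in>cells X. \<exists>v'\<in>RT_ref s. \<forall>y\<in>interior ref_cube.
     v (refmap X K y) = (1 / det (ref_Jac (refmap X K) y)) *\<^sub>R (ref_Jac (refmap X K) y *v v' y)}"

definition H_h :: "('d::finite) mesh \<Rightarrow> nat \<Rightarrow> (real^'d \<Rightarrow> real^'d) set" where
  "H_h X l = {z \<in> L2 (region X).
     (\<forall>K\<in>cells X. \<exists>q. (\<forall>i. (\<lambda>y. q y $ i) \<in> Qpoly (\<lambda>_. l)) \<and>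
        (\<forall>y\<in>interior ref_cube. z (refmap X K y) = q y)) \<and>
     (\<forall>K\<in>cells X. \<forall>F. F facet_of K \<and> F \<subseteq> frontier (region X) \<longrightarrow>
        (\<forall>x\<in>F. trace_from K z x = 0))}"


section \<open>Problem data and bilinear forms\<close>

record 'd biot =
  mu :: real
  lam :: real
  coup :: real
  rho :: real
  modM :: real
  perm :: "real^'d \<Rightarrow> real^'d^'d"
  src :: "real \<Rightarrow> real^'d \<Rightarrow> real"
  grav :: "real \<Rightarrow> real^'d \<Rightarrow> real^'d"

definition sigma :: "('d::finite) biot \<Rightarrow> (real^'d \<Rightarrow> real^'d) \<Rightarrow> real^'d \<Rightarrow> real^'d^'d" where
  "sigma D u x = (2 * mu D) *\<^sub>R eps u x + (lam D * dvg u x) *\<^sub>R mat 1"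

definition J_delta :: "('d::finite) mesh \<Rightarrow> ((real^'d) set \<Rightarrow> real) \<Rightarrow> real \<Rightarrow>
    (real^'d \<Rightarrow> real^'d) \<Rightarrow> (real^'d \<Rightarrow> real^'d) \<Rightarrow> real" where
  "J_delta X \<delta> \<beta> y z =
     (\<Sum>e\<in>int_faces X. \<delta> e / (face_measure X e powr \<beta>) * face_ip X e (jump X e y) (jump X e z))"

definition J_p :: "('d::finite) mesh \<Rightarrow> (real^'d \<Rightarrow> real) \<Rightarrow> (real^'d \<Rightarrow> real^'d) \<Rightarrow> real" where
  "J_p X w z = (\<Sum>e\<in>int_faces X. face_ip X e (\<lambda>x. avg X e w x *\<^sub>R nu X e) (jump X e z))"

definition J_d :: "('d::finite) mesh \<Rightarrow> 'd biot \<Rightarrow>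
    (real^'d \<Rightarrow> real^'d) \<Rightarrow> (real^'d \<Rightarrow> real^'d) \<Rightarrow> real" where
  "J_d X D y z = (\<Sum>e\<in>int_faces X.
       face_ip X e (avg X e (\<lambda>x. sigma D y x *v nu X e)) (jump X e z)
     + face_ip X e (avg X e (\<lambda>x. sigma D z x *v nu X e)) (jump X e y))"

definition div_form :: "('d::finite) mesh \<Rightarrow> (real^'d \<Rightarrow> real^'d) \<Rightarrow> (real^'d \<Rightarrow> real) \<Rightarrow> real" where
  "div_form X z w = (\<Sum>K\<in>cells X. ip K (dvg z) w)"

definition mech_eq :: "('d::finite) mesh \<Rightarrow> 'd biot \<Rightarrow> ((real^'d) set \<Rightarrow> real) \<Rightarrow> real \<Rightarrow> real \<Rightarrow>
    (real^'d \<Rightarrow> real) \<Rightarrow> (real^'d \<Rightarrow> real^'d) \<Rightarrow> (real^'d \<Rightarrow> real^'d) \<Rightarrow> bool" where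
  "mech_eq X D \<delta> \<beta> t P U z \<longleftrightarrow>
     (\<Sum>K\<in>cells X. ip K (sigma D U) (eps z)) + J_delta X \<delta> \<beta> U z - J_d X D U z
     = rho D * ip (region X) (grav D t) z + coup D * div_form X z P - coup D * J_p X P z"

definition darcy_eq :: "('d::finite) mesh \<Rightarrow> 'd biot \<Rightarrow>
    (real^'d \<Rightarrow> real) \<Rightarrow> (real^'d \<Rightarrow> real^'d) \<Rightarrow> (real^'d \<Rightarrow> real^'d) \<Rightarrow> bool" where
  "darcy_eq X D P Q v \<longleftrightarrow>
     ip (region X) (\<lambda>x. matrix_inv (perm D x) *v Q x) v - ip (region X) P (wdiv (region X) v) = 0"


section \<open>Time discretization\<close>

text \<open>\<open>gnode G n i\<close> is the \<open>i\<close>-th Gauss node in the \<open>n\<close>-th time interval.\<close>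

record tgrid =
  steps :: nat
  tn :: "nat \<Rightarrow> real"
  gnode :: "nat \<Rightarrow> nat \<Rightarrow> real"

definition I_n :: "tgrid \<Rightarrow> nat \<Rightarrow> real set" where
  "I_n G n = {tn G (n - 1)<..tn G n}"

definition tau :: "tgrid \<Rightarrow> nat \<Rightarrow> real" where
  "tau G n = tn G n - tn G (n - 1)"

definition gauss_nodes :: "nat \<Rightarrow> real set \<Rightarrow> (nat \<Rightarrow> real) \<Rightarrow> bool" where
  "gauss_nodes r I x \<longleftrightarrow> inj_on x {..r} \<and> x ` {..r} \<subseteq> I \<and>
     (\<exists>\<omega>. \<forall>p::real poly. degree p \<le> 2 * r + 1 \<longrightarrow>
        (LINT t|lebesgue_on I. poly p t) = (\<Sum>j\<le>r. \<omega> j * poly p (x j)))"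

definition time_grid :: "real \<Rightarrow> nat \<Rightarrow> tgrid \<Rightarrow> bool" where
  "time_grid T r G \<longleftrightarrow> tn G 0 = 0 \<and> tn G (steps G) = T \<and> strict_mono_on {..steps G} (tn G) \<and>
     steps G \<ge> 1 \<and> (\<forall>n\<in>{1..steps G}. gauss_nodes r (I_n G n) (gnode G n))"

definition phi :: "tgrid \<Rightarrow> nat \<Rightarrow> nat \<Rightarrow> nat \<Rightarrow> real \<Rightarrow> real" where
  "phi G r n j t = (\<Prod>m\<in>{..r} - {j}. (t - gnode G n m) / (gnode G n j - gnode G n m))"

text \<open>The one-sided limit at the left end point of the interval is the value of the polynomial \<open>phi\<close>.\<close>

definition gam :: "tgrid \<Rightarrow> nat \<Rightarrow> nat \<Rightarrow> nat \<Rightarrow> real" where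
  "gam G r n i = phi G r n i (tn G (n - 1))"

definition alpha :: "tgrid \<Rightarrow> nat \<Rightarrow> nat \<Rightarrow> nat \<Rightarrow> nat \<Rightarrow> real" where
  "alpha G r n i j = (LINT t|lebesgue_on (I_n G n). deriv (phi G r n j) t * phi G r n i t)
     + gam G r n i * gam G r n j"

definition betaii :: "tgrid \<Rightarrow> nat \<Rightarrow> nat \<Rightarrow> nat \<Rightarrow> real" where
  "betaii G r n i = 1 / tau G n * (LINT t|lebesgue_on (I_n G n). (phi G r n i t)\<^sup>2)"

text \<open>Piecewise polynomials in time with values in \<open>S\<close>. Together with the polynomial structure, integrability of
  the squared norm is all that membership in the Bochner space over \<open>(0,T]\<close> amounts to.\<close>

definition st_space :: "('d::finite) mesh \<Rightarrow> tgrid \<Rightarrow> nat \<Rightarrow> (real^'d \<Rightarrow> 'b::euclidean_space) set \<Rightarrow>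
    (real \<Rightarrow> real^'d \<Rightarrow> 'b) set" where
  "st_space X G r S = {w.
     (\<lambda>t. (L2norm (region X) (w t))\<^sup>2) absolutely_integrable_on {0<..tn G (steps G)} \<and>
     (\<forall>n\<in>{1..steps G}. \<exists>c. (\<forall>l\<le>r. c l \<in> S) \<and>
        (\<forall>t\<in>I_n G n. w t = (\<lambda>x. \<Sum>l\<le>r. t ^ l *\<^sub>R c l x))) \<and>
     w 0 \<in> S}"

definition expands :: "tgrid \<Rightarrow> nat \<Rightarrow> (real \<Rightarrow> 'a \<Rightarrow> 'b::real_normed_vector) \<Rightarrow> (nat \<Rightarrow> nat \<Rightarrow> 'a \<Rightarrow> 'b) \<Rightarrow> bool" where
  "expands G r w C \<longleftrightarrow> (\<forall>n\<in>{1..steps G}. \<forall>t\<in>I_n G n. w t = (\<lambda>x. \<Sum>j\<le>r. phi G r n j t *\<^sub>R C n j x))"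

definition left_lim :: "(real \<Rightarrow> 'a \<Rightarrow> 'b::real_normed_vector) \<Rightarrow> real \<Rightarrow> 'a \<Rightarrow> 'b" where
  "left_lim w t x = Lim (at_left t) (\<lambda>t'. w t' x)"

definition right_lim :: "(real \<Rightarrow> 'a \<Rightarrow> 'b::real_normed_vector) \<Rightarrow> real \<Rightarrow> 'a \<Rightarrow> 'b" where
  "right_lim w t x = Lim (at_right t) (\<lambda>t'. w t' x)"

definition L2_time_norm :: "(real^'d) set \<Rightarrow> real set \<Rightarrow> (real \<Rightarrow> real^'d \<Rightarrow> 'b::real_inner) \<Rightarrow> real" where
  "L2_time_norm A I w = sqrt (LINT t|lebesgue_on I. (L2norm A (w t))\<^sup>2)"


section \<open>Monolithic approximation and splitting scheme\<close>

text \<open>For the data, only their values at the time nodes enter. No upper bound on the permeability is needed.\<close>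

definition biot_data :: "('d::finite) mesh \<Rightarrow> nat \<Rightarrow> tgrid \<Rightarrow> 'd biot \<Rightarrow> bool" where
  "biot_data X r G D \<longleftrightarrow> mu D > 0 \<and> lam D > 0 \<and> coup D > 0 \<and> rho D > 0 \<and> modM D > 0 \<and>
     perm D \<in> borel_measurable (lebesgue_on (region X)) \<and>
     (\<forall>x\<in>region X. transpose (perm D x) = perm D x) \<and>
     (\<exists>k>0. \<forall>x\<in>region X. \<forall>\<xi>. k * (norm \<xi>)\<^sup>2 \<le> \<xi> \<bullet> (perm D x *v \<xi>)) \<and>
     (AE x in lebesgue_on (region X). grav D 0 x = 0) \<and>
     (\<forall>n\<in>{1..steps G}. \<forall>i\<le>r.
        src D (gnode G n i) \<in> L2 (region X) \<and> grav D (gnode G n i) \<in> L2 (region X))"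

text \<open>
  Mass balance on the \<open>n\<close>-th interval, \<open>i\<close>-th equation: \<open>P\<close>, \<open>Q\<close> are the unknown coefficients, \<open>Pold\<close> the
  pressure coefficients in the stabilization term, \<open>U\<close> the displacement coefficients and \<open>p0\<close>, \<open>u0\<close> the
  values at the end of the preceding interval. The monolithic equation is the case \<open>L = 0\<close>.
\<close>

definition mass_eq :: "('d::finite) mesh \<Rightarrow> 'd biot \<Rightarrow> tgrid \<Rightarrow> nat \<Rightarrow> real \<Rightarrow> nat \<Rightarrow> nat \<Rightarrow>
    (real^'d \<Rightarrow> real) \<Rightarrow> (real^'d \<Rightarrow> real^'d) \<Rightarrow>
    (nat \<Rightarrow> real^'d \<Rightarrow> real) \<Rightarrow> (nat \<Rightarrow> real^'d \<Rightarrow> real) \<Rightarrow> (nat \<Rightarrow> real^'d \<Rightarrow> real^'d) \<Rightarrow>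
    (nat \<Rightarrow> real^'d \<Rightarrow> real^'d) \<Rightarrow> (real^'d \<Rightarrow> real) \<Rightarrow> bool" where
  "mass_eq X D G r L n i p0 u0 P Pold Q U w \<longleftrightarrow>
     1 / modM D * (\<Sum>j\<le>r. alpha G r n i j * ip (region X) (P j) w)
     + L * (\<Sum>j\<le>r. alpha G r n i j * ip (region X) (\<lambda>x. P j x - Pold j x) w)
     + tau G n * betaii G r n i * ip (region X) (wdiv (region X) (Q i)) w
     = tau G n * betaii G r n i * ip (region X) (src D (gnode G n i)) w
     - coup D * (\<Sum>j\<le>r. alpha G r n i j * div_form X (U j) w)
     + gam G r n i / modM D * ip (region X) p0 w
     + gam G r n i * coup D * div_form X u0 w"

definition monolithic :: "('d::finite) mesh \<Rightarrow> 'd biot \<Rightarrow> tgrid \<Rightarrow> nat \<Rightarrow> nat \<Rightarrow>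
    ((real^'d) set \<Rightarrow> real) \<Rightarrow> real \<Rightarrow>
    (real \<Rightarrow> real^'d \<Rightarrow> real) \<Rightarrow> (real \<Rightarrow> real^'d \<Rightarrow> real^'d) \<Rightarrow> (real \<Rightarrow> real^'d \<Rightarrow> real^'d) \<Rightarrow>
    (nat \<Rightarrow> nat \<Rightarrow> real^'d \<Rightarrow> real) \<Rightarrow> (nat \<Rightarrow> nat \<Rightarrow> real^'d \<Rightarrow> real^'d) \<Rightarrow>
    (nat \<Rightarrow> nat \<Rightarrow> real^'d \<Rightarrow> real^'d) \<Rightarrow> bool" where
  "monolithic X D G r s \<delta> \<beta> p q u P Q U \<longleftrightarrow>
     p \<in> st_space X G r (W_h X s) \<and> q \<in> st_space X G r (V_h X s) \<and> u \<in> st_space X G r (H_h X (s + 1)) \<and>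
     expands G r p P \<and> expands G r q Q \<and> expands G r u U \<and>
     (\<forall>n\<in>{1..steps G}.
        (let p0 = (if n = 1 then (\<lambda>_. 0) else left_lim p (tn G (n - 1)));
             u0 = (if n = 1 then (\<lambda>_. 0) else left_lim u (tn G (n - 1))) in
         \<forall>i\<le>r. P n i \<in> W_h X s \<and> Q n i \<in> V_h X s \<and> U n i \<in> H_h X (s + 1) \<and>
           (\<forall>w\<in>W_h X s. mass_eq X D G r 0 n i p0 u0 (P n) (P n) (Q n) (U n) w) \<and>
           (\<forall>v\<in>V_h X s. darcy_eq X D (P n i) (Q n i) v) \<and>
           (\<forall>z\<in>H_h X (s + 1). mech_eq X D \<delta> \<beta> (gnode G n i) (P n i) (U n i) z)))"

text \<open>The limit in \<open>S\<close> of a sequence with respect to the norm of \<open>L\<^sup>2\<close>, as a function determined almost everywhere;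
  an arbitrary function if there is no limit.\<close>

definition L2lim :: "(real^'d) set \<Rightarrow> (real^'d \<Rightarrow> 'b::real_inner) set \<Rightarrow> (nat \<Rightarrow> real^'d \<Rightarrow> 'b) \<Rightarrow> real^'d \<Rightarrow> 'b" where
  "L2lim A S f = (SOME l. l \<in> S \<and> (\<lambda>k. L2norm A (\<lambda>x. f k x - l x)) \<longlonglongrightarrow> 0)"

text \<open>All sequences \<open>pk\<close>, \<open>Pk\<close>, ... are indexed by the iteration index first. The coefficients for index 0 are
  arbitrary elements of the discrete spaces.\<close>

definition splitting :: "('d::finite) mesh \<Rightarrow> 'd biot \<Rightarrow> tgrid \<Rightarrow> nat \<Rightarrow> nat \<Rightarrow>
    ((real^'d) set \<Rightarrow> real) \<Rightarrow> real \<Rightarrow> real \<Rightarrow>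
    (nat \<Rightarrow> real \<Rightarrow> real^'d \<Rightarrow> real) \<Rightarrow> (nat \<Rightarrow> real \<Rightarrow> real^'d \<Rightarrow> real^'d) \<Rightarrow>
    (nat \<Rightarrow> real \<Rightarrow> real^'d \<Rightarrow> real^'d) \<Rightarrow>
    (nat \<Rightarrow> nat \<Rightarrow> nat \<Rightarrow> real^'d \<Rightarrow> real) \<Rightarrow> (nat \<Rightarrow> nat \<Rightarrow> nat \<Rightarrow> real^'d \<Rightarrow> real^'d) \<Rightarrow>
    (nat \<Rightarrow> nat \<Rightarrow> nat \<Rightarrow> real^'d \<Rightarrow> real^'d) \<Rightarrow> bool" where
  "splitting X D G r s \<delta> \<beta> L pk qk uk Pk Qk Uk \<longleftrightarrow>
     (\<forall>k. pk k \<in> st_space X G r (W_h X s) \<and> qk k \<in> st_space X G r (V_h X s) \<and>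
        uk k \<in> st_space X G r (H_h X (s + 1)) \<and>
        expands G r (pk k) (Pk k) \<and> expands G r (qk k) (Qk k) \<and> expands G r (uk k) (Uk k)) \<and>
     (\<forall>k. \<forall>n\<in>{1..steps G}. \<forall>i\<le>r. Pk k n i \<in> W_h X s \<and> Qk k n i \<in> V_h X s \<and> Uk k n i \<in> H_h X (s + 1)) \<and>
     (\<forall>n\<in>{1..steps G}.
        (let p0 = (if n = 1 then (\<lambda>_. 0)
                   else L2lim (region X) (W_h X s) (\<lambda>k. left_lim (pk k) (tn G (n - 1))));
             u0 = (if n = 1 then (\<lambda>_. 0)
                   else L2lim (region X) (H_h X (s + 1)) (\<lambda>k. left_lim (uk k) (tn G (n - 1)))) in
         \<forall>k. \<forall>i\<le>r.
           (\<forall>w\<in>W_h X s. mass_eq X D G r L n i p0 u0 (Pk (Suc k) n) (Pk k n) (Qk (Suc k) n) (Uk k n) w) \<and>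
           (\<forall>v\<in>V_h X s. darcy_eq X D (Pk (Suc k) n i) (Qk (Suc k) n i) v) \<and>
           (\<forall>z\<in>H_h X (s + 1).
              mech_eq X D \<delta> \<beta> (gnode G n i) (Pk (Suc k) n i) (Uk (Suc k) n i) z)))"

definition S_p :: "tgrid \<Rightarrow> nat \<Rightarrow> (nat \<Rightarrow> nat \<Rightarrow> nat \<Rightarrow> real^'d \<Rightarrow> real) \<Rightarrow>
    (nat \<Rightarrow> nat \<Rightarrow> real^'d \<Rightarrow> real) \<Rightarrow> nat \<Rightarrow> nat \<Rightarrow> nat \<Rightarrow> real^'d \<Rightarrow> real" where
  "S_p G r Pk P n i k x = (\<Sum>j\<le>r. alpha G r n i j * (Pk k n j x - P n j x))"

definition L2_tendsto :: "(real^'d) set \<Rightarrow> (nat \<Rightarrow> real^'d \<Rightarrow> 'b::real_inner) \<Rightarrow> (real^'d \<Rightarrow> 'b) \<Rightarrow> bool" where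
  "L2_tendsto A f l \<longleftrightarrow> (\<lambda>k. L2norm A (\<lambda>x. f k x - l x)) \<longlonglongrightarrow> 0"

definition Hdiv_tendsto :: "(real^'d) set \<Rightarrow> (nat \<Rightarrow> real^'d \<Rightarrow> real^'d) \<Rightarrow> (real^'d \<Rightarrow> real^'d) \<Rightarrow> bool" where
  "Hdiv_tendsto A f l \<longleftrightarrow> (\<lambda>k. Hdiv_norm A (\<lambda>x. f k x - l x)) \<longlonglongrightarrow> 0"

definition L2_time_tendsto :: "(real^'d) set \<Rightarrow> real set \<Rightarrow> (nat \<Rightarrow> real \<Rightarrow> real^'d \<Rightarrow> 'b::real_inner) \<Rightarrow>
    (real \<Rightarrow> real^'d \<Rightarrow> 'b) \<Rightarrow> bool" where
  "L2_time_tendsto A I f l \<longleftrightarrow> (\<lambda>k. L2_time_norm A I (\<lambda>t x. f k t x - l t x)) \<longlonglongrightarrow> 0"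

end

theory Submission
  imports Defs "HOL-Library.Function_Algebras"
begin

text \<open>
  The errors \<open>e\<close> between the iterates and the monolithic solution satisfy the homogeneous scheme. On one time
  interval, let \<open>S\<^sub>i\<close> be the sum over \<open>j\<close> of \<open>\<alpha>\<^sub>i\<^sub>j e\<^sub>P\<^sub>j\<close>, let \<open>U\<^sub>i\<close> be the displacement driven by \<open>S\<^sub>i\<close>, and let primes
  denote the next iterate. Test the \<open>i\<close>-th mass balance with \<open>S'\<^sub>i\<close>, divide by \<open>\<tau> \<beta>\<^sub>i\<^sub>i\<close> and sum over \<open>i\<close>. By Darcy's law
  the flux terms add up to a quadratic form of the time derivative with jump, which is nonnegative. By the mechanics
  equation the coupling with the old displacement is \<open>a(U'\<^sub>i, U\<^sub>i)\<close> plus the face term \<open>b J\<^sub>p(S'\<^sub>i, U\<^sub>i)\<close>. For large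
  penalties \<open>a\<close> is coercive and absorbs the face term together with half of \<open>\<parallel>S'\<^sub>i\<parallel>\<^sup>2 / M\<close>; for large \<open>L\<close> the
  polarization remainder \<open>a(U'\<^sub>i - U\<^sub>i, U'\<^sub>i - U\<^sub>i)\<close> is at most \<open>L \<parallel>S'\<^sub>i - S\<^sub>i\<parallel>\<^sup>2\<close>. The result is a contraction: the weighted
  sums of \<open>\<parallel>S\<^sub>i\<parallel>\<^sup>2\<close> decrease at least by the factor \<open>(L/2) / (1/(2M) + L/2)\<close>. The matrix \<open>\<alpha>\<close> is invertible, so the pressure
  errors tend to 0, hence also the fluxes and displacements, and the next time interval starts from the monolithic
  values.

  All constants (trace, inverse and Korn inequalities) come from one principle: on a finite-dimensional space, a
  positive semidefinite form whose null vectors are null for a second one dominates the latter up to a constant.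
\<close>

section \<open>Bilinear forms on spaces of functions\<close>

text \<open>The obstacle is a lack of adjointness: the flow equation contains only the elementwise
  divergence of the discontinuous displacement, while the mechanics equation adds face averages of
  the pressure. This is why the penalty has to serve the pressure as well. All constants must be
  fixed before L and delta: the bounds are taken against strain and jump forms without penalty
  weights, and delta enters only through the lower bound on \<open>a\<close>, which is uniform above
  the threshold. The threshold for L is the constant \<open>CT\<close> that bounds the energy of a
  displacement by the squared norm of the pressure driving it. Testing with S'_i rather than with
  the pressure matches the combination in which the old displacement enters; the price is a weight
  that depends on i and must be divided out before the flux terms can be summed. The zeroth iterate
  is arbitrary, so the contraction starts at index 1. Functions that agree almost everywhere are not
  identified: all forms are merely semidefinite, and every estimate comes with a check of null
  vectors.\<close>

instantiation "fun" :: (type, real_vector) real_vector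
begin

definition "c *\<^sub>R f = (\<lambda>x. c *\<^sub>R f x)"

instance
  by standard (simp_all add: scaleR_fun_def fun_eq_iff algebra_simps)

end

lemma scaleR_fun_apply [simp]: "(c *\<^sub>R f) x = c *\<^sub>R f x"
  by (simp add: scaleR_fun_def)

lemma sum_fun_apply: "(\<Sum>i\<in>I. f i) x = (\<Sum>i\<in>I. f i x)"
  by (induction I rule: infinite_finite_induct) auto

text \<open>Linearity is relative to a set: integrals, derivatives and traces are additive only on
  functions that are regular enough, so most functionals below are not linear on the whole function
  type.\<close>

definition lin_on :: "'v::real_vector set \<Rightarrow> ('v \<Rightarrow> real) \<Rightarrow> bool" where
  "lin_on S l \<longleftrightarrow> (\<forall>f\<in>S. \<forall>g\<in>S. l (f + g) = l f + l g) \<and> (\<forall>f\<in>S. \<forall>c. l (c *\<^sub>R f) = c * l f)"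

definition bil_on :: "'v::real_vector set \<Rightarrow> 'w::real_vector set \<Rightarrow> ('v \<Rightarrow> 'w \<Rightarrow> real) \<Rightarrow> bool" where
  "bil_on S T B \<longleftrightarrow> (\<forall>g\<in>T. lin_on S (\<lambda>f. B f g)) \<and> (\<forall>f\<in>S. lin_on T (B f))"

text \<open>Only semidefinite: functions that differ on a null set are distinct elements, so even
  the L2 product has nonzero null vectors.\<close>

definition psd_form :: "'v::real_vector set \<Rightarrow> ('v \<Rightarrow> 'v \<Rightarrow> real) \<Rightarrow> bool" where
  "psd_form S A \<longleftrightarrow> bil_on S S A \<and> (\<forall>f\<in>S. \<forall>g\<in>S. A f g = A g f) \<and> (\<forall>f\<in>S. A f f \<ge> 0)"

section \<open>Calculus of linear, bilinear and semidefinite forms\<close>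

lemma lin_on_add: "lin_on S l \<Longrightarrow> f \<in> S \<Longrightarrow> g \<in> S \<Longrightarrow> l (f + g) = l f + l g"
  and lin_on_scale: "lin_on S l \<Longrightarrow> f \<in> S \<Longrightarrow> l (c *\<^sub>R f) = c * l f"
  by (auto simp: lin_on_def)

lemma lin_on_zero: "lin_on S l \<Longrightarrow> 0 \<in> S \<Longrightarrow> l 0 = 0"
  using lin_on_scale[of S l 0 0] by simp

lemma lin_on_diff:
  assumes "lin_on S l" "subspace S" "f \<in> S" "g \<in> S"
  shows "l (f - g) = l f - l g"
  using lin_on_add[OF assms(1) subspace_diff[OF assms(2-4)] assms(4)] by simp

lemma lin_on_sum:
  assumes "lin_on S l" "subspace S" "\<And>i. i \<in> I \<Longrightarrow> f i \<in> S"
  shows "l (\<Sum>i\<in>I. c i *\<^sub>R f i) = (\<Sum>i\<in>I. c i * l (f i))"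
  using assms(3)
proof (induction I rule: infinite_finite_induct)
  case (insert i I)
  have "(\<Sum>i\<in>I. c i *\<^sub>R f i) \<in> S"
    using insert.prems assms(2) by (intro subspace_sum) (auto intro: subspace_scale)
  then show ?case
    using insert assms by (simp add: lin_on_add lin_on_scale subspace_scale)
next
  case (infinite I)
  then show ?case using lin_on_zero[OF assms(1) subspace_0[OF assms(2)]] by simp
next
  case empty
  then show ?case using lin_on_zero[OF assms(1) subspace_0[OF assms(2)]] by simp
qed

lemma lin_on_subset: "lin_on S l \<Longrightarrow> T \<subseteq> S \<Longrightarrow> lin_on T l"
  unfolding lin_on_def by blast

lemma bil_on_left: "bil_on S T B \<Longrightarrow> g \<in> T \<Longrightarrow> lin_on S (\<lambda>f. B f g)"
  and bil_on_right: "bil_on S T B \<Longrightarrow> f \<in> S \<Longrightarrow> lin_on T (B f)"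
  by (auto simp: bil_on_def)

lemma bil_on_subset: "bil_on S T B \<Longrightarrow> S' \<subseteq> S \<Longrightarrow> T' \<subseteq> T \<Longrightarrow> bil_on S' T' B"
  unfolding bil_on_def by (meson lin_on_subset subsetD)

lemma psd_formD:
  assumes "psd_form S A"
  shows "bil_on S S A" "\<And>f g. f \<in> S \<Longrightarrow> g \<in> S \<Longrightarrow> A f g = A g f" "\<And>f. f \<in> S \<Longrightarrow> A f f \<ge> 0"
    "\<And>g. g \<in> S \<Longrightarrow> lin_on S (\<lambda>f. A f g)" "\<And>f. f \<in> S \<Longrightarrow> lin_on S (A f)"
  using assms by (auto simp: psd_form_def bil_on_def)

lemma psd_form_subset: "psd_form S A \<Longrightarrow> T \<subseteq> S \<Longrightarrow> psd_form T A"
  unfolding psd_form_def using bil_on_subset by (meson subsetD)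

lemma lin_on_plus: "lin_on S l \<Longrightarrow> lin_on S l' \<Longrightarrow> lin_on S (\<lambda>f. l f + l' f)"
  and lin_on_minus: "lin_on S l \<Longrightarrow> lin_on S l' \<Longrightarrow> lin_on S (\<lambda>f. l f - l' f)"
  and lin_on_cmult: "lin_on S l \<Longrightarrow> lin_on S (\<lambda>f. c * l f)"
  and lin_on_const_zero: "lin_on S (\<lambda>f. 0)"
  by (auto simp: lin_on_def algebra_simps)

lemma lin_on_Sum: "(\<And>i. i \<in> I \<Longrightarrow> lin_on S (l i)) \<Longrightarrow> lin_on S (\<lambda>f. \<Sum>i\<in>I. l i f)"
  by (induction I rule: infinite_finite_induct) (auto intro: lin_on_plus lin_on_const_zero)

lemma bil_on_plus: "bil_on S T B \<Longrightarrow> bil_on S T B' \<Longrightarrow> bil_on S T (\<lambda>f g. B f g + B' f g)"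
  and bil_on_minus: "bil_on S T B \<Longrightarrow> bil_on S T B' \<Longrightarrow> bil_on S T (\<lambda>f g. B f g - B' f g)"
  and bil_on_cmult: "bil_on S T B \<Longrightarrow> bil_on S T (\<lambda>f g. c * B f g)"
  by (auto simp: bil_on_def intro: lin_on_plus lin_on_minus lin_on_cmult)

lemma bil_on_Sum: "(\<And>i. i \<in> I \<Longrightarrow> bil_on S T (B i)) \<Longrightarrow> bil_on S T (\<lambda>f g. \<Sum>i\<in>I. B i f g)"
  by (auto simp: bil_on_def intro: lin_on_Sum)

lemma bil_on_swap: "bil_on S T B \<Longrightarrow> bil_on T S (\<lambda>f g. B g f)"
  by (auto simp: bil_on_def)

lemma psd_form_Sum:
  "(\<And>i. i \<in> I \<Longrightarrow> psd_form S (B i)) \<Longrightarrow> psd_form S (\<lambda>f g. \<Sum>i\<in>I. B i f g)"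
  by (auto simp: psd_form_def intro: bil_on_Sum sum_nonneg sum.cong)

lemma psd_form_plus: "psd_form S A \<Longrightarrow> psd_form S B \<Longrightarrow> psd_form S (\<lambda>f g. A f g + B f g)"
  by (auto simp: psd_form_def intro: bil_on_plus)

lemma psd_form_expand:
  assumes "psd_form S A" "subspace S" "f \<in> S" "g \<in> S"
  shows "A (f + c *\<^sub>R g) (f + c *\<^sub>R g) = A f f + 2 * c * A f g + c\<^sup>2 * A g g"
proof -
  note D = psd_formD[OF assms(1)]
  have cg: "c *\<^sub>R g \<in> S" and fcg: "f + c *\<^sub>R g \<in> S"
    using assms by (auto intro: subspace_scale subspace_add)
  show ?thesis
    using lin_on_add[OF D(4)[OF fcg] assms(3) cg] lin_on_scale[OF D(4)[OF fcg] assms(4)]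
      lin_on_add[OF D(5)[OF assms(3)] assms(3) cg] lin_on_scale[OF D(5)[OF assms(3)] assms(4)]
      lin_on_add[OF D(5)[OF assms(4)] assms(3) cg] lin_on_scale[OF D(5)[OF assms(4)] assms(4)]
      D(2)[OF assms(4,3)]
    by (simp add: algebra_simps power2_eq_square)
qed

lemma psd_form_diff:
  assumes "psd_form S A" "subspace S" "f \<in> S" "g \<in> S"
  shows "A (f - g) (f - g) = A f f - 2 * A f g + A g g"
  using psd_form_expand[OF assms, of "-1"] by simp

lemma psd_form_null:
  assumes "psd_form S A" "subspace S" "f \<in> S" "g \<in> S" "A f f = 0"
  shows "A f g = 0"
proof (rule ccontr)
  assume ne: "A f g \<noteq> 0"
  have *: "0 \<le> A g g + 2 * c * A f g" for c
    using psd_form_expand[OF assms(1,2,4,3), of c] psd_formD(2)[OF assms(1), of f g] assms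
      psd_formD(3)[OF assms(1) subspace_add[OF assms(2,4) subspace_scale[OF assms(2,3)]], of c]
    by simp
  from *[of "- (A g g + 1) / (2 * A f g)"] ne show False
    by (simp add: field_simps)
qed

lemma psd_form_Cauchy_Schwarz:
  assumes "psd_form S A" "subspace S" "f \<in> S" "g \<in> S"
  shows "(A f g)\<^sup>2 \<le> A f f * A g g"
proof (cases "A g g = 0")
  case True
  then show ?thesis
    using psd_form_null[OF assms(1,2,4,3)] psd_formD(2)[OF assms(1,3,4)] by simp
next
  case False
  then have pos: "A g g > 0"
    using psd_formD(3)[OF assms(1,4)] by simp
  have "0 \<le> A f f + 2 * (- A f g / A g g) * A f g + (- A f g / A g g)\<^sup>2 * A g g"
    using psd_form_expand[OF assms, of "- A f g / A g g"]
      psd_formD(3)[OF assms(1) subspace_add[OF assms(2,3) subspace_scale[OF assms(2,4)]], of "- A f g / A g g"]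
    by simp
  also have "\<dots> = A f f - (A f g)\<^sup>2 / A g g"
    using pos by (simp add: power2_eq_square field_simps)
  finally show ?thesis
    using pos by (simp add: field_simps)
qed

text \<open>The parallelogram identity, with the nonnegative value at f - g dropped.\<close>

lemma psd_form_triangle:
  assumes "psd_form S A" "subspace S" "f \<in> S" "g \<in> S"
  shows "A (f + g) (f + g) \<le> 2 * A f f + 2 * A g g"
  using psd_form_expand[OF assms, of 1] psd_form_diff[OF assms]
    psd_formD(3)[OF assms(1) subspace_diff[OF assms(2-4)]] by simp

text \<open>Iterating the two-term bound doubles the factor with each summand. The exponential
  constant is harmless, since the number of terms stays fixed in all limits.\<close>

lemma psd_form_sum_bound:
  assumes "psd_form S A" "subspace S" "finite I" "\<And>i. i \<in> I \<Longrightarrow> f i \<in> S"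
  shows "A (\<Sum>i\<in>I. c i *\<^sub>R f i) (\<Sum>i\<in>I. c i *\<^sub>R f i) \<le> 2 ^ card I * (\<Sum>i\<in>I. (c i)\<^sup>2 * A (f i) (f i))"
  using assms(3,4)
proof (induction I rule: finite_induct)
  case empty
  then show ?case
    using lin_on_zero[OF psd_formD(5)[OF assms(1) subspace_0[OF assms(2)]] subspace_0[OF assms(2)]] by simp
next
  case (insert i I)
  have sI: "(\<Sum>i\<in>I. c i *\<^sub>R f i) \<in> S" and si: "c i *\<^sub>R f i \<in> S"
    using insert.prems assms(2) by (auto intro!: subspace_sum intro: subspace_scale)
  have "A (c i *\<^sub>R f i) (c i *\<^sub>R f i) = (c i)\<^sup>2 * A (f i) (f i)"
    using si insert.prems assms by (simp add: lin_on_scale[OF psd_formD(4)[OF assms(1)]]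
      lin_on_scale[OF psd_formD(5)[OF assms(1)]] power2_eq_square)
  moreover have "2 * ((c i)\<^sup>2 * A (f i) (f i)) \<le> 2 ^ card (insert i I) * ((c i)\<^sup>2 * A (f i) (f i))"
    using insert psd_formD(3)[OF assms(1)] by (intro mult_right_mono) auto
  ultimately show ?case
    using psd_form_triangle[OF assms(1,2) si sI] insert by (simp add: algebra_simps)
qed

text \<open>Gram-Schmidt by induction on the functionals, which encode finite dimension modulo null
  vectors of \<open>A\<close>. Removing one functional l means passing to its kernel, of codimension
  at most one, where the remaining functionals suffice.\<close>

lemma orthonormal_frame:
  assumes "finite L" "\<And>l. l \<in> L \<Longrightarrow> lin_on S l" "psd_form S A" "subspace S"
    and "\<And>f. f \<in> S \<Longrightarrow> (\<And>l. l \<in> L \<Longrightarrow> l f = 0) \<Longrightarrow> A f f = 0"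
  shows "\<exists>(k::nat) b. (\<forall>i<k. b i \<in> S) \<and> (\<forall>i<k. \<forall>j<k. A (b i) (b j) = (if i = j then 1 else 0)) \<and>
    (\<forall>f\<in>S. A (f - (\<Sum>i<k. A f (b i) *\<^sub>R b i)) (f - (\<Sum>i<k. A f (b i) *\<^sub>R b i)) = 0)"
  using assms
proof (induction L arbitrary: S rule: finite_induct)
  case empty
  show ?case
    using empty.prems by (intro exI[of _ 0]) simp
next
  case (insert l L)
  define S' where "S' = {f \<in> S. l f = 0}"
  have l: "lin_on S l" by (simp add: insert.prems)
  have sub': "S' \<subseteq> S" by (auto simp: S'_def)
  have S': "subspace S'"
    using insert.prems(3) l unfolding subspace_def S'_def
    by (auto simp: lin_on_add lin_on_scale lin_on_zero)
  have "\<exists>(k::nat) b. (\<forall>i<k. b i \<in> S') \<and> (\<forall>i<k. \<forall>j<k. A (b i) (b j) = (if i = j then 1 else 0)) \<and>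
    (\<forall>f\<in>S'. A (f - (\<Sum>i<k. A f (b i) *\<^sub>R b i)) (f - (\<Sum>i<k. A f (b i) *\<^sub>R b i)) = 0)"
  proof (rule insert.IH)
    show "lin_on S' m" if "m \<in> L" for m
      using insert.prems(1) that lin_on_subset sub' by blast
    show "psd_form S' A" using insert.prems(2) psd_form_subset sub' by blast
    show "subspace S'" by (rule S')
    show "A f f = 0" if "f \<in> S'" "\<And>l. l \<in> L \<Longrightarrow> l f = 0" for f
      using that by (intro insert.prems(4)) (auto simp: S'_def)
  qed
  then obtain k b where b: "\<And>i. i < (k::nat) \<Longrightarrow> b i \<in> S'"
    and on: "\<And>i j. i < k \<Longrightarrow> j < k \<Longrightarrow> A (b i) (b j) = (if i = j then 1 else 0)"
    and res: "\<And>f. f \<in> S' \<Longrightarrow> A (f - (\<Sum>i<k. A f (b i) *\<^sub>R b i)) (f - (\<Sum>i<k. A f (b i) *\<^sub>R b i)) = 0"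
    by blast
  note D = psd_formD[OF insert.prems(2)]
  note sub = insert.prems(3)
  have bS: "b i \<in> S" if "i < k" for i using b that sub' by auto
  have sumS: "(\<Sum>i<k. c i *\<^sub>R b i) \<in> S" for c
    using bS by (intro subspace_sum[OF sub] subspace_scale[OF sub]) auto
  show ?case
  proof (cases "S' = S")
    case True
    then show ?thesis using b on res by (intro exI[of _ k] exI[of _ b]) auto
  next
    case False
    then obtain f1 where f1: "f1 \<in> S" "l f1 \<noteq> 0" by (auto simp: S'_def)
    define f0 where "f0 = (1 / l f1) *\<^sub>R f1"
    have f0: "f0 \<in> S" "l f0 = 1"
      using f1 l sub by (auto simp: f0_def lin_on_scale subspace_scale)
    \<comment> \<open>g is f0 made orthogonal to the frame of the kernel; together with that frame
      it spans S modulo null vectors.\<close>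
    define g where "g = f0 - (\<Sum>i<k. A f0 (b i) *\<^sub>R b i)"
    have g: "g \<in> S" unfolding g_def by (rule subspace_diff[OF sub f0(1) sumS])
    have Agb: "A g (b j) = 0" if "j < k" for j
    proof -
      have "A (\<Sum>i<k. A f0 (b i) *\<^sub>R b i) (b j) = (\<Sum>i<k. A f0 (b i) * A (b i) (b j))"
        using bS that by (intro lin_on_sum[OF D(4) sub]) auto
      also have "\<dots> = (\<Sum>i<k. if i = j then A f0 (b i) else 0)"
        using on that by (intro sum.cong) auto
      also have "\<dots> = A f0 (b j)" using that by simp
      finally show ?thesis
        unfolding g_def using lin_on_diff[OF D(4)[OF bS[OF that]] sub f0(1) sumS] by simp
    qed
    have decomp: "\<exists>c d n. n \<in> S \<and> A n n = 0 \<and> f = c *\<^sub>R g + (\<Sum>i<k. d i *\<^sub>R b i) + n" if f: "f \<in> S" for f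
    proof -
      define f' where "f' = f - l f *\<^sub>R f0"
      have f': "f' \<in> S'"
        using f f0 sub l by (simp add: S'_def f'_def subspace_diff subspace_scale lin_on_diff lin_on_scale)
      define n where "n = f' - (\<Sum>i<k. A f' (b i) *\<^sub>R b i)"
      have nS: "n \<in> S" unfolding n_def using f' sub' by (intro subspace_diff[OF sub _ sumS]) auto
      have "f = l f *\<^sub>R g + (\<Sum>i<k. (l f * A f0 (b i) + A f' (b i)) *\<^sub>R b i) + n"
        by (simp add: n_def f'_def g_def scaleR_sum_right algebra_simps sum.distrib)
      moreover have "A n n = 0" using res[OF f'] by (simp add: n_def)
      ultimately show ?thesis using nS by metis
    qed
    show ?thesis
    \<comment> \<open>If g is itself null, the old frame is already complete; otherwise g is
      normalized and appended.\<close>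
    proof (cases "A g g = 0")
      case True
      have "A (f - (\<Sum>i<k. A f (b i) *\<^sub>R b i)) (f - (\<Sum>i<k. A f (b i) *\<^sub>R b i)) = 0" if f: "f \<in> S" for f
      proof -
        obtain c d n where n: "n \<in> S" "A n n = 0" and fe: "f = c *\<^sub>R g + (\<Sum>i<k. d i *\<^sub>R b i) + n"
          using decomp[OF f] by blast
        have cgS: "c *\<^sub>R g \<in> S" using g sub subspace_scale by blast
        have "A f (b j) = d j" if j: "j < k" for j
        proof -
          have "A f (b j) = c * A g (b j) + (\<Sum>i<k. d i * A (b i) (b j)) + A n (b j)"
            unfolding fe using lin_on_add[OF D(4)[OF bS[OF j]] subspace_add[OF sub cgS sumS] n(1)]
              lin_on_add[OF D(4)[OF bS[OF j]] cgS sumS] lin_on_scale[OF D(4)[OF bS[OF j]] g]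
              lin_on_sum[OF D(4)[OF bS[OF j]] sub, of "{..<k}" b d] bS by simp
          also have "\<dots> = (\<Sum>i<k. if i = j then d i else 0)"
            using on j Agb psd_form_null[OF insert.prems(2) sub n(1) bS[OF j] n(2)]
            by (simp add: if_distrib[of "\<lambda>x. _ * x"] cong: if_cong)
          finally show ?thesis using j by simp
        qed
        then have "f - (\<Sum>i<k. A f (b i) *\<^sub>R b i) = c *\<^sub>R g + n"
          by (simp add: fe)
        moreover have "A (c *\<^sub>R g + n) (c *\<^sub>R g + n) \<le> 0"
          using psd_form_triangle[OF insert.prems(2) sub cgS n(1)] n True
          by (simp add: lin_on_scale[OF D(4)[OF cgS] g] lin_on_scale[OF D(5)[OF g] g])
        ultimately show ?thesis using D(3)[OF subspace_add[OF sub cgS n(1)]] by simp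
      qed
      then show ?thesis using bS on by (intro exI[of _ k] exI[of _ b]) auto
    next
      case False
      then have pos: "A g g > 0" using D(3)[OF g] by simp
      define h where "h = (1 / sqrt (A g g)) *\<^sub>R g"
      have hS: "h \<in> S" unfolding h_def using g sub subspace_scale by blast
      have hh: "A h h = 1"
        using pos D g hS by (simp add: h_def lin_on_scale[OF D(4)] lin_on_scale[OF D(5)] subspace_scale[OF sub])
      have hb: "A h (b j) = 0" if "j < k" for j
        using Agb[OF that] lin_on_scale[OF D(4)[OF bS[OF that]] g] by (simp add: h_def)
      have bh: "A (b j) h = 0" if "j < k" for j
        using hb[OF that] D(2)[OF hS bS[OF that]] by simp
      define b' where "b' = b(k := h)"
      have b'S: "b' i \<in> S" if "i < Suc k" for i using that bS hS by (auto simp: b'_def less_Suc_eq)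
      have on': "A (b' i) (b' j) = (if i = j then 1 else 0)" if "i < Suc k" "j < Suc k" for i j
        using that on hh hb bh by (auto simp: b'_def less_Suc_eq)
      have "A (f - (\<Sum>i<Suc k. A f (b' i) *\<^sub>R b' i)) (f - (\<Sum>i<Suc k. A f (b' i) *\<^sub>R b' i)) = 0" if f: "f \<in> S" for f
      proof -
        obtain c d n where n: "n \<in> S" "A n n = 0" and fe: "f = c *\<^sub>R g + (\<Sum>i<k. d i *\<^sub>R b i) + n"
          using decomp[OF f] by blast
        define d' where "d' = d(k := c * sqrt (A g g))"
        have s': "(\<Sum>i<Suc k. d' i *\<^sub>R b' i) \<in> S"
          using b'S by (intro subspace_sum[OF sub] subspace_scale[OF sub]) auto
        have "(\<Sum>i<k. d' i *\<^sub>R b' i) = (\<Sum>i<k. d i *\<^sub>R b i)"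
          by (intro sum.cong) (auto simp: d'_def b'_def)
        then have fe': "f = (\<Sum>i<Suc k. d' i *\<^sub>R b' i) + n"
          using pos by (simp add: fe d'_def b'_def h_def)
        have "A f (b' j) = d' j" if j: "j < Suc k" for j
        proof -
          have "A f (b' j) = (\<Sum>i<Suc k. d' i * A (b' i) (b' j)) + A n (b' j)"
            unfolding fe' using lin_on_add[OF D(4)[OF b'S[OF j]] s' n(1)]
              lin_on_sum[OF D(4)[OF b'S[OF j]] sub, of "{..<Suc k}" b' d'] b'S by simp
          also have "\<dots> = (\<Sum>i<Suc k. if i = j then d' i else 0)"
            using on' j psd_form_null[OF insert.prems(2) sub n(1) b'S[OF j] n(2)]
            by (simp add: if_distrib[of "\<lambda>x. _ * x"] cong: if_cong del: sum.lessThan_Suc)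
          finally show ?thesis using j by (simp del: sum.lessThan_Suc)
        qed
        then have "f - (\<Sum>i<Suc k. A f (b' i) *\<^sub>R b' i) = f - (\<Sum>i<Suc k. d' i *\<^sub>R b' i)"
          by simp
        also have "\<dots> = n" by (subst fe') (simp del: sum.lessThan_Suc)
        finally show ?thesis using n by simp
      qed
      then show ?thesis using b'S on' by (intro exI[of _ "Suc k"] exI[of _ b']) auto
    qed
  qed
qed

text \<open>Up to an \<open>A\<close>-null, hence \<open>B\<close>-null, remainder, f is a
  combination of an \<open>A\<close>-orthonormal frame, and Cauchy-Schwarz bounds its coefficients
  by the square root of A f f.\<close>

lemma form_dominated:
  assumes "finite L" "\<And>l. l \<in> L \<Longrightarrow> lin_on S l" "psd_form S A" "psd_form S B" "subspace S"
    and "\<And>f. f \<in> S \<Longrightarrow> (\<And>l. l \<in> L \<Longrightarrow> l f = 0) \<Longrightarrow> A f f = 0"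
    and null: "\<And>f. f \<in> S \<Longrightarrow> A f f = 0 \<Longrightarrow> B f f = 0"
  shows "\<exists>C>0. \<forall>f\<in>S. B f f \<le> C * A f f"
proof -
  obtain k b where b: "\<And>i. i < (k::nat) \<Longrightarrow> b i \<in> S"
    and on: "\<And>i j. i < k \<Longrightarrow> j < k \<Longrightarrow> A (b i) (b j) = (if i = j then 1 else 0)"
    and res: "\<And>f. f \<in> S \<Longrightarrow> A (f - (\<Sum>i<k. A f (b i) *\<^sub>R b i)) (f - (\<Sum>i<k. A f (b i) *\<^sub>R b i)) = 0"
    using orthonormal_frame[OF assms(1-3,5,6)] by blast
  \<comment> \<open>One factor 2 splits off the remainder, \<open>2 ^ k\<close> comes from the sum
    over the frame, and the 1 makes C positive even for an empty frame.\<close>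
  define C where "C = 2 ^ Suc k * (\<Sum>i<k. B (b i) (b i)) + 1"
  have Bb: "B (b i) (b i) \<ge> 0" if "i < k" for i using psd_formD(3)[OF assms(4)] b that by auto
  have "B f f \<le> C * A f f" if f: "f \<in> S" for f
  proof -
    define g where "g = (\<Sum>i<k. A f (b i) *\<^sub>R b i)"
    have g: "g \<in> S" unfolding g_def using b assms(5) by (auto intro!: subspace_sum subspace_scale)
    have fg: "f - g \<in> S" using f g assms(5) subspace_diff by blast
    have "B (f - g) (f - g) = 0" using null[OF fg] res[OF f] by (simp add: g_def)
    then have "B f f \<le> 2 * B g g"
      using psd_form_triangle[OF assms(4,5) fg g] by simp
    also have "B g g \<le> 2 ^ k * (\<Sum>i<k. (A f (b i))\<^sup>2 * B (b i) (b i))"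
      unfolding g_def using psd_form_sum_bound[OF assms(4,5), of "{..<k}" b] b by simp
    also have "\<dots> \<le> 2 ^ k * (\<Sum>i<k. A f f * B (b i) (b i))"
      using psd_form_Cauchy_Schwarz[OF assms(3,5) f] on b Bb
      by (intro mult_left_mono sum_mono mult_right_mono) force+
    finally show ?thesis
      using psd_formD(3)[OF assms(3) f] by (simp add: C_def sum_distrib_left sum_distrib_right algebra_simps)
  qed
  moreover have "C > 0"
    unfolding C_def using Bb by (intro add_nonneg_pos mult_nonneg_nonneg sum_nonneg) auto
  ultimately show ?thesis by blast
qed

section \<open>Uniqueness and linearity of the weak divergence\<close>

lemma L2_integrable_inner:
  assumes "f \<in> L2 A" "g \<in> L2 A"
  shows "integrable (lebesgue_on A) (\<lambda>x. f x \<bullet> g x)"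
proof (rule Bochner_Integration.integrable_bound)
  show "integrable (lebesgue_on A) (\<lambda>x. (norm (f x))\<^sup>2 + (norm (g x))\<^sup>2)"
    using assms by (auto simp: L2_def)
  show "(\<lambda>x. f x \<bullet> g x) \<in> borel_measurable (lebesgue_on A)"
    using assms by (auto simp: L2_def)
  have "norm (f x \<bullet> g x) \<le> norm ((norm (f x))\<^sup>2 + (norm (g x))\<^sup>2)" for x
  proof -
    have "norm (f x \<bullet> g x) \<le> norm (f x) * norm (g x)"
      by (simp add: Cauchy_Schwarz_ineq2)
    also have "\<dots> \<le> (norm (f x))\<^sup>2 + (norm (g x))\<^sup>2"
      using sum_squares_bound[of "norm (f x)" "norm (g x)"] mult_nonneg_nonneg[of "norm (f x)" "norm (g x)"]
      by (simp del: zero_le_mult_iff mult_nonneg_nonneg)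
    finally show ?thesis by simp
  qed
  then show "AE x in lebesgue_on A. norm (f x \<bullet> g x) \<le> norm ((norm (f x))\<^sup>2 + (norm (g x))\<^sup>2)" by simp
qed

lemma subspace_L2: "subspace (L2 A)"
proof (rule subspaceI)
  show "0 \<in> L2 A" by (simp add: L2_def zero_fun_def)
  show "c *\<^sub>R f \<in> L2 A" if "f \<in> L2 A" for c and f :: "_ \<Rightarrow> 'b"
    using that by (auto simp: L2_def scaleR_fun_def power_mult_distrib)
  show "f + g \<in> L2 A" if "f \<in> L2 A" "g \<in> L2 A" for f g :: "_ \<Rightarrow> 'b"
  proof -
    have "(norm (f x + g x))\<^sup>2 = (norm (f x))\<^sup>2 + 2 * (f x \<bullet> g x) + (norm (g x))\<^sup>2" for x
      by (simp add: power2_norm_eq_inner inner_left_distrib inner_right_distrib inner_commute)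
    then show ?thesis
      using that L2_integrable_inner[OF that] by (auto simp: L2_def plus_fun_def)
  qed
qed

lemma psd_form_ip: "psd_form (L2 A) (ip A)"
  unfolding psd_form_def bil_on_def lin_on_def ip_def
  by (auto simp: plus_fun_def scaleR_fun_def inner_left_distrib inner_right_distrib L2_integrable_inner inner_commute
      intro!: integral_nonneg_AE)

lemma bil_on_ip: "bil_on (L2 A) (L2 A) (ip A)"
  using psd_form_ip psd_formD(1) by blast

lemma ip_cong_AE:
  assumes "AE x in lebesgue_on A. f x = f' x" "AE x in lebesgue_on A. g x = g' x"
    "f \<in> L2 A" "g \<in> L2 A" "f' \<in> L2 A" "g' \<in> L2 A"
  shows "ip A f g = ip A f' g'"
  unfolding ip_def
  by (intro integral_cong_AE) (use assms in \<open>auto simp: L2_def\<close>)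

lemma ip_null_iff:
  assumes "f \<in> L2 A"
  shows "ip A f f = 0 \<longleftrightarrow> (AE x in lebesgue_on A. f x = 0)"
  unfolding ip_def using integral_nonneg_eq_0_iff_AE[OF L2_integrable_inner[OF assms assms]] by simp

text \<open>Squaring removes the kink of the positive part at 0, which makes products of such
  factors admissible as C1 test functions.\<close>

lemma DERIV_pos_part_square: "((\<lambda>t::real. (max 0 t)\<^sup>2) has_field_derivative 2 * max 0 t) (at t)"
proof (cases "t = 0")
  case True
  have "((\<lambda>h. (max 0 h)\<^sup>2 / h) \<longlongrightarrow> 0) (at (0::real))"
  proof (rule Lim_null_comparison)
    show "\<forall>\<^sub>F h::real in at 0. norm ((max 0 h)\<^sup>2 / h) \<le> \<bar>h\<bar>"
      by (intro always_eventually) (auto simp: max_def power2_eq_square)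
    show "(abs \<longlongrightarrow> (0::real)) (at 0)" by (intro tendsto_eq_intros) auto
  qed
  then show ?thesis using True by (simp add: DERIV_def)
next
  case False
  then consider "t > 0" | "t < 0" by linarith
  then show ?thesis
  proof cases
    case 1
    have "((\<lambda>t::real. t\<^sup>2) has_field_derivative 2 * max 0 t) (at t)"
      using 1 by (auto intro!: derivative_eq_intros)
    then show ?thesis
      by (rule has_field_derivative_transform_within_open[where S = "{0<..}"]) (use 1 in auto)
  next
    case 2
    have "((\<lambda>t::real. 0) has_field_derivative 2 * max 0 t) (at t)"
      using 2 by (auto intro!: derivative_eq_intros)
    then show ?thesis
      by (rule has_field_derivative_transform_within_open[where S = "{..<0}"]) (use 2 in auto)
  qed
qed

text \<open>The guard handles empty boxes: if a exceeds b in some coordinate, the product of the two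
  differences is positive between b and a, and the factor would not vanish there.\<close>

definition box_bump :: "real^'d \<Rightarrow> real^'d \<Rightarrow> real^'d \<Rightarrow> real" where
  "box_bump a b x = (\<Prod>i\<in>UNIV. if a $ i \<le> b $ i then (max 0 ((x $ i - a $ i) * (b $ i - x $ i)))\<^sup>2 else 0)"

lemma box_bump_nonneg: "box_bump a b x \<ge> 0"
  unfolding box_bump_def by (auto intro!: prod_nonneg)

lemma box_bump_pos_iff: "box_bump a b x \<noteq> 0 \<longleftrightarrow> x \<in> box a b"
proof -
  have "(if a $ i \<le> b $ i then (max 0 ((x $ i - a $ i) * (b $ i - x $ i)))\<^sup>2 else 0) \<noteq> 0
      \<longleftrightarrow> a $ i < x $ i \<and> x $ i < b $ i" for i
    by (cases "x $ i < a $ i"; cases "b $ i < x $ i")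
      (auto simp: max_def mult_le_0_iff zero_le_mult_iff not_le)
  then show ?thesis
    by (simp add: box_bump_def mem_box_cart)
qed

lemma box_bump_has_derivative:
  "(box_bump a b has_derivative (\<lambda>y. \<Sum>i\<in>UNIV. (if a $ i \<le> b $ i then
      2 * max 0 ((x $ i - a $ i) * (b $ i - x $ i)) * (a $ i + b $ i - 2 * x $ i) * y $ i else 0) *
      (\<Prod>j\<in>UNIV - {i}. if a $ j \<le> b $ j then (max 0 ((x $ j - a $ j) * (b $ j - x $ j)))\<^sup>2 else 0))) (at x)"
proof -
  have "((\<lambda>x. if a $ i \<le> b $ i then (max 0 ((x $ i - a $ i) * (b $ i - x $ i)))\<^sup>2 else 0) has_derivative
    (\<lambda>y. if a $ i \<le> b $ i then
      2 * max 0 ((x $ i - a $ i) * (b $ i - x $ i)) * (a $ i + b $ i - 2 * x $ i) * y $ i else 0)) (at x)" for i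
  proof (cases "a $ i \<le> b $ i")
    case True
    have "((\<lambda>x. (x $ i - a $ i) * (b $ i - x $ i)) has_derivative (\<lambda>y. (a $ i + b $ i - 2 * x $ i) * y $ i)) (at x)"
      by (auto intro!: derivative_eq_intros bounded_linear.has_derivative[OF bounded_linear_vec_nth] simp: algebra_simps)
    then have "((\<lambda>x. (max 0 ((x $ i - a $ i) * (b $ i - x $ i)))\<^sup>2) has_derivative
      (\<lambda>y. 2 * max 0 ((x $ i - a $ i) * (b $ i - x $ i)) * ((a $ i + b $ i - 2 * x $ i) * y $ i))) (at x)"
      using has_derivative_compose[OF _ DERIV_pos_part_square[unfolded has_field_derivative_def],
        of "\<lambda>x. (x $ i - a $ i) * (b $ i - x $ i)" _ x UNIV]
      by simp
    then show ?thesis using True by (simp add: mult.assoc)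
  qed simp
  then show ?thesis
    unfolding box_bump_def[abs_def] by (rule has_derivative_prod)
qed

text \<open>For growing n these quotients increase to the indicator of the open box, while they stay
  C1, take values in [0, 1) and vanish off the closed box.\<close>

lemma C1_compact_box_bump:
  fixes a b :: "real^'d"
  assumes "cbox a b \<subseteq> A"
  shows "(\<lambda>x. real n * box_bump a b x / (1 + real n * box_bump a b x)) \<in> C1_compact A"
proof -
  define D where "D = (\<lambda>x y :: real^'d. \<Sum>i\<in>UNIV. (if a $ i \<le> b $ i then
      2 * max 0 ((x $ i - a $ i) * (b $ i - x $ i)) * (a $ i + b $ i - 2 * x $ i) * y $ i else 0) *
      (\<Prod>j\<in>UNIV - {i}. if a $ j \<le> b $ j then (max 0 ((x $ j - a $ j) * (b $ j - x $ j)))\<^sup>2 else 0))"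
  have D: "(box_bump a b has_derivative D x) (at x)" for x
    using box_bump_has_derivative[of a b x] by (simp add: D_def)
  have pos: "1 + real n * box_bump a b x > 0" for x
    using box_bump_nonneg[of a b x] by (simp add: add_pos_nonneg)
  let ?\<phi> = "\<lambda>x. real n * box_bump a b x / (1 + real n * box_bump a b x)"
  have der: "(?\<phi> has_derivative (\<lambda>y. real n * D x y / (1 + real n * box_bump a b x)\<^sup>2)) (at x)" for x
    using pos[of x] by (auto intro!: derivative_eq_intros D simp: field_simps power2_eq_square)
  have "grad ?\<phi> = (\<lambda>x. \<chi> i. real n * D x (axis i 1) / (1 + real n * box_bump a b x)\<^sup>2)"
    by (simp add: grad_def fun_eq_iff frechet_derivative_at[OF der, symmetric])
  moreover have "continuous_on UNIV (box_bump a b)"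
    using D by (intro continuous_at_imp_continuous_on ballI has_derivative_continuous)
  moreover have cif: "continuous_on UNIV (\<lambda>x. if a $ i \<le> b $ i then f x else (0::real))"
    if "continuous_on UNIV f" for f :: "real^'d \<Rightarrow> real" and i
    using that by (cases "a $ i \<le> b $ i") auto
  have "continuous_on UNIV (\<lambda>x. D x y)" for y
    unfolding D_def
    by (intro continuous_on_sum continuous_on_mult continuous_on_prod cif) (intro continuous_intros)+
  ultimately have "continuous_on UNIV (grad ?\<phi>)"
    using pos by (auto intro!: continuous_intros simp: less_imp_neq[symmetric])
  moreover have "?\<phi> x = 0" if "x \<notin> cbox a b" for x
    using that box_bump_pos_iff[of a b x] box_subset_cbox by auto
  moreover have "?\<phi> differentiable at x" for x
    using der unfolding differentiable_def by blast
  ultimately show ?thesis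
    using assms unfolding C1_compact_def by (auto intro!: exI[of _ "cbox a b"])
qed

lemma indicator_box_in_L2:
  assumes "A \<in> sets lebesgue" "B \<in> lmeasurable"
  shows "(indicator B :: _ \<Rightarrow> real) \<in> L2 A"
proof -
  have "integrable lebesgue (indicator (A \<inter> B) :: _ \<Rightarrow> real)"
    using fmeasurable_Int_fmeasurable[OF assms(2,1)] by (auto simp: Int_commute fmeasurable_def intro!: integrable_real_indicator)
  moreover have "(\<lambda>x. indicator A x *\<^sub>R indicator B x :: real) = indicator (A \<inter> B)"
    by (auto simp: fun_eq_iff indicator_def)
  ultimately have "integrable lebesgue (\<lambda>x. indicator A x *\<^sub>R indicator B x :: real)"
    by simp
  then have "integrable (lebesgue_on A) (indicator B :: _ \<Rightarrow> real)"
    using assms by (simp add: integrable_restrict_space)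
  moreover have "(norm (indicator B x :: real))\<^sup>2 = indicator B x" for x by (simp add: indicator_def)
  ultimately show ?thesis by (auto simp: L2_def)
qed

text \<open>A Dynkin argument: boxes are stable under intersection and generate the Borel sets, and
  a Lebesgue set differs from a Borel set by a null set. Vanishing integrals over all measurable
  sets then force h = 0 almost everywhere.\<close>

lemma set_integral_zero_all:
  fixes h :: "real^'d \<Rightarrow> real"
  assumes h: "integrable lebesgue h" and box: "\<And>a b. (LINT x:box a b|lebesgue. h x) = 0"
  shows "AE x in lebesgue. h x = 0"
proof (rule density_unique_real[OF h integrable_zero])
  have si: "set_integrable lebesgue A h" if "A \<in> sets lebesgue" for A
    unfolding set_integrable_def using h integrable_mult_indicator[OF that h] by simp
  \<comment> \<open>Complements in the Dynkin induction need the integral over the whole space,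
    obtained by exhausting it with cubes.\<close>
  have univ: "(LINT x|lebesgue. h x) = 0"
  proof -
    have "(\<lambda>n. LINT x|lebesgue. indicator (box (\<chi> i. - real n) (\<chi> i. real n)) x *\<^sub>R h x) \<longlonglongrightarrow> (LINT x|lebesgue. h x)"
    proof (rule integral_dominated_convergence[where w = "\<lambda>x. \<bar>h x\<bar>"])
      show "AE x in lebesgue. (\<lambda>n. indicat_real (box (\<chi> i. - real n) (\<chi> i. real n)) x *\<^sub>R h x) \<longlonglongrightarrow> h x"
      proof (intro AE_I2 tendsto_eventually)
        fix x :: "real^'d"
        obtain n0 where n0: "norm x < real n0" using reals_Archimedean2 by blast
        have "x \<in> box (\<chi> i. - real n) (\<chi> i. real n)" if "n \<ge> n0" for n
          unfolding mem_box_cart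
        proof
          fix i
          have "\<bar>x $ i\<bar> < real n" using that n0 component_le_norm_cart[of x i] by linarith
          then show "(\<chi> i. - real n) $ i < x $ i \<and> x $ i < (\<chi> i. real n) $ i" by auto
        qed
        then show "\<forall>\<^sub>F n in sequentially. indicat_real (box (\<chi> i. - real n) (\<chi> i. real n)) x *\<^sub>R h x = h x"
          unfolding eventually_sequentially by (intro exI[of _ n0]) auto
      qed
      show "(\<lambda>x. indicat_real (box (\<chi> i. - real n) (\<chi> i. real n)) x *\<^sub>R h x) \<in> borel_measurable lebesgue" for n
        using si[of "box (\<chi> i. - real n) (\<chi> i. real n)"] unfolding set_integrable_def
        by (intro borel_measurable_integrable) simp
    qed (use h in \<open>auto simp: indicator_def\<close>)
    moreover have "(\<lambda>n. LINT x|lebesgue. indicator (box (\<chi> i. - real n) (\<chi> i. real n)) x *\<^sub>R h x) = (\<lambda>n. 0)"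
      using box by (simp add: set_lebesgue_integral_def)
    ultimately show ?thesis by (simp add: LIMSEQ_const_iff)
  qed
  have Int: "Int_stable (range (\<lambda>(a, b). box a b :: (real^'d) set))"
    by (auto simp: Int_stable_def box_Int_box)
  have sig: "sigma_sets UNIV (range (\<lambda>(a, b). box a b :: (real^'d) set)) = sets borel"
    by (simp add: borel_eq_box)
  have pw: "range (\<lambda>(a, b). box a b :: (real^'d) set) \<subseteq> Pow UNIV" by simp
  have borel: "(LINT x:A|lebesgue. h x) = 0" if "A \<in> sets borel" for A
    using Int pw that[folded sig]
  proof (induct A rule: sigma_sets_induct_disjoint)
    case (basic A)
    then show ?case using box by auto
  next
    case empty
    then show ?case by (simp add: set_lebesgue_integral_def)
  next
    case (compl A)
    then have A: "A \<in> sets lebesgue" by (simp add: sig)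
    have "(LINT x:UNIV - A|lebesgue. h x) = (LINT x|lebesgue. h x - indicator A x *\<^sub>R h x)"
      unfolding set_lebesgue_integral_def
      by (intro Bochner_Integration.integral_cong) (auto simp: indicator_def)
    also have "\<dots> = (LINT x|lebesgue. h x) - (LINT x:A|lebesgue. h x)"
      using h si[OF A] unfolding set_lebesgue_integral_def set_integrable_def
      by (rule Bochner_Integration.integral_diff)
    finally show ?case using compl univ by simp
  next
    case (union A)
    have A: "A i \<in> sets lebesgue" for i using union(2) by (auto simp: sig)
    have "(\<Union>i. A i) \<in> sets lebesgue" using A by blast
    then have "(LINT x:(\<Union>i. A i)|lebesgue. h x) = (\<Sum>i. (LINT x:(A i)|lebesgue. h x))"
      using union(1) A by (intro lebesgue_integral_countable_add si) (auto simp: disjoint_family_on_def)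
    then show ?case using union(3) by (simp only: suminf_zero)
  qed
  fix A :: "(real^'d) set" assume "A \<in> sets lebesgue"
  then obtain S N N' where A: "A = S \<union> N" "N \<subseteq> N'" "N' \<in> null_sets lborel" "S \<in> sets lborel"
    by (rule sets_completionE)
  have N: "N \<in> null_sets lebesgue" using A(2) null_sets_completionI[OF A(3)] by (rule null_sets_completion_subset)
  have S: "S \<in> sets lebesgue" using A(4) by simp
  have "(LINT x:A|lebesgue. h x) = (LINT x:S|lebesgue. h x)"
    unfolding set_lebesgue_integral_def
  proof (rule integral_cong_AE)
    show "AE x in lebesgue. indicat_real A x *\<^sub>R h x = indicat_real S x *\<^sub>R h x"
      using AE_not_in[OF N] by eventually_elim (auto simp: A indicator_def)
    show "(\<lambda>x. indicat_real A x *\<^sub>R h x) \<in> borel_measurable lebesgue"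
      "(\<lambda>x. indicat_real S x *\<^sub>R h x) \<in> borel_measurable lebesgue"
      using borel_measurable_integrable[OF si[OF \<open>A \<in> sets lebesgue\<close>, unfolded set_integrable_def]]
        borel_measurable_integrable[OF si[OF S, unfolded set_integrable_def]] .
  qed
  then show "(LINT x:A|lebesgue. h x) = (LINT x:A|lebesgue. 0)" using borel[of S] A by simp
qed

text \<open>Test functions that increase to the indicator of a box show that g integrates to 0 over
  every box whose closed box lies in A; countably many closed boxes cover A.\<close>

lemma fundamental_lemma_variations:
  fixes g :: "real^'d \<Rightarrow> real"
  assumes "open A" "g \<in> L2 A" and orth: "\<And>\<phi>. \<phi> \<in> C1_compact A \<Longrightarrow> ip A g \<phi> = 0"
  shows "AE x in lebesgue_on A. g x = 0"
proof -
  have A: "A \<in> sets lebesgue" using assms(1) by auto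
  have gint: "integrable (lebesgue_on A) (\<lambda>x. g x * indicator (box a b) x)" for a b
    using L2_integrable_inner[OF assms(2) indicator_box_in_L2[OF A, of "box a b"]] by simp
  have box0: "(LINT x|lebesgue_on A. g x * indicator (box a b) x) = 0" if "cbox a b \<subseteq> A" for a b
  proof -
    let ?\<phi> = "\<lambda>n x. real n * box_bump a b x / (1 + real n * box_bump a b x)"
    have bnd: "0 \<le> ?\<phi> n x" "?\<phi> n x \<le> indicator (box a b) x" for n x
    proof -
      have nn: "real n * box_bump a b x \<ge> 0" using box_bump_nonneg[of a b x] by simp
      then show "0 \<le> ?\<phi> n x" by simp
      show "?\<phi> n x \<le> indicator (box a b) x"
        using nn box_bump_pos_iff[of a b x] by (cases "x \<in> box a b") (auto simp: divide_le_eq)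
    qed
    have mg: "g \<in> borel_measurable (lebesgue_on A)" using assms(2) by (auto simp: L2_def)
    have "continuous_on UNIV (box_bump a b)"
      by (intro continuous_at_imp_continuous_on ballI has_derivative_continuous[OF box_bump_has_derivative])
    then have mb: "box_bump a b \<in> borel_measurable (lebesgue_on A)"
      by (rule continuous_imp_measurable_on_sets_lebesgue[OF continuous_on_subset A]) simp
    have "(\<lambda>n. LINT x|lebesgue_on A. g x * ?\<phi> n x) \<longlonglongrightarrow> (LINT x|lebesgue_on A. g x * indicator (box a b) x)"
    proof (rule integral_dominated_convergence[where w = "\<lambda>x. \<bar>g x * indicator (box a b) x\<bar>"])
      show "integrable (lebesgue_on A) (\<lambda>x. \<bar>g x * indicator (box a b) x\<bar>)" using gint by simp
      show "AE x in lebesgue_on A. norm (g x * ?\<phi> n x) \<le> \<bar>g x * indicator (box a b) x\<bar>" for n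
      proof (rule AE_I2)
        fix x
        have "norm (g x * ?\<phi> n x) = \<bar>g x\<bar> * ?\<phi> n x"
          using bnd(1)[of n x] by (simp only: abs_mult real_norm_def abs_of_nonneg)
        also have "\<dots> \<le> \<bar>g x\<bar> * indicator (box a b) x"
          by (intro mult_left_mono bnd) simp
        finally show "norm (g x * ?\<phi> n x) \<le> \<bar>g x * indicator (box a b) x\<bar>"
          by (simp add: abs_mult)
      qed
      show "AE x in lebesgue_on A. (\<lambda>n. g x * ?\<phi> n x) \<longlonglongrightarrow> g x * indicator (box a b) x"
      proof (intro AE_I2 tendsto_mult_left)
        fix x
        show "(\<lambda>n. ?\<phi> n x) \<longlonglongrightarrow> indicator (box a b) x"
        proof (cases "x \<in> box a b")
          case True
          then have p: "box_bump a b x > 0" using box_bump_nonneg[of a b x] box_bump_pos_iff[of a b x] by auto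
          have "(\<lambda>n. 1 - inverse (1 + real n * box_bump a b x)) \<longlonglongrightarrow> 1 - 0"
            using p by (intro tendsto_diff tendsto_const tendsto_inverse_0_at_top filterlim_tendsto_add_at_top[OF tendsto_const]
              filterlim_at_top_mult_tendsto_pos[OF tendsto_const] filterlim_real_sequentially) auto
          moreover have "1 - inverse (1 + real n * box_bump a b x) = ?\<phi> n x" for n
          proof -
            have "1 + real n * box_bump a b x > 0" using p by (simp add: add_pos_nonneg)
            then show ?thesis by (simp add: field_simps)
          qed
          ultimately show ?thesis using True by simp
        qed (use box_bump_pos_iff[of a b x] in simp)
      qed
      show "(\<lambda>x. g x * indicator (box a b) x) \<in> borel_measurable (lebesgue_on A)"
        using gint borel_measurable_integrable by blast
    qed (use mg mb in \<open>auto intro!: borel_measurable_times borel_measurable_divide\<close>)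
    moreover have "(LINT x|lebesgue_on A. g x * ?\<phi> n x) = 0" for n
      using orth[OF C1_compact_box_bump[OF that, of n]] by (simp add: ip_def)
    ultimately show ?thesis by (simp add: LIMSEQ_const_iff)
  qed
  \<comment> \<open>Inside one closed box of A the function is localized to h. Any box meets
    \<open>box a b\<close> in a box again, so all box integrals of h vanish.\<close>
  have loc: "AE x in lebesgue. x \<in> cbox a b \<longrightarrow> g x = 0" if "cbox a b \<subseteq> A" for a b
  proof -
    define h where "h x = indicator A x * (g x * indicator (box a b) x)" for x
    have h: "integrable lebesgue h"
      using gint[of a b] A unfolding h_def by (simp add: integrable_restrict_space)
    have "AE x in lebesgue. h x = 0"
    proof (rule set_integral_zero_all[OF h])
      fix c d :: "real^'d"
      obtain e f where ef: "box a b \<inter> box c d = box e f" using box_Int_box by blast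
      have "(LINT x:box c d|lebesgue. h x) = (LINT x|lebesgue_on A. g x * indicator (box e f) x)"
        using A unfolding set_lebesgue_integral_def h_def
        by (subst integral_restrict_space) (auto intro!: Bochner_Integration.integral_cong simp: indicator_def ef[symmetric])
      also have "\<dots> = 0"
      \<comment> \<open>A nonempty box determines its closed box as its closure, which keeps
        \<open>cbox e f\<close> inside A; for an empty box nothing is known about the corners, but
        the integrand is 0.\<close>
      proof (cases "box e f = {}")
        case False
        then have "cbox e f \<subseteq> closure (box a b)"
          using ef by (metis closure_box closure_mono inf_le1)
        also have "\<dots> \<subseteq> cbox a b" by (intro closure_minimal box_subset_cbox closed_cbox)
        finally show ?thesis using that by (intro box0) auto
      qed simp
      finally show "(LINT x:box c d|lebesgue. h x) = 0" .
    qed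
    moreover have "AE x in lebesgue. x \<notin> cbox a b - box a b"
      using negligible_frontier_interval[of a b] unfolding negligible_iff_null_sets by (rule AE_not_in)
    ultimately show ?thesis
    proof eventually_elim
      case (elim x)
      then show ?case using that by (auto simp: h_def indicator_def split: if_splits)
    qed
  qed
  obtain \<D> where D: "countable \<D>" "\<D> \<subseteq> Pow A" "\<And>X. X \<in> \<D> \<Longrightarrow> \<exists>a b. X = cbox a b" "\<Union>\<D> = A"
    using open_countable_Union_open_cbox[OF assms(1)] by metis
  have "AE x in lebesgue. \<forall>X\<in>\<D>. x \<in> X \<longrightarrow> g x = 0"
  proof (subst AE_ball_countable[OF D(1)], intro ballI)
    fix X assume "X \<in> \<D>"
    moreover then obtain a b where "X = cbox a b" using D(3) by blast
    ultimately show "AE x in lebesgue. x \<in> X \<longrightarrow> g x = 0" using loc[of a b] D(2) by auto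
  qed
  then have "AE x in lebesgue. x \<in> A \<longrightarrow> g x = 0"
    by eventually_elim (use D(4) in blast)
  then show ?thesis using A by (simp add: AE_restrict_space_iff)
qed


section \<open>Test functions and the space H(div)\<close>

lemma continuous_compact_support_L2:
  fixes f :: "real^'d \<Rightarrow> 'b::euclidean_space"
  assumes "continuous_on UNIV f" "compact C" "\<And>x. x \<notin> C \<Longrightarrow> f x = 0" "A \<in> sets lebesgue"
  shows "f \<in> L2 A"
proof -
  have meas: "f \<in> borel_measurable (lebesgue_on A)"
    by (rule continuous_imp_measurable_on_sets_lebesgue[OF continuous_on_subset[OF assms(1)] assms(4)]) simp
  have "compact (f ` C)"
    using compact_continuous_image[OF continuous_on_subset[OF assms(1)] assms(2)] by simp
  then obtain B where B: "\<And>x. x \<in> C \<Longrightarrow> norm (f x) \<le> B"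
    using compact_imp_bounded[of "f ` C"] unfolding bounded_iff by blast
  have ind: "(indicator C :: _ \<Rightarrow> real) \<in> L2 A"
    by (rule indicator_box_in_L2[OF assms(4) lmeasurable_compact[OF assms(2)]])
  have "integrable (lebesgue_on A) (\<lambda>x. B\<^sup>2 * (indicator C x \<bullet> (indicator C x :: real)))"
    using L2_integrable_inner[OF ind ind] by simp
  then have "integrable (lebesgue_on A) (\<lambda>x. (norm (f x))\<^sup>2)"
  proof (rule Bochner_Integration.integrable_bound)
    show "(\<lambda>x. (norm (f x))\<^sup>2) \<in> borel_measurable (lebesgue_on A)"
      using meas by (intro borel_measurable_power) measurable
    have "norm ((norm (f x))\<^sup>2) \<le> norm (B\<^sup>2 * (indicator C x \<bullet> (indicator C x :: real)))" for x
    proof (cases "x \<in> C")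
      case True
      then show ?thesis using power_mono[OF B[OF True], of 2] by simp
    qed (simp add: assms(3))
    then show "AE x in lebesgue_on A. norm ((norm (f x))\<^sup>2) \<le> norm (B\<^sup>2 * (indicator C x \<bullet> (indicator C x :: real)))"
      by simp
  qed
  then show ?thesis using meas by (simp add: L2_def)
qed

lemma C1_compact_L2:
  assumes "\<phi> \<in> C1_compact A" "A \<in> sets lebesgue"
  shows "\<phi> \<in> L2 A" "grad \<phi> \<in> L2 A"
proof -
  obtain C where C: "compact C" "\<And>x. x \<notin> C \<Longrightarrow> \<phi> x = 0"
    and diff: "\<And>x. \<phi> differentiable (at x)" and cg: "continuous_on UNIV (grad \<phi>)"
    using assms(1) by (auto simp: C1_compact_def)
  have "continuous_on UNIV \<phi>"
    using diff by (simp add: continuous_at_imp_continuous_on differentiable_imp_continuous_within)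
  then show "\<phi> \<in> L2 A" by (rule continuous_compact_support_L2[OF _ C assms(2)])
  have "grad \<phi> x = 0" if "x \<notin> C" for x
  proof -
    have "((\<lambda>x. 0) has_derivative (\<lambda>h. 0)) (at x)" by simp
    then have "(\<phi> has_derivative (\<lambda>h. 0)) (at x)"
      by (rule has_derivative_transform_within_open[OF _ open_Compl[OF compact_imp_closed[OF C(1)]]])
        (use that C in auto)
    then show ?thesis
      by (simp add: grad_def frechet_derivative_at[symmetric] vec_eq_iff)
  qed
  then show "grad \<phi> \<in> L2 A" by (intro continuous_compact_support_L2[OF cg C(1) _ assms(2)])
qed

lemma is_weak_div_add_scale:
  assumes "A \<in> sets lebesgue" "u \<in> L2 A" "v \<in> L2 A" "is_weak_div A u g" "is_weak_div A v h"
  shows "is_weak_div A (u + v) (g + h)" "is_weak_div A (c *\<^sub>R u) (c *\<^sub>R g)"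
proof -
  have gh: "g \<in> L2 A" "h \<in> L2 A" using assms by (auto simp: is_weak_div_def)
  note l = bil_on_left[OF bil_on_ip]
  have eq: "ip A u (grad \<phi>) = - ip A g \<phi>" "ip A v (grad \<phi>) = - ip A h \<phi>" if "\<phi> \<in> C1_compact A" for \<phi>
    using assms that by (auto simp: is_weak_div_def)
  have "ip A (u + v) (grad \<phi>) = - ip A (g + h) \<phi>" "ip A (c *\<^sub>R u) (grad \<phi>) = - ip A (c *\<^sub>R g) \<phi>"
    if "\<phi> \<in> C1_compact A" for \<phi>
    using lin_on_add[OF l[OF C1_compact_L2(2)[OF that assms(1)]] assms(2,3)]
      lin_on_scale[OF l[OF C1_compact_L2(2)[OF that assms(1)]] assms(2)]
      lin_on_add[OF l[OF C1_compact_L2(1)[OF that assms(1)]] gh]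
      lin_on_scale[OF l[OF C1_compact_L2(1)[OF that assms(1)]] gh(1)] eq[OF that]
    by simp_all
  then show "is_weak_div A (u + v) (g + h)" "is_weak_div A (c *\<^sub>R u) (c *\<^sub>R g)"
    using subspace_add[OF subspace_L2 gh] subspace_scale[OF subspace_L2 gh(1)]
    unfolding is_weak_div_def by blast+
qed

lemma weak_div_unique:
  assumes "open A" "is_weak_div A v g" "is_weak_div A v h"
  shows "AE x in lebesgue_on A. g x = h x"
proof -
  have A: "A \<in> sets lebesgue" using assms(1) by auto
  have gh: "g \<in> L2 A" "h \<in> L2 A" using assms by (auto simp: is_weak_div_def)
  have "AE x in lebesgue_on A. (g - h) x = 0"
  proof (rule fundamental_lemma_variations[OF assms(1)])
    show "g - h \<in> L2 A" by (rule subspace_diff[OF subspace_L2 gh])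
    show "ip A (g - h) \<phi> = 0" if "\<phi> \<in> C1_compact A" for \<phi>
      using lin_on_diff[OF bil_on_left[OF bil_on_ip C1_compact_L2(1)[OF that A]] subspace_L2 gh] that assms(2,3)
      by (simp add: is_weak_div_def)
  qed
  then show ?thesis by simp
qed

lemma is_weak_div_wdiv: "v \<in> Hdiv A \<Longrightarrow> is_weak_div A v (wdiv A v)"
  unfolding wdiv_def by (rule someI_ex[of "is_weak_div A v"]) (simp add: Hdiv_def)

lemma wdiv_L2: "v \<in> Hdiv A \<Longrightarrow> wdiv A v \<in> L2 A"
  using is_weak_div_wdiv[of v A] by (simp add: is_weak_div_def)

lemma wdiv_AE_eq: "open A \<Longrightarrow> is_weak_div A v g \<Longrightarrow> AE x in lebesgue_on A. wdiv A v x = g x"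
  unfolding wdiv_def by (rule weak_div_unique[OF _ someI[of "is_weak_div A v"]]) assumption+

lemma Hdiv_L2: "v \<in> Hdiv A \<Longrightarrow> v \<in> L2 A"
  by (simp add: Hdiv_def)

lemma is_weak_div_null:
  assumes "A \<in> sets lebesgue" "v \<in> L2 A" "ip A v v = 0"
  shows "is_weak_div A v 0"
proof -
  have "ip A v w = 0" if "w \<in> L2 A" for w
    using psd_form_null[where A = "ip A", OF psd_form_ip subspace_L2 assms(2) that assms(3)] .
  then show ?thesis
    using C1_compact_L2(2)[OF _ assms(1)] subspace_0[OF subspace_L2, of A]
    by (simp add: is_weak_div_def ip_def[of A 0])
qed

lemma subspace_Hdiv: "open A \<Longrightarrow> subspace (Hdiv A)"
proof (rule subspaceI)
  assume A: "open A"
  then have A': "A \<in> sets lebesgue" by auto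
  show "0 \<in> Hdiv A"
    using is_weak_div_null[OF A' subspace_0[OF subspace_L2]] subspace_0[OF subspace_L2, of A]
    unfolding Hdiv_def by (auto simp: ip_def)
  show "u + v \<in> Hdiv A" if "u \<in> Hdiv A" "v \<in> Hdiv A" for u v
    using is_weak_div_add_scale(1)[OF A' _ _ is_weak_div_wdiv[OF that(1)] is_weak_div_wdiv[OF that(2)]] that
      subspace_add[OF subspace_L2, of u A v] by (auto simp: Hdiv_def)
  show "c *\<^sub>R u \<in> Hdiv A" if "u \<in> Hdiv A" for c u
    using is_weak_div_add_scale(2)[OF A' _ _ is_weak_div_wdiv[OF that] is_weak_div_wdiv[OF that]] that
      subspace_scale[OF subspace_L2, of u A] by (auto simp: Hdiv_def)
qed

text \<open>\<open>wdiv\<close> is an arbitrary choice of a representative for each field, so it is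
  linear only almost everywhere, by uniqueness of the weak divergence.\<close>

lemma wdiv_linear_AE:
  assumes "open A" "u \<in> Hdiv A" "v \<in> Hdiv A"
  shows "AE x in lebesgue_on A. wdiv A (u + v) x = (wdiv A u + wdiv A v) x"
    "AE x in lebesgue_on A. wdiv A (c *\<^sub>R u) x = (c *\<^sub>R wdiv A u) x"
proof -
  have A: "A \<in> sets lebesgue" using assms(1) by auto
  note * = is_weak_div_add_scale[OF A assms(2)[THEN Hdiv_L2] assms(3)[THEN Hdiv_L2]
    assms(2)[THEN is_weak_div_wdiv] assms(3)[THEN is_weak_div_wdiv]]
  show "AE x in lebesgue_on A. wdiv A (u + v) x = (wdiv A u + wdiv A v) x"
    "AE x in lebesgue_on A. wdiv A (c *\<^sub>R u) x = (c *\<^sub>R wdiv A u) x"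
    using wdiv_AE_eq[OF assms(1) *(1)] wdiv_AE_eq[OF assms(1) *(2)] .
qed

lemma bil_on_wdiv:
  assumes "open A"
  shows "bil_on (Hdiv A) (L2 A) (\<lambda>v w. ip A (wdiv A v) w)"
  unfolding bil_on_def
proof (intro conjI ballI)
  show "lin_on (L2 A) (ip A (wdiv A f))" if "f \<in> Hdiv A" for f
    using bil_on_right[OF bil_on_ip wdiv_L2[OF that]] .
  fix w :: "real^'a \<Rightarrow> real" assume w: "w \<in> L2 A"
  note l = bil_on_left[OF bil_on_ip w] and H = subspace_Hdiv[OF assms]
  show "lin_on (Hdiv A) (\<lambda>v. ip A (wdiv A v) w)"
    unfolding lin_on_def
  proof (intro conjI ballI allI)
    fix u v assume uv: "u \<in> Hdiv A" "v \<in> Hdiv A"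
    have "ip A (wdiv A (u + v)) w = ip A (wdiv A u + wdiv A v) w"
      by (rule ip_cong_AE[where f' = "wdiv A u + wdiv A v", OF wdiv_linear_AE(1)[OF assms uv]])
        (use uv w in \<open>auto intro!: wdiv_L2 subspace_add[OF H] subspace_add[OF subspace_L2]\<close>)
    then show "ip A (wdiv A (u + v)) w = ip A (wdiv A u) w + ip A (wdiv A v) w"
      using lin_on_add[OF l wdiv_L2[OF uv(1)] wdiv_L2[OF uv(2)]] by (rule trans)
  next
    fix u c assume u: "u \<in> Hdiv A"
    have "ip A (wdiv A (c *\<^sub>R u)) w = ip A (c *\<^sub>R wdiv A u) w"
      by (rule ip_cong_AE[where f' = "c *\<^sub>R wdiv A u", OF wdiv_linear_AE(2)[OF assms u u]])
        (use u w in \<open>auto intro!: wdiv_L2 subspace_scale[OF H] subspace_scale[OF subspace_L2]\<close>)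
    then show "ip A (wdiv A (c *\<^sub>R u)) w = c * ip A (wdiv A u) w"
      using lin_on_scale[OF l wdiv_L2[OF u]] by (rule trans)
  qed
qed

lemma psd_form_wdiv:
  assumes "open A"
  shows "psd_form (Hdiv A) (\<lambda>u v. ip A (wdiv A u) (wdiv A v))"
proof -
  have sym: "ip A (wdiv A u) (wdiv A v) = ip A (wdiv A v) (wdiv A u)" for u v
    by (simp add: ip_def mult.commute)
  have "lin_on (Hdiv A) (\<lambda>u. ip A (wdiv A u) (wdiv A v))" if "v \<in> Hdiv A" for v
    using bil_on_left[OF bil_on_wdiv[OF assms] wdiv_L2[OF that]] .
  then show ?thesis
    unfolding psd_form_def bil_on_def using sym psd_formD(3)[where A = "ip A", OF psd_form_ip wdiv_L2] by auto
qed

text \<open>The kernel condition for dominating the divergence by the L2 norm: a field that is 0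
  almost everywhere has the weak divergence 0, and by uniqueness the chosen one agrees with
  it.\<close>

lemma wdiv_null:
  assumes "open A" "v \<in> Hdiv A" "ip A v v = 0"
  shows "ip A (wdiv A v) (wdiv A v) = 0"
proof -
  have A: "A \<in> sets lebesgue" using assms(1) by auto
  have "is_weak_div A v 0" using is_weak_div_null[OF A Hdiv_L2[OF assms(2)] assms(3)] .
  from wdiv_AE_eq[OF assms(1) this] have "AE x in lebesgue_on A. wdiv A v x = 0" by simp
  then show ?thesis
    using ip_null_iff[OF wdiv_L2[OF assms(2)]] by blast
qed

section \<open>Mesh geometry\<close>

text \<open>One affine set contains the other, and both have codimension one, since K has interior
  and is therefore full-dimensional.\<close>

lemma facet_affine_hull_eq_hyperplane:
  fixes K :: "'a::euclidean_space set"
  assumes "interior K \<noteq> {}" "e facet_of K" "\<nu> \<noteq> 0" "\<And>y. y \<in> e \<Longrightarrow> \<nu> \<bullet> y = c"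
  shows "affine hull e = {y. \<nu> \<bullet> y = c}"
proof (rule affine_dim_equal)
  show "affine hull e \<subseteq> {y. \<nu> \<bullet> y = c}"
    using assms(4) by (intro hull_minimal) (auto simp: affine_hyperplane)
  have "aff_dim e = int (DIM('a)) - 1"
    using assms(1,2) by (simp add: facet_of_def aff_dim_nonempty_interior)
  moreover have "DIM('a) \<ge> 1" by (simp add: Suc_leI)
  ultimately show "aff_dim (affine hull e) = aff_dim {y. \<nu> \<bullet> y = c}"
    using assms(3) by (simp add: of_nat_diff)
  show "affine hull e \<noteq> {}" using assms(2) by (auto simp: facet_of_def)
qed (auto simp: affine_hyperplane)

text \<open>The affine hull of a proper face misses the relative interior, so the connected interior
  lies on one side of the plane of the facet; closure extends this to K.\<close>

lemma facet_one_side: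
  fixes K :: "'a::euclidean_space set"
  assumes "convex K" "interior K \<noteq> {}" "e facet_of K" "\<nu> \<noteq> 0" "\<And>y. y \<in> e \<Longrightarrow> \<nu> \<bullet> y = c"
  shows "(\<forall>y\<in>K. \<nu> \<bullet> y \<le> c) \<or> (\<forall>y\<in>K. \<nu> \<bullet> y \<ge> c)"
proof -
  have ne: "e \<noteq> K" using assms(3) by auto
  have "affine hull e \<inter> rel_interior K = {}"
    by (rule affine_hull_face_of_disjoint_rel_interior[OF assms(1) facet_of_imp_face_of[OF assms(3)] ne])
  then have disj: "\<nu> \<bullet> y \<noteq> c" if "y \<in> interior K" for y
    using that facet_affine_hull_eq_hyperplane[OF assms(2-5)] rel_interior_nonempty_interior[OF assms(2)] by auto
  have conn: "connected (interior K)" using assms(1) convex_connected convex_interior by blast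
  have cl: "K \<subseteq> closure (interior K)"
    using convex_closure_interior[OF assms(1,2)] closure_subset by auto
  have "(\<forall>y\<in>interior K. \<nu> \<bullet> y \<le> c) \<or> (\<forall>y\<in>interior K. \<nu> \<bullet> y \<ge> c)"
  proof (rule ccontr)
    assume "\<not> ?thesis"
    then obtain x y where "x \<in> interior K" "y \<in> interior K" "\<nu> \<bullet> x \<ge> c" "\<nu> \<bullet> y \<le> c"
      by (auto simp: not_le intro: less_imp_le)
    then show False using connected_ivt_hyperplane[OF conn, of y x \<nu> c] disj by blast
  qed
  then show ?thesis
  proof
    assume "\<forall>y\<in>interior K. \<nu> \<bullet> y \<le> c"
    then have "closure (interior K) \<subseteq> {y. \<nu> \<bullet> y \<le> c}"
      by (intro closure_minimal closed_halfspace_le) auto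
    then show ?thesis using cl by blast
  next
    assume "\<forall>y\<in>interior K. \<nu> \<bullet> y \<ge> c"
    then have "closure (interior K) \<subseteq> {y. \<nu> \<bullet> y \<ge> c}"
      by (intro closure_minimal closed_halfspace_ge) auto
    then show ?thesis using cl by blast
  qed
qed

text \<open>The ray from an interior point p through \<open>x + t *\<^sub>R w\<close> hits the plane
  of the facet in a point \<open>z t\<close> near x, which belongs to the facet because x is in its
  relative interior. The point in question thus lies strictly between p and a point of K.\<close>

lemma facet_inward_direction:
  fixes K :: "'a::euclidean_space set"
  assumes "convex K" "interior K \<noteq> {}" "e facet_of K" "\<nu> \<noteq> 0" "\<And>y. y \<in> e \<Longrightarrow> \<nu> \<bullet> y = c"
    and "\<And>y. y \<in> K \<Longrightarrow> \<nu> \<bullet> y \<le> c" "x \<in> rel_interior e" "\<nu> \<bullet> w < 0"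
  shows "\<forall>\<^sub>F t in at_right 0. x + t *\<^sub>R w \<in> interior K"
proof -
  obtain p where p: "p \<in> interior K" using assms(2) by blast
  have eK: "e \<subseteq> K" by (rule facet_of_imp_subset[OF assms(3)])
  have xe: "x \<in> e" using assms(7) rel_interior_subset by blast
  have hull: "affine hull e = {y. \<nu> \<bullet> y = c}"
    by (rule facet_affine_hull_eq_hyperplane[OF assms(2-5)])
  have "p \<in> interior {y. \<nu> \<bullet> y \<le> c}" using p assms(6) interior_mono[of K "{y. \<nu> \<bullet> y \<le> c}"] by blast
  then have pc: "\<nu> \<bullet> p < c" using assms(4) by simp
  define h where "h = c - \<nu> \<bullet> p"
  have h: "h > 0" using pc by (simp add: h_def)
  \<comment> \<open>The stretching factor that brings the level of \<open>z t\<close> to c: the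
    denominator is the level difference between \<open>x + t *\<^sub>R w\<close> and p, and h is the
    one between the plane and p.\<close>
  define s where "s t = h / (h + t * (\<nu> \<bullet> w))" for t
  define z where "z t = p + s t *\<^sub>R (x + t *\<^sub>R w - p)" for t
  obtain r where r: "r > 0" "ball x r \<inter> affine hull e \<subseteq> e"
    using assms(7) unfolding mem_rel_interior_ball by blast
  have "((\<lambda>t. h + t * (\<nu> \<bullet> w)) \<longlongrightarrow> h + 0 * (\<nu> \<bullet> w)) (at_right 0)" by (intro tendsto_intros)
  then have lim_h: "((\<lambda>t. h + t * (\<nu> \<bullet> w)) \<longlongrightarrow> h) (at_right 0)" by simp
  have s1: "(s \<longlongrightarrow> h / h) (at_right 0)"
    unfolding s_def[abs_def] using h by (intro tendsto_intros lim_h) auto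
  have "(z \<longlongrightarrow> p + (h / h) *\<^sub>R (x + 0 *\<^sub>R w - p)) (at_right 0)"
    unfolding z_def[abs_def] by (intro tendsto_intros s1)
  then have "(z \<longlongrightarrow> x) (at_right 0)" using h by simp
  then have "\<forall>\<^sub>F t in at_right 0. dist (z t) x < r" using r(1) by (rule tendstoD)
  moreover have "\<forall>\<^sub>F t in at_right 0. h + t * (\<nu> \<bullet> w) > 0" using order_tendstoD(1)[OF lim_h h] .
  moreover have "\<forall>\<^sub>F t in at_right 0. (t::real) > 0" by (simp add: eventually_at_right_less)
  ultimately show ?thesis
  proof eventually_elim
    case (elim t)
    have lt: "h + t * (\<nu> \<bullet> w) < h" using elim assms(8) by (simp add: mult_pos_neg)
    then have s: "s t > 1" using elim by (simp add: s_def)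
    have "\<nu> \<bullet> z t = \<nu> \<bullet> p + s t * (h + t * (\<nu> \<bullet> w))"
      using assms(5)[OF xe] by (simp add: z_def h_def inner_add_right inner_diff_right algebra_simps)
    also have "\<dots> = c" using elim by (simp add: s_def h_def)
    finally have "z t \<in> e" using r(2) elim hull by (auto simp: dist_commute)
    then have "z t \<in> closure K" using eK closure_subset by blast
    moreover have "x + t *\<^sub>R w \<in> open_segment p (z t)"
    proof -
      have "x + t *\<^sub>R w = (1 - 1 / s t) *\<^sub>R p + (1 / s t) *\<^sub>R z t"
        using s by (simp add: z_def algebra_simps)
      moreover have "p \<noteq> z t" using assms(5)[OF \<open>z t \<in> e\<close>] pc by auto
      ultimately show ?thesis using s unfolding in_segment by (intro conjI exI[of _ "1 / s t"]) auto
    qed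
    ultimately show ?case using in_interior_closure_convex_segment[OF assms(1) p] by blast
  qed
qed

text \<open>Invariance of domain, applied to f on the interior of S and to its inverse on the
  interior of the image.\<close>

lemma homeomorphic_image_interior:
  fixes f :: "'a::euclidean_space \<Rightarrow> 'a"
  assumes "compact S" "continuous_on S f" "inj_on f S"
  shows "f ` interior S = interior (f ` S)"
proof
  have "open (f ` interior S)"
    by (rule invariance_of_domain[OF continuous_on_subset[OF assms(2) interior_subset] open_interior
      inj_on_subset[OF assms(3) interior_subset]])
  then show "f ` interior S \<subseteq> interior (f ` S)"
    by (simp add: image_mono interior_maximal interior_subset)
  obtain g where g: "homeomorphism S (f ` S) f g"
    using homeomorphism_compact[OF assms(1,2) refl assms(3)] by blast
  have "inj_on g (f ` S)" using g by (metis homeomorphism_apply2 inj_on_inverseI)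
  then have "open (g ` interior (f ` S))"
    by (rule invariance_of_domain[OF continuous_on_subset[OF homeomorphism_cont2[OF g] interior_subset] open_interior
      inj_on_subset[OF _ interior_subset]])
  moreover have "g ` interior (f ` S) \<subseteq> S"
    using g interior_subset[of "f ` S"] by (auto simp: homeomorphism_def)
  ultimately have "g ` interior (f ` S) \<subseteq> interior S" by (simp add: interior_maximal)
  then show "interior (f ` S) \<subseteq> f ` interior S"
  proof (intro subsetI)
    fix y assume "g ` interior (f ` S) \<subseteq> interior S" and y: "y \<in> interior (f ` S)"
    then have "g y \<in> interior S" "f (g y) = y"
      using g interior_subset[of "f ` S"] by (auto simp: homeomorphism_def)
    then show "y \<in> f ` interior S" by (metis imageI)
  qed
qed

section \<open>Reference cube, cells and interior faces\<close>

lemma compact_ref_cube: "compact ref_cube"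
  and interior_ref_cube_nonempty: "interior (ref_cube :: (real^'d) set) \<noteq> {}"
proof -
  show "compact ref_cube" by (auto simp: ref_cube_def)
  have "(\<chi> i. 1 / 2) \<in> interior (ref_cube :: (real^'d) set)"
    by (simp add: ref_cube_def interior_cbox mem_box_cart)
  then show "interior (ref_cube :: (real^'d) set) \<noteq> {}" by blast
qed

lemma ref_diffeo_interior:
  assumes "ref_diffeo F K"
  shows "F ` interior ref_cube = interior K" "interior K \<noteq> {}"
proof -
  have F: "continuous_on ref_cube F" "inj_on F ref_cube" "F ` ref_cube = K"
    using assms differentiable_imp_continuous_on by (auto simp: ref_diffeo_def bij_betw_def)
  show "F ` interior ref_cube = interior K"
    using homeomorphic_image_interior[OF compact_ref_cube F(1,2)] F(3) by simp
  then show "interior K \<noteq> {}" using interior_ref_cube_nonempty by blast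
qed

locale mesh_geometry =
  fixes X :: "('d::finite) mesh"
  assumes mesh: "fe_mesh X" and open_region: "open (region X)"
    and bounded_region: "bounded (region X)" and region_nonempty: "region X \<noteq> {}"
begin

lemma finite_cells: "finite (cells X)"
  and Union_cells: "\<Union>(cells X) = closure (region X)"
  using mesh by (auto simp: fe_mesh_def)

lemma cell:
  assumes "K \<in> cells X"
  shows cell_polytope: "polytope K" and cell_diffeo: "ref_diffeo (refmap X K) K"
    and cell_convex: "convex K" and cell_compact: "compact K" and cell_closed: "closed K"
    and cell_interior: "interior K \<noteq> {}"
    and cell_aff_dim: "aff_dim K = int DIM(real^'d)"
proof -
  show p: "polytope K" "ref_diffeo (refmap X K) K" using mesh assms by (auto simp: fe_mesh_def)
  show c: "convex K" "compact K" using p polytope_imp_convex polytope_imp_compact by auto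
  then show "closed K" by (simp add: compact_imp_closed)
  show i: "interior K \<noteq> {}" using ref_diffeo_interior(2) p by blast
  show "aff_dim K = int DIM(real^'d)" by (rule aff_dim_nonempty_interior[OF i])
qed

lemma cells_face: "K \<in> cells X \<Longrightarrow> K' \<in> cells X \<Longrightarrow> K \<noteq> K' \<Longrightarrow> (K \<inter> K') face_of K"
  using mesh by (auto simp: fe_mesh_def)

text \<open>Otherwise K would be a proper face of K' and hence of lower dimension, while all cells
  are full-dimensional.\<close>

lemma cells_Int_neq:
  assumes "K \<in> cells X" "K' \<in> cells X" "K \<noteq> K'"
  shows "K \<inter> K' \<noteq> K"
proof
  assume *: "K \<inter> K' = K"
  have "K' \<inter> K face_of K'" using cells_face assms by metis
  then have f: "K face_of K'" using * by (simp add: Int_commute)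
  from face_of_aff_dim_lt[OF cell_convex[OF assms(2)] f assms(3)]
  show False using cell_aff_dim assms by simp
qed

lemma cells_disjoint_interior:
  assumes "K \<in> cells X" "K' \<in> cells X" "K \<noteq> K'"
  shows "interior K \<inter> interior K' = {}"
  using face_of_disjoint_interior[OF cells_face[OF assms] cells_Int_neq[OF assms]]
    interior_subset[of K] interior_subset[of K'] by blast

lemma int_face:
  assumes "e \<in> int_faces X"
  obtains K K' where "K \<in> cells X" "K' \<in> cells X" "K \<noteq> K'" "e = K \<inter> K'" "e facet_of K" "e facet_of K'"
proof -
  obtain K K' where K: "K \<in> cells X" "K' \<in> cells X" "K \<noteq> K'" "e = K \<inter> K'" "e facet_of K"
    using assms unfolding int_faces_def by blast
  have "e face_of K'" using cells_face[OF K(2,1)] K by (simp add: Int_commute)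
  then have "e facet_of K'"
    using K(5) cell_aff_dim K(1,2) by (simp add: facet_of_def)
  then show thesis using that K by blast
qed

text \<open>Every point of the face gives the same value; the plane of the face is the level set of
  its normal at this height.\<close>

definition face_level :: "(real^'d) set \<Rightarrow> real" where
  "face_level e = nu X e \<bullet> (SOME y. y \<in> e)"

lemma face_normal:
  assumes "e \<in> int_faces X"
  shows "norm (nu X e) = 1" "nu X e \<noteq> 0" "\<And>y. y \<in> e \<Longrightarrow> nu X e \<bullet> y = face_level e" "e \<noteq> {}"
proof -
  show n: "norm (nu X e) = 1" using mesh assms by (auto simp: fe_mesh_def)
  then show "nu X e \<noteq> 0" by auto
  obtain K where "e facet_of K" using int_face[OF assms] by metis
  then show ne: "e \<noteq> {}" by (simp add: facet_of_def)
  show "nu X e \<bullet> y = face_level e" if "y \<in> e" for y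
  proof -
    have "nu X e \<bullet> (y - (SOME y. y \<in> e)) = 0"
      using mesh assms that some_in_eq[of e] ne by (simp add: fe_mesh_def)
    then show ?thesis by (simp add: face_level_def inner_diff_right)
  qed
qed

lemma face_side_le: "e \<in> int_faces X \<Longrightarrow> (\<forall>x\<in>K. \<forall>y\<in>e. nu X e \<bullet> (x - y) \<le> 0) \<longleftrightarrow> (\<forall>x\<in>K. nu X e \<bullet> x \<le> face_level e)"
  and face_side_ge: "e \<in> int_faces X \<Longrightarrow> (\<forall>x\<in>K. \<forall>y\<in>e. nu X e \<bullet> (x - y) \<ge> 0) \<longleftrightarrow> (\<forall>x\<in>K. nu X e \<bullet> x \<ge> face_level e)"
  using face_normal(3,4)[of e] by (auto simp: inner_diff_right)

lemma inward_le:
  assumes "e \<in> int_faces X" "K \<in> cells X" "e facet_of K" "\<forall>x\<in>K. nu X e \<bullet> x \<le> face_level e"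
    "x \<in> rel_interior e" "nu X e \<bullet> w < 0"
  shows "\<forall>\<^sub>F t in at_right 0. x + t *\<^sub>R w \<in> interior K"
  by (rule facet_inward_direction[OF cell_convex[OF assms(2)] cell_interior[OF assms(2)] assms(3)
    face_normal(2)[OF assms(1)] face_normal(3)[OF assms(1)]]) (use assms in auto)

lemma inward_ge:
  assumes "e \<in> int_faces X" "K \<in> cells X" "e facet_of K" "\<forall>x\<in>K. nu X e \<bullet> x \<ge> face_level e"
    "x \<in> rel_interior e" "nu X e \<bullet> w > 0"
  shows "\<forall>\<^sub>F t in at_right 0. x + t *\<^sub>R w \<in> interior K"
  by (rule facet_inward_direction[where \<nu> = "- nu X e" and c = "- face_level e",
        OF cell_convex[OF assms(2)] cell_interior[OF assms(2)] assms(3)])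
    (use assms face_normal[OF assms(1)] in auto)

lemma rel_interior_face_nonempty:
  assumes "K \<in> cells X" "e facet_of K"
  shows "rel_interior e \<noteq> {}"
  using rel_interior_eq_empty[OF face_of_imp_convex[OF facet_of_imp_face_of[OF assms(2)]]] assms(2)
  by (auto simp: facet_of_def)

text \<open>Moving off a relative interior point of the face against the normal enters the interior
  of every cell on that side, and the interiors of distinct cells are disjoint.\<close>

lemma side_le_unique:
  assumes "e \<in> int_faces X" "K \<in> cells X" "e facet_of K" "\<forall>x\<in>K. nu X e \<bullet> x \<le> face_level e"
    "K' \<in> cells X" "e facet_of K'" "\<forall>x\<in>K'. nu X e \<bullet> x \<le> face_level e"
  shows "K = K'"
proof (rule ccontr)
  assume ne: "K \<noteq> K'"
  obtain x where x: "x \<in> rel_interior e" using rel_interior_face_nonempty assms by blast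
  have w: "nu X e \<bullet> (- nu X e) < 0" using face_normal(2)[OF assms(1)] by simp
  have "\<forall>\<^sub>F t in at_right 0. x + t *\<^sub>R (- nu X e) \<in> interior K \<inter> interior K'"
    using inward_le[OF assms(1-4) x w] inward_le[OF assms(1,5-7) x w] by eventually_elim simp
  then have "\<exists>y. y \<in> interior K \<inter> interior K'"
    by (meson eventually_happens trivial_limit_at_right_real)
  then show False using cells_disjoint_interior[OF assms(2,5) ne] by blast
qed

lemma side_ge_unique:
  assumes "e \<in> int_faces X" "K \<in> cells X" "e facet_of K" "\<forall>x\<in>K. nu X e \<bullet> x \<ge> face_level e"
    "K' \<in> cells X" "e facet_of K'" "\<forall>x\<in>K'. nu X e \<bullet> x \<ge> face_level e"
  shows "K = K'"
proof (rule ccontr)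
  assume ne: "K \<noteq> K'"
  obtain x where x: "x \<in> rel_interior e" using rel_interior_face_nonempty assms by blast
  have w: "nu X e \<bullet> nu X e > 0" using face_normal(2)[OF assms(1)] by simp
  have "\<forall>\<^sub>F t in at_right 0. x + t *\<^sub>R nu X e \<in> interior K \<inter> interior K'"
    using inward_ge[OF assms(1-4) x w] inward_ge[OF assms(1,5-7) x w] by eventually_elim simp
  then have "\<exists>y. y \<in> interior K \<inter> interior K'"
    by (meson eventually_happens trivial_limit_at_right_real)
  then show False using cells_disjoint_interior[OF assms(2,5) ne] by blast
qed

text \<open>The definite descriptions are proper: each side of a face carries at most one cell
  having it as a facet, so the two cells that share the face lie on opposite sides.\<close>

lemma elem_sides:
  assumes "e \<in> int_faces X"
  shows elem_from_cell: "elem_from X e \<in> cells X" and elem_from_facet: "e facet_of elem_from X e"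
    and elem_from_side: "\<forall>x\<in>elem_from X e. nu X e \<bullet> x \<le> face_level e"
    and elem_to_cell: "elem_to X e \<in> cells X" and elem_to_facet: "e facet_of elem_to X e"
    and elem_to_side: "\<forall>x\<in>elem_to X e. nu X e \<bullet> x \<ge> face_level e"
proof -
  obtain K K' where K: "K \<in> cells X" "K' \<in> cells X" "K \<noteq> K'" "e = K \<inter> K'" "e facet_of K" "e facet_of K'"
    using int_face[OF assms] by metis
  have one: "(\<forall>y\<in>K. nu X e \<bullet> y \<le> face_level e) \<or> (\<forall>y\<in>K. nu X e \<bullet> y \<ge> face_level e)"
    if "K \<in> cells X" "e facet_of K" for K
    by (rule facet_one_side[OF cell_convex[OF that(1)] cell_interior[OF that(1)] that(2)
      face_normal(2,3)[OF assms]])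
  have "\<exists>K1 K2. K1 \<in> cells X \<and> e facet_of K1 \<and> (\<forall>x\<in>K1. nu X e \<bullet> x \<le> face_level e) \<and>
     K2 \<in> cells X \<and> e facet_of K2 \<and> (\<forall>x\<in>K2. nu X e \<bullet> x \<ge> face_level e)"
  proof (cases "\<forall>y\<in>K. nu X e \<bullet> y \<le> face_level e")
    case True
    then have "\<not> (\<forall>y\<in>K'. nu X e \<bullet> y \<le> face_level e)"
      using side_le_unique[OF assms K(1,5) True K(2,6)] K(3) by auto
    then have "\<forall>y\<in>K'. nu X e \<bullet> y \<ge> face_level e" using one[OF K(2,6)] by blast
    then show ?thesis using True K by (intro exI[of _ K, OF exI[of _ K']]) simp
  next
    case False
    then have ge: "\<forall>y\<in>K. nu X e \<bullet> y \<ge> face_level e" using one[OF K(1,5)] by blast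
    then have "\<not> (\<forall>y\<in>K'. nu X e \<bullet> y \<ge> face_level e)"
      using side_ge_unique[OF assms K(1,5) ge K(2,6)] K(3) by auto
    then have "\<forall>y\<in>K'. nu X e \<bullet> y \<le> face_level e" using one[OF K(2,6)] by blast
    then show ?thesis using ge K by (intro exI[of _ K', OF exI[of _ K]]) simp
  qed
  then obtain K1 K2 where K1: "K1 \<in> cells X" "e facet_of K1" "\<forall>x\<in>K1. nu X e \<bullet> x \<le> face_level e"
    and K2: "K2 \<in> cells X" "e facet_of K2" "\<forall>x\<in>K2. nu X e \<bullet> x \<ge> face_level e"
    by auto
  have from1: "elem_from X e = K1"
    unfolding elem_from_def face_side_le[OF assms]
  proof (rule the_equality)
    show "K1 \<in> cells X \<and> e facet_of K1 \<and> (\<forall>x\<in>K1. nu X e \<bullet> x \<le> face_level e)" using K1 by simp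
    show "J = K1" if "J \<in> cells X \<and> e facet_of J \<and> (\<forall>x\<in>J. nu X e \<bullet> x \<le> face_level e)" for J
      by (rule side_le_unique[OF assms _ _ _ K1]) (use that in simp_all)
  qed
  show "elem_from X e \<in> cells X" "e facet_of elem_from X e" "\<forall>x\<in>elem_from X e. nu X e \<bullet> x \<le> face_level e"
    unfolding from1 by (fact K1)+
  have to2: "elem_to X e = K2"
    unfolding elem_to_def face_side_ge[OF assms]
  proof (rule the_equality)
    show "K2 \<in> cells X \<and> e facet_of K2 \<and> (\<forall>x\<in>K2. nu X e \<bullet> x \<ge> face_level e)" using K2 by simp
    show "J = K2" if "J \<in> cells X \<and> e facet_of J \<and> (\<forall>x\<in>J. nu X e \<bullet> x \<ge> face_level e)" for J
      by (rule side_ge_unique[OF assms _ _ _ K2]) (use that in simp_all)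
  qed
  show "elem_to X e \<in> cells X" "e facet_of elem_to X e" "\<forall>x\<in>elem_to X e. nu X e \<bullet> x \<ge> face_level e"
    unfolding to2 by (fact K2)+
qed

lemma facet_elem:
  assumes "e \<in> int_faces X" "K \<in> cells X" "e facet_of K"
  shows "K = elem_from X e \<or> K = elem_to X e"
  using facet_one_side[OF cell_convex[OF assms(2)] cell_interior[OF assms(2)] assms(3)
      face_normal(2,3)[OF assms(1)]]
proof
  assume "\<forall>y\<in>K. nu X e \<bullet> y \<le> face_level e"
  from side_le_unique[OF assms this elem_from_cell[OF assms(1)] elem_from_facet[OF assms(1)] elem_from_side[OF assms(1)]]
  show ?thesis ..
next
  assume "\<forall>y\<in>K. nu X e \<bullet> y \<ge> face_level e"
  from side_ge_unique[OF assms this elem_to_cell[OF assms(1)] elem_to_facet[OF assms(1)] elem_to_side[OF assms(1)]]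
  show ?thesis ..
qed

text \<open>A relative interior point x of F inside the region needs a second cell, since pushing x
  outwards from K stays in the region. The intersection of the two cells is a proper face of K
  containing F, and the dimension of F leaves no room for a larger one.\<close>

lemma facet_interior_or_boundary:
  assumes K: "K \<in> cells X" and F: "F facet_of K"
  shows "F \<in> int_faces X \<or> F \<subseteq> frontier (region X)"
proof (rule disjCI)
  assume nb: "\<not> F \<subseteq> frontier (region X)"
  have FK: "F \<subseteq> K" "F face_of K" using F facet_of_imp_subset facet_of_imp_face_of by auto
  have cF: "convex F" using FK(2) face_of_imp_convex by blast
  have "\<not> rel_interior F \<subseteq> frontier (region X)"
  proof
    assume "rel_interior F \<subseteq> frontier (region X)"
    then have "closure (rel_interior F) \<subseteq> frontier (region X)" by (simp add: closure_minimal)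
    then show False using nb convex_closure_rel_interior[OF cF] closure_subset by blast
  qed
  then obtain x where x: "x \<in> rel_interior F" "x \<notin> frontier (region X)" by blast
  have xF: "x \<in> F" using x rel_interior_subset by blast
  have "x \<in> closure (region X)" using xF FK K Union_cells by blast
  then have xO: "x \<in> region X" using x(2) open_region by (simp add: frontier_def interior_open)
  obtain a b where ab: "a \<noteq> 0" "K \<subseteq> {y. a \<bullet> y \<le> b}" "F = K \<inter> {y. a \<bullet> y = b}"
    using F exposed_face_of_polyhedron[OF polytope_imp_polyhedron[OF cell_polytope[OF K]], of F] FK
    unfolding exposed_face_of facet_of_def by fastforce
  have "\<exists>K'\<in>cells X. K' \<noteq> K \<and> x \<in> K'"
  proof (rule ccontr)
    assume no: "\<not> ?thesis"
    let ?C = "\<Union>(cells X - {K})"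
    have "closed ?C" using finite_cells cell_closed by (intro closed_Union) auto
    then have "open (region X - ?C)" using open_region by (simp add: open_Diff)
    moreover have "x \<in> region X - ?C" using no xO by blast
    ultimately obtain r where r: "r > 0" "ball x r \<subseteq> region X - ?C" by (metis open_contains_ball)
    \<comment> \<open>A point just beyond the supporting plane of F, still in the ball around x: it
      lies in the region but in no other cell, hence in K, contrary to the choice of the
      plane.\<close>
    define y where "y = x + (r / (2 * norm a)) *\<^sub>R a"
    have "norm ((r / (2 * norm a)) *\<^sub>R a) < r" using r ab(1) by simp
    then have "y \<in> ball x r" by (simp add: y_def dist_norm)
    then have "y \<in> region X" "y \<notin> ?C" using r by auto
    then have "y \<in> K" using Union_cells closure_subset[of "region X"] by blast
    then have "a \<bullet> y \<le> b" using ab by blast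
    moreover have "a \<bullet> x = b" using ab xF by blast
    moreover have "(r / (2 * norm a)) * (a \<bullet> a) > 0" using r ab by simp
    ultimately show False by (simp add: y_def inner_add_right)
  qed
  then obtain K' where K': "K' \<in> cells X" "K' \<noteq> K" "x \<in> K'" by blast
  have G: "K \<inter> K' face_of K" "K \<inter> K' \<noteq> K" using cells_face cells_Int_neq K K' by metis+
  have "F \<subseteq> K \<inter> K'"
    using subset_of_face_of[OF G(1) FK(1)] x(1) K'(3) xF FK(1) by blast
  then have "F face_of K \<inter> K'" using face_of_subset[OF FK(2)] by blast
  moreover have "\<not> aff_dim F < aff_dim (K \<inter> K')"
    using face_of_aff_dim_lt[OF cell_convex[OF K] G] F by (simp add: facet_of_def)
  ultimately have "F = K \<inter> K'"
    using face_of_aff_dim_lt[of "K \<inter> K'" F] convex_Int cell_convex K K' by blast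
  then show "F \<in> int_faces X"
    using K K' F unfolding int_faces_def by blast
qed

text \<open>A boundary point of K lies on a facet, and if it is not in the relative interior there,
  on a facet of that facet. Such ridges have codimension two and can be avoided by a generic
  segment.\<close>

lemma facet_rel_interior_or_ridge:
  assumes "K \<in> cells X" "x \<in> K" "x \<notin> interior K"
  obtains F where "F facet_of K" "x \<in> rel_interior F"
  | F E where "F facet_of K" "E facet_of F" "x \<in> E"
proof -
  have "x \<in> K - rel_interior K"
    using assms rel_interior_nonempty_interior[OF cell_interior] by auto
  then obtain F where F: "F facet_of K" "x \<in> F"
    using rel_boundary_of_polyhedron[OF polytope_imp_polyhedron[OF cell_polytope[OF assms(1)]]] by blast
  have "polyhedron F"
    using face_of_polytope_polytope[OF cell_polytope[OF assms(1)] facet_of_imp_face_of[OF F(1)]]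
    by (rule polytope_imp_polyhedron)
  then show thesis
    using rel_boundary_of_polyhedron[of F] that F by blast
qed

text \<open>The segment from an interior point of a bad cell to a generic point outside the bad cells leaves their
  union through the relative interior of a facet.\<close>

lemma cells_induct_from_boundary:
  assumes bdry: "\<And>K F. K \<in> cells X \<Longrightarrow> F facet_of K \<Longrightarrow> F \<subseteq> frontier (region X) \<Longrightarrow> P K"
    and across: "\<And>e. e \<in> int_faces X \<Longrightarrow> P (elem_from X e) \<longleftrightarrow> P (elem_to X e)"
    and K: "K \<in> cells X"
  shows "P K"
proof (rule ccontr)
  assume nP: "\<not> P K"
  define \<C> where "\<C> = {K \<in> cells X. \<not> P K}"
  have fin: "finite \<C>" and KC: "K \<in> \<C>" using finite_cells nP K by (auto simp: \<C>_def)
  define A where "A = \<Union>\<C>"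
  have "compact A" unfolding A_def using fin cell_compact by (intro compact_Union) (auto simp: \<C>_def)
  then have clA: "closed A" and bA: "bounded A" by (auto simp: compact_imp_closed compact_imp_bounded)
  obtain x where x: "x \<in> interior K" using cell_interior[OF K] by blast
  \<comment> \<open>What the end point y must avoid: the planes of facets, so that the exit is
    transversal, and the hulls of x with ridges, so that the exit point is not on a ridge.\<close>
  define \<B> where "\<B> = (\<Union>K\<in>\<C>. (\<lambda>F. affine hull F) ` {F. F facet_of K} \<union>
      (\<Union>F\<in>{F. F facet_of K}. (\<lambda>E. affine hull (insert x E)) ` {E. E facet_of F}))"
  have finF: "finite {F. F facet_of K}" if "K \<in> \<C>" for K
    using that cell_polytope finite_polytope_facets by (auto simp: \<C>_def)
  moreover have "finite {E. E facet_of F}" if "K \<in> \<C>" "F facet_of K" for K F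
    using that by (intro finite_polytope_facets face_of_polytope_polytope[OF cell_polytope facet_of_imp_face_of])
      (auto simp: \<C>_def)
  ultimately have finB: "finite \<B>" unfolding \<B>_def using fin by (intro finite_UN_I finite_UnI finite_imageI) auto
  have negl: "negligible B" if B: "B \<in> \<B>" for B
  proof -
    obtain S where S: "B = affine hull S" "aff_dim S < int DIM(real^'d)"
    proof -
      from B consider K F where "K \<in> \<C>" "F facet_of K" "B = affine hull F"
        | K F E where "K \<in> \<C>" "F facet_of K" "E facet_of F" "B = affine hull (insert x E)"
        unfolding \<B>_def by blast
      then show thesis
      proof cases
        case 1
        then show thesis using that cell_aff_dim by (force simp: \<C>_def facet_of_def)
      next
        case 2
        then have "aff_dim E = int DIM(real^'d) - 2"
          using cell_aff_dim by (force simp: \<C>_def facet_of_def)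
        then show thesis using that[OF 2(4)] by (simp add: aff_dim_insert)
      qed
    qed
    have "interior B = {}" using S by (intro low_dim_interior) simp
    moreover have "convex B" using S affine_imp_convex by simp
    ultimately have "B \<subseteq> frontier B" by (simp add: frontier_def closure_subset)
    then show ?thesis using negligible_subset[OF negligible_convex_frontier[OF \<open>convex B\<close>]] by blast
  qed
  \<comment> \<open>A is bounded and closed, so its complement is a nonempty open set and not
    negligible, unlike the finite union of lower-dimensional sets.\<close>
  have "\<not> - A \<subseteq> \<Union>\<B>"
  proof
    assume "- A \<subseteq> \<Union>\<B>"
    then have "negligible (- A)" using negligible_subset[OF negligible_Union[OF finB negl]] by blast
    moreover have "open (- A)" using clA by (simp add: open_Compl)
    ultimately have "- A = {}" using open_not_negligible by blast
    then show False using bA by (metis Compl_empty_eq double_compl not_bounded_UNIV)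
  qed
  then obtain y where y: "y \<notin> A" "y \<notin> \<Union>\<B>" by blast
  have xA: "x \<in> A" using x interior_subset KC by (auto simp: A_def)
  have "closed (closed_segment x y \<inter> A)" "closed_segment x y \<inter> A \<noteq> {}"
    using clA xA by auto
  \<comment> \<open>The point of the bad cells on the segment that is nearest to y: beyond it the
    segment has left A for good.\<close>
  then obtain z where z: "z \<in> closed_segment x y" "z \<in> A"
    and zmin: "\<And>v. v \<in> closed_segment x y \<Longrightarrow> v \<in> A \<Longrightarrow> dist y z \<le> dist y v"
    using distance_attains_inf[of "closed_segment x y \<inter> A" y] by (metis IntE IntI)
  have yz: "y \<noteq> z" using y z by blast
  define w where "w = y - z"
  have out: "z + t *\<^sub>R w \<notin> A" if t: "0 < t" "t < 1" for t
  proof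
    assume in_A: "z + t *\<^sub>R w \<in> A"
    have *: "z + t *\<^sub>R w = (1 - t) *\<^sub>R z + t *\<^sub>R y" by (simp add: w_def algebra_simps)
    then have "z + t *\<^sub>R w \<in> closed_segment z y" using t by (auto simp: in_segment intro!: exI[of _ t])
    then have "z + t *\<^sub>R w \<in> closed_segment x y"
      using z(1) subset_closed_segment[of z y x y] by auto
    then have "dist y z \<le> dist y (z + t *\<^sub>R w)" using zmin in_A by blast
    also have "dist y (z + t *\<^sub>R w) = (1 - t) * dist y z"
    proof -
      have "y - (z + t *\<^sub>R w) = (1 - t) *\<^sub>R (y - z)" by (simp add: w_def algebra_simps)
      then show ?thesis using t by (simp add: dist_norm)
    qed
    finally show False using t yz by simp
  qed
  have contra: False if "K' \<in> \<C>" "\<forall>\<^sub>F t in at_right 0. z + t *\<^sub>R w \<in> interior K'" for K'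
  proof -
    have "\<forall>\<^sub>F t in at_right 0. t < (1::real)" by (rule eventually_at_rightI[of 0 1]) auto
    then have "\<forall>\<^sub>F t in at_right (0::real). False"
      using that(2) eventually_at_right_less[of 0]
    proof eventually_elim
      case (elim t)
      then show ?case using out[of t] that(1) interior_subset by (auto simp: A_def)
    qed
    then show False by (simp add: trivial_limit_at_right_real)
  qed
  obtain K' where K': "K' \<in> \<C>" "z \<in> K'" using z by (auto simp: A_def)
  have K'c: "K' \<in> cells X" using K' by (simp add: \<C>_def)
  have "z \<notin> interior K'"
  proof
    assume zi: "z \<in> interior K'"
    have "((\<lambda>t. z + t *\<^sub>R w) \<longlongrightarrow> z + 0 *\<^sub>R w) (at_right (0::real))" by (intro tendsto_intros)
    then have "\<forall>\<^sub>F t in at_right 0. z + t *\<^sub>R w \<in> interior K'"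
      using topological_tendstoD[of _ z _ "interior K'"] zi by simp
    then show False using contra K' by blast
  qed
  from K'c K'(2) this show False
  proof (cases rule: facet_rel_interior_or_ridge)
    case (2 F E)
    \<comment> \<open>An exit through a ridge point z other than x puts y on the line through x and
      z, inside an excluded hull; z = x is impossible, because x is interior to a bad cell.\<close>
    have "y \<in> affine hull (insert x E)"
    proof (cases "z = x")
      case True
      then have "x \<in> E" using 2 by simp
      obtain u where u: "0 \<le> u" "u \<le> 1" "z = (1 - u) *\<^sub>R x + u *\<^sub>R y" using z(1) by (auto simp: in_segment)
      have "x \<in> interior K" "\<forall>\<^sub>F t in at_right 0. z + t *\<^sub>R w \<in> interior K"
      proof -
        show "x \<in> interior K" by (rule x)
        have "((\<lambda>t. z + t *\<^sub>R w) \<longlongrightarrow> z + 0 *\<^sub>R w) (at_right (0::real))" by (intro tendsto_intros)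
        then show "\<forall>\<^sub>F t in at_right 0. z + t *\<^sub>R w \<in> interior K"
          using topological_tendstoD[of _ z _ "interior K"] x True by simp
      qed
      then show ?thesis using contra KC by blast
    next
      case False
      obtain u where u: "0 \<le> u" "u \<le> 1" "z = (1 - u) *\<^sub>R x + u *\<^sub>R y" using z(1) by (auto simp: in_segment)
      then have "u \<noteq> 0" using False by auto
      have "(1 / u) *\<^sub>R z = (1 / u * (1 - u)) *\<^sub>R x + (1 / u * u) *\<^sub>R y"
        by (simp add: u(3) scaleR_add_right del: times_divide_eq_left)
      moreover have u1: "1 / u * (1 - u) = 1 / u - 1" and u2: "1 / u * u = 1"
        using \<open>u \<noteq> 0\<close> by (auto simp: field_simps)
      ultimately have "(1 / u) *\<^sub>R z = (1 / u - 1) *\<^sub>R x + y" unfolding u1 u2 by simp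
      then have "y = (1 - 1 / u) *\<^sub>R x + (1 / u) *\<^sub>R z" by (simp add: scaleR_diff_left)
      moreover have "x \<in> affine hull (insert x E)" "z \<in> affine hull (insert x E)"
        using 2 by (auto intro: hull_inc)
      ultimately show ?thesis using affine_affine_hull[of "insert x E"] by (auto intro: mem_affine)
    qed
    then show False using y(2) 2 K'(1) unfolding \<B>_def by blast
  next
    case (1 F)
    have "\<not> F \<subseteq> frontier (region X)" using bdry[OF K'c 1(1)] K' by (auto simp: \<C>_def)
    then have F: "F \<in> int_faces X" using facet_interior_or_boundary[OF K'c 1(1)] by blast
    \<comment> \<open>The exit facet is interior and P is equivalent across it, so both neighbours
      are bad; the direction w, not parallel to the facet, enters one of them.\<close>
    have fromto: "elem_from X F \<in> \<C>" "elem_to X F \<in> \<C>"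
      using facet_elem[OF F K'c 1(1)] across[OF F] K'(1) elem_from_cell[OF F] elem_to_cell[OF F]
      by (auto simp: \<C>_def)
    have "y \<notin> affine hull F" using y(2) 1 K'(1) unfolding \<B>_def by blast
    then have "nu X F \<bullet> y \<noteq> face_level F"
      using facet_affine_hull_eq_hyperplane[OF cell_interior[OF K'c] 1(1) face_normal(2,3)[OF F]] by blast
    moreover have "nu X F \<bullet> z = face_level F"
      using face_normal(3)[OF F] 1(2) rel_interior_subset by blast
    ultimately have "nu X F \<bullet> w \<noteq> 0" by (simp add: w_def inner_diff_right)
    then show False
      using contra[OF fromto(1) inward_le[OF F elem_from_cell[OF F] elem_from_facet[OF F] elem_from_side[OF F] 1(2)]]
        contra[OF fromto(2) inward_ge[OF F elem_to_cell[OF F] elem_to_facet[OF F] elem_to_side[OF F] 1(2)]]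
      by linarith
  qed
qed

section \<open>Prisms over faces\<close>

lemma face_convex_compact:
  assumes "e \<in> int_faces X"
  shows "convex e" "compact e" "closed e"
proof -
  obtain K where "K \<in> cells X" "e facet_of K" using int_face[OF assms] by metis
  then have "polytope e" by (metis face_of_polytope_polytope cell_polytope facet_of_imp_face_of)
  then show "convex e" "compact e" and "closed e"
    by (auto intro: polytope_imp_convex polytope_imp_compact polytope_imp_closed)
qed

text \<open>By Pythagoras: the normal displacement is orthogonal to differences within the
  face.\<close>

lemma closest_point_prism:
  assumes e: "e \<in> int_faces X" and x: "x \<in> e"
  shows "closest_point e (x + h *\<^sub>R nu X e) = x"
proof (rule closest_point_unique[OF face_convex_compact(1)[OF e] face_convex_compact(3)[OF e] x, symmetric], rule ballI)
  fix z assume z: "z \<in> e"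
  have orth: "nu X e \<bullet> (x - z) = 0" using face_normal(3)[OF e] x z by (simp add: inner_diff_right)
  have "(norm (h *\<^sub>R nu X e))\<^sup>2 \<le> (norm ((x - z) + h *\<^sub>R nu X e))\<^sup>2"
    using orth by (subst norm_add_Pythagorean) (auto simp: orthogonal_def inner_commute)
  then have "norm (h *\<^sub>R nu X e) \<le> norm ((x - z) + h *\<^sub>R nu X e)" by (rule power2_le_imp_le) simp
  then show "dist (x + h *\<^sub>R nu X e) x \<le> dist (x + h *\<^sub>R nu X e) z"
    by (simp add: dist_norm algebra_simps)
qed

lemma prism:
  assumes e: "e \<in> int_faces X"
  shows prism_compact: "compact (prism e (nu X e))" and prism_convex: "convex (prism e (nu X e))"
    and prism_interior: "interior (prism e (nu X e)) \<noteq> {}"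
    and prism_base: "closest_point e ` prism e (nu X e) = e"
    and face_subset_prism: "e \<subseteq> prism e (nu X e)"
proof -
  let ?\<nu> = "nu X e"
  have "prism e ?\<nu> = (\<lambda>(x, h). x + h *\<^sub>R ?\<nu>) ` (e \<times> {0..1})"
    by (force simp: prism_def)
  moreover have "compact ((\<lambda>(x, h). x + h *\<^sub>R ?\<nu>) ` (e \<times> {0..1}))"
    by (intro compact_continuous_image compact_Times face_convex_compact[OF e] compact_Icc)
      (auto simp: split_beta intro!: continuous_intros)
  ultimately show "compact (prism e ?\<nu>)" by simp
  have "prism e ?\<nu> = (\<Union>x\<in>e. \<Union>y\<in>(\<lambda>h. h *\<^sub>R ?\<nu>) ` {0..1}. {x + y})"
    by (force simp: prism_def)
  moreover have "convex ((\<lambda>h. h *\<^sub>R ?\<nu>) ` {0..1})"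
    by (intro convex_linear_image linearI) (auto simp: algebra_simps)
  ultimately show conv: "convex (prism e ?\<nu>)"
    using convex_sums[OF face_convex_compact(1)[OF e], of "(\<lambda>h. h *\<^sub>R ?\<nu>) ` {0..1}"] by argo
  show sub: "e \<subseteq> prism e ?\<nu>"
  proof
    fix x assume "x \<in> e"
    then show "x \<in> prism e ?\<nu>" unfolding prism_def by (intro CollectI exI[of _ x] exI[of _ 0]) simp
  qed
  show "closest_point e ` prism e ?\<nu> = e"
  proof
    show "closest_point e ` prism e ?\<nu> \<subseteq> e"
      using closest_point_prism[OF e] by (auto simp: prism_def)
    show "e \<subseteq> closest_point e ` prism e ?\<nu>"
    proof
      fix x assume "x \<in> e"
      then show "x \<in> closest_point e ` prism e ?\<nu>"
        using sub closest_point_self[of x e] by (intro image_eqI[of _ _ x]) auto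
    qed
  qed
  show "interior (prism e ?\<nu>) \<noteq> {}"
  proof
    \<comment> \<open>Without interior the prism would lie in a hyperplane; this must be the plane
      of e, but the translate of e by the unit normal leaves it.\<close>
    assume "interior (prism e ?\<nu>) = {}"
    then obtain a b where ab: "a \<noteq> 0" "prism e ?\<nu> \<subseteq> {x. a \<bullet> x = b}"
      using empty_interior_subset_hyperplane[OF conv] by metis
    obtain K where K: "K \<in> cells X" "e facet_of K" using int_face[OF e] by metis
    have "affine hull e = {y. a \<bullet> y = b}"
      by (rule facet_affine_hull_eq_hyperplane[OF cell_interior[OF K(1)] K(2) ab(1)]) (use sub ab in auto)
    moreover have "affine hull e = {y. ?\<nu> \<bullet> y = face_level e}"
      by (rule facet_affine_hull_eq_hyperplane[OF cell_interior[OF K(1)] K(2) face_normal(2,3)[OF e]])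
    moreover obtain x where x: "x \<in> e" using face_normal(4)[OF e] by blast
    moreover have "x + 1 *\<^sub>R ?\<nu> \<in> prism e ?\<nu>" unfolding prism_def using x by (intro CollectI exI[of _ x] exI[of _ 1]) simp
    ultimately have "?\<nu> \<bullet> (x + 1 *\<^sub>R ?\<nu>) = face_level e" using ab(2) by blast
    then show False using face_normal[OF e] x by (simp add: inner_add_right)
  qed
qed

end

text \<open>The subset of U where f is nonzero is open and negligible, hence empty.\<close>

lemma AE_zero_open:
  fixes f :: "'a::euclidean_space \<Rightarrow> 'b::real_normed_vector"
  assumes "open U" "continuous_on U f" "AE x in lebesgue. x \<in> U \<longrightarrow> f x = 0" "x \<in> U"
  shows "f x = 0"
proof -
  define V where "V = U \<inter> f -` (- {0})"
  have "open V" unfolding V_def by (intro continuous_open_preimage assms open_Compl) auto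
  moreover have "negligible V"
  proof -
    have "AE x in lebesgue. x \<notin> V" using assms(3) by eventually_elim (auto simp: V_def)
    then show ?thesis
      using \<open>open V\<close> by (simp add: negligible_iff_null_sets AE_iff_null_sets[symmetric])
  qed
  ultimately have "V = {}" using open_not_negligible by blast
  then show ?thesis using assms(4) by (auto simp: V_def)
qed

lemma continuous_zero_closure:
  fixes f :: "'a::euclidean_space \<Rightarrow> 'b::real_normed_vector"
  assumes "continuous_on S f" "U \<subseteq> S" "S \<subseteq> closure U" "\<And>x. x \<in> U \<Longrightarrow> f x = 0" "x \<in> S"
  shows "f x = 0"
proof -
  obtain y where y: "\<And>n. y n \<in> U" "y \<longlonglongrightarrow> x" using assms(3,5) closure_sequential by blast
  then have "(f \<circ> y) \<longlonglongrightarrow> f x"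
    using assms(1,2,5) unfolding continuous_on_sequentially by blast
  moreover have "f \<circ> y = (\<lambda>n. 0)" using y assms(4) by (auto simp: fun_eq_iff)
  ultimately show ?thesis by (simp add: LIMSEQ_const_iff)
qed

section \<open>Discrete spaces\<close>

text \<open>Both arguments are expanded in orthonormal frames for \<open>A\<close> and
  \<open>B\<close>; null remainders do not contribute, so G is governed by its finitely many values
  on pairs of frame vectors.\<close>

lemma bil_dominated:
  assumes L: "finite L" "\<And>l. l \<in> L \<Longrightarrow> lin_on S l" "psd_form S A" "subspace S"
      "\<And>f. f \<in> S \<Longrightarrow> (\<And>l. l \<in> L \<Longrightarrow> l f = 0) \<Longrightarrow> A f f = 0"
    and M: "finite M" "\<And>l. l \<in> M \<Longrightarrow> lin_on T l" "psd_form T B" "subspace T"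
      "\<And>f. f \<in> T \<Longrightarrow> (\<And>l. l \<in> M \<Longrightarrow> l f = 0) \<Longrightarrow> B f f = 0"
    and G: "bil_on S T G" "\<And>f g. f \<in> S \<Longrightarrow> g \<in> T \<Longrightarrow> A f f = 0 \<Longrightarrow> G f g = 0"
      "\<And>f g. f \<in> S \<Longrightarrow> g \<in> T \<Longrightarrow> B g g = 0 \<Longrightarrow> G f g = 0"
  shows "\<exists>C>0. \<forall>f\<in>S. \<forall>g\<in>T. (G f g)\<^sup>2 \<le> C * A f f * B g g"
proof -
  obtain k b where b: "\<And>i. i < (k::nat) \<Longrightarrow> b i \<in> S"
    and onb: "\<And>i j. i < k \<Longrightarrow> j < k \<Longrightarrow> A (b i) (b j) = (if i = j then 1 else 0)"
    and resb: "\<And>f. f \<in> S \<Longrightarrow> A (f - (\<Sum>i<k. A f (b i) *\<^sub>R b i)) (f - (\<Sum>i<k. A f (b i) *\<^sub>R b i)) = 0"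
    using orthonormal_frame[OF L] by blast
  obtain m c where c: "\<And>i. i < (m::nat) \<Longrightarrow> c i \<in> T"
    and onc: "\<And>i j. i < m \<Longrightarrow> j < m \<Longrightarrow> B (c i) (c j) = (if i = j then 1 else 0)"
    and resc: "\<And>f. f \<in> T \<Longrightarrow> B (f - (\<Sum>i<m. B f (c i) *\<^sub>R c i)) (f - (\<Sum>i<m. B f (c i) *\<^sub>R c i)) = 0"
    using orthonormal_frame[OF M] by blast
  define N where "N = (\<Sum>i<k. \<Sum>j<m. \<bar>G (b i) (c j)\<bar>)"
  have N: "N \<ge> 0" by (simp add: N_def sum_nonneg)
  have "(G f g)\<^sup>2 \<le> (N\<^sup>2 + 1) * A f f * B g g" if f: "f \<in> S" and g: "g \<in> T" for f g
  proof -
    define f' where "f' = (\<Sum>i<k. A f (b i) *\<^sub>R b i)"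
    define g' where "g' = (\<Sum>j<m. B g (c j) *\<^sub>R c j)"
    have f': "f' \<in> S" and g': "g' \<in> T"
      unfolding f'_def g'_def using b c L(4) M(4) by (auto intro!: subspace_sum subspace_scale)
    have Aff: "A f f \<ge> 0" and Bgg: "B g g \<ge> 0" using psd_formD(3) L(3) M(3) f g by blast+
    have "G f g = G f' g"
      using G(2)[OF subspace_diff[OF L(4) f f'] g] resb[OF f] lin_on_diff[OF bil_on_left[OF G(1) g] L(4) f f']
      by (simp add: f'_def)
    also have "\<dots> = G f' g'"
      using G(3)[OF f' subspace_diff[OF M(4) g g']] resc[OF g] lin_on_diff[OF bil_on_right[OF G(1) f'] M(4) g g']
      by (simp add: g'_def)
    also have "\<dots> = (\<Sum>i<k. A f (b i) * G (b i) g')"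
      unfolding f'_def using b by (intro lin_on_sum[OF bil_on_left[OF G(1) g'] L(4)]) auto
    also have "\<dots> = (\<Sum>i<k. A f (b i) * (\<Sum>j<m. B g (c j) * G (b i) (c j)))"
    proof (intro sum.cong refl arg_cong2[of _ _ _ _ "(*)"])
      fix i assume "i \<in> {..<k}"
      then show "G (b i) g' = (\<Sum>j<m. B g (c j) * G (b i) (c j))"
        unfolding g'_def using b c by (intro lin_on_sum[OF bil_on_right[OF G(1)] M(4)]) auto
    qed
    finally have eq: "G f g = (\<Sum>i<k. \<Sum>j<m. A f (b i) * B g (c j) * G (b i) (c j))"
      by (simp add: sum_distrib_left mult.assoc)
    have ab: "\<bar>A f (b i)\<bar> \<le> sqrt (A f f)" if "i < k" for i
      using psd_form_Cauchy_Schwarz[OF L(3,4) f b[OF that]] onb[OF that that] by (simp add: real_le_rsqrt)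
    have bc: "\<bar>B g (c j)\<bar> \<le> sqrt (B g g)" if "j < m" for j
      using psd_form_Cauchy_Schwarz[OF M(3,4) g c[OF that]] onc[OF that that] by (simp add: real_le_rsqrt)
    have "\<bar>G f g\<bar> \<le> (\<Sum>i<k. \<Sum>j<m. \<bar>A f (b i) * B g (c j) * G (b i) (c j)\<bar>)"
      unfolding eq by (intro order_trans[OF sum_abs] sum_mono sum_abs)
    also have "\<dots> \<le> (\<Sum>i<k. \<Sum>j<m. sqrt (A f f) * sqrt (B g g) * \<bar>G (b i) (c j)\<bar>)"
      using Aff Bgg by (intro sum_mono) (auto simp: abs_mult intro!: mult_mono ab bc)
    also have "\<dots> = sqrt (A f f) * sqrt (B g g) * N"
      by (simp add: N_def sum_distrib_left)
    finally have "\<bar>G f g\<bar>\<^sup>2 \<le> (sqrt (A f f) * sqrt (B g g) * N)\<^sup>2" by (intro power_mono) auto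
    also have "\<dots> = N\<^sup>2 * A f f * B g g" using Aff Bgg by (simp add: power_mult_distrib)
    also have "\<dots> \<le> (N\<^sup>2 + 1) * A f f * B g g" using Aff Bgg by (intro mult_right_mono) auto
    finally show ?thesis by simp
  qed
  moreover have "N\<^sup>2 + 1 > 0" by (simp add: add_nonneg_pos)
  ultimately show ?thesis by blast
qed

text \<open>Point values, coordinate by coordinate, are the functionals that witness finite
  dimension; \<open>Basis\<close> covers scalar and vector fields alike.\<close>

definition point_functionals :: "'a set \<Rightarrow> (('a \<Rightarrow> 'b::euclidean_space) \<Rightarrow> real) set" where
  "point_functionals X0 = (\<lambda>(x, b) f. f x \<bullet> b) ` (X0 \<times> Basis)"

section \<open>Finite sets of points that determine discrete functions\<close>

lemma point_functionals:
  "finite X0 \<Longrightarrow> finite (point_functionals X0)"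
  "l \<in> point_functionals X0 \<Longrightarrow> lin_on S l"
  "(\<And>l. l \<in> point_functionals X0 \<Longrightarrow> l f = 0) \<Longrightarrow> x \<in> X0 \<Longrightarrow> f x = 0"
proof -
  show "finite X0 \<Longrightarrow> finite (point_functionals X0)" by (simp add: point_functionals_def)
  show "l \<in> point_functionals X0 \<Longrightarrow> lin_on S l"
    by (auto simp: point_functionals_def lin_on_def inner_left_distrib)
  assume *: "\<And>l. l \<in> point_functionals X0 \<Longrightarrow> l f = 0" and x: "x \<in> X0"
  have "f x \<bullet> b = 0" if "b \<in> Basis" for b
    by (rule *[of "\<lambda>f. f x \<bullet> b"]) (use x that in \<open>force simp: point_functionals_def\<close>)
  then show "f x = 0" using euclidean_all_zero_iff by blast
qed

text \<open>Gaussian elimination: a point y0 where some function b k is nonzero determines c k from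
  the other coefficients, which removes one function.\<close>

lemma finite_determining_set:
  fixes b :: "'i \<Rightarrow> 'y \<Rightarrow> real"
  assumes "finite I"
  shows "\<exists>Y0\<subseteq>Y. finite Y0 \<and> (\<forall>c. (\<forall>y\<in>Y0. (\<Sum>i\<in>I. c i * b i y) = 0) \<longrightarrow> (\<forall>y\<in>Y. (\<Sum>i\<in>I. c i * b i y) = 0))"
  using assms
proof (induction "card I" arbitrary: I b)
  case 0
  then show ?case by (intro exI[of _ "{}"]) auto
next
  case (Suc n)
  show ?case
  proof (cases "\<forall>i\<in>I. \<forall>y\<in>Y. b i y = 0")
    case True
    then show ?thesis by (intro exI[of _ "{}"]) auto
  next
    case False
    then obtain k y0 where k: "k \<in> I" and y0: "y0 \<in> Y" and nz: "b k y0 \<noteq> 0" by blast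
    \<comment> \<open>Elimination of b k: for coefficients whose combination vanishes at y0, the
      combination of b over I equals the combination of b' over the remaining indices.\<close>
    define b' where "b' i y = b i y - b i y0 / b k y0 * b k y" for i y
    have "n = card (I - {k})" using Suc k by simp
    from Suc.hyps(1)[OF this, of b'] Suc.prems
    obtain Y0 where Y0: "Y0 \<subseteq> Y" "finite Y0"
      "\<And>c. (\<forall>y\<in>Y0. (\<Sum>i\<in>I - {k}. c i * b' i y) = 0) \<Longrightarrow> (\<forall>y\<in>Y. (\<Sum>i\<in>I - {k}. c i * b' i y) = 0)"
      by auto
    have eq: "(\<Sum>i\<in>I. c i * b i y) = (\<Sum>i\<in>I - {k}. c i * b' i y)" if c: "(\<Sum>i\<in>I. c i * b i y0) = 0" for c y
    proof -
      have s: "(\<Sum>i\<in>I. c i * b i y) = c k * b k y + (\<Sum>i\<in>I - {k}. c i * b i y)" for y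
        using sum.remove[OF Suc.prems k] .
      have "c k = - (\<Sum>i\<in>I - {k}. c i * b i y0) / b k y0"
        using c nz unfolding s by (simp add: field_simps)
      then show ?thesis
        unfolding s b'_def
        by (simp add: right_diff_distrib sum_subtractf sum_divide_distrib sum_distrib_right mult.assoc)
    qed
    show ?thesis
      using Y0 y0 eq by (intro exI[of _ "insert y0 Y0"]) auto
  qed
qed

text \<open>Cramer's rule as a definition: the inverse becomes a rational expression in the entries,
  so that its continuity and measurability follow from those of determinants.\<close>

definition cofactor_inverse :: "real^'n^'n \<Rightarrow> real^'n^'n" where
  "cofactor_inverse A = (\<chi> k l. det (\<chi> i j. if j = k then (axis l 1 :: real^'n) $ i else A $ i $ j) / det A)"

lemma cofactor_inverse:
  assumes "det A \<noteq> 0"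
  shows "A ** cofactor_inverse A = mat 1" "cofactor_inverse A ** A = mat 1"
    "matrix_inv A = cofactor_inverse A"
proof -
  have col: "A *v column l (cofactor_inverse A) = axis l 1" for l
  proof -
    have "column l (cofactor_inverse A) =
      (\<chi> k. det (\<chi> i j. if j = k then (axis l 1 :: real^_) $ i else A $ i $ j) / det A)"
      by (simp add: column_def cofactor_inverse_def vec_eq_iff)
    then show ?thesis using cramer[OF assms] by blast
  qed
  have "(A ** cofactor_inverse A) $ i $ l = (mat 1 :: real^_^_) $ i $ l" for i l
  proof -
    have "(A ** cofactor_inverse A) $ i $ l = (A *v column l (cofactor_inverse A)) $ i"
      by (simp add: matrix_matrix_mult_def matrix_vector_mult_def column_def)
    then show ?thesis by (simp add: col axis_def mat_def)
  qed
  then show 1: "A ** cofactor_inverse A = mat 1" by (simp add: vec_eq_iff)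
  then show 2: "cofactor_inverse A ** A = mat 1" using matrix_left_right_inverse by blast
  show "matrix_inv A = cofactor_inverse A"
  proof -
    have "matrix_inv A ** A = mat 1"
      using someI[of "\<lambda>A'. A ** A' = mat 1 \<and> A' ** A = mat 1" "cofactor_inverse A"] 1 2
      by (simp add: matrix_inv_def)
    then have "matrix_inv A ** (A ** cofactor_inverse A) = cofactor_inverse A"
      by (simp add: matrix_mul_assoc)
    then show ?thesis by (simp add: 1)
  qed
qed

lemma continuous_on_matrix_mult:
  fixes F :: "'a::topological_space \<Rightarrow> real^'n^'m" and G :: "'a \<Rightarrow> real^'k^'n"
  assumes "continuous_on S F" "continuous_on S G"
  shows "continuous_on S (\<lambda>x. F x ** G x)"
  unfolding matrix_matrix_mult_def using assms by (intro continuous_intros)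

lemma continuous_on_det:
  fixes F :: "'a::topological_space \<Rightarrow> real^'n^'n"
  assumes "continuous_on S F"
  shows "continuous_on S (\<lambda>x. det (F x))"
  unfolding det_def using assms by (intro continuous_intros)

lemma continuous_on_cofactor_inverse:
  fixes F :: "'a::topological_space \<Rightarrow> real^'n^'n"
  assumes "continuous_on S F" "\<And>x. x \<in> S \<Longrightarrow> det (F x) \<noteq> 0"
  shows "continuous_on S (\<lambda>x. cofactor_inverse (F x))"
proof -
  have "continuous_on S (\<lambda>x. if j = k then (axis l 1 :: real^'n) $ i else F x $ i $ j)" for i j k l
    using assms(1) by (cases "j = k") (auto intro!: continuous_intros)
  then show ?thesis
    unfolding cofactor_inverse_def using assms
    by (intro continuous_on_vec_lambda continuous_on_divide continuous_on_det) auto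
qed

definition C1_scalar :: "(real^'d \<Rightarrow> real) \<Rightarrow> bool" where
  "C1_scalar q \<longleftrightarrow> (\<exists>dq. continuous_on UNIV dq \<and> (\<forall>y. (q has_derivative (\<lambda>h. dq y \<bullet> h)) (at y)))"

section \<open>Polynomials as continuously differentiable functions\<close>

lemma C1_scalar_intros:
  fixes f g :: "real^'d \<Rightarrow> real"
  shows "C1_scalar (\<lambda>y :: real^'d. c)" "C1_scalar (\<lambda>y :: real^'d. y $ i)"
  "C1_scalar f \<Longrightarrow> C1_scalar g \<Longrightarrow> C1_scalar (\<lambda>y. f y + g y)"
  "C1_scalar f \<Longrightarrow> C1_scalar g \<Longrightarrow> C1_scalar (\<lambda>y. f y * g y)"
proof -
  have "((\<bullet>) (0 :: real^'d)) = (\<lambda>h. 0)" by (simp add: fun_eq_iff)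
  then show "C1_scalar (\<lambda>y :: real^'d. c)" unfolding C1_scalar_def by (intro exI[of _ "\<lambda>y. 0"]) auto
  have "((\<bullet>) (axis i 1 :: real^'d)) = (\<lambda>h. h $ i)" by (simp add: fun_eq_iff inner_axis')
  then show "C1_scalar (\<lambda>y :: real^'d. y $ i)"
    unfolding C1_scalar_def
    by (intro exI[of _ "\<lambda>y. axis i 1"])
      (simp add: bounded_linear_imp_has_derivative bounded_linear_vec_nth)
  assume "C1_scalar f" "C1_scalar g"
  then obtain df dg where f: "continuous_on UNIV df" "\<And>y. (f has_derivative (\<lambda>h. df y \<bullet> h)) (at y)"
    and g: "continuous_on UNIV dg" "\<And>y. (g has_derivative (\<lambda>h. dg y \<bullet> h)) (at y)"
    unfolding C1_scalar_def by blast
  show "C1_scalar (\<lambda>y. f y + g y)"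
    unfolding C1_scalar_def using f g
    by (intro exI[of _ "\<lambda>y. df y + dg y"]) (auto intro!: continuous_intros derivative_eq_intros simp: inner_left_distrib)
  have "continuous_on UNIV f" "continuous_on UNIV g"
    using f(2) g(2) by (meson continuous_at_imp_continuous_on has_derivative_continuous)+
  then show "C1_scalar (\<lambda>y. f y * g y)"
    unfolding C1_scalar_def using f g
    by (intro exI[of _ "\<lambda>y. g y *\<^sub>R df y + f y *\<^sub>R dg y"])
      (auto intro!: continuous_intros derivative_eq_intros simp: inner_left_distrib algebra_simps)
qed

lemma C1_scalar_power: "C1_scalar f \<Longrightarrow> C1_scalar (\<lambda>y. f y ^ n)"
  by (induction n) (auto intro: C1_scalar_intros)

lemma C1_scalar_prod: "(\<And>i. i \<in> I \<Longrightarrow> C1_scalar (f i)) \<Longrightarrow> C1_scalar (\<lambda>y. \<Prod>i\<in>I. f i y)"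
  by (induction I rule: infinite_finite_induct) (auto intro: C1_scalar_intros)

lemma C1_scalar_sum: "(\<And>i. i \<in> I \<Longrightarrow> C1_scalar (f i)) \<Longrightarrow> C1_scalar (\<lambda>y. \<Sum>i\<in>I. f i y)"
  by (induction I rule: infinite_finite_induct) (auto intro: C1_scalar_intros)

lemma C1_scalar_Qpoly: "q \<in> Qpoly k \<Longrightarrow> C1_scalar q"
  unfolding Qpoly_def by (auto intro!: C1_scalar_sum C1_scalar_prod C1_scalar_power C1_scalar_intros)

lemma C1_scalar_continuous: "C1_scalar q \<Longrightarrow> continuous_on S q"
  unfolding C1_scalar_def
  by (meson continuous_at_imp_continuous_on has_derivative_continuous)

lemma C1_vector:
  fixes q :: "real^'d \<Rightarrow> real^'d"
  assumes "\<And>i. C1_scalar (\<lambda>y. q y $ i)"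
  shows "continuous_on S q"
    "\<exists>dq. continuous_on UNIV dq \<and> (\<forall>y. (q has_derivative (\<lambda>h. dq y *v h)) (at y))"
proof -
  have "continuous_on S (\<lambda>y. \<chi> i. q y $ i)"
    by (intro continuous_intros C1_scalar_continuous assms)
  then show "continuous_on S q" by simp
  obtain dq where dq: "\<And>i. continuous_on UNIV (dq i)" "\<And>i y. ((\<lambda>y. q y $ i) has_derivative (\<lambda>h. dq i y \<bullet> h)) (at y)"
    using assms unfolding C1_scalar_def by metis
  have "(q has_derivative (\<lambda>h. (\<chi> i. dq i y) *v h)) (at y)" for y
  proof (subst has_derivative_componentwise_within, rule ballI)
    fix b :: "real^'d" assume "b \<in> Basis"
    then obtain i where b: "b = axis i 1" by (auto simp: Basis_vec_def)
    show "((\<lambda>x. q x \<bullet> b) has_derivative (\<lambda>h. ((\<chi> i. dq i y) *v h) \<bullet> b)) (at y)"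
      using dq(2)[of i y] by (simp add: b inner_axis matrix_vector_mul_component)
  qed
  moreover have "continuous_on UNIV (\<lambda>y. \<chi> i. dq i y)" by (intro continuous_intros dq)
  ultimately show "\<exists>dq. continuous_on UNIV dq \<and> (\<forall>y. (q has_derivative (\<lambda>h. dq y *v h)) (at y))" by blast
qed

text \<open>The values of a discrete function on the mesh skeleton are arbitrary; only the
  continuous extension from the interior of a cell is meaningful, and \<open>trace_from\<close>
  recovers it.\<close>

definition cext :: "(real^'d) set \<Rightarrow> (real^'d \<Rightarrow> 'b::real_normed_vector) \<Rightarrow> bool" where
  "cext K f \<longleftrightarrow> (\<exists>g. continuous_on K g \<and> (\<forall>x\<in>interior K. f x = g x))"

section \<open>Traces and integrals on convex bodies\<close>

lemma cextI: "continuous_on K g \<Longrightarrow> (\<And>x. x \<in> interior K \<Longrightarrow> f x = g x) \<Longrightarrow> cext K f"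
  by (auto simp: cext_def)

lemma cext_cong: "cext K g \<Longrightarrow> (\<And>x. x \<in> interior K \<Longrightarrow> f x = g x) \<Longrightarrow> cext K f"
  by (auto simp: cext_def)

lemma cext_compose: "cext K f \<Longrightarrow> continuous_on UNIV h \<Longrightarrow> cext K (\<lambda>x. h (f x))"
  unfolding cext_def by (metis continuous_on_compose2 subset_UNIV)

lemma cext_compose2:
  assumes "cext K f" "cext K g" "continuous_on UNIV (\<lambda>(a, b). h a b)"
  shows "cext K (\<lambda>x. h (f x) (g x))"
proof -
  obtain f' g' where fg: "continuous_on K f'" "continuous_on K g'"
    "\<And>x. x \<in> interior K \<Longrightarrow> f x = f' x" "\<And>x. x \<in> interior K \<Longrightarrow> g x = g' x"
    using assms(1,2) by (auto simp: cext_def)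
  have "continuous_on K (\<lambda>x. (\<lambda>(a, b). h a b) (f' x, g' x))"
    using fg by (intro continuous_on_compose2[OF assms(3)] continuous_intros) auto
  then show ?thesis using fg by (intro cextI) auto
qed

lemma cext_inner: "cext K f \<Longrightarrow> cext K g \<Longrightarrow> cext K (\<lambda>x. f x \<bullet> g x)"
  by (rule cext_compose2) (auto simp: split_beta intro!: continuous_intros)

text \<open>Instantiated both by the mesh cells and by the prisms over faces, so that volume and
  surface integrals share one set of lemmas.\<close>

locale convex_body =
  fixes K :: "(real^'d) set"
  assumes convex: "convex K" and compact: "compact K" and nonempty_interior: "interior K \<noteq> {}"
begin

lemma closure_int: "closure (interior K) = K"
  using convex_closure_interior[OF convex nonempty_interior] closure_closed[OF compact_imp_closed[OF compact]] by simp

lemma interior_not_trivial: "x \<in> K \<Longrightarrow> at x within interior K \<noteq> bot"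
proof -
  assume x: "x \<in> K"
  have "x islimpt interior K"
  proof (cases "x \<in> interior K")
    case True
    then show ?thesis by (rule interior_limit_point[of x "interior K", unfolded interior_interior])
  next
    case False
    then show ?thesis using x closure_int by (auto simp: closure_def)
  qed
  then show ?thesis by (simp add: trivial_limit_within)
qed

text \<open>K is the closure of its interior, so the limit from the interior is taken along a
  nontrivial filter and is unique.\<close>

lemma trace_from_eq:
  assumes "continuous_on K g" "\<And>x. x \<in> interior K \<Longrightarrow> f x = g x" "x \<in> K"
  shows "trace_from K f x = g x"
  unfolding trace_from_def
proof (rule tendsto_Lim[OF interior_not_trivial[OF assms(3)]])
  have "(g \<longlongrightarrow> g x) (at x within interior K)"
    using assms(1,3) interior_subset by (auto simp: continuous_on_def intro: tendsto_within_subset)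
  then show "(f \<longlongrightarrow> g x) (at x within interior K)"
    using assms(2) by (subst tendsto_cong[of f g]) (auto simp: eventually_at_filter)
qed

lemma cext_trace:
  assumes "cext K f"
  shows "continuous_on K (trace_from K f)" "\<And>x. x \<in> interior K \<Longrightarrow> trace_from K f x = f x"
proof -
  obtain g where g: "continuous_on K g" "\<And>x. x \<in> interior K \<Longrightarrow> f x = g x"
    using assms by (auto simp: cext_def)
  have eq: "trace_from K f x = g x" if "x \<in> K" for x using trace_from_eq[OF g that] .
  show "continuous_on K (trace_from K f)" using g(1) by (subst continuous_on_cong[OF refl eq])
  show "\<And>x. x \<in> interior K \<Longrightarrow> trace_from K f x = f x" using eq g(2) interior_subset by auto
qed

lemma trace_from_add:
  assumes "cext K f" "cext K g" "x \<in> K" "\<And>x. x \<in> interior K \<Longrightarrow> h x = f x + g x"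
  shows "trace_from K h x = trace_from K f x + trace_from K g x"
  by (rule trace_from_eq[OF continuous_on_add[OF cext_trace(1)[OF assms(1)] cext_trace(1)[OF assms(2)]] _ assms(3)])
    (simp add: assms cext_trace)

lemma trace_from_scaleR:
  assumes "cext K f" "x \<in> K" "\<And>x. x \<in> interior K \<Longrightarrow> h x = c *\<^sub>R f x"
  shows "trace_from K h x = c *\<^sub>R trace_from K f x"
  by (rule trace_from_eq[OF continuous_on_scaleR[OF continuous_on_const cext_trace(1)[OF assms(1)]] _ assms(2)])
    (simp add: assms cext_trace)

lemma trace_from_zero:
  assumes "\<And>x. x \<in> interior K \<Longrightarrow> f x = 0" "x \<in> K"
  shows "trace_from K f x = 0"
  by (rule trace_from_eq[of "\<lambda>x. 0"]) (use assms in auto)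

lemma K_sets: "K \<in> sets lebesgue" and K_lmeasurable: "K \<in> lmeasurable"
  using compact lmeasurable_compact by auto

lemma AE_interior: "AE x in lebesgue_on K. x \<in> interior K"
proof -
  have "AE x in lebesgue. x \<notin> frontier K"
    using negligible_convex_frontier[OF convex] unfolding negligible_iff_null_sets by (rule AE_not_in)
  then show ?thesis
    using K_sets compact compact_imp_closed[OF compact]
    by (auto simp: AE_restrict_space_iff frontier_def elim!: eventually_mono)
qed

lemma cext_integrable:
  fixes f :: "real^'d \<Rightarrow> 'b::euclidean_space"
  assumes "cext K f"
  shows "integrable (lebesgue_on K) f"
proof -
  obtain g where g: "continuous_on K g" "\<And>x. x \<in> interior K \<Longrightarrow> f x = g x"
    using assms by (auto simp: cext_def)
  have "bounded (g ` K)" using compact_continuous_image[OF g(1) compact] compact_imp_bounded by blast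
  then obtain B where B: "\<And>x. x \<in> K \<Longrightarrow> norm (g x) \<le> B" unfolding bounded_iff by blast
  have "integrable (lebesgue_on K) g"
  proof (rule Bochner_Integration.integrable_bound[of _ "\<lambda>x. B"])
    interpret finite_measure "lebesgue_on K" by (rule finite_measure_lebesgue_on[OF K_lmeasurable])
    show "integrable (lebesgue_on K) (\<lambda>x. B)" by simp
    show "g \<in> borel_measurable (lebesgue_on K)" by (rule continuous_imp_measurable_on_sets_lebesgue[OF g(1) K_sets])
    show "AE x in lebesgue_on K. norm (g x) \<le> norm B" using B by (intro AE_I2) force
  qed
  then have "g absolutely_integrable_on K"
    using K_sets by (simp add: integrable_restrict_space set_integrable_def)
  then have "f absolutely_integrable_on K"
  proof (rule absolutely_integrable_spike[OF _ negligible_convex_frontier[OF convex]])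
    show "f x = g x" if "x \<in> K - frontier K" for x
      using that g(2) compact_imp_closed[OF compact] by (auto simp: frontier_def)
  qed
  then show ?thesis
    using K_sets by (simp add: integrable_restrict_space set_integrable_def)
qed

lemma ip_cong_interior:
  assumes "cext K f" "cext K g" "\<And>x. x \<in> interior K \<Longrightarrow> f x \<bullet> g x = f' x \<bullet> g' x"
  shows "ip K f g = ip K f' g'"
  unfolding ip_def
proof (rule integral_cong_AE)
  have "cext K (\<lambda>x. f' x \<bullet> g' x)"
    using cext_inner[OF assms(1,2)] by (rule cext_cong) (simp add: assms(3))
  then show "(\<lambda>x. f' x \<bullet> g' x) \<in> borel_measurable (lebesgue_on K)"
    using cext_integrable borel_measurable_integrable by blast
  show "(\<lambda>x. f x \<bullet> g x) \<in> borel_measurable (lebesgue_on K)"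
    using cext_integrable[OF cext_inner[OF assms(1,2)]] borel_measurable_integrable by blast
  show "AE x in lebesgue_on K. f x \<bullet> g x = f' x \<bullet> g' x"
    using AE_interior by eventually_elim (rule assms(3))
qed

lemma ip_zero_interior:
  assumes "\<And>x. x \<in> interior K \<Longrightarrow> f x \<bullet> g x = 0"
  shows "ip K f g = 0"
proof -
  have "(LINT x|lebesgue_on K. f x \<bullet> g x) = 0"
    using AE_interior by (intro integral_eq_zero_AE) (auto elim: eventually_mono simp: assms)
  then show ?thesis by (simp add: ip_def)
qed

lemma ip_null_interior:
  fixes f :: "real^'d \<Rightarrow> 'b::euclidean_space"
  assumes "cext K f" "ip K f f = 0" "x \<in> interior K"
  shows "f x = 0"
proof -
  have "AE x in lebesgue_on K. f x \<bullet> f x = 0"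
    using integral_nonneg_eq_0_iff_AE[OF cext_integrable[OF cext_inner[OF assms(1,1)]]] assms(2)
    by (simp add: ip_def)
  then have ae: "AE x in lebesgue. x \<in> interior K \<longrightarrow> trace_from K f x = 0"
    using K_sets by (auto simp: AE_restrict_space_iff cext_trace(2)[OF assms(1)] elim!: eventually_mono
        intro: interior_subset[THEN subsetD])
  show ?thesis
    using AE_zero_open[OF open_interior continuous_on_subset[OF cext_trace(1)[OF assms(1)] interior_subset] ae assms(3)]
    by (simp add: cext_trace(2)[OF assms(1,3)])
qed

end

text \<open>A continuous inverse of a map with invertible derivative is differentiable in the
  interior; Cramer's formula extends its derivative continuously to all of K.\<close>

lemma ref_diffeo_inverse:
  assumes "ref_diffeo T K"
  obtains S where "continuous_on K S" "\<And>y. y \<in> ref_cube \<Longrightarrow> S (T y) = y"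
    "\<And>x. x \<in> K \<Longrightarrow> S x \<in> ref_cube \<and> T (S x) = x"
    "\<And>x. x \<in> interior K \<Longrightarrow> S x \<in> interior ref_cube"
    "\<And>x. x \<in> interior K \<Longrightarrow> (S has_derivative (\<lambda>h. cofactor_inverse (ref_Jac T (S x)) *v h)) (at x)"
    "continuous_on K (\<lambda>x. cofactor_inverse (ref_Jac T (S x)))"
proof -
  have T: "continuous_on ref_cube T" "inj_on T ref_cube" "T ` ref_cube = K" "T differentiable_on ref_cube"
    and J: "continuous_on ref_cube (ref_Jac T)" "\<And>y. y \<in> ref_cube \<Longrightarrow> det (ref_Jac T y) \<noteq> 0"
    using assms differentiable_imp_continuous_on by (auto simp: ref_diffeo_def bij_betw_def)
  obtain S where S: "homeomorphism ref_cube K T S"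
    using homeomorphism_compact[OF compact_ref_cube T(1,3,2)] by blast
  have ST: "S (T y) = y" if "y \<in> ref_cube" for y using S that by (simp add: homeomorphism_def)
  have TS: "S x \<in> ref_cube \<and> T (S x) = x" if "x \<in> K" for x using S that by (auto simp: homeomorphism_def)
  have cS: "continuous_on K S" using S by (simp add: homeomorphism_def)
  have Sint: "S x \<in> interior ref_cube" if x: "x \<in> interior K" for x
  proof -
    obtain y where "y \<in> interior ref_cube" "x = T y" using ref_diffeo_interior(1)[OF assms] x by blast
    then show ?thesis using ST interior_subset[of ref_cube] by auto
  qed
  have dS: "(S has_derivative (\<lambda>h. cofactor_inverse (ref_Jac T (S x)) *v h)) (at x)" if x: "x \<in> interior K" for x
  proof -
    have y: "S x \<in> interior ref_cube" using Sint[OF x] .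
    then have yc: "S x \<in> ref_cube" using interior_subset by blast
    have "(T has_derivative frechet_derivative T (at (S x) within ref_cube)) (at (S x) within ref_cube)"
      using T(4) yc by (simp add: differentiable_on_def frechet_derivative_works)
    then have "(T has_derivative (\<lambda>h. ref_Jac T (S x) *v h)) (at (S x) within ref_cube)"
      using has_derivative_linear by (fastforce simp: ref_Jac_def matrix_works)
    then have dT: "(T has_derivative (\<lambda>h. ref_Jac T (S x) *v h)) (at (S x))"
      using at_within_interior[OF y] by simp
    show ?thesis
    proof (rule has_derivative_inverse_basic[where g = S and y = x, OF dT _ _ _ open_interior[of K] x])
      show "bounded_linear ((*v) (cofactor_inverse (ref_Jac T (S x))))"
        by (rule matrix_vector_mul_bounded_linear)
      show "(*v) (cofactor_inverse (ref_Jac T (S x))) \<circ> (*v) (ref_Jac T (S x)) = id"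
        using cofactor_inverse(2)[OF J(2)[OF yc]] by (simp add: fun_eq_iff matrix_vector_mul_assoc)
      show "continuous (at x) S"
        using cS x by (meson continuous_on_eq_continuous_at continuous_on_subset interior_subset open_interior)
      show "T (S z) = z" if "z \<in> interior K" for z using TS that interior_subset by blast
    qed
  qed
  have "continuous_on K (\<lambda>x. ref_Jac T (S x))"
    using TS by (intro continuous_on_compose2[OF J(1) cS]) auto
  then have "continuous_on K (\<lambda>x. cofactor_inverse (ref_Jac T (S x)))"
    by (rule continuous_on_cofactor_inverse) (use J(2) TS in blast)
  from that[OF cS ST TS Sint dS this] show thesis .
qed

lemma cext_pullback:
  assumes "ref_diffeo T K" "C1_scalar q" "\<And>y. y \<in> interior ref_cube \<Longrightarrow> w (T y) = q y"
  shows "cext K w"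
proof -
  obtain S where S: "continuous_on K S" "\<And>x. x \<in> K \<Longrightarrow> S x \<in> ref_cube \<and> T (S x) = x"
    "\<And>x. x \<in> interior K \<Longrightarrow> S x \<in> interior ref_cube"
    using ref_diffeo_inverse[OF assms(1)] by metis
  show ?thesis
  proof (rule cextI)
    show "continuous_on K (\<lambda>x. q (S x))"
      by (rule continuous_on_compose2[OF C1_scalar_continuous[OF assms(2)] S(1) subset_UNIV])
    show "w x = q (S x)" if x: "x \<in> interior K" for x
      using S(2)[of x] assms(3)[OF S(3)[OF x]] subsetD[OF interior_subset x] by simp
  qed
qed

text \<open>Chain rule through the inverse cell map. The Jacobian agrees with an expression that is
  continuous on all of K, so strains and stresses have traces on the faces.\<close>

lemma C1_pullback:
  fixes z :: "real^'d \<Rightarrow> real^'d"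
  assumes "ref_diffeo T K" "\<And>i. C1_scalar (\<lambda>y. q y $ i)" "\<And>y. y \<in> interior ref_cube \<Longrightarrow> z (T y) = q y"
  shows "cext K z" "cext K (Jac z)" "\<And>x. x \<in> interior K \<Longrightarrow> (z has_derivative (\<lambda>h. Jac z x *v h)) (at x)"
proof -
  obtain S where S1: "continuous_on K S" and "\<And>y. y \<in> ref_cube \<Longrightarrow> S (T y) = y"
    and S2: "\<And>x. x \<in> K \<Longrightarrow> S x \<in> ref_cube \<and> T (S x) = x"
    and S3: "\<And>x. x \<in> interior K \<Longrightarrow> S x \<in> interior ref_cube"
    and S4: "\<And>x. x \<in> interior K \<Longrightarrow> (S has_derivative (\<lambda>h. cofactor_inverse (ref_Jac T (S x)) *v h)) (at x)"
    and S5: "continuous_on K (\<lambda>x. cofactor_inverse (ref_Jac T (S x)))"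
    by (rule ref_diffeo_inverse[OF assms(1)]) (rule that)
  note S = S1 S2 S3 S4 S5
  have zS: "z x = q (S x)" if x: "x \<in> interior K" for x
    using S(2)[of x] assms(3)[OF S(3)[OF x]] subsetD[OF interior_subset x] by simp
  have "continuous_on UNIV q" by (rule C1_vector(1)) (rule assms(2))
  then have "continuous_on K (\<lambda>x. q (S x))" using S(1) by (rule continuous_on_compose2) simp
  then show "cext K z" by (rule cextI) (rule zS)
  obtain dq where dq: "continuous_on UNIV dq" "\<And>y. (q has_derivative (\<lambda>h. dq y *v h)) (at y)"
    using C1_vector(2)[of q] assms(2) by blast
  have dz: "(z has_derivative (\<lambda>h. (dq (S x) ** cofactor_inverse (ref_Jac T (S x))) *v h)) (at x)"
    if x: "x \<in> interior K" for x
  proof -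
    have "((\<lambda>x. q (S x)) has_derivative (\<lambda>h. dq (S x) *v (cofactor_inverse (ref_Jac T (S x)) *v h))) (at x)"
      using has_derivative_compose[OF S(4)[OF x] dq(2)] .
    then have "(z has_derivative (\<lambda>h. dq (S x) *v (cofactor_inverse (ref_Jac T (S x)) *v h))) (at x)"
      by (rule has_derivative_transform_within_open[OF _ open_interior x]) (simp add: zS)
    then show ?thesis by (simp add: matrix_vector_mul_assoc)
  qed
  have Jz: "Jac z x = dq (S x) ** cofactor_inverse (ref_Jac T (S x))" if "x \<in> interior K" for x
    unfolding Jac_def frechet_derivative_at[OF dz[OF that], symmetric] by (rule matrix_of_matrix_vector_mul)
  have "continuous_on K (\<lambda>x. dq (S x))" using dq(1) S(1) by (rule continuous_on_compose2) simp
  then have "continuous_on K (\<lambda>x. dq (S x) ** cofactor_inverse (ref_Jac T (S x)))"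
    using S(5) by (rule continuous_on_matrix_mult)
  then show "cext K (Jac z)" by (rule cextI) (rule Jz)
  show "(z has_derivative (\<lambda>h. Jac z x *v h)) (at x)" if "x \<in> interior K" for x
    using dz[OF that] by (simp add: Jz[OF that])
qed

section \<open>Polynomial spaces on the cube\<close>

lemma Qpoly_add: "p \<in> Qpoly k \<Longrightarrow> q \<in> Qpoly k \<Longrightarrow> (\<lambda>y. p y + q y) \<in> Qpoly k"
  unfolding Qpoly_def
proof clarify
  fix c d :: "('a \<Rightarrow> nat) \<Rightarrow> real"
  show "\<exists>e. (\<lambda>y. (\<Sum>m | \<forall>i. m i \<le> k i. c m * (\<Prod>i\<in>UNIV. y $ i ^ m i)) + (\<Sum>m | \<forall>i. m i \<le> k i. d m * (\<Prod>i\<in>UNIV. y $ i ^ m i)))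
     = (\<lambda>y. \<Sum>m | \<forall>i. m i \<le> k i. e m * (\<Prod>i\<in>UNIV. y $ i ^ m i))"
    by (intro exI[of _ "\<lambda>m. c m + d m"]) (simp add: distrib_right sum.distrib)
qed

lemma Qpoly_scale: "p \<in> Qpoly k \<Longrightarrow> (\<lambda>y. c * p y) \<in> Qpoly k"
  unfolding Qpoly_def
proof clarify
  fix d :: "('a \<Rightarrow> nat) \<Rightarrow> real"
  show "\<exists>e. (\<lambda>y. c * (\<Sum>m | \<forall>i. m i \<le> k i. d m * (\<Prod>i\<in>UNIV. y $ i ^ m i)))
     = (\<lambda>y. \<Sum>m | \<forall>i. m i \<le> k i. e m * (\<Prod>i\<in>UNIV. y $ i ^ m i))"
    by (intro exI[of _ "\<lambda>m. c * d m"]) (simp add: sum_distrib_left mult.assoc)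
qed

lemma Qpoly_zero: "(\<lambda>y. 0) \<in> Qpoly k"
  unfolding Qpoly_def by (intro CollectI exI[of _ "\<lambda>m. 0"]) simp

lemma Qpoly_determined:
  fixes k :: "'d::finite \<Rightarrow> nat"
  shows "\<exists>Y0\<subseteq>interior (ref_cube :: (real^'d) set). finite Y0 \<and>
    (\<forall>q\<in>Qpoly k. (\<forall>y\<in>Y0. q y = 0) \<longrightarrow> (\<forall>y\<in>interior ref_cube. q y = 0))"
proof -
  have "{m. \<forall>i. m i \<le> k i} = (\<Pi>\<^sub>E i\<in>UNIV. {..k i})" by (auto simp: PiE_def Pi_def)
  then have fin: "finite {m. \<forall>i. m i \<le> k i}" by (simp add: finite_PiE)
  from finite_determining_set[OF fin, of "interior ref_cube" "\<lambda>m y. \<Prod>i\<in>UNIV. y $ i ^ m i"]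
  show ?thesis unfolding Qpoly_def by (elim exE conjE) (intro exI conjI, assumption, assumption, auto)
qed

lemma vector_Qpoly_determined:
  fixes k :: "'d::finite \<Rightarrow> 'd \<Rightarrow> nat"
  shows "\<exists>Y0\<subseteq>interior (ref_cube :: (real^'d) set). finite Y0 \<and> (\<forall>q :: real^'d \<Rightarrow> real^'d.
    (\<forall>i. (\<lambda>y. q y $ i) \<in> Qpoly (k i)) \<longrightarrow> (\<forall>y\<in>Y0. q y = 0) \<longrightarrow> (\<forall>y\<in>interior ref_cube. q y = 0))"
proof -
  from Qpoly_determined[of "k i" for i] obtain Y where Y: "\<And>i. Y i \<subseteq> interior (ref_cube :: (real^'d) set)"
    "\<And>i. finite (Y i)"
    "\<And>i. \<forall>q\<in>Qpoly (k i). (\<forall>y\<in>Y i. q y = 0) \<longrightarrow> (\<forall>y\<in>interior ref_cube. q y = 0)"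
    by metis
  show ?thesis
  proof (intro exI[of _ "\<Union>i. Y i"] conjI allI impI ballI)
    fix q :: "real^'d \<Rightarrow> real^'d" and y :: "real^'d"
    assume q: "\<forall>i. (\<lambda>y. q y $ i) \<in> Qpoly (k i)" "\<forall>y\<in>(\<Union>i. Y i). q y = 0" and y: "y \<in> interior ref_cube"
    have "q y $ i = 0" for i
    proof -
      have "\<forall>y\<in>Y i. q y $ i = 0" using q(2) by auto
      moreover have "(\<forall>y\<in>Y i. q y $ i = 0) \<longrightarrow> (\<forall>y\<in>interior ref_cube. q y $ i = 0)"
        by (rule bspec[OF Y(3)[of i] q(1)[THEN spec, of i]])
      ultimately show ?thesis using y by simp
    qed
    then show "q y = 0" by (simp add: vec_eq_iff)
  qed (use Y in auto)
qed

section \<open>The discrete spaces on the mesh\<close>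

context mesh_geometry
begin

lemma cell_body: "K \<in> cells X \<Longrightarrow> convex_body K"
  using cell_convex cell_compact cell_interior by unfold_locales auto

lemma region_sets: "region X \<in> sets lebesgue" using open_region by auto

lemma AE_region_interior: "AE x in lebesgue_on (region X). \<exists>K\<in>cells X. x \<in> interior K"
proof -
  have "AE x in lebesgue. \<forall>K\<in>cells X. x \<notin> frontier K"
  proof (subst AE_ball_countable[OF countable_finite[OF finite_cells]], intro ballI)
    fix K assume "K \<in> cells X"
    then show "AE x in lebesgue. x \<notin> frontier K"
      using negligible_convex_frontier[OF cell_convex] unfolding negligible_iff_null_sets by (intro AE_not_in) auto
  qed
  then have "AE x in lebesgue. x \<in> region X \<longrightarrow> (\<exists>K\<in>cells X. x \<in> interior K)"
  proof eventually_elim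
    case (elim x)
    show ?case
    proof
      assume "x \<in> region X"
      then obtain K where "K \<in> cells X" "x \<in> K" using Union_cells closure_subset by blast
      then show "\<exists>K\<in>cells X. x \<in> interior K"
        using elim closure_subset[of K] by (auto simp: frontier_def)
    qed
  qed
  then show ?thesis using region_sets by (simp add: AE_restrict_space_iff)
qed

lemma ip_region_null:
  fixes f :: "real^'d \<Rightarrow> 'b::euclidean_space"
  assumes "\<And>K x. K \<in> cells X \<Longrightarrow> x \<in> interior K \<Longrightarrow> f x = 0"
  shows "ip (region X) f g = 0"
proof -
  have "(LINT x|lebesgue_on (region X). f x \<bullet> g x) = 0"
    using AE_region_interior by (intro integral_eq_zero_AE) (auto elim!: eventually_mono simp: assms)
  then show ?thesis by (simp add: ip_def)
qed

text \<open>The cells cover the closure of the region, so the interior of a cell may contain points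
  outside the region; the region is dense in it, and continuity transports the zeros.\<close>

lemma ip_region_null_interior:
  fixes f :: "real^'d \<Rightarrow> 'b::euclidean_space"
  assumes "f \<in> L2 (region X)" "ip (region X) f f = 0" "K \<in> cells X" "cext K f" "x \<in> interior K"
  shows "f x = 0"
proof -
  interpret convex_body K by (rule cell_body[OF assms(3)])
  have ae: "AE x in lebesgue. x \<in> interior K \<inter> region X \<longrightarrow> trace_from K f x = 0"
    using assms(2) region_sets unfolding ip_null_iff[OF assms(1)]
    by (auto simp: AE_restrict_space_iff cext_trace(2)[OF assms(4)] elim!: eventually_mono)
  have cont: "continuous_on (interior K) (trace_from K f)"
    using cext_trace(1)[OF assms(4)] continuous_on_subset interior_subset by blast
  have "trace_from K f x = 0"
  proof (rule continuous_zero_closure[OF cont, of "interior K \<inter> region X"])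
    have "interior K \<subseteq> closure (region X)" using assms(3) Union_cells interior_subset by blast
    then show "interior K \<subseteq> closure (interior K \<inter> region X)"
      using open_Int_closure_subset[OF open_interior, of K "region X"] by blast
    show "trace_from K f x = 0" if "x \<in> interior K \<inter> region X" for x
      by (rule AE_zero_open[OF _ continuous_on_subset[OF cont] ae that]) (use open_region in auto)
  qed (use assms(5) in auto)
  then show ?thesis by (simp add: cext_trace(2)[OF assms(4,5)])
qed

lemma W_hD: "w \<in> W_h X s \<Longrightarrow> K \<in> cells X \<Longrightarrow>
    \<exists>q\<in>Qpoly (\<lambda>_. s). \<forall>y\<in>interior ref_cube. w (refmap X K y) = q y"
  by (simp add: W_h_def)

lemma V_hD: "v \<in> V_h X s \<Longrightarrow> K \<in> cells X \<Longrightarrow> \<exists>v'\<in>RT_ref s. \<forall>y\<in>interior ref_cube.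
    v (refmap X K y) = (1 / det (ref_Jac (refmap X K) y)) *\<^sub>R (ref_Jac (refmap X K) y *v v' y)"
  by (simp add: V_h_def)

lemma H_hD: "z \<in> H_h X l \<Longrightarrow> K \<in> cells X \<Longrightarrow>
    \<exists>q. (\<forall>i. (\<lambda>y. q y $ i) \<in> Qpoly (\<lambda>_. l)) \<and> (\<forall>y\<in>interior ref_cube. z (refmap X K y) = q y)"
  by (simp add: H_h_def)

lemma H_h_boundary: "z \<in> H_h X l \<Longrightarrow> K \<in> cells X \<Longrightarrow> F facet_of K \<Longrightarrow> F \<subseteq> frontier (region X) \<Longrightarrow>
    x \<in> F \<Longrightarrow> trace_from K z x = 0"
  by (simp add: H_h_def)

lemma W_h_cext: "w \<in> W_h X s \<Longrightarrow> K \<in> cells X \<Longrightarrow> cext K w"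
  unfolding W_h_def using cext_pullback[OF cell_diffeo C1_scalar_Qpoly] by blast

lemma W_h_L2: "w \<in> W_h X s \<Longrightarrow> w \<in> L2 (region X)"
  by (simp add: W_h_def)

lemma V_h_Hdiv: "v \<in> V_h X s \<Longrightarrow> v \<in> Hdiv (region X)"
  by (simp add: V_h_def)

lemma H_h_L2: "z \<in> H_h X l \<Longrightarrow> z \<in> L2 (region X)"
  by (simp add: H_h_def)

lemma H_h_regular:
  assumes "z \<in> H_h X l" "K \<in> cells X"
  shows "cext K z" "cext K (Jac z)" "\<And>x. x \<in> interior K \<Longrightarrow> (z has_derivative (\<lambda>h. Jac z x *v h)) (at x)"
proof -
  obtain q where "\<And>i. (\<lambda>y. q y $ i) \<in> Qpoly (\<lambda>_. l)" "\<And>y. y \<in> interior ref_cube \<Longrightarrow> z (refmap X K y) = q y"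
    using H_hD[OF assms] by blast
  note q = this
  show "cext K z" "cext K (Jac z)" "\<And>x. x \<in> interior K \<Longrightarrow> (z has_derivative (\<lambda>h. Jac z x *v h)) (at x)"
    by (rule C1_pullback[OF cell_diffeo[OF assms(2)] C1_scalar_Qpoly[OF q(1)]]; use q(2) in blast)+
qed

lemma subspace_W_h: "subspace (W_h X s)"
proof (rule subspaceI)
  show "0 \<in> W_h X s" using subspace_0[OF subspace_L2] Qpoly_zero by (auto simp: W_h_def intro!: bexI[of _ "\<lambda>y. 0"])
  show "f + g \<in> W_h X s" if fg: "f \<in> W_h X s" "g \<in> W_h X s" for f g
    unfolding W_h_def
  proof (intro CollectI conjI ballI)
    show "f + g \<in> L2 (region X)" by (rule subspace_add[OF subspace_L2 W_h_L2[OF that(1)] W_h_L2[OF that(2)]])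
    fix K assume K: "K \<in> cells X"
    obtain p q where "p \<in> Qpoly (\<lambda>_. s)" "\<forall>y\<in>interior ref_cube. f (refmap X K y) = p y"
      "q \<in> Qpoly (\<lambda>_. s)" "\<forall>y\<in>interior ref_cube. g (refmap X K y) = q y"
      using W_hD[OF fg(1) K] W_hD[OF fg(2) K] by blast
    then show "\<exists>q\<in>Qpoly (\<lambda>_. s). \<forall>y\<in>interior ref_cube. (f + g) (refmap X K y) = q y"
      by (intro bexI[of _ "\<lambda>y. p y + q y"]) (auto intro: Qpoly_add)
  qed
  show "c *\<^sub>R f \<in> W_h X s" if f: "f \<in> W_h X s" for c f
    unfolding W_h_def
  proof (intro CollectI conjI ballI)
    show "c *\<^sub>R f \<in> L2 (region X)" by (rule subspace_scale[OF subspace_L2 W_h_L2[OF that]])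
    fix K assume K: "K \<in> cells X"
    obtain p where "p \<in> Qpoly (\<lambda>_. s)" "\<forall>y\<in>interior ref_cube. f (refmap X K y) = p y"
      using W_hD[OF f K] by blast
    then show "\<exists>q\<in>Qpoly (\<lambda>_. s). \<forall>y\<in>interior ref_cube. (c *\<^sub>R f) (refmap X K y) = q y"
      by (intro bexI[of _ "\<lambda>y. c * p y"]) (auto intro: Qpoly_scale)
  qed
qed

lemma subspace_V_h: "subspace (V_h X s)"
proof (rule subspaceI)
  note H = subspace_Hdiv[OF open_region]
  have "(\<lambda>y. 0) \<in> RT_ref s" by (simp add: RT_ref_def Qpoly_zero)
  then show "0 \<in> V_h X s"
    using subspace_0[OF H] unfolding V_h_def by (auto intro!: bexI[of _ "\<lambda>y. 0"])
  show "f + g \<in> V_h X s" if "f \<in> V_h X s" "g \<in> V_h X s" for f g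
    unfolding V_h_def
  proof (intro CollectI conjI ballI)
    show "f + g \<in> Hdiv (region X)" by (rule subspace_add[OF H V_h_Hdiv[OF that(1)] V_h_Hdiv[OF that(2)]])
    fix K assume K: "K \<in> cells X"
    from V_hD[OF that(1) K] obtain p where p: "p \<in> RT_ref s" "\<forall>y\<in>interior ref_cube. f (refmap X K y) =
        (1 / det (ref_Jac (refmap X K) y)) *\<^sub>R (ref_Jac (refmap X K) y *v p y)" by (rule bexE)
    from V_hD[OF that(2) K] obtain q where q: "q \<in> RT_ref s" "\<forall>y\<in>interior ref_cube. g (refmap X K y) =
        (1 / det (ref_Jac (refmap X K) y)) *\<^sub>R (ref_Jac (refmap X K) y *v q y)" by (rule bexE)
    from p q show "\<exists>v'\<in>RT_ref s. \<forall>y\<in>interior ref_cube. (f + g) (refmap X K y) =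
        (1 / det (ref_Jac (refmap X K) y)) *\<^sub>R (ref_Jac (refmap X K) y *v v' y)"
      by (intro bexI[of _ "\<lambda>y. p y + q y"])
        (auto intro: Qpoly_add simp: RT_ref_def scaleR_add_right matrix_vector_right_distrib)
  qed
  show "c *\<^sub>R f \<in> V_h X s" if "f \<in> V_h X s" for c f
    unfolding V_h_def
  proof (intro CollectI conjI ballI)
    show "c *\<^sub>R f \<in> Hdiv (region X)" by (rule subspace_scale[OF H V_h_Hdiv[OF that]])
    fix K assume K: "K \<in> cells X"
    from V_hD[OF that K] obtain p where "p \<in> RT_ref s" "\<forall>y\<in>interior ref_cube. f (refmap X K y) =
        (1 / det (ref_Jac (refmap X K) y)) *\<^sub>R (ref_Jac (refmap X K) y *v p y)" by (rule bexE)
    then show "\<exists>v'\<in>RT_ref s. \<forall>y\<in>interior ref_cube. (c *\<^sub>R f) (refmap X K y) =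
        (1 / det (ref_Jac (refmap X K) y)) *\<^sub>R (ref_Jac (refmap X K) y *v v' y)"
      by (intro bexI[of _ "\<lambda>y. c *\<^sub>R p y"])
        (auto intro: Qpoly_scale simp: RT_ref_def matrix_vector_mult_scaleR)
  qed
qed

lemma subspace_H_h: "subspace (H_h X l)"
proof (rule subspaceI)
  show "0 \<in> H_h X l"
    unfolding H_h_def
  proof (intro CollectI conjI ballI allI impI)
    fix K F x assume K: "K \<in> cells X" and F: "F facet_of K \<and> F \<subseteq> frontier (region X)" "x \<in> F"
    interpret convex_body K by (rule cell_body[OF K])
    show "trace_from K (0 :: real^'d \<Rightarrow> real^'d) x = 0"
      using F facet_of_imp_subset by (intro trace_from_zero) auto
  qed (use subspace_0[OF subspace_L2] Qpoly_zero in \<open>auto intro!: exI[of _ "\<lambda>y. 0"]\<close>)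
  show "f + g \<in> H_h X l" if fg: "f \<in> H_h X l" "g \<in> H_h X l" for f g
    unfolding H_h_def
  proof (intro CollectI conjI ballI allI impI)
    show "f + g \<in> L2 (region X)" by (rule subspace_add[OF subspace_L2 H_h_L2[OF fg(1)] H_h_L2[OF fg(2)]])
    fix K assume K: "K \<in> cells X"
    obtain p q where "\<forall>i. (\<lambda>y. p y $ i) \<in> Qpoly (\<lambda>_. l)" "\<forall>y\<in>interior ref_cube. f (refmap X K y) = p y"
      "\<forall>i. (\<lambda>y. q y $ i) \<in> Qpoly (\<lambda>_. l)" "\<forall>y\<in>interior ref_cube. g (refmap X K y) = q y"
      using H_hD[OF fg(1) K] H_hD[OF fg(2) K] by blast
    then show "\<exists>q. (\<forall>i. (\<lambda>y. q y $ i) \<in> Qpoly (\<lambda>_. l)) \<and> (\<forall>y\<in>interior ref_cube. (f + g) (refmap X K y) = q y)"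
      by (intro exI[of _ "\<lambda>y. p y + q y"]) (auto intro: Qpoly_add)
    fix F x assume F: "F facet_of K \<and> F \<subseteq> frontier (region X)" "x \<in> F"
    interpret convex_body K by (rule cell_body[OF K])
    have x: "x \<in> K" using F facet_of_imp_subset by blast
    have "trace_from K f x = 0" "trace_from K g x = 0" using H_h_boundary[OF fg(1) K] H_h_boundary[OF fg(2) K] F by blast+
    then show "trace_from K (f + g) x = 0"
      using trace_from_add[OF H_h_regular(1)[OF fg(1) K] H_h_regular(1)[OF fg(2) K] x, of "f + g"] by simp
  qed
  show "c *\<^sub>R f \<in> H_h X l" if f: "f \<in> H_h X l" for c f
    unfolding H_h_def
  proof (intro CollectI conjI ballI allI impI)
    show "c *\<^sub>R f \<in> L2 (region X)" by (rule subspace_scale[OF subspace_L2 H_h_L2[OF f]])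
    fix K assume K: "K \<in> cells X"
    obtain p where "\<forall>i. (\<lambda>y. p y $ i) \<in> Qpoly (\<lambda>_. l)" "\<forall>y\<in>interior ref_cube. f (refmap X K y) = p y"
      using H_hD[OF f K] by blast
    then show "\<exists>q. (\<forall>i. (\<lambda>y. q y $ i) \<in> Qpoly (\<lambda>_. l)) \<and> (\<forall>y\<in>interior ref_cube. (c *\<^sub>R f) (refmap X K y) = q y)"
      by (intro exI[of _ "\<lambda>y. c *\<^sub>R p y"]) (auto intro: Qpoly_scale)
    fix F x assume F: "F facet_of K \<and> F \<subseteq> frontier (region X)" "x \<in> F"
    interpret convex_body K by (rule cell_body[OF K])
    have x: "x \<in> K" using F facet_of_imp_subset by blast
    have "trace_from K f x = 0" using H_h_boundary[OF f K] F by blast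
    then show "trace_from K (c *\<^sub>R f) x = 0"
      using trace_from_scaleR[OF H_h_regular(1)[OF f K] x, of "c *\<^sub>R f" c] by simp
  qed
qed

text \<open>Determining points of the polynomial space on the cube are carried to each cell by its
  map; they make the discrete space finite-dimensional modulo functions that vanish inside all
  cells.\<close>

lemma W_h_determined:
  "\<exists>X0. finite X0 \<and> (\<forall>w\<in>W_h X s. (\<forall>x\<in>X0. w x = 0) \<longrightarrow> (\<forall>K\<in>cells X. \<forall>x\<in>interior K. w x = 0))"
proof -
  from Qpoly_determined obtain Y0 where Y0: "Y0 \<subseteq> interior (ref_cube :: (real^'d) set)" "finite Y0"
    "\<forall>q\<in>Qpoly (\<lambda>_. s). (\<forall>y\<in>Y0. q y = 0) \<longrightarrow> (\<forall>y\<in>interior ref_cube. q y = 0)"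
    by blast
  show ?thesis
  proof (intro exI[of _ "\<Union>K\<in>cells X. refmap X K ` Y0"] conjI ballI impI)
    show "finite (\<Union>K\<in>cells X. refmap X K ` Y0)" using finite_cells Y0(2) by blast
    fix w K x assume w: "w \<in> W_h X s" "\<forall>x\<in>(\<Union>K\<in>cells X. refmap X K ` Y0). w x = 0"
      and K: "K \<in> cells X" and x: "x \<in> interior K"
    from W_hD[OF w(1) K] obtain q where q: "q \<in> Qpoly (\<lambda>_. s)" "\<forall>y\<in>interior ref_cube. w (refmap X K y) = q y"
      by (rule bexE)
    obtain y where y: "y \<in> interior ref_cube" "x = refmap X K y"
      using ref_diffeo_interior(1)[OF cell_diffeo[OF K]] x by blast
    have "\<forall>y\<in>Y0. q y = 0"
    proof
      fix y assume y: "y \<in> Y0"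
      then have "w (refmap X K y) = 0" using w(2) K by blast
      then show "q y = 0" using q(2) Y0(1) y by auto
    qed
    then show "w x = 0" using Y0(3) q y by auto
  qed
qed

lemma H_h_determined:
  "\<exists>X0. finite X0 \<and> (\<forall>z\<in>H_h X l. (\<forall>x\<in>X0. z x = 0) \<longrightarrow> (\<forall>K\<in>cells X. \<forall>x\<in>interior K. z x = 0))"
proof -
  from vector_Qpoly_determined[of "\<lambda>i j. l"] obtain Y0 where Y0: "Y0 \<subseteq> interior (ref_cube :: (real^'d) set)" "finite Y0"
    "\<forall>q :: real^'d \<Rightarrow> real^'d. (\<forall>i. (\<lambda>y. q y $ i) \<in> Qpoly (\<lambda>_. l)) \<longrightarrow> (\<forall>y\<in>Y0. q y = 0) \<longrightarrow>
      (\<forall>y\<in>interior ref_cube. q y = 0)"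
    by blast
  show ?thesis
  proof (intro exI[of _ "\<Union>K\<in>cells X. refmap X K ` Y0"] conjI ballI impI)
    show "finite (\<Union>K\<in>cells X. refmap X K ` Y0)" using finite_cells Y0(2) by blast
    fix z K x assume z: "z \<in> H_h X l" "\<forall>x\<in>(\<Union>K\<in>cells X. refmap X K ` Y0). z x = 0"
      and K: "K \<in> cells X" and x: "x \<in> interior K"
    obtain q where q: "\<forall>i. (\<lambda>y. q y $ i) \<in> Qpoly (\<lambda>_. l)" "\<forall>y\<in>interior ref_cube. z (refmap X K y) = q y"
      using H_hD[OF z(1) K] by blast
    obtain y where y: "y \<in> interior ref_cube" "x = refmap X K y"
      using ref_diffeo_interior(1)[OF cell_diffeo[OF K]] x by blast
    have "\<forall>y\<in>Y0. q y = 0"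
    proof
      fix y assume y: "y \<in> Y0"
      then have "z (refmap X K y) = 0" using z(2) K by blast
      then show "q y = 0" using q(2) Y0(1) y by auto
    qed
    then have "q y = 0" using Y0(3)[THEN spec, THEN mp, OF q(1)] y(1) by simp
    then show "z x = 0" using q(2) y by simp
  qed
qed

lemma V_h_determined:
  "\<exists>X0. finite X0 \<and> (\<forall>v\<in>V_h X s. (\<forall>x\<in>X0. v x = 0) \<longrightarrow> (\<forall>K\<in>cells X. \<forall>x\<in>interior K. v x = 0))"
proof -
  from vector_Qpoly_determined[of "\<lambda>i j. if j = i then s + 1 else s"]
  obtain Y0 where Y0: "Y0 \<subseteq> interior (ref_cube :: (real^'d) set)" "finite Y0"
    "\<forall>q :: real^'d \<Rightarrow> real^'d. (\<forall>i. (\<lambda>y. q y $ i) \<in> Qpoly (\<lambda>j. if j = i then s + 1 else s)) \<longrightarrow>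
      (\<forall>y\<in>Y0. q y = 0) \<longrightarrow> (\<forall>y\<in>interior ref_cube. q y = 0)"
    by blast
  show ?thesis
  proof (intro exI[of _ "\<Union>K\<in>cells X. refmap X K ` Y0"] conjI ballI impI)
    show "finite (\<Union>K\<in>cells X. refmap X K ` Y0)" using finite_cells Y0(2) by blast
    fix v K x assume v: "v \<in> V_h X s" "\<forall>x\<in>(\<Union>K\<in>cells X. refmap X K ` Y0). v x = 0"
      and K: "K \<in> cells X" and x: "x \<in> interior K"
    define J where "J = ref_Jac (refmap X K)"
    from V_hD[OF v(1) K, folded J_def] obtain q where q: "q \<in> RT_ref s"
      "\<forall>y\<in>interior ref_cube. v (refmap X K y) = (1 / det (J y)) *\<^sub>R (J y *v q y)" by (rule bexE)
    obtain y where y: "y \<in> interior ref_cube" "x = refmap X K y"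
      using ref_diffeo_interior(1)[OF cell_diffeo[OF K]] x by blast
    have "\<forall>y\<in>Y0. q y = 0"
    proof
      fix y assume y: "y \<in> Y0"
      then have yi: "y \<in> interior ref_cube" using Y0(1) by blast
      then have det: "det (J y) \<noteq> 0"
        using cell_diffeo[OF K] interior_subset[of ref_cube] by (auto simp: ref_diffeo_def J_def)
      have "v (refmap X K y) = 0" using v(2) K y by blast
      then have "(1 / det (J y)) *\<^sub>R (J y *v q y) = 0" using q(2) yi by simp
      then have "J y *v q y = 0" using det by simp
      \<comment> \<open>The Piola factor is an invertible matrix, so zeros of v are zeros of the
        reference field.\<close>
      then have "cofactor_inverse (J y) *v (J y *v q y) = 0" by simp
      then show "q y = 0" by (simp add: matrix_vector_mul_assoc cofactor_inverse(2)[OF det])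
    qed
    moreover have qp: "\<forall>i. (\<lambda>y. q y $ i) \<in> Qpoly (\<lambda>j. if j = i then s + 1 else s)"
      using q(1) by (simp add: RT_ref_def)
    ultimately have "q y = 0" using Y0(3)[THEN spec, THEN mp, OF qp] y(1) by blast
    then show "v x = 0" using q(2) y by simp
  qed
qed

end

section \<open>Elastic and face forms\<close>

text \<open>Covers the identity, the Jacobian, strain, divergence, stress and normal stress at once.
  Linearity is demanded only in the interior of K, where the cellwise smooth fields are known to be
  differentiable.\<close>

definition cell_op :: "'v::real_vector set \<Rightarrow> (real^'d) set \<Rightarrow> ('v \<Rightarrow> real^'d \<Rightarrow> 'b::real_normed_vector) \<Rightarrow> bool" where
  "cell_op S K \<Lambda> \<longleftrightarrow> (\<forall>f\<in>S. cext K (\<Lambda> f)) \<and>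
     (\<forall>f\<in>S. \<forall>g\<in>S. \<forall>x\<in>interior K. \<Lambda> (f + g) x = \<Lambda> f x + \<Lambda> g x) \<and>
     (\<forall>f\<in>S. \<forall>c. \<forall>x\<in>interior K. \<Lambda> (c *\<^sub>R f) x = c *\<^sub>R \<Lambda> f x)"

lemma cell_opD:
  assumes "cell_op S K \<Lambda>"
  shows "f \<in> S \<Longrightarrow> cext K (\<Lambda> f)"
    "f \<in> S \<Longrightarrow> g \<in> S \<Longrightarrow> x \<in> interior K \<Longrightarrow> \<Lambda> (f + g) x = \<Lambda> f x + \<Lambda> g x"
    "f \<in> S \<Longrightarrow> x \<in> interior K \<Longrightarrow> \<Lambda> (c *\<^sub>R f) x = c *\<^sub>R \<Lambda> f x"
  using assms by (auto simp: cell_op_def)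

lemma cell_op_linear:
  fixes L :: "'b::euclidean_space \<Rightarrow> 'c::real_normed_vector"
  assumes "cell_op S K \<Lambda>" "linear L" "\<And>f x. \<Lambda>' f x = L (\<Lambda> f x)"
  shows "cell_op S K \<Lambda>'"
proof -
  have eq: "\<Lambda>' f = (\<lambda>x. L (\<Lambda> f x))" for f using assms(3) by (simp add: fun_eq_iff)
  have "continuous_on UNIV L" using assms(2) by (simp add: linear_continuous_on linear_conv_bounded_linear)
  then show ?thesis
    using assms(1) unfolding cell_op_def eq
    by (auto simp: linear_add[OF assms(2)] linear_cmul[OF assms(2)] intro: cext_compose)
qed

context convex_body
begin

lemma bil_on_cell_ip:
  fixes \<Lambda> :: "'v::real_vector \<Rightarrow> real^'d \<Rightarrow> 'b::euclidean_space" and \<Lambda>' :: "'w::real_vector \<Rightarrow> real^'d \<Rightarrow> 'b"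
  assumes "cell_op S K \<Lambda>" "cell_op T K \<Lambda>'" "subspace S" "subspace T"
  shows "bil_on S T (\<lambda>f g. ip K (\<Lambda> f) (\<Lambda>' g))"
proof -
  note L = cell_opD[OF assms(1)] and L' = cell_opD[OF assms(2)]
  have int: "integrable (lebesgue_on K) (\<lambda>x. \<Lambda> f x \<bullet> \<Lambda>' g x)" if "f \<in> S" "g \<in> T" for f g
    using cext_integrable[OF cext_inner[OF L(1)[OF that(1)] L'(1)[OF that(2)]]] .
  have "ip K (\<Lambda> (f + f')) (\<Lambda>' g) = ip K (\<Lambda> f) (\<Lambda>' g) + ip K (\<Lambda> f') (\<Lambda>' g)"
    if "f \<in> S" "f' \<in> S" "g \<in> T" for f f' g
  proof -
    have "ip K (\<Lambda> (f + f')) (\<Lambda>' g) = ip K (\<lambda>x. \<Lambda> f x + \<Lambda> f' x) (\<Lambda>' g)"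
      by (rule ip_cong_interior[OF L(1)[OF subspace_add[OF assms(3) that(1,2)]] L'(1)[OF that(3)]])
        (simp add: L(2)[OF that(1,2)])
    also have "\<dots> = ip K (\<Lambda> f) (\<Lambda>' g) + ip K (\<Lambda> f') (\<Lambda>' g)"
      unfolding ip_def inner_add_left
      by (rule Bochner_Integration.integral_add[OF int[OF that(1,3)] int[OF that(2,3)]])
    finally show ?thesis .
  qed
  moreover have "ip K (\<Lambda> (c *\<^sub>R f)) (\<Lambda>' g) = c * ip K (\<Lambda> f) (\<Lambda>' g)" if "f \<in> S" "g \<in> T" for f g c
  proof -
    have "ip K (\<Lambda> (c *\<^sub>R f)) (\<Lambda>' g) = ip K (\<lambda>x. c *\<^sub>R \<Lambda> f x) (\<Lambda>' g)"
      by (rule ip_cong_interior[OF L(1)[OF subspace_scale[OF assms(3) that(1)]] L'(1)[OF that(2)]])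
        (simp add: L(3)[OF that(1)])
    then show ?thesis by (simp add: ip_def)
  qed
  moreover have "ip K (\<Lambda> f) (\<Lambda>' (g + g')) = ip K (\<Lambda> f) (\<Lambda>' g) + ip K (\<Lambda> f) (\<Lambda>' g')"
    if "f \<in> S" "g \<in> T" "g' \<in> T" for f g g'
  proof -
    have "ip K (\<Lambda> f) (\<Lambda>' (g + g')) = ip K (\<Lambda> f) (\<lambda>x. \<Lambda>' g x + \<Lambda>' g' x)"
      by (rule ip_cong_interior[OF L(1)[OF that(1)] L'(1)[OF subspace_add[OF assms(4) that(2,3)]]])
        (simp add: L'(2)[OF that(2,3)])
    also have "\<dots> = ip K (\<Lambda> f) (\<Lambda>' g) + ip K (\<Lambda> f) (\<Lambda>' g')"
      unfolding ip_def inner_add_right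
      by (rule Bochner_Integration.integral_add[OF int[OF that(1,2)] int[OF that(1,3)]])
    finally show ?thesis .
  qed
  moreover have "ip K (\<Lambda> f) (\<Lambda>' (c *\<^sub>R g)) = c * ip K (\<Lambda> f) (\<Lambda>' g)" if "f \<in> S" "g \<in> T" for f g c
  proof -
    have "ip K (\<Lambda> f) (\<Lambda>' (c *\<^sub>R g)) = ip K (\<Lambda> f) (\<lambda>x. c *\<^sub>R \<Lambda>' g x)"
      by (rule ip_cong_interior[OF L(1)[OF that(1)] L'(1)[OF subspace_scale[OF assms(4) that(2)]]])
        (simp add: L'(3)[OF that(2)])
    then show ?thesis by (simp add: ip_def)
  qed
  ultimately show ?thesis unfolding bil_on_def lin_on_def by blast
qed

lemma psd_form_cell_ip:
  fixes \<Lambda> :: "'v::real_vector \<Rightarrow> real^'d \<Rightarrow> 'b::euclidean_space"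
  assumes "cell_op S K \<Lambda>" "subspace S"
  shows "psd_form S (\<lambda>f g. ip K (\<Lambda> f) (\<Lambda> g))"
  unfolding psd_form_def
  using bil_on_cell_ip[OF assms(1,1,2,2)] by (auto simp: ip_def inner_commute intro!: integral_nonneg_AE)

end

text \<open>The counterpart on a face for traces, averages and jumps. Composed with the closest
  point map it becomes a \<open>cell_op\<close> on the prism, so face integrals are treated as
  integrals over a convex body.\<close>

definition face_op :: "'v::real_vector set \<Rightarrow> (real^'d) set \<Rightarrow> ('v \<Rightarrow> real^'d \<Rightarrow> 'b::real_normed_vector) \<Rightarrow> bool" where
  "face_op S e \<Theta> \<longleftrightarrow> (\<forall>f\<in>S. continuous_on e (\<Theta> f)) \<and>
     (\<forall>f\<in>S. \<forall>g\<in>S. \<forall>x\<in>e. \<Theta> (f + g) x = \<Theta> f x + \<Theta> g x) \<and>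
     (\<forall>f\<in>S. \<forall>c. \<forall>x\<in>e. \<Theta> (c *\<^sub>R f) x = c *\<^sub>R \<Theta> f x)"

section \<open>Algebra of strain and stress, rigid fields\<close>

lemma linear_eps_matrix: "linear (\<lambda>J :: real^'d^'d. (1/2) *\<^sub>R (J + transpose J))"
  by (rule linearI) (simp_all add: vec_eq_iff transpose_def algebra_simps)

lemma linear_trace: "linear (trace :: real^'d^'d \<Rightarrow> real)"
  by (rule linearI) (simp_all add: trace_def sum.distrib sum_distrib_left)

lemma trace_transpose: "trace (transpose A) = trace (A :: real^'d^'d)"
  by (simp add: trace_def transpose_def)

lemma linear_sigma_matrix:
  "linear (\<lambda>J :: real^'d^'d. a *\<^sub>R ((1/2) *\<^sub>R (J + transpose J)) + (b * trace J) *\<^sub>R (mat 1 :: real^'d^'d))"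
  by (rule linearI)
    (simp_all add: vec_eq_iff transpose_def linear_add[OF linear_trace] linear_cmul[OF linear_trace] algebra_simps)

lemma inner_mat_one: "(mat 1 :: real^'d^'d) \<bullet> A = trace A"
  by (simp add: inner_vec_def mat_def trace_def if_distrib[of "\<lambda>x. x * _"] cong: if_cong)

text \<open>The pairing of the identity matrix with the strain is the trace of the strain, which is
  the divergence.\<close>

lemma sigma_inner_eps: "sigma D u x \<bullet> eps z x = 2 * mu D * (eps u x \<bullet> eps z x) + lam D * (dvg u x * dvg z x)"
proof -
  have "mat 1 \<bullet> eps z x = dvg z x"
    unfolding inner_mat_one eps_def dvg_def
    by (simp add: linear_cmul[OF linear_trace] linear_add[OF linear_trace] trace_transpose)
  then show ?thesis by (simp add: sigma_def inner_add_left)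
qed

lemma sigma_eq_0: "eps u x = 0 \<Longrightarrow> dvg u x = 0 \<and> sigma D u x = 0"
proof -
  assume e: "eps u x = 0"
  have "trace (eps u x) = dvg u x"
    unfolding eps_def dvg_def
    by (simp add: linear_cmul[OF linear_trace] linear_add[OF linear_trace] trace_transpose)
  then have "dvg u x = 0" using e by (simp add: linear_0[OF linear_trace])
  then show ?thesis using e by (simp add: sigma_def)
qed

text \<open>A field with vanishing symmetric gradient satisfies \<open>(z x - z y) \<bullet> (x - y) = 0\<close>. This identity survives
  in the limit at the boundary and suffices to propagate zeros; second derivatives are not needed.\<close>

lemma eps_zero_inner:
  fixes z :: "real^'d \<Rightarrow> real^'d"
  assumes "convex U" "\<And>x. x \<in> U \<Longrightarrow> (z has_derivative (\<lambda>h. Jac z x *v h)) (at x)"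
    "\<And>x. x \<in> U \<Longrightarrow> eps z x = 0" "x \<in> U" "y \<in> U"
  shows "(z x - z y) \<bullet> (x - y) = 0"
proof -
  define w where "w = x - y"
  define \<phi> where "\<phi> t = z (y + t *\<^sub>R w) \<bullet> w" for t
  have inU: "y + t *\<^sub>R w \<in> U" if "t \<in> {0..1}" for t
  proof -
    have "y + t *\<^sub>R w = (1 - t) *\<^sub>R y + t *\<^sub>R x" by (simp add: w_def algebra_simps)
    then show ?thesis using assms(1,4,5) that by (auto simp: convex_alt)
  qed
  \<comment> \<open>A vanishing strain means a skew Jacobian, so the derivative of
    \<open>\<phi>\<close> along the segment is 0.\<close>
  have skew: "(Jac z v *v h) \<bullet> h = 0" if "v \<in> U" for v h
  proof -
    have "Jac z v + transpose (Jac z v) = 0" using assms(3)[OF that] by (simp add: eps_def)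
    then have "(Jac z v + transpose (Jac z v)) *v h = 0" by simp
    then have "(Jac z v *v h + transpose (Jac z v) *v h) \<bullet> h = 0"
      unfolding matrix_vector_mult_add_rdistrib by simp
    moreover have "(transpose (Jac z v) *v h) \<bullet> h = h \<bullet> (Jac z v *v h)"
      by (simp add: dot_lmul_matrix)
    ultimately show ?thesis by (simp add: inner_add_right inner_commute)
  qed
  have "(\<phi> has_real_derivative 0) (at t within {0..1})" if t: "t \<in> {0..1}" for t
  proof -
    have "((\<lambda>t. y + t *\<^sub>R w) has_derivative (\<lambda>s. s *\<^sub>R w)) (at t)"
      by (auto intro!: derivative_eq_intros)
    from has_derivative_compose[OF this assms(2)[OF inU[OF t]]]
    have "((\<lambda>t. z (y + t *\<^sub>R w)) has_derivative (\<lambda>s. Jac z (y + t *\<^sub>R w) *v (s *\<^sub>R w))) (at t)" .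
    then have "(\<phi> has_derivative (\<lambda>s. (Jac z (y + t *\<^sub>R w) *v (s *\<^sub>R w)) \<bullet> w)) (at t)"
      unfolding \<phi>_def[abs_def] by (rule has_derivative_inner_left)
    moreover have "(\<lambda>s. (Jac z (y + t *\<^sub>R w) *v (s *\<^sub>R w)) \<bullet> w) = (\<lambda>s. 0 * s)"
      using skew[OF inU[OF t], of w] by (simp add: fun_eq_iff matrix_vector_mult_scaleR)
    moreover have "((*) 0 :: real \<Rightarrow> real) = (\<lambda>s. 0)" by (simp add: fun_eq_iff)
    ultimately show ?thesis
      unfolding has_field_derivative_def by (simp add: has_derivative_at_withinI)
  qed
  then obtain c where "\<And>t. t \<in> {0..1} \<Longrightarrow> \<phi> t = c"
    using has_field_derivative_zero_constant[of "{0..1}" \<phi>] by auto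
  then have "\<phi> 1 = \<phi> 0" by simp
  then show ?thesis by (simp add: \<phi>_def w_def inner_diff_left)
qed

text \<open>If g x were nonzero, the identity would put F into the hyperplane through x normal to g
  x; this is then the affine hull of F, which cannot contain the interior point x.\<close>

lemma rigid_zero_on_facet:
  fixes g :: "real^'d \<Rightarrow> real^'d"
  assumes "convex K" "interior K \<noteq> {}" "F facet_of K"
    and "\<And>x y. x \<in> K \<Longrightarrow> y \<in> K \<Longrightarrow> (g x - g y) \<bullet> (x - y) = 0" "\<And>y. y \<in> F \<Longrightarrow> g y = 0"
    and x: "x \<in> interior K"
  shows "g x = 0"
proof (rule ccontr)
  assume nz: "g x \<noteq> 0"
  have FK: "F \<subseteq> K" "F \<noteq> K" using assms(3) facet_of_imp_subset by auto
  have xK: "x \<in> K" using x interior_subset by blast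
  have "g x \<bullet> y = g x \<bullet> x" if "y \<in> F" for y
    using assms(4)[OF xK, of y] assms(5)[OF that] FK that by (auto simp: inner_diff_right)
  then have "affine hull F = {y. g x \<bullet> y = g x \<bullet> x}"
    by (intro facet_affine_hull_eq_hyperplane[OF assms(2,3) nz])
  moreover have "affine hull F \<inter> rel_interior K = {}"
    by (rule affine_hull_face_of_disjoint_rel_interior[OF assms(1) facet_of_imp_face_of[OF assms(3)] FK(2)])
  ultimately show False using x rel_interior_nonempty_interior[OF assms(2)] by auto
qed

context mesh_geometry
begin

section \<open>Cell and face operators on the discrete spaces\<close>

lemma cell_op_W_h: "K \<in> cells X \<Longrightarrow> cell_op (W_h X s) K (\<lambda>w. w)"
  by (simp add: cell_op_def W_h_cext)

lemma cell_op_H_h: "K \<in> cells X \<Longrightarrow> cell_op (H_h X l) K (\<lambda>z. z)"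
  by (simp add: cell_op_def H_h_regular(1))

lemma cell_op_Jac:
  assumes K: "K \<in> cells X"
  shows "cell_op (H_h X l) K Jac"
  unfolding cell_op_def
proof (intro conjI ballI allI)
  note r = H_h_regular[OF _ K]
  have Jac_eq: "Jac z x = M" if "(z has_derivative (\<lambda>h. M *v h)) (at x)" for z x and M :: "real^'d^'d"
    unfolding Jac_def frechet_derivative_at[OF that, symmetric] by (rule matrix_of_matrix_vector_mul)
  show "cext K (Jac z)" if "z \<in> H_h X l" for z using r(2)[OF that] .
  fix f x assume f: "f \<in> H_h X l" and x: "x \<in> interior K"
  show "Jac (f + g) x = Jac f x + Jac g x" if g: "g \<in> H_h X l" for g
  proof (rule Jac_eq)
    show "((f + g) has_derivative (\<lambda>h. (Jac f x + Jac g x) *v h)) (at x)"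
      using has_derivative_add[OF r(3)[OF f x] r(3)[OF g x]]
      by (simp add: plus_fun_def matrix_vector_mult_add_rdistrib)
  qed
  show "Jac (c *\<^sub>R f) x = c *\<^sub>R Jac f x" for c
  proof (rule Jac_eq)
    show "((c *\<^sub>R f) has_derivative (\<lambda>h. (c *\<^sub>R Jac f x) *v h)) (at x)"
      using has_derivative_scaleR_right[OF r(3)[OF f x], of c]
      by (simp add: scaleR_fun_def scaleR_matrix_vector_assoc)
  qed
qed

lemma cell_op_eps: "K \<in> cells X \<Longrightarrow> cell_op (H_h X l) K eps"
  by (rule cell_op_linear[OF cell_op_Jac linear_eps_matrix]) (simp_all add: eps_def)

lemma cell_op_dvg: "K \<in> cells X \<Longrightarrow> cell_op (H_h X l) K dvg"
  by (rule cell_op_linear[OF cell_op_Jac linear_trace]) (simp_all add: dvg_def)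

lemma cell_op_sigma: "K \<in> cells X \<Longrightarrow> cell_op (H_h X l) K (sigma D)"
  by (rule cell_op_linear[OF cell_op_Jac linear_sigma_matrix[of "2 * mu D" "lam D"]])
    (simp_all add: sigma_def eps_def dvg_def)

lemma cell_op_sigma_normal: "K \<in> cells X \<Longrightarrow> cell_op (H_h X l) K (\<lambda>z x. sigma D z x *v n)"
proof (rule cell_op_linear[OF cell_op_sigma])
  show "linear (\<lambda>A :: real^'d^'d. A *v n)"
    by (rule linearI) (simp_all add: matrix_vector_mult_add_rdistrib scaleR_matrix_vector_assoc)
qed simp_all

lemma face_op_trace:
  assumes K: "K \<in> cells X" "e facet_of K" and L: "cell_op S K \<Lambda>" and S: "subspace S"
  shows "face_op S e (\<lambda>f. trace_from K (\<Lambda> f))"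
  unfolding face_op_def
proof (intro conjI ballI allI)
  interpret convex_body K by (rule cell_body[OF K(1)])
  have eK: "e \<subseteq> K" by (rule facet_of_imp_subset[OF K(2)])
  fix f assume f: "f \<in> S"
  show "continuous_on e (trace_from K (\<Lambda> f))"
    using cext_trace(1)[OF cell_opD(1)[OF L f]] eK continuous_on_subset by blast
  fix x assume x: "x \<in> e"
  then have xK: "x \<in> K" using eK by blast
  show "trace_from K (\<Lambda> (c *\<^sub>R f)) x = c *\<^sub>R trace_from K (\<Lambda> f) x" for c
    by (rule trace_from_scaleR[OF cell_opD(1)[OF L f] xK cell_opD(3)[OF L f]])
next
  interpret convex_body K by (rule cell_body[OF K(1)])
  fix f g x assume f: "f \<in> S" and g: "g \<in> S" and x: "x \<in> e"
  then have xK: "x \<in> K" using facet_of_imp_subset[OF K(2)] by blast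
  show "trace_from K (\<Lambda> (f + g)) x = trace_from K (\<Lambda> f) x + trace_from K (\<Lambda> g) x"
    by (rule trace_from_add[OF cell_opD(1)[OF L f] cell_opD(1)[OF L g] xK cell_opD(2)[OF L f g]])
qed

lemma face_op_avg_jump:
  assumes e: "e \<in> int_faces X" and L: "\<And>K. K \<in> cells X \<Longrightarrow> cell_op S K \<Lambda>" and S: "subspace S"
  shows "face_op S e (\<lambda>f. avg X e (\<Lambda> f))" "face_op S e (\<lambda>f. jump X e (\<Lambda> f))"
proof -
  note t1 = face_op_trace[OF elem_from_cell[OF e] elem_from_facet[OF e] L[OF elem_from_cell[OF e]] S]
  note t2 = face_op_trace[OF elem_to_cell[OF e] elem_to_facet[OF e] L[OF elem_to_cell[OF e]] S]
  show "face_op S e (\<lambda>f. avg X e (\<Lambda> f))" "face_op S e (\<lambda>f. jump X e (\<Lambda> f))"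
    using t1 t2 unfolding face_op_def avg_def[abs_def] jump_def[abs_def]
    by (auto intro!: continuous_intros simp: algebra_simps)
qed

lemma prism_body: "e \<in> int_faces X \<Longrightarrow> convex_body (prism e (nu X e))"
  using prism_convex prism_compact prism_interior by unfold_locales auto

lemma closest_point_continuous: "e \<in> int_faces X \<Longrightarrow> continuous_on U (closest_point e)"
  using continuous_on_closest_point face_convex_compact face_normal(4) by blast

lemma closest_point_in_face: "e \<in> int_faces X \<Longrightarrow> y \<in> prism e (nu X e) \<Longrightarrow> closest_point e y \<in> e"
  using prism_base by blast

lemma cell_op_prism:
  assumes e: "e \<in> int_faces X" and "face_op S e \<Theta>"
  shows "cell_op S (prism e (nu X e)) (\<lambda>f y. \<Theta> f (closest_point e y))"
  unfolding cell_op_def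
proof (intro conjI ballI allI)
  show "cext (prism e (nu X e)) (\<lambda>y. \<Theta> f (closest_point e y))" if "f \<in> S" for f
  proof (rule cextI)
    have "continuous_on e (\<Theta> f)" using assms(2) that by (simp add: face_op_def)
    then show "continuous_on (prism e (nu X e)) (\<lambda>y. \<Theta> f (closest_point e y))"
      by (rule continuous_on_compose2[OF _ closest_point_continuous[OF e]]) (simp add: prism_base[OF e])
  qed simp
qed (use assms(2) closest_point_in_face[OF e] interior_subset[of "prism e (nu X e)"] in \<open>auto simp: face_op_def\<close>)

lemma bil_on_face_ip:
  fixes \<Theta> :: "'v::real_vector \<Rightarrow> real^'d \<Rightarrow> 'b::euclidean_space" and \<Theta>' :: "'w::real_vector \<Rightarrow> real^'d \<Rightarrow> 'b"
  assumes e: "e \<in> int_faces X" and "face_op S e \<Theta>" "face_op T e \<Theta>'" "subspace S" "subspace T"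
  shows "bil_on S T (\<lambda>f g. face_ip X e (\<Theta> f) (\<Theta>' g))"
  unfolding face_ip_def
  by (rule convex_body.bil_on_cell_ip[OF prism_body[OF e] cell_op_prism[OF e assms(2)] cell_op_prism[OF e assms(3)] assms(4,5)])

lemma psd_form_face_ip:
  fixes \<Theta> :: "'v::real_vector \<Rightarrow> real^'d \<Rightarrow> 'b::euclidean_space"
  assumes e: "e \<in> int_faces X" and "face_op S e \<Theta>" "subspace S"
  shows "psd_form S (\<lambda>f g. face_ip X e (\<Theta> f) (\<Theta> g))"
  unfolding face_ip_def
  by (rule convex_body.psd_form_cell_ip[OF prism_body[OF e] cell_op_prism[OF e assms(2)] assms(3)])

lemma face_ip_zero:
  assumes e: "e \<in> int_faces X" and "(\<forall>x\<in>e. f x = 0) \<or> (\<forall>x\<in>e. g x = 0)"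
  shows "face_ip X e f g = 0"
proof -
  have "f (closest_point e y) \<bullet> g (closest_point e y) = 0" if "y \<in> interior (prism e (nu X e))" for y
    using assms(2) closest_point_in_face[OF e, of y] that interior_subset by fastforce
  then show ?thesis
    unfolding face_ip_def by (intro convex_body.ip_zero_interior[OF prism_body[OF e]])
qed

text \<open>The integrand vanishes in the interior of the prism and, by continuity, on the whole
  prism, which contains the face as its base.\<close>

lemma face_ip_null:
  fixes f :: "real^'d \<Rightarrow> 'b::euclidean_space"
  assumes e: "e \<in> int_faces X" and cont: "continuous_on e f" and "face_ip X e f f = 0" "x \<in> e"
  shows "f x = 0"
proof -
  let ?P = "prism e (nu X e)"
  interpret convex_body ?P by (rule prism_body[OF e])
  have c: "continuous_on ?P (\<lambda>y. f (closest_point e y))"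
    by (rule continuous_on_compose2[OF cont closest_point_continuous[OF e]]) (simp add: prism_base[OF e])
  have ce: "cext ?P (\<lambda>y. f (closest_point e y))" by (rule cextI[OF c]) simp
  have z: "f (closest_point e y) = 0" if "y \<in> interior ?P" for y
    by (rule ip_null_interior[OF ce _ that]) (use assms(3) in \<open>simp add: face_ip_def\<close>)
  have "f (closest_point e x) = 0"
    by (rule continuous_zero_closure[OF c interior_subset _ z])
      (use closure_int face_subset_prism[OF e] assms(4) in auto)
  then show ?thesis using closest_point_self[OF assms(4)] by simp
qed

definition E_form :: "(real^'d \<Rightarrow> real^'d) \<Rightarrow> (real^'d \<Rightarrow> real^'d) \<Rightarrow> real" where
  "E_form y z = (\<Sum>K\<in>cells X. ip K (eps y) (eps z))"

text \<open>Carries no penalty weights, so constants relative to it do not depend on the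
  penalty.\<close>

definition jump_form :: "(real^'d \<Rightarrow> real^'d) \<Rightarrow> (real^'d \<Rightarrow> real^'d) \<Rightarrow> real" where
  "jump_form y z = (\<Sum>e\<in>int_faces X. face_ip X e (jump X e y) (jump X e z))"

definition flux_form :: "'d biot \<Rightarrow> (real^'d \<Rightarrow> real^'d) \<Rightarrow> (real^'d \<Rightarrow> real^'d) \<Rightarrow> real" where
  "flux_form D y z = (\<Sum>e\<in>int_faces X. face_ip X e (avg X e (\<lambda>x. sigma D y x *v nu X e)) (jump X e z))"

definition elastic_form :: "'d biot \<Rightarrow> (real^'d \<Rightarrow> real^'d) \<Rightarrow> (real^'d \<Rightarrow> real^'d) \<Rightarrow> real" where
  "elastic_form D y z = (\<Sum>K\<in>cells X. ip K (sigma D y) (eps z))"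

lemma J_d_flux: "J_d X D y z = flux_form D y z + flux_form D z y"
  by (simp add: J_d_def flux_form_def sum.distrib)

lemma psd_E_form: "psd_form (H_h X l) E_form"
  unfolding E_form_def[abs_def]
  by (intro psd_form_Sum convex_body.psd_form_cell_ip cell_body cell_op_eps subspace_H_h)

lemma face_op_jump_H_h: "e \<in> int_faces X \<Longrightarrow> face_op (H_h X l) e (jump X e)"
  using face_op_avg_jump(2)[OF _ cell_op_H_h subspace_H_h] by simp

lemma face_op_flux: "e \<in> int_faces X \<Longrightarrow> face_op (H_h X l) e (\<lambda>z. avg X e (\<lambda>x. sigma D z x *v n))"
  by (rule face_op_avg_jump(1)[OF _ cell_op_sigma_normal subspace_H_h])

lemma psd_jump_form: "psd_form (H_h X l) jump_form"
  unfolding jump_form_def[abs_def]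
  by (intro psd_form_Sum psd_form_face_ip face_op_jump_H_h subspace_H_h)

lemma bil_on_J_delta: "bil_on (H_h X l) (H_h X l) (J_delta X \<delta> \<beta>)"
  unfolding J_delta_def[abs_def]
  by (intro bil_on_Sum bil_on_cmult bil_on_face_ip face_op_jump_H_h subspace_H_h)

lemma bil_on_flux_form: "bil_on (H_h X l) (H_h X l) (flux_form D)"
  unfolding flux_form_def[abs_def]
  by (intro bil_on_Sum bil_on_face_ip face_op_jump_H_h face_op_flux subspace_H_h)

lemma bil_on_elastic_form: "bil_on (H_h X l) (H_h X l) (elastic_form D)"
  unfolding elastic_form_def[abs_def]
  by (intro bil_on_Sum convex_body.bil_on_cell_ip cell_body cell_op_eps cell_op_sigma subspace_H_h)

lemma bil_on_div_form: "bil_on (H_h X l) (W_h X s) (div_form X)"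
  unfolding div_form_def[abs_def]
  by (intro bil_on_Sum convex_body.bil_on_cell_ip cell_body cell_op_dvg cell_op_W_h subspace_H_h subspace_W_h)

lemma bil_on_J_p: "bil_on (W_h X s) (H_h X l) (J_p X)"
  unfolding J_p_def[abs_def]
proof (intro bil_on_Sum bil_on_face_ip face_op_jump_H_h subspace_H_h subspace_W_h)
  fix e assume e: "e \<in> int_faces X"
  show "face_op (W_h X s) e (\<lambda>w x. avg X e w x *\<^sub>R nu X e)"
    using face_op_avg_jump(1)[OF e cell_op_W_h subspace_W_h, of s]
    unfolding face_op_def by (auto intro!: continuous_intros simp: algebra_simps)
qed

lemma elastic_form_eq:
  assumes "y \<in> H_h X l" "z \<in> H_h X l"
  shows "elastic_form D y z = 2 * mu D * E_form y z + lam D * (\<Sum>K\<in>cells X. ip K (dvg y) (dvg z))"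
proof -
  have "ip K (sigma D y) (eps z) = 2 * mu D * ip K (eps y) (eps z) + lam D * ip K (dvg y) (dvg z)"
    if K: "K \<in> cells X" for K
  proof -
    interpret convex_body K by (rule cell_body[OF K])
    have "integrable (lebesgue_on K) (\<lambda>x. eps y x \<bullet> eps z x)" "integrable (lebesgue_on K) (\<lambda>x. dvg y x \<bullet> dvg z x)"
      using cell_opD(1)[OF cell_op_eps[OF K] assms(1)] cell_opD(1)[OF cell_op_eps[OF K] assms(2)]
        cell_opD(1)[OF cell_op_dvg[OF K] assms(1)] cell_opD(1)[OF cell_op_dvg[OF K] assms(2)]
      by (blast intro: cext_integrable cext_inner)+
    then show ?thesis by (simp add: ip_def sigma_inner_eps)
  qed
  then show ?thesis
    by (simp add: elastic_form_def E_form_def sum.distrib sum_distrib_left)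
qed

lemma elastic_form_sym: "y \<in> H_h X l \<Longrightarrow> z \<in> H_h X l \<Longrightarrow> elastic_form D y z = elastic_form D z y"
  using elastic_form_eq[of y l z D] elastic_form_eq[of z l y D]
  by (simp add: E_form_def ip_def inner_commute mult.commute)

section \<open>Null vectors of the forms\<close>

lemma sum_zero_terms:
  assumes "finite I" "(\<Sum>i\<in>I. f i) = (0::real)" "\<And>i. i \<in> I \<Longrightarrow> f i \<ge> 0" "i \<in> I"
  shows "f i = 0"
  using sum_nonneg_eq_0_iff[of I f] assms by auto

lemma finite_int_faces: "finite (int_faces X)"
proof -
  have "int_faces X \<subseteq> (\<lambda>(K, K'). K \<inter> K') ` (cells X \<times> cells X)" by (auto simp: int_faces_def)
  then show ?thesis using finite_cells finite_subset by blast
qed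

lemma E_form_null:
  assumes "z \<in> H_h X l" "E_form z z = 0" "K \<in> cells X" "x \<in> interior K"
  shows "eps z x = 0"
proof -
  interpret convex_body K by (rule cell_body[OF assms(3)])
  have "ip K (eps z) (eps z) \<ge> 0" for K by (auto simp: ip_def intro!: integral_nonneg_AE)
  then have "ip K (eps z) (eps z) = 0"
    using sum_zero_terms[OF finite_cells] assms(2,3) unfolding E_form_def by blast
  then show ?thesis
    using ip_null_interior[OF cell_opD(1)[OF cell_op_eps[OF assms(3)] assms(1)]] assms(4) by blast
qed

lemma jump_form_null:
  assumes "z \<in> H_h X l" "jump_form z z = 0" "e \<in> int_faces X" "x \<in> e"
  shows "jump X e z x = 0"
proof -
  have "face_ip X e (jump X e z) (jump X e z) \<ge> 0" for e
    by (auto simp: face_ip_def ip_def intro!: integral_nonneg_AE)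
  then have "face_ip X e (jump X e z) (jump X e z) = 0"
    using sum_zero_terms[OF finite_int_faces] assms(2,3) unfolding jump_form_def by blast
  moreover have "continuous_on e (jump X e z)"
    using face_op_jump_H_h[OF assms(3)] assms(1) by (simp add: face_op_def)
  ultimately show ?thesis using face_ip_null[OF assms(3)] assms(4) by blast
qed

text \<open>The kernel condition that lets strain and jumps dominate the consistency term: zero
  strain forces zero stress and hence zero normal traces.\<close>

lemma flux_form_null:
  assumes "y \<in> H_h X l" "z \<in> H_h X l" "E_form y y = 0 \<or> jump_form z z = 0"
  shows "flux_form D y z = 0"
  unfolding flux_form_def
proof (intro sum.neutral ballI face_ip_zero)
  fix e assume e: "e \<in> int_faces X"
  have tr: "trace_from K (\<lambda>x. sigma D y x *v nu X e) x = 0"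
    if E: "E_form y y = 0" and K: "K \<in> cells X" and x: "x \<in> K" for K x
  proof -
    have "sigma D y x *v nu X e = 0" if "x \<in> interior K" for x
      using sigma_eq_0[OF E_form_null[OF assms(1) E K that], of D] by simp
    then show ?thesis by (rule convex_body.trace_from_zero[OF cell_body[OF K] _ x])
  qed
  from assms(3) show "(\<forall>x\<in>e. avg X e (\<lambda>x. sigma D y x *v nu X e) x = 0) \<or> (\<forall>x\<in>e. jump X e z x = 0)"
  proof
    assume E: "E_form y y = 0"
    have "avg X e (\<lambda>x. sigma D y x *v nu X e) x = 0" if "x \<in> e" for x
      using tr[OF E elem_from_cell[OF e] subsetD[OF facet_of_imp_subset[OF elem_from_facet[OF e]] that]]
        tr[OF E elem_to_cell[OF e] subsetD[OF facet_of_imp_subset[OF elem_to_facet[OF e]] that]]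
      by (simp add: avg_def)
    then show ?thesis by blast
  next
    assume "jump_form z z = 0"
    then show ?thesis using jump_form_null[OF assms(2) _ e] by blast
  qed
qed

lemma W_h_null:
  assumes "w \<in> W_h X s" "ip (region X) w w = 0" "K \<in> cells X" "x \<in> interior K"
  shows "w x = 0"
  by (rule ip_region_null_interior[OF W_h_L2[OF assms(1)] assms(2,3) W_h_cext[OF assms(1,3)] assms(4)])

lemma J_p_null:
  assumes "w \<in> W_h X s" "z \<in> H_h X l" "ip (region X) w w = 0 \<or> jump_form z z = 0"
  shows "J_p X w z = 0"
  unfolding J_p_def
proof (intro sum.neutral ballI face_ip_zero)
  fix e assume e: "e \<in> int_faces X"
  have tr: "trace_from K w x = 0" if "ip (region X) w w = 0" "K \<in> cells X" "x \<in> K" for K x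
  proof -
    interpret convex_body K by (rule cell_body[OF that(2)])
    show ?thesis by (rule trace_from_zero[OF W_h_null[OF assms(1) that(1,2)] that(3)])
  qed
  from assms(3) show "(\<forall>x\<in>e. avg X e w x *\<^sub>R nu X e = 0) \<or> (\<forall>x\<in>e. jump X e z x = 0)"
  proof
    assume E: "ip (region X) w w = 0"
    have "avg X e w x *\<^sub>R nu X e = 0" if "x \<in> e" for x
      using tr[OF E elem_from_cell[OF e] subsetD[OF facet_of_imp_subset[OF elem_from_facet[OF e]] that]]
        tr[OF E elem_to_cell[OF e] subsetD[OF facet_of_imp_subset[OF elem_to_facet[OF e]] that]]
      by (simp add: avg_def)
    then show ?thesis by blast
  next
    assume "jump_form z z = 0"
    then show ?thesis using jump_form_null[OF assms(2) _ e] by blast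
  qed
qed

lemma div_form_null:
  assumes "z \<in> H_h X l" "w \<in> W_h X s" "E_form z z = 0 \<or> ip (region X) w w = 0"
  shows "div_form X z w = 0"
  unfolding div_form_def
proof (intro sum.neutral ballI)
  fix K assume K: "K \<in> cells X"
  show "ip K (dvg z) w = 0"
    by (rule convex_body.ip_zero_interior[OF cell_body[OF K]])
      (use assms(3) E_form_null[OF assms(1) _ K] W_h_null[OF assms(2) _ K] sigma_eq_0 in force)
qed

lemma dvg_zero_of_zero:
  assumes "K \<in> cells X" "z \<in> H_h X l" "\<And>x. x \<in> interior K \<Longrightarrow> z x = 0" "x \<in> interior K"
  shows "eps z x = 0"
proof -
  have "((\<lambda>x. 0) has_derivative (\<lambda>h. (0 :: real^'d^'d) *v h)) (at x)" by simp
  then have "(z has_derivative (\<lambda>h. (0 :: real^'d^'d) *v h)) (at x)"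
    by (rule has_derivative_transform_within_open[OF _ open_interior assms(4)]) (simp add: assms(3))
  then have "Jac z x = matrix (\<lambda>h. (0 :: real^'d^'d) *v h)"
    unfolding Jac_def using frechet_derivative_at by metis
  then have "Jac z x = 0" by (simp add: matrix_def vec_eq_iff)
  then show ?thesis by (simp add: eps_def transpose_def vec_eq_iff)
qed

lemma H_h_null:
  assumes "z \<in> H_h X l" "ip (region X) z z = 0" "K \<in> cells X" "x \<in> interior K"
  shows "z x = 0"
  by (rule ip_region_null_interior[OF H_h_L2[OF assms(1)] assms(2,3) H_h_regular(1)[OF assms(1,3)] assms(4)])

text \<open>The start value of a time interval is known only as an L2 limit. A discrete field that
  is 0 almost everywhere is 0 inside every cell, derivatives included, so the elementwise divergence
  does not depend on the representative.\<close>

lemma div_form_null_L2: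
  assumes "z \<in> H_h X l" "ip (region X) z z = 0"
  shows "div_form X z w = 0"
  unfolding div_form_def
proof (intro sum.neutral ballI)
  fix K assume K: "K \<in> cells X"
  have "dvg z x = 0" if "x \<in> interior K" for x
    using sigma_eq_0 dvg_zero_of_zero[OF K assms(1) H_h_null[OF assms K] that] by blast
  then show "ip K (dvg z) w = 0"
    by (intro convex_body.ip_zero_interior[OF cell_body[OF K]]) simp
qed

text \<open>On a boundary facet the trace is 0, which kills the rigid field in that cell; a
  vanishing jump passes the zero on to the facet of the neighbour, and so on through the
  mesh.\<close>

lemma broken_Korn:
  assumes z: "z \<in> H_h X l" and E: "E_form z z = 0" and j: "jump_form z z = 0"
    and K: "K \<in> cells X" and x: "x \<in> interior K"
  shows "z x = 0"
proof -
  \<comment> \<open>The rigidity identity is extended to the boundary in one variable at a time, by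
    continuity of the trace.\<close>
  have rigid: "(trace_from K z x - trace_from K z y) \<bullet> (x - y) = 0"
    if K: "K \<in> cells X" and xy: "x \<in> K" "y \<in> K" for K x y
  proof -
    interpret convex_body K by (rule cell_body[OF K])
    note ct = cext_trace[OF H_h_regular(1)[OF z K]]
    have int: "(z x - z y) \<bullet> (x - y) = 0" if "x \<in> interior K" "y \<in> interior K" for x y
      by (rule eps_zero_inner[OF convex_interior[OF convex] H_h_regular(3)[OF z K] E_form_null[OF z E K] that])
    have half: "(trace_from K z x - trace_from K z y) \<bullet> (x - y) = 0" if y: "y \<in> interior K" and xK: "x \<in> K" for x y
    proof (rule continuous_zero_closure[of K "\<lambda>x. (trace_from K z x - trace_from K z y) \<bullet> (x - y)" "interior K"])
      show "continuous_on K (\<lambda>x. (trace_from K z x - trace_from K z y) \<bullet> (x - y))"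
        by (intro continuous_intros ct)
      show "(trace_from K z x - trace_from K z y) \<bullet> (x - y) = 0" if "x \<in> interior K" for x
        using int[OF that y] ct(2)[OF that] ct(2)[OF y] by simp
    qed (use xK closure_int interior_subset in auto)
    show ?thesis
    proof (rule continuous_zero_closure[of K "\<lambda>y. (trace_from K z x - trace_from K z y) \<bullet> (x - y)" "interior K"])
      show "continuous_on K (\<lambda>y. (trace_from K z x - trace_from K z y) \<bullet> (x - y))"
        by (intro continuous_intros ct)
      show "(trace_from K z x - trace_from K z y) \<bullet> (x - y) = 0" if "y \<in> interior K" for y
        by (rule half[OF that xy(1)])
    qed (use xy(2) closure_int interior_subset in auto)
  qed
  have from_facet: "\<forall>x\<in>interior K. z x = 0"
    if K: "K \<in> cells X" and F: "F facet_of K" "\<And>y. y \<in> F \<Longrightarrow> trace_from K z y = 0" for K F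
  proof
    fix x assume x: "x \<in> interior K"
    interpret convex_body K by (rule cell_body[OF K])
    have "trace_from K z x = 0"
      by (rule rigid_zero_on_facet[OF convex nonempty_interior F(1) rigid[OF K] F(2) x])
    then show "z x = 0" using cext_trace(2)[OF H_h_regular(1)[OF z K] x] by simp
  qed
  have tr0: "trace_from K z y = 0" if "K \<in> cells X" "\<forall>x\<in>interior K. z x = 0" "y \<in> K" for K y
    using convex_body.trace_from_zero[OF cell_body[OF that(1)]] that(2,3) by blast
  have "\<forall>x\<in>interior K. z x = 0"
  proof (rule cells_induct_from_boundary[OF _ _ K, where P = "\<lambda>K. \<forall>x\<in>interior K. z x = 0"])
    show "\<forall>x\<in>interior K. z x = 0" if "K \<in> cells X" "F facet_of K" "F \<subseteq> frontier (region X)" for K F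
      by (rule from_facet[OF that(1,2) H_h_boundary[OF z that]])
    fix e assume e: "e \<in> int_faces X"
    have eq: "trace_from (elem_from X e) z y = trace_from (elem_to X e) z y" if "y \<in> e" for y
      using jump_form_null[OF z j e that] by (simp add: jump_def)
    have sub: "e \<subseteq> elem_from X e" "e \<subseteq> elem_to X e"
      using facet_of_imp_subset elem_from_facet[OF e] elem_to_facet[OF e] by auto
    show "(\<forall>x\<in>interior (elem_from X e). z x = 0) \<longleftrightarrow> (\<forall>x\<in>interior (elem_to X e). z x = 0)"
    proof
      assume *: "\<forall>x\<in>interior (elem_from X e). z x = 0"
      show "\<forall>x\<in>interior (elem_to X e). z x = 0"
      proof (rule from_facet[OF elem_to_cell[OF e] elem_to_facet[OF e]])
        show "trace_from (elem_to X e) z y = 0" if "y \<in> e" for y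
          using eq[OF that] tr0[OF elem_from_cell[OF e] *] that sub by auto
      qed
    next
      assume *: "\<forall>x\<in>interior (elem_to X e). z x = 0"
      show "\<forall>x\<in>interior (elem_from X e). z x = 0"
      proof (rule from_facet[OF elem_from_cell[OF e] elem_from_facet[OF e]])
        show "trace_from (elem_from X e) z y = 0" if "y \<in> e" for y
          using eq[OF that] tr0[OF elem_to_cell[OF e] *] that sub by auto
      qed
    qed
  qed
  then show ?thesis using x by blast
qed

end

section \<open>Time discretization\<close>

definition lagrange_poly :: "nat \<Rightarrow> (nat \<Rightarrow> real) \<Rightarrow> nat \<Rightarrow> real poly" where
  "lagrange_poly r x j = (\<Prod>m\<in>{..r} - {j}. smult (1 / (x j - x m)) [:- x m, 1:])"

section \<open>Lagrange basis and integrals of polynomials\<close>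

lemma phi_eq_poly: "phi G r n j = poly (lagrange_poly r (gnode G n) j)"
proof
  fix t
  show "phi G r n j t = poly (lagrange_poly r (gnode G n) j) t"
    unfolding phi_def lagrange_poly_def poly_prod
    by (rule prod.cong) (simp_all add: diff_divide_distrib)
qed

lemma lagrange_poly_node:
  assumes "inj_on x {..r}" "i \<le> r" "j \<le> r"
  shows "poly (lagrange_poly r x j) (x i) = (if i = j then 1 else 0)"
proof (cases "i = j")
  case True
  have "x j \<noteq> x m" if "m \<in> {..r} - {j}" for m using assms that by (auto simp: inj_on_def)
  then have "poly (smult (1 / (x j - x m)) [:- x m, 1:]) (x j) = 1" if "m \<in> {..r} - {j}" for m
    using that by (auto simp: diff_divide_distrib[symmetric])
  then show ?thesis using True unfolding lagrange_poly_def poly_prod by simp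
next
  case False
  then show ?thesis using assms by (force simp: lagrange_poly_def poly_prod intro!: prod_zero)
qed

lemma degree_lagrange_poly: "j \<le> r \<Longrightarrow> degree (lagrange_poly r x j) \<le> r"
proof -
  assume j: "j \<le> r"
  have "degree (lagrange_poly r x j) \<le> (\<Sum>m\<in>{..r} - {j}. degree (smult (1 / (x j - x m)) [:- x m, 1:]))"
    unfolding lagrange_poly_def by (rule degree_prod_sum_le[unfolded o_def]) simp
  also have "\<dots> \<le> (\<Sum>m\<in>{..r} - {j}. 1)" by (intro sum_mono order_trans[OF degree_smult_le]) simp
  finally show ?thesis using j by simp
qed

lemma lagrange_interpolation:
  assumes "inj_on x {..r}" "degree q \<le> r"
  shows "q = (\<Sum>i\<le>r. smult (poly q (x i)) (lagrange_poly r x i))"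
proof (rule poly_eqI_degree[of "x ` {..r}"])
  have c: "card (x ` {..r}) = Suc r" using assms(1) by (simp add: card_image)
  show "degree q < card (x ` {..r})" using assms(2) c by simp
  have "degree (\<Sum>i\<le>r. smult (poly q (x i)) (lagrange_poly r x i)) \<le> r"
    by (intro degree_sum_le) (auto intro!: order_trans[OF degree_smult_le] degree_lagrange_poly)
  then show "degree (\<Sum>i\<le>r. smult (poly q (x i)) (lagrange_poly r x i)) < card (x ` {..r})" using c by simp
  fix y assume "y \<in> x ` {..r}"
  then obtain k where k: "k \<le> r" "y = x k" by auto
  have "poly (\<Sum>i\<le>r. smult (poly q (x i)) (lagrange_poly r x i)) y
      = (\<Sum>i\<le>r. if i = k then poly q (x i) else 0)"
    unfolding poly_sum k by (intro sum.cong) (auto simp: lagrange_poly_node[OF assms(1) k(1)])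
  then show "poly q y = poly (\<Sum>i\<le>r. smult (poly q (x i)) (lagrange_poly r x i)) y"
    using k by simp
qed

lemma poly_integrable: "integrable (lebesgue_on {a<..b}) (poly (p :: real poly))"
proof -
  have "poly p absolutely_integrable_on {a..b}"
    by (intro absolutely_integrable_continuous_real continuous_intros)
  then have "poly p absolutely_integrable_on {a<..b}"
    by (rule set_integrable_subset) auto
  then show ?thesis by (simp add: integrable_restrict_space set_integrable_def)
qed

lemma LINT_pderiv:
  assumes "a \<le> b"
  shows "(LINT t|lebesgue_on {a<..b}. poly (pderiv p) t) = poly p b - poly (p :: real poly) a"
proof -
  have "(LINT t|lebesgue_on {a<..b}. poly (pderiv p) t) = integral {a<..b} (poly (pderiv p))"
    by (rule lebesgue_integral_eq_integral[OF poly_integrable]) simp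
  also have "\<dots> = integral {a..b} (poly (pderiv p))"
    by (rule integral_spike_set) (auto intro: negligible_subset[of "{a}"])
  also have "\<dots> = poly p b - poly p a"
  proof (rule integral_unique, rule fundamental_theorem_of_calculus[OF assms])
    fix t
    show "(poly p has_vector_derivative poly (pderiv p) t) (at t within {a..b})"
      unfolding has_real_derivative_iff_has_vector_derivative[symmetric]
      using poly_DERIV by (rule has_field_derivative_at_within)
  qed
  finally show ?thesis .
qed

text \<open>A nonzero polynomial has finitely many roots, so it cannot vanish almost everywhere on
  an interval.\<close>

lemma LINT_poly_square_zero:
  assumes "a < b" "(LINT t|lebesgue_on {a<..b}. (poly (p :: real poly) t)\<^sup>2) = 0"
  shows "p = 0"
proof -
  have eq: "(\<lambda>t. (poly p t)\<^sup>2) = poly (p\<^sup>2)" by (simp add: fun_eq_iff)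
  have "AE t in lebesgue_on {a<..b}. (poly p t)\<^sup>2 = 0"
    using integral_nonneg_eq_0_iff_AE[of "lebesgue_on {a<..b}" "\<lambda>t. (poly p t)\<^sup>2"] assms(2) poly_integrable[of a b "p\<^sup>2"]
    by (simp add: eq[symmetric])
  then have "AE t in lebesgue. t \<in> {a<..b} \<longrightarrow> poly p t = 0"
    by (simp add: AE_restrict_space_iff)
  then have "AE t in lebesgue. t \<notin> {a<..b} - {t. poly p t = 0}"
    by eventually_elim auto
  moreover have "{a<..b} - {t. poly p t = 0} \<in> sets lebesgue"
  proof -
    have "closed {t. poly p t = 0}" by (intro closed_Collect_eq continuous_intros)
    then show ?thesis by auto
  qed
  ultimately have null: "negligible ({a<..b} - {t. poly p t = 0})"
    by (simp add: negligible_iff_null_sets AE_iff_null_sets)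
  show ?thesis
  proof (rule ccontr)
    assume "p \<noteq> 0"
    then have "finite {t. poly p t = 0}" by (rule poly_roots_finite)
    then have "negligible (({a<..b} - {t. poly p t = 0}) \<union> {t. poly p t = 0})"
      using null negligible_finite negligible_Un by blast
    then have "negligible {a<..<b}" by (rule negligible_subset) auto
    then show False using assms(1) open_not_negligible[of "{a<..<b}"] by simp
  qed
qed

lemma pderiv_sum: "pderiv (\<Sum>i\<in>I. f i) = (\<Sum>i\<in>I. pderiv (f i))"
  by (induction I rule: infinite_finite_induct) (auto simp: pderiv_add)

lemma psd_form_square: "lin_on S l \<Longrightarrow> psd_form S (\<lambda>f g. l f * l g)"
  by (auto simp: psd_form_def bil_on_def lin_on_def algebra_simps)

locale time_interval =
  fixes G :: tgrid and r n :: nat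
  assumes step: "tn G (n - 1) < tn G n" and inj: "inj_on (gnode G n) {..r}"
begin

abbreviation "a0 \<equiv> tn G (n - 1)"
abbreviation "b0 \<equiv> tn G n"
abbreviation "Lg \<equiv> lagrange_poly r (gnode G n)"

section \<open>The matrix of the discrete time derivative\<close>

lemma alpha_eq: "alpha G r n i j = (LINT t|lebesgue_on {a0<..b0}. poly (pderiv (Lg j) * Lg i) t) + poly (Lg i) a0 * poly (Lg j) a0"
proof -
  have "deriv (poly (Lg j)) = poly (pderiv (Lg j))" by (intro ext DERIV_imp_deriv poly_DERIV)
  then show ?thesis by (simp add: alpha_def gam_def phi_eq_poly I_n_def)
qed

text \<open>Integration by parts: the two integrals add up to the difference of the end point
  products, and the doubled jump term turns the minus sign at the left end into a plus.\<close>

lemma alpha_symmetrized: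
  "alpha G r n i j + alpha G r n j i = phi G r n i b0 * phi G r n j b0 + gam G r n i * gam G r n j"
proof -
  have "(LINT t|lebesgue_on {a0<..b0}. poly (pderiv (Lg j) * Lg i) t) + (LINT t|lebesgue_on {a0<..b0}. poly (pderiv (Lg i) * Lg j) t)
      = (LINT t|lebesgue_on {a0<..b0}. poly (pderiv (Lg j) * Lg i) t + poly (pderiv (Lg i) * Lg j) t)"
    by (rule Bochner_Integration.integral_add[symmetric, OF poly_integrable poly_integrable])
  also have "\<dots> = (LINT t|lebesgue_on {a0<..b0}. poly (pderiv (Lg i * Lg j)) t)"
    by (intro Bochner_Integration.integral_cong) (auto simp: pderiv_mult algebra_simps)
  also have "\<dots> = poly (Lg i * Lg j) b0 - poly (Lg i * Lg j) a0"
    using step by (intro LINT_pderiv) simp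
  finally show ?thesis by (simp add: alpha_eq gam_def phi_eq_poly algebra_simps)
qed

text \<open>Weighting the rows with the nodal values of q recombines the Lagrange test polynomials
  to q itself. What appears is the time derivative of the discontinuous scheme with incoming value
  0: an integral plus a jump at the left end.\<close>

lemma alpha_test:
  assumes "degree q \<le> r"
  shows "(\<Sum>i\<le>r. poly q (gnode G n i) * (\<Sum>j\<le>r. alpha G r n i j * c j)) =
    (LINT t|lebesgue_on {a0<..b0}. poly (pderiv (\<Sum>j\<le>r. smult (c j) (Lg j)) * q) t)
      + poly (\<Sum>j\<le>r. smult (c j) (Lg j)) a0 * poly q a0"
proof -
  define P where "P = (\<Sum>j\<le>r. smult (c j) (Lg j))"
  have 1: "(\<Sum>j\<le>r. alpha G r n i j * c j) =
      (LINT t|lebesgue_on {a0<..b0}. poly (pderiv P * Lg i) t) + poly P a0 * poly (Lg i) a0" for i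
  proof -
    have "(LINT t|lebesgue_on {a0<..b0}. poly (pderiv P * Lg i) t)
        = (LINT t|lebesgue_on {a0<..b0}. (\<Sum>j\<le>r. c j * poly (pderiv (Lg j) * Lg i) t))"
      by (intro Bochner_Integration.integral_cong)
        (simp_all add: P_def pderiv_sum pderiv_smult poly_sum sum_distrib_right mult.assoc)
    also have "\<dots> = (\<Sum>j\<le>r. c j * (LINT t|lebesgue_on {a0<..b0}. poly (pderiv (Lg j) * Lg i) t))"
      by (subst Bochner_Integration.integral_sum) (intro integrable_mult_right poly_integrable, simp del: poly_mult)
    finally show ?thesis
      unfolding alpha_eq
      by (simp add: P_def poly_sum sum_distrib_left sum_distrib_right distrib_left sum.distrib mult_ac del: poly_mult)
  qed
  let ?q = "\<Sum>i\<le>r. smult (poly q (gnode G n i)) (Lg i)"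
  have "(LINT t|lebesgue_on {a0<..b0}. poly (pderiv P * ?q) t)
      = (LINT t|lebesgue_on {a0<..b0}. (\<Sum>i\<le>r. poly q (gnode G n i) * poly (pderiv P * Lg i) t))"
    by (intro Bochner_Integration.integral_cong) (simp_all add: poly_sum sum_distrib_left mult_ac)
  also have "\<dots> = (\<Sum>i\<le>r. poly q (gnode G n i) * (LINT t|lebesgue_on {a0<..b0}. poly (pderiv P * Lg i) t))"
    by (subst Bochner_Integration.integral_sum) (intro integrable_mult_right poly_integrable, simp del: poly_mult)
  finally have 2: "(LINT t|lebesgue_on {a0<..b0}. poly (pderiv P * ?q) t)
      = (\<Sum>i\<le>r. poly q (gnode G n i) * (LINT t|lebesgue_on {a0<..b0}. poly (pderiv P * Lg i) t))" .
  have 3: "poly P a0 * poly ?q a0 = (\<Sum>i\<le>r. poly q (gnode G n i) * (poly P a0 * poly (Lg i) a0))"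
    by (simp add: poly_sum sum_distrib_left mult_ac)
  have "(\<Sum>i\<le>r. poly q (gnode G n i) * (\<Sum>j\<le>r. alpha G r n i j * c j)) =
    (LINT t|lebesgue_on {a0<..b0}. poly (pderiv P * ?q) t) + poly P a0 * poly ?q a0"
    unfolding 1 2 3 by (simp add: distrib_left sum.distrib del: poly_mult)
  then show ?thesis
    unfolding lagrange_interpolation[OF inj assms, symmetric] P_def .
qed

text \<open>Testing p with itself leaves the squares of both end point values, which must vanish;
  testing with its derivative then gives \<open>pderiv p = 0\<close>.\<close>

lemma alpha_injective:
  assumes "\<And>i. i \<le> r \<Longrightarrow> (\<Sum>j\<le>r. alpha G r n i j * c j) = 0" "j \<le> r"
  shows "c j = 0"
proof -
  define p where "p = (\<Sum>j\<le>r. smult (c j) (Lg j))"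
  have deg: "degree p \<le> r"
    unfolding p_def by (intro degree_sum_le) (auto intro!: order_trans[OF degree_smult_le] degree_lagrange_poly)
  have test: "(LINT t|lebesgue_on {a0<..b0}. poly (pderiv p * q) t) + poly p a0 * poly q a0 = 0" if "degree q \<le> r" for q
    using alpha_test[OF that, of c] assms(1) by (simp add: p_def del: poly_mult)
  have "2 * (LINT t|lebesgue_on {a0<..b0}. poly (pderiv p * p) t) = (LINT t|lebesgue_on {a0<..b0}. poly (pderiv (p * p)) t)"
    by (subst Bochner_Integration.integral_mult_right_zero[symmetric])
      (intro Bochner_Integration.integral_cong, auto simp: pderiv_mult)
  also have "\<dots> = (poly p b0)\<^sup>2 - (poly p a0)\<^sup>2"
    using step by (subst LINT_pderiv) (auto simp: power2_eq_square)
  finally have "2 * (LINT t|lebesgue_on {a0<..b0}. poly (pderiv p * p) t) = (poly p b0)\<^sup>2 - (poly p a0)\<^sup>2" .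
  moreover have "(LINT t|lebesgue_on {a0<..b0}. poly (pderiv p * p) t) + (poly p a0)\<^sup>2 = 0"
    using test[OF deg] unfolding power2_eq_square .
  ultimately have "(poly p b0)\<^sup>2 + (poly p a0)\<^sup>2 = 0" by linarith
  then have pa: "poly p a0 = 0" by (simp add: sum_power2_eq_zero_iff)
  have "degree (pderiv p) \<le> r" using deg by (simp add: degree_pderiv)
  from test[OF this] have "(LINT t|lebesgue_on {a0<..b0}. (poly (pderiv p) t)\<^sup>2) = 0"
    unfolding pa by (simp add: power2_eq_square)
  then have "pderiv p = 0" by (rule LINT_poly_square_zero[OF step])
  then have "degree p = 0" by (simp add: pderiv_eq_0_iff)
  then obtain d where "p = [:d:]" using degree_eq_zeroE by blast
  then have "p = 0" using pa by simp
  moreover have "poly p (gnode G n j) = (\<Sum>i\<le>r. if j = i then c i else 0)"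
    unfolding p_def poly_sum by (intro sum.cong) (auto simp: lagrange_poly_node[OF inj assms(2)])
  ultimately show ?thesis using assms(2) by simp
qed

text \<open>The quantitative form of injectivity: on sequences both sides are semidefinite forms
  that see only the entries up to r, and \<open>alpha_injective\<close> supplies the condition on
  null vectors.\<close>

lemma alpha_bound: "\<exists>C>0. \<forall>c. (\<Sum>j\<le>r. (c j)\<^sup>2) \<le> C * (\<Sum>i\<le>r. (\<Sum>j\<le>r. alpha G r n i j * c j)\<^sup>2)"
proof -
  let ?A = "\<lambda>c d. \<Sum>i\<le>r. (\<Sum>j\<le>r. alpha G r n i j * c j) * (\<Sum>j\<le>r. alpha G r n i j * d j)"
  let ?B = "\<lambda>c d :: nat \<Rightarrow> real. \<Sum>j\<le>r. c j * d j"
  have "\<exists>C>0. \<forall>c\<in>UNIV. ?B c c \<le> C * ?A c c"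
  proof (rule form_dominated[where L = "(\<lambda>j c. c j) ` {..r}" and A = ?A and B = ?B])
    have "lin_on UNIV (\<lambda>c. \<Sum>j\<le>r. alpha G r n i j * c j)" for i
      by (auto simp: lin_on_def algebra_simps sum.distrib sum_distrib_left)
    then show "psd_form UNIV ?A" by (intro psd_form_Sum psd_form_square)
    show "psd_form UNIV ?B"
      by (intro psd_form_Sum psd_form_square) (auto simp: lin_on_def)
    show "lin_on UNIV l" if "l \<in> (\<lambda>j c. c j) ` {..r}" for l :: "(nat \<Rightarrow> real) \<Rightarrow> real"
      using that by (auto simp: lin_on_def)
    show "?A c c = 0" if "\<And>l. l \<in> (\<lambda>j c. c j) ` {..r} \<Longrightarrow> l c = 0" for c :: "nat \<Rightarrow> real"
    proof -
      have "c j = 0" if "j \<le> r" for j using that \<open>\<And>l. l \<in> (\<lambda>j c. c j) ` {..r} \<Longrightarrow> l c = 0\<close>[of "\<lambda>c. c j"] by auto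
      then show ?thesis by simp
    qed
    show "?B c c = 0" if "?A c c = 0" for c
    proof -
      have "(\<Sum>j\<le>r. alpha G r n i j * c j) * (\<Sum>j\<le>r. alpha G r n i j * c j) = 0" if "i \<le> r" for i
        using \<open>?A c c = 0\<close> that by (subst (asm) sum_nonneg_eq_0_iff) auto
      then have "c j = 0" if "j \<le> r" for j using alpha_injective[OF _ that] by simp
      then show ?thesis by simp
    qed
  qed auto
  then show ?thesis by (simp add: power2_eq_square)
qed

text \<open>Symmetry of \<open>A\<close> allows \<alpha> to be symmetrized. By
  \<open>alpha_symmetrized\<close>, \<alpha> plus its transpose is a sum of two rank-one squares,
  and each contributes the value of \<open>A\<close> at one combination of the f j.\<close>

lemma alpha_monotone:
  assumes A: "psd_form S A" "subspace S" and f: "\<And>j. j \<le> r \<Longrightarrow> f j \<in> S"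
  shows "(\<Sum>i\<le>r. \<Sum>j\<le>r. alpha G r n i j * A (f j) (f i)) \<ge> 0"
proof -
  have sq: "(\<Sum>i\<le>r. \<Sum>j\<le>r. c i * c j * A (f j) (f i)) \<ge> 0" for c
  proof -
    let ?F = "\<Sum>i\<le>r. c i *\<^sub>R f i"
    have F: "?F \<in> S" using f by (intro subspace_sum[OF A(2)] subspace_scale[OF A(2)]) auto
    have "A ?F ?F = (\<Sum>j\<le>r. c j * A (f j) ?F)"
      using f by (intro lin_on_sum[OF psd_formD(4)[OF A(1) F] A(2)]) auto
    also have "\<dots> = (\<Sum>j\<le>r. c j * (\<Sum>i\<le>r. c i * A (f j) (f i)))"
    proof (intro sum.cong refl arg_cong2[of _ _ _ _ "(*)"])
      fix j assume "j \<in> {..r}"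
      then show "A (f j) ?F = (\<Sum>i\<le>r. c i * A (f j) (f i))"
        using f by (intro lin_on_sum[OF psd_formD(5)[OF A(1)] A(2)]) auto
    qed
    also have "\<dots> = (\<Sum>i\<le>r. \<Sum>j\<le>r. c i * c j * A (f j) (f i))"
      by (subst sum.swap) (simp add: sum_distrib_left mult_ac)
    finally show ?thesis using psd_formD(3)[OF A(1) F] by simp
  qed
  let ?s = "\<Sum>i\<le>r. \<Sum>j\<le>r. alpha G r n i j * A (f j) (f i)"
  have "?s = (\<Sum>i\<le>r. \<Sum>j\<le>r. alpha G r n j i * A (f j) (f i))"
    by (subst sum.swap) (auto intro!: sum.cong simp: psd_formD(2)[OF A(1)] f)
  then have "2 * ?s = (\<Sum>i\<le>r. \<Sum>j\<le>r. (alpha G r n i j + alpha G r n j i) * A (f j) (f i))"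
    by (simp add: distrib_right sum.distrib)
  also have "\<dots> = (\<Sum>i\<le>r. \<Sum>j\<le>r. phi G r n i b0 * phi G r n j b0 * A (f j) (f i))
      + (\<Sum>i\<le>r. \<Sum>j\<le>r. gam G r n i * gam G r n j * A (f j) (f i))"
    unfolding alpha_symmetrized by (simp add: distrib_right sum.distrib)
  finally show ?thesis using sq[of "\<lambda>i. phi G r n i b0"] sq[of "gam G r n"] by simp
qed

text \<open>The weight is the integral of a squared Lagrange polynomial, which is nonzero because it
  takes the value 1 at its node.\<close>

lemma weight_pos:
  assumes "i \<le> r"
  shows "tau G n * betaii G r n i > 0"
proof -
  have "(LINT t|lebesgue_on {a0<..b0}. (poly (Lg i) t)\<^sup>2) \<noteq> 0"
  proof
    assume "(LINT t|lebesgue_on {a0<..b0}. (poly (Lg i) t)\<^sup>2) = 0"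
    then have "Lg i = 0" by (rule LINT_poly_square_zero[OF step])
    then show False using lagrange_poly_node[OF inj assms assms] by simp
  qed
  moreover have "(LINT t|lebesgue_on {a0<..b0}. (poly (Lg i) t)\<^sup>2) \<ge> 0"
    by (intro integral_nonneg_AE) auto
  ultimately have "(LINT t|lebesgue_on {a0<..b0}. (poly (Lg i) t)\<^sup>2) > 0" by linarith
  moreover have "tau G n * betaii G r n i = (LINT t|lebesgue_on {a0<..b0}. (poly (Lg i) t)\<^sup>2)"
    using step by (simp add: tau_def betaii_def phi_eq_poly I_n_def)
  ultimately show ?thesis by simp
qed

end

section \<open>Coercivity and continuity constants\<close>

lemma measurable_matrix_inv_vector:
  fixes P :: "real^'d \<Rightarrow> real^'d^'d" and u :: "real^'d \<Rightarrow> real^'d"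
  assumes P: "P \<in> borel_measurable M" and u: "u \<in> borel_measurable M"
    and det: "\<And>x. x \<in> space M \<Longrightarrow> det (P x) \<noteq> 0"
  shows "(\<lambda>x. matrix_inv (P x) *v u x) \<in> borel_measurable M"
proof -
  have comp: "(\<lambda>x. f (P x)) \<in> borel_measurable M" if "continuous_on UNIV f" for f :: "real^'d^'d \<Rightarrow> real"
    using measurable_compose[OF P borel_measurable_continuous_onI[OF that]] .
  have num: "(\<lambda>x. cofactor_inverse (P x) $ k $ l) \<in> borel_measurable M" for k l
  proof -
    have c: "continuous_on UNIV (\<lambda>A :: real^'d^'d. det (\<chi> i j. if j = k then (axis l 1 :: real^'d) $ i else A $ i $ j))"
    proof (intro continuous_on_det continuous_on_vec_lambda)
      show "continuous_on UNIV (\<lambda>A :: real^'d^'d. if j = k then (axis l 1 :: real^'d) $ i else A $ i $ j)" for i j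
        by (cases "j = k") (auto intro!: continuous_intros)
    qed
    have d: "continuous_on UNIV (\<lambda>A :: real^'d^'d. det A)" by (intro continuous_on_det continuous_intros)
    show ?thesis
      unfolding cofactor_inverse_def using comp[OF c] comp[OF d] by simp
  qed
  have "(\<lambda>x. u x $ l) \<in> borel_measurable M" for l
    by (rule measurable_compose[OF u borel_measurable_continuous_onI]) (intro continuous_intros)
  then have "(\<lambda>x. (cofactor_inverse (P x) *v u x) $ k) \<in> borel_measurable M" for k
    using num by (simp add: matrix_vector_mult_def)
  then have "(\<lambda>x. (cofactor_inverse (P x) *v u x) \<bullet> b) \<in> borel_measurable M" if "b \<in> Basis" for b
    using that by (auto simp: Basis_vec_def inner_axis)
  then have "(\<lambda>x. cofactor_inverse (P x) *v u x) \<in> borel_measurable M"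
    using borel_measurable_euclidean_space by blast
  then show ?thesis
    by (rule measurable_cong[THEN iffD1, rotated]) (simp add: cofactor_inverse(3)[OF det])
qed

text \<open>All claims come from the symmetry of A and its coercivity at the vector
  \<open>matrix_inv A *v v\<close>, which A maps to v.\<close>

lemma spd_inverse:
  fixes A :: "real^'d^'d"
  assumes sym: "transpose A = A" and k: "k > 0" "\<And>\<xi>. k * (norm \<xi>)\<^sup>2 \<le> \<xi> \<bullet> (A *v \<xi>)"
  shows "det A \<noteq> 0" "norm (matrix_inv A *v v) \<le> norm v / k"
    "(matrix_inv A *v u) \<bullet> v = (matrix_inv A *v v) \<bullet> u" "(matrix_inv A *v v) \<bullet> v \<ge> 0"
    "(matrix_inv A *v v) \<bullet> v = 0 \<Longrightarrow> v = 0"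
proof -
  have "A *v \<xi> = 0 \<Longrightarrow> \<xi> = 0" for \<xi> using k(2)[of \<xi>] k(1) by (simp add: mult_le_0_iff)
  then have "inj ((*v) A)" using matrix_left_invertible_ker matrix_left_invertible_injective by blast
  then show det: "det A \<noteq> 0"
    using matrix_left_invertible_injective[of A] invertible_left_inverse[of A] invertible_det_nz[of A] by simp
  note inv = cofactor_inverse[OF det]
  have AB: "A *v (matrix_inv A *v v) = v" for v
    unfolding inv(3) matrix_vector_mul_assoc inv(1) by simp
  have low: "k * (norm (matrix_inv A *v v))\<^sup>2 \<le> (matrix_inv A *v v) \<bullet> v" for v
    using k(2)[of "matrix_inv A *v v"] by (simp add: AB)
  have self: "(A *v a) \<bullet> b = a \<bullet> (A *v b)" for a b
    using dot_lmul_matrix[of a A b] sym by (simp flip: transpose_matrix_vector)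
  show "(matrix_inv A *v u) \<bullet> v = (matrix_inv A *v v) \<bullet> u"
    using self[of "matrix_inv A *v u" "matrix_inv A *v v"] by (simp add: AB inner_commute)
  show nn: "(matrix_inv A *v v) \<bullet> v \<ge> 0" using low[of v] k(1) by (meson mult_nonneg_nonneg less_imp_le order_trans zero_le_power2)
  show "norm (matrix_inv A *v v) \<le> norm v / k"
  proof (cases "matrix_inv A *v v = 0")
    case False
    have "k * (norm (matrix_inv A *v v))\<^sup>2 \<le> norm (matrix_inv A *v v) * norm v"
      using low[of v] norm_cauchy_schwarz order_trans by blast
    then have "k * norm (matrix_inv A *v v) \<le> norm v" using False by (simp add: power2_eq_square)
    then show ?thesis using k(1) by (simp add: field_simps)
  qed (use k in simp)
  show "v = 0" if "(matrix_inv A *v v) \<bullet> v = 0"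
  proof -
    have "k * (norm (matrix_inv A *v v))\<^sup>2 \<le> 0" using low[of v] that by simp
    then have "matrix_inv A *v v = 0" using k(1) by (simp add: mult_le_0_iff)
    then show "v = 0" using AB[of v] by simp
  qed
qed

section \<open>Discrete inequalities on the mesh\<close>

context mesh_geometry
begin

lemma zero_forms:
  assumes z: "z \<in> H_h X l" and zero: "\<And>K x. K \<in> cells X \<Longrightarrow> x \<in> interior K \<Longrightarrow> z x = 0"
  shows "E_form z z = 0" "jump_form z z = 0" "ip (region X) z z = 0"
proof -
  show "ip (region X) z z = 0" by (rule ip_region_null[OF zero])
  show "E_form z z = 0"
    unfolding E_form_def
  proof (intro sum.neutral ballI)
    fix K assume K: "K \<in> cells X"
    show "ip K (eps z) (eps z) = 0"
      by (rule convex_body.ip_zero_interior[OF cell_body[OF K]])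
        (simp add: dvg_zero_of_zero[OF K z zero[OF K]])
  qed
  show "jump_form z z = 0"
    unfolding jump_form_def
  proof (intro sum.neutral ballI face_ip_zero)
    fix e assume e: "e \<in> int_faces X"
    have "jump X e z x = 0" if "x \<in> e" for x
      using convex_body.trace_from_zero[OF cell_body[OF elem_from_cell[OF e]] zero[OF elem_from_cell[OF e]]
          subsetD[OF facet_of_imp_subset[OF elem_from_facet[OF e]] that]]
        convex_body.trace_from_zero[OF cell_body[OF elem_to_cell[OF e]] zero[OF elem_to_cell[OF e]]
          subsetD[OF facet_of_imp_subset[OF elem_to_facet[OF e]] that]]
      by (simp add: jump_def)
    then show "(\<forall>x\<in>e. jump X e z x = 0) \<or> (\<forall>x\<in>e. jump X e z x = 0)" by blast
  qed
qed

lemma H_h_functionals: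
  "\<exists>L. finite L \<and> (\<forall>f\<in>L. lin_on (H_h X l) f) \<and>
    (\<forall>z\<in>H_h X l. (\<forall>f\<in>L. f z = 0) \<longrightarrow> E_form z z = 0 \<and> jump_form z z = 0)"
proof -
  obtain X0 where X0: "finite X0" "\<forall>z\<in>H_h X l. (\<forall>x\<in>X0. z x = 0) \<longrightarrow> (\<forall>K\<in>cells X. \<forall>x\<in>interior K. z x = 0)"
    using H_h_determined by blast
  show ?thesis
  proof (intro exI[of _ "point_functionals X0"] conjI ballI impI point_functionals(1)[OF X0(1)] point_functionals(2))
    fix z assume z: "z \<in> H_h X l" "\<forall>f\<in>point_functionals X0. f z = 0"
    have "\<forall>x\<in>X0. z x = 0" using point_functionals(3)[of X0 z] z(2) by blast
    then have zero: "(\<forall>K\<in>cells X. \<forall>x\<in>interior K. z x = 0)" using X0(2) z(1) by blast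
    show "E_form z z = 0" by (rule zero_forms(1)[OF z(1)]) (use zero in blast)
    show "jump_form z z = 0" by (rule zero_forms(2)[OF z(1)]) (use zero in blast)
  qed
qed

lemma W_h_functionals:
  "\<exists>L. finite L \<and> (\<forall>f\<in>L. lin_on (W_h X s) f) \<and>
    (\<forall>w\<in>W_h X s. (\<forall>f\<in>L. f w = 0) \<longrightarrow> ip (region X) w w = 0)"
proof -
  obtain X0 where X0: "finite X0" "\<forall>w\<in>W_h X s. (\<forall>x\<in>X0. w x = 0) \<longrightarrow> (\<forall>K\<in>cells X. \<forall>x\<in>interior K. w x = 0)"
    using W_h_determined by blast
  show ?thesis
  proof (intro exI[of _ "point_functionals X0"] conjI ballI impI point_functionals(1)[OF X0(1)] point_functionals(2))
    fix w assume w: "w \<in> W_h X s" "\<forall>f\<in>point_functionals X0. f w = 0"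
    have "\<forall>x\<in>X0. w x = 0" using point_functionals(3)[of X0 w] w(2) by blast
    then have zero: "(\<forall>K\<in>cells X. \<forall>x\<in>interior K. w x = 0)" using X0(2) w(1) by blast
    show "ip (region X) w w = 0" by (rule ip_region_null) (use zero in blast)
  qed
qed

lemma V_h_functionals:
  "\<exists>L. finite L \<and> (\<forall>f\<in>L. lin_on (V_h X s) f) \<and>
    (\<forall>v\<in>V_h X s. (\<forall>f\<in>L. f v = 0) \<longrightarrow> ip (region X) v v = 0)"
proof -
  obtain X0 where X0: "finite X0" "\<forall>v\<in>V_h X s. (\<forall>x\<in>X0. v x = 0) \<longrightarrow> (\<forall>K\<in>cells X. \<forall>x\<in>interior K. v x = 0)"
    using V_h_determined by blast
  show ?thesis
  proof (intro exI[of _ "point_functionals X0"] conjI ballI impI point_functionals(1)[OF X0(1)] point_functionals(2))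
    fix v assume v: "v \<in> V_h X s" "\<forall>f\<in>point_functionals X0. f v = 0"
    have "\<forall>x\<in>X0. v x = 0" using point_functionals(3)[of X0 v] v(2) by blast
    then have zero: "(\<forall>K\<in>cells X. \<forall>x\<in>interior K. v x = 0)" using X0(2) v(1) by blast
    show "ip (region X) v v = 0" by (rule ip_region_null) (use zero in blast)
  qed
qed

lemma V_h_L2: "v \<in> V_h X s \<Longrightarrow> v \<in> L2 (region X)"
  using V_h_Hdiv Hdiv_L2 by blast

lemma psd_ip_on:
  "psd_form (W_h X s) (ip (region X))" "psd_form (V_h X s) (ip (region X))" "psd_form (H_h X l) (ip (region X))"
  by (rule psd_form_subset[OF psd_form_ip], use W_h_L2 V_h_L2 H_h_L2 in blast)+

text \<open>Zero strain has zero trace, so \<open>div_form_null\<close> supplies the kernel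
  conditions for domination.\<close>

lemma div_form_bound:
  "\<exists>C>0. \<forall>z\<in>H_h X l. \<forall>w\<in>W_h X s. (div_form X z w)\<^sup>2 \<le> C * E_form z z * ip (region X) w w"
proof -
  from H_h_functionals[of l] obtain L where "finite L" "\<forall>f\<in>L. lin_on (H_h X l) f"
    "\<forall>z\<in>H_h X l. (\<forall>f\<in>L. f z = 0) \<longrightarrow> E_form z z = 0 \<and> jump_form z z = 0"
    by (elim exE conjE) (rule that)
  then have L: "finite L" "\<And>f. f \<in> L \<Longrightarrow> lin_on (H_h X l) f"
    "\<And>z. z \<in> H_h X l \<Longrightarrow> (\<And>f. f \<in> L \<Longrightarrow> f z = 0) \<Longrightarrow> E_form z z = 0"
    "\<And>z. z \<in> H_h X l \<Longrightarrow> (\<And>f. f \<in> L \<Longrightarrow> f z = 0) \<Longrightarrow> jump_form z z = 0"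
    by blast+
  from W_h_functionals[of s] obtain M where "finite M" "\<forall>f\<in>M. lin_on (W_h X s) f"
    "\<forall>w\<in>W_h X s. (\<forall>f\<in>M. f w = 0) \<longrightarrow> ip (region X) w w = 0"
    by (elim exE conjE) (rule that)
  then have M: "finite M" "\<And>f. f \<in> M \<Longrightarrow> lin_on (W_h X s) f"
    "\<And>w. w \<in> W_h X s \<Longrightarrow> (\<And>f. f \<in> M \<Longrightarrow> f w = 0) \<Longrightarrow> ip (region X) w w = 0"
    by blast+
  show ?thesis
    by (rule bil_dominated[OF L(1,2) psd_E_form subspace_H_h L(3) M(1,2) psd_ip_on(1) subspace_W_h M(3) bil_on_div_form])
      (auto intro: div_form_null)
qed

text \<open>Contains the discrete trace inequality for the pressure: its averages on faces are
  controlled by its L2 norm.\<close>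

lemma J_p_bound:
  "\<exists>C>0. \<forall>z\<in>H_h X l. \<forall>w\<in>W_h X s. (J_p X w z)\<^sup>2 \<le> C * jump_form z z * ip (region X) w w"
proof -
  from H_h_functionals[of l] obtain L where "finite L" "\<forall>f\<in>L. lin_on (H_h X l) f"
    "\<forall>z\<in>H_h X l. (\<forall>f\<in>L. f z = 0) \<longrightarrow> E_form z z = 0 \<and> jump_form z z = 0"
    by (elim exE conjE) (rule that)
  then have L: "finite L" "\<And>f. f \<in> L \<Longrightarrow> lin_on (H_h X l) f"
    "\<And>z. z \<in> H_h X l \<Longrightarrow> (\<And>f. f \<in> L \<Longrightarrow> f z = 0) \<Longrightarrow> E_form z z = 0"
    "\<And>z. z \<in> H_h X l \<Longrightarrow> (\<And>f. f \<in> L \<Longrightarrow> f z = 0) \<Longrightarrow> jump_form z z = 0"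
    by blast+
  from W_h_functionals[of s] obtain M where "finite M" "\<forall>f\<in>M. lin_on (W_h X s) f"
    "\<forall>w\<in>W_h X s. (\<forall>f\<in>M. f w = 0) \<longrightarrow> ip (region X) w w = 0"
    by (elim exE conjE) (rule that)
  then have M: "finite M" "\<And>f. f \<in> M \<Longrightarrow> lin_on (W_h X s) f"
    "\<And>w. w \<in> W_h X s \<Longrightarrow> (\<And>f. f \<in> M \<Longrightarrow> f w = 0) \<Longrightarrow> ip (region X) w w = 0"
    by blast+
  show ?thesis
    by (rule bil_dominated[OF L(1,2) psd_jump_form subspace_H_h L(4) M(1,2) psd_ip_on(1) subspace_W_h M(3)
        bil_on_swap[OF bil_on_J_p]])
      (auto intro: J_p_null)
qed

text \<open>The discrete trace inequality for normal stresses from the theory of interior penalties;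
  its constant depends on mesh, degree and material, but not on the penalty.\<close>

lemma flux_form_bound:
  "\<exists>C>0. \<forall>y\<in>H_h X l. \<forall>z\<in>H_h X l. (flux_form D y z)\<^sup>2 \<le> C * E_form y y * jump_form z z"
proof -
  from H_h_functionals[of l] obtain L where "finite L" "\<forall>f\<in>L. lin_on (H_h X l) f"
    "\<forall>z\<in>H_h X l. (\<forall>f\<in>L. f z = 0) \<longrightarrow> E_form z z = 0 \<and> jump_form z z = 0"
    by (elim exE conjE) (rule that)
  then have L: "finite L" "\<And>f. f \<in> L \<Longrightarrow> lin_on (H_h X l) f"
    "\<And>z. z \<in> H_h X l \<Longrightarrow> (\<And>f. f \<in> L \<Longrightarrow> f z = 0) \<Longrightarrow> E_form z z = 0"
    "\<And>z. z \<in> H_h X l \<Longrightarrow> (\<And>f. f \<in> L \<Longrightarrow> f z = 0) \<Longrightarrow> jump_form z z = 0"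
    by blast+
  show ?thesis
    by (rule bil_dominated[OF L(1,2) psd_E_form subspace_H_h L(3) L(1,2) psd_jump_form subspace_H_h L(4) bil_on_flux_form])
      (auto intro: flux_form_null)
qed

text \<open>Both inequalities in one, with the boundary condition built into the space; the kernel
  condition for domination is \<open>broken_Korn\<close>.\<close>

lemma broken_Poincare_Korn:
  "\<exists>C>0. \<forall>z\<in>H_h X l. ip (region X) z z \<le> C * (E_form z z + jump_form z z)"
proof -
  from H_h_functionals[of l] obtain L where "finite L" "\<forall>f\<in>L. lin_on (H_h X l) f"
    "\<forall>z\<in>H_h X l. (\<forall>f\<in>L. f z = 0) \<longrightarrow> E_form z z = 0 \<and> jump_form z z = 0"
    by (elim exE conjE) (rule that)
  then have L: "finite L" "\<And>f. f \<in> L \<Longrightarrow> lin_on (H_h X l) f"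
    "\<And>z. z \<in> H_h X l \<Longrightarrow> (\<And>f. f \<in> L \<Longrightarrow> f z = 0) \<Longrightarrow> E_form z z = 0"
    "\<And>z. z \<in> H_h X l \<Longrightarrow> (\<And>f. f \<in> L \<Longrightarrow> f z = 0) \<Longrightarrow> jump_form z z = 0"
    by blast+
  show ?thesis
  proof (rule form_dominated[where A = "\<lambda>y z. E_form y z + jump_form y z" and B = "ip (region X)" and S = "H_h X l",
        OF L(1,2) psd_form_plus[OF psd_E_form psd_jump_form] psd_ip_on(3) subspace_H_h])
    show "E_form z z + jump_form z z = 0" if "z \<in> H_h X l" "\<And>f. f \<in> L \<Longrightarrow> f z = 0" for z
      using L(3)[OF that(1)] L(4)[OF that(1)] that(2) by simp
    show "ip (region X) z z = 0" if z: "z \<in> H_h X l" and "E_form z z + jump_form z z = 0" for z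
    proof -
      have "E_form z z = 0" "jump_form z z = 0"
        using that psd_formD(3)[OF psd_E_form z] psd_formD(3)[OF psd_jump_form z] by linarith+
      then have "z x = 0" if "K \<in> cells X" "x \<in> interior K" for K x
        using broken_Korn[OF z _ _ that] by simp
      then show ?thesis by (rule ip_region_null)
    qed
  qed
qed

text \<open>An inverse inequality. It lets the Darcy equation bound the flux, since the pressure is
  paired there with the divergence of the test field.\<close>

lemma wdiv_bound:
  "\<exists>C>0. \<forall>v\<in>V_h X s. ip (region X) (wdiv (region X) v) (wdiv (region X) v) \<le> C * ip (region X) v v"
proof -
  from V_h_functionals[of s] obtain L where "finite L" "\<forall>f\<in>L. lin_on (V_h X s) f"
    "\<forall>v\<in>V_h X s. (\<forall>f\<in>L. f v = 0) \<longrightarrow> ip (region X) v v = 0"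
    by (elim exE conjE) (rule that)
  then have L: "finite L" "\<And>f. f \<in> L \<Longrightarrow> lin_on (V_h X s) f"
    "\<And>v. v \<in> V_h X s \<Longrightarrow> (\<And>f. f \<in> L \<Longrightarrow> f v = 0) \<Longrightarrow> ip (region X) v v = 0"
    by blast+
  have sub: "V_h X s \<subseteq> Hdiv (region X)" using V_h_Hdiv by blast
  show ?thesis
    by (rule form_dominated[where A = "ip (region X)" and S = "V_h X s"
          and B = "\<lambda>u v. ip (region X) (wdiv (region X) u) (wdiv (region X) v)",
          OF L(1,2) psd_ip_on(2) psd_form_subset[OF psd_form_wdiv[OF open_region] sub] subspace_V_h L(3)])
      (use wdiv_null[OF open_region V_h_Hdiv] in blast)+
qed

lemma face_measure_pos: "e \<in> int_faces X \<Longrightarrow> face_measure X e > 0"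
proof -
  assume e: "e \<in> int_faces X"
  have P: "prism e (nu X e) \<in> lmeasurable" by (rule lmeasurable_compact[OF prism_compact[OF e]])
  have "measure lebesgue (prism e (nu X e)) \<noteq> 0"
  proof
    assume "measure lebesgue (prism e (nu X e)) = 0"
    then have "negligible (prism e (nu X e))" using P by (simp add: negligible_iff_measure)
    then have "negligible (interior (prism e (nu X e)))" using negligible_subset interior_subset by blast
    then show False using open_not_negligible[OF open_interior] prism_interior[OF e] by blast
  qed
  then show ?thesis unfolding face_measure_def by (simp add: zero_less_measure_iff)
qed

definition mech_form :: "'d biot \<Rightarrow> ((real^'d) set \<Rightarrow> real) \<Rightarrow> real \<Rightarrow> (real^'d \<Rightarrow> real^'d) \<Rightarrow> (real^'d \<Rightarrow> real^'d) \<Rightarrow> real" where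
  "mech_form D \<delta> \<beta> y z = elastic_form D y z + J_delta X \<delta> \<beta> y z - J_d X D y z"

lemma bil_on_mech_form: "bil_on (H_h X l) (H_h X l) (mech_form D \<delta> \<beta>)"
  unfolding mech_form_def[abs_def] J_d_flux
  by (intro bil_on_plus bil_on_minus bil_on_elastic_form bil_on_J_delta bil_on_flux_form bil_on_swap[OF bil_on_flux_form])

lemma mech_form_sym: "y \<in> H_h X l \<Longrightarrow> z \<in> H_h X l \<Longrightarrow> mech_form D \<delta> \<beta> y z = mech_form D \<delta> \<beta> z y"
  using elastic_form_sym by (simp add: mech_form_def J_d_flux J_delta_def face_ip_def ip_def inner_commute)

text \<open>Young's inequality on the consistency terms costs half of the strain part 2 mu E and C /
  mu times the jump form; a large penalty pays for the latter and leaves \<open>\<kappa>\<close>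
  over.\<close>

lemma mech_form_coercive:
  assumes "mu D > 0" "lam D > 0" "\<kappa> > 0"
  shows "\<exists>\<delta>0>0. \<forall>\<delta>. (\<forall>e\<in>int_faces X. \<delta> e \<ge> \<delta>0) \<longrightarrow>
    (\<forall>z\<in>H_h X l. mech_form D \<delta> \<beta> z z \<ge> mu D * E_form z z + \<kappa> * jump_form z z)"
proof -
  obtain C where C: "C > 0" "\<And>y z. y \<in> H_h X l \<Longrightarrow> z \<in> H_h X l \<Longrightarrow> (flux_form D y z)\<^sup>2 \<le> C * E_form y y * jump_form z z"
    using flux_form_bound by blast
  define \<theta> where "\<theta> = C / mu D + \<kappa>"
  have th: "\<theta> > 0" using C(1) assms by (simp add: \<theta>_def add_pos_pos)
  \<comment> \<open>The sum bounds every single face weight, so the quotient of penalty and weight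
    is at least \<open>\<theta>\<close> on each face; the 1 keeps the threshold positive when there
    are no interior faces.\<close>
  define \<delta>0 where "\<delta>0 = \<theta> * (1 + (\<Sum>e\<in>int_faces X. face_measure X e powr \<beta>))"
  have "\<delta>0 > 0" unfolding \<delta>0_def using th by (intro mult_pos_pos add_pos_nonneg sum_nonneg) auto
  moreover have "mech_form D \<delta> \<beta> z z \<ge> mu D * E_form z z + \<kappa> * jump_form z z"
    if \<delta>: "\<forall>e\<in>int_faces X. \<delta> e \<ge> \<delta>0" and z: "z \<in> H_h X l" for \<delta> z
  proof -
    have E: "E_form z z \<ge> 0" and j: "jump_form z z \<ge> 0"
      using psd_formD(3)[OF psd_E_form z] psd_formD(3)[OF psd_jump_form z] by auto
    have "(\<Sum>K\<in>cells X. ip K (dvg z) (dvg z)) \<ge> 0"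
      by (auto simp: ip_def intro!: sum_nonneg integral_nonneg_AE)
    then have el: "elastic_form D z z \<ge> 2 * mu D * E_form z z"
      using elastic_form_eq[OF z z, of D] assms(2) by simp
    have "\<theta> * jump_form z z \<le> J_delta X \<delta> \<beta> z z"
      unfolding J_delta_def jump_form_def sum_distrib_left
    proof (intro sum_mono mult_right_mono)
      fix e assume e: "e \<in> int_faces X"
      have pos: "face_measure X e powr \<beta> > 0" using face_measure_pos[OF e] by simp
      have "face_measure X e powr \<beta> \<le> (\<Sum>e\<in>int_faces X. face_measure X e powr \<beta>)"
        using e finite_int_faces by (intro member_le_sum) auto
      then have "\<theta> * face_measure X e powr \<beta> \<le> \<delta>0" unfolding \<delta>0_def using th by (intro mult_left_mono) auto
      also have "\<delta>0 \<le> \<delta> e" using \<delta> e by blast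
      finally show "\<theta> \<le> \<delta> e / face_measure X e powr \<beta>" using pos by (simp add: pos_le_divide_eq)
      show "0 \<le> face_ip X e (jump X e z) (jump X e z)"
        by (auto simp: face_ip_def ip_def intro!: integral_nonneg_AE)
    qed
    moreover have "2 * flux_form D z z \<le> mu D * E_form z z + C / mu D * jump_form z z"
    proof -
      have "(2 * flux_form D z z)\<^sup>2 \<le> 4 * (C * E_form z z * jump_form z z)"
        using C(2)[OF z z] by (simp add: power_mult_distrib)
      also have "\<dots> = 4 * (mu D * E_form z z) * (C / mu D * jump_form z z)" using assms(1) by simp
      also have "4 * a * b \<le> (a + b)\<^sup>2" for a b :: real
        using sum_squares_bound[of a b] by (simp add: power2_sum)
      finally show ?thesis
        by (rule power2_le_imp_le) (use assms(1) C(1) E j in \<open>auto intro!: add_nonneg_nonneg mult_nonneg_nonneg\<close>)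
    qed
    ultimately show ?thesis
      using el by (simp add: mech_form_def J_d_flux \<theta>_def algebra_simps)
  qed
  ultimately show ?thesis by blast
qed

definition perm_form :: "'d biot \<Rightarrow> (real^'d \<Rightarrow> real^'d) \<Rightarrow> (real^'d \<Rightarrow> real^'d) \<Rightarrow> real" where
  "perm_form D u v = ip (region X) (\<lambda>x. matrix_inv (perm D x) *v u x) v"

section \<open>The permeability form\<close>

lemma perm_spd:
  assumes "biot_data X r G D"
  obtains k where "k > 0" "\<And>x. x \<in> region X \<Longrightarrow> transpose (perm D x) = perm D x"
    "\<And>x \<xi>. x \<in> region X \<Longrightarrow> k * (norm \<xi>)\<^sup>2 \<le> \<xi> \<bullet> (perm D x *v \<xi>)"
  using assms unfolding biot_data_def by blast

lemma perm_inverse_L2: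
  assumes D: "biot_data X r G D" and u: "u \<in> L2 (region X)"
  shows "(\<lambda>x. matrix_inv (perm D x) *v u x) \<in> L2 (region X)"
proof -
  obtain k where k: "k > 0" "\<And>x. x \<in> region X \<Longrightarrow> transpose (perm D x) = perm D x"
    "\<And>x \<xi>. x \<in> region X \<Longrightarrow> k * (norm \<xi>)\<^sup>2 \<le> \<xi> \<bullet> (perm D x *v \<xi>)"
    by (rule perm_spd[OF D]) (rule that)
  note spd = spd_inverse[OF k(2) k(1) k(3)]
  have meas: "(\<lambda>x. matrix_inv (perm D x) *v u x) \<in> borel_measurable (lebesgue_on (region X))"
    by (rule measurable_matrix_inv_vector) (use D u spd(1) in \<open>auto simp: biot_data_def L2_def\<close>)
  have "integrable (lebesgue_on (region X)) (\<lambda>x. (norm (matrix_inv (perm D x) *v u x))\<^sup>2)"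
  proof (rule Bochner_Integration.integrable_bound)
    show "integrable (lebesgue_on (region X)) (\<lambda>x. (1 / k)\<^sup>2 * (norm (u x))\<^sup>2)"
      using u by (auto simp: L2_def)
    show "(\<lambda>x. (norm (matrix_inv (perm D x) *v u x))\<^sup>2) \<in> borel_measurable (lebesgue_on (region X))"
      using meas by (intro borel_measurable_power) measurable
    show "AE x in lebesgue_on (region X). norm ((norm (matrix_inv (perm D x) *v u x))\<^sup>2) \<le> norm ((1 / k)\<^sup>2 * (norm (u x))\<^sup>2)"
    proof (rule AE_I2)
      fix x assume "x \<in> space (lebesgue_on (region X))"
      then have "(norm (matrix_inv (perm D x) *v u x))\<^sup>2 \<le> (norm (u x) / k)\<^sup>2"
        using spd(2) by (intro power_mono) auto
      then show "norm ((norm (matrix_inv (perm D x) *v u x))\<^sup>2) \<le> norm ((1 / k)\<^sup>2 * (norm (u x))\<^sup>2)"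
        by (simp add: power_divide)
    qed
  qed
  then show ?thesis using meas by (simp add: L2_def)
qed

lemma psd_perm_form:
  assumes D: "biot_data X r G D"
  shows "psd_form (L2 (region X)) (perm_form D)"
proof -
  obtain k where k: "k > 0" "\<And>x. x \<in> region X \<Longrightarrow> transpose (perm D x) = perm D x"
    "\<And>x \<xi>. x \<in> region X \<Longrightarrow> k * (norm \<xi>)\<^sup>2 \<le> \<xi> \<bullet> (perm D x *v \<xi>)"
    by (rule perm_spd[OF D]) (rule that)
  note spd = spd_inverse[OF k(2) k(1) k(3)]
  have sym: "perm_form D u v = perm_form D v u" for u v
    unfolding perm_form_def ip_def by (intro Bochner_Integration.integral_cong refl spd(3)) auto
  have lin: "lin_on (L2 (region X)) (perm_form D u)" if "u \<in> L2 (region X)" for u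
    using bil_on_right[OF bil_on_ip perm_inverse_L2[OF D that]] unfolding perm_form_def[abs_def] .
  then have "lin_on (L2 (region X)) (\<lambda>u. perm_form D u v)" if "v \<in> L2 (region X)" for v
    unfolding sym[of _ v] using that by blast
  moreover have "perm_form D u u \<ge> 0" for u
    unfolding perm_form_def ip_def by (intro integral_nonneg_AE AE_I2 spd(4)) auto
  ultimately show ?thesis unfolding psd_form_def bil_on_def using lin sym by blast
qed

text \<open>The inverse permeability need not have a positive lower bound pointwise. The estimate
  holds on the finite-dimensional flux space, because the form vanishes only for fields that are 0
  almost everywhere.\<close>

lemma perm_bound:
  assumes D: "biot_data X r G D"
  shows "\<exists>C>0. \<forall>v\<in>V_h X s. ip (region X) v v \<le> C * perm_form D v v"
proof -
  obtain k where k: "k > 0" "\<And>x. x \<in> region X \<Longrightarrow> transpose (perm D x) = perm D x"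
    "\<And>x \<xi>. x \<in> region X \<Longrightarrow> k * (norm \<xi>)\<^sup>2 \<le> \<xi> \<bullet> (perm D x *v \<xi>)"
    by (rule perm_spd[OF D]) (rule that)
  note spd = spd_inverse[OF k(2) k(1) k(3)]
  from V_h_functionals[of s] obtain L where "finite L" "\<forall>f\<in>L. lin_on (V_h X s) f"
    "\<forall>v\<in>V_h X s. (\<forall>f\<in>L. f v = 0) \<longrightarrow> ip (region X) v v = 0"
    by (elim exE conjE) (rule that)
  then have L: "finite L" "\<And>f. f \<in> L \<Longrightarrow> lin_on (V_h X s) f"
    "\<And>v. v \<in> V_h X s \<Longrightarrow> (\<And>f. f \<in> L \<Longrightarrow> f v = 0) \<Longrightarrow> ip (region X) v v = 0"
    by blast+
  have sub: "V_h X s \<subseteq> L2 (region X)" using V_h_L2 by blast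
  show ?thesis
  proof (rule form_dominated[where A = "perm_form D" and S = "V_h X s" and B = "ip (region X)",
          OF L(1,2) psd_form_subset[OF psd_perm_form[OF D] sub] psd_ip_on(2) subspace_V_h])
    show "perm_form D v v = 0" if "v \<in> V_h X s" "\<And>f. f \<in> L \<Longrightarrow> f v = 0" for v
    proof -
      have "ip (region X) v v = 0" using L(3)[OF that(1)] that(2) by simp
      then have "ip (region X) v (\<lambda>x. matrix_inv (perm D x) *v v x) = 0"
        by (rule psd_form_null[where A = "ip (region X)", OF psd_form_ip subspace_L2 V_h_L2[OF that(1)]
          perm_inverse_L2[OF D V_h_L2[OF that(1)]]])
      then show ?thesis by (simp add: perm_form_def ip_def inner_commute)
    qed
    show "ip (region X) v v = 0" if v: "v \<in> V_h X s" and z: "perm_form D v v = 0" for v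
    proof -
      have int: "integrable (lebesgue_on (region X)) (\<lambda>x. (matrix_inv (perm D x) *v v x) \<bullet> v x)"
        by (rule L2_integrable_inner[OF perm_inverse_L2[OF D V_h_L2[OF v]] V_h_L2[OF v]])
      have "AE x in lebesgue_on (region X). (matrix_inv (perm D x) *v v x) \<bullet> v x \<ge> 0"
        using spd(4) by (intro AE_I2) auto
      then have "AE x in lebesgue_on (region X). (matrix_inv (perm D x) *v v x) \<bullet> v x = 0"
        using integral_nonneg_eq_0_iff_AE[OF int] z by (simp add: perm_form_def ip_def)
      then have "AE x in lebesgue_on (region X). v x = 0"
        using AE_space by eventually_elim (use spd(5) in auto)
      then show ?thesis using ip_null_iff[OF V_h_L2[OF v]] by blast
    qed
  qed
qed

end

section \<open>Contraction of the splitting error\<close>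

context mesh_geometry
begin

definition coupling :: "'d biot \<Rightarrow> (real^'d \<Rightarrow> real^'d) \<Rightarrow> (real^'d \<Rightarrow> real) \<Rightarrow> real" where
  "coupling D z w = coup D * div_form X z w - coup D * J_p X w z"

lemma bil_on_coupling: "bil_on (H_h X l) (W_h X s) (coupling D)"
  unfolding coupling_def[abs_def]
  by (intro bil_on_minus bil_on_cmult bil_on_div_form bil_on_swap[OF bil_on_J_p])

end

text \<open>The mechanics equation reads \<open>a(u, z) = B(z, p)\<close>, with \<open>a\<close> symmetric and \<open>B\<close> the full coupling, whereas the
  flow equation only contains the volume part of \<open>B\<close>. The difference, the face term \<open>J_p\<close>, is absorbed by the
  penalty term.\<close>

locale penalized_mechanics = mesh_geometry X for X :: "('d::finite) mesh" +
  fixes D :: "'d biot" and \<delta> :: "(real^'d) set \<Rightarrow> real" and \<beta> :: real and l s :: nat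
    and \<kappa> CT CL :: real
  assumes pos: "mu D > 0" "coup D > 0" "modM D > 0" "\<kappa> > 0" "CT > 0" "CL > 0"
    and coercive: "\<And>z. z \<in> H_h X l \<Longrightarrow> mech_form D \<delta> \<beta> z z \<ge> mu D * E_form z z + \<kappa> * jump_form z z"
    and face_coupling: "\<And>z w. z \<in> H_h X l \<Longrightarrow> w \<in> W_h X s \<Longrightarrow>
      2 * \<bar>coup D * J_p X w z\<bar> \<le> ip (region X) w w / modM D + \<kappa> * jump_form z z"
    and coupling_bound: "\<And>z w. z \<in> H_h X l \<Longrightarrow> w \<in> W_h X s \<Longrightarrow>
      (coupling D z w)\<^sup>2 \<le> CT * mech_form D \<delta> \<beta> z z * ip (region X) w w"
    and L2_bound: "\<And>z. z \<in> H_h X l \<Longrightarrow> ip (region X) z z \<le> CL * mech_form D \<delta> \<beta> z z"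

lemma (in mesh_geometry) penalized_mechanics_exists:
  assumes D: "mu D > 0" "lam D > 0" "coup D > 0" "modM D > 0"
  shows "\<exists>\<delta>0>0. \<exists>\<kappa>. \<exists>CT>0. \<exists>CL. \<forall>\<delta>. (\<forall>e\<in>int_faces X. \<delta> e \<ge> \<delta>0) \<longrightarrow> penalized_mechanics X D \<delta> \<beta> l s \<kappa> CT CL"
proof -
  obtain Cd where Cd: "Cd > 0" "\<forall>z\<in>H_h X l. \<forall>w\<in>W_h X s. (div_form X z w)\<^sup>2 \<le> Cd * E_form z z * ip (region X) w w"
    using div_form_bound by blast
  obtain Cp where Cp: "Cp > 0" "\<forall>z\<in>H_h X l. \<forall>w\<in>W_h X s. (J_p X w z)\<^sup>2 \<le> Cp * jump_form z z * ip (region X) w w"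
    using J_p_bound by blast
  obtain Ck where Ck: "Ck > 0" "\<forall>z\<in>H_h X l. ip (region X) z z \<le> Ck * (E_form z z + jump_form z z)"
    using broken_Poincare_Korn by blast
  define b where "b = coup D"
  \<comment> \<open>Chosen such that Young's inequality fits: the square of twice the face coupling
    is at most 4 times the product of the pressure term with weight 1/M and the jump term with
    weight \<open>\<kappa>\<close>.\<close>
  define \<kappa> where "\<kappa> = modM D * b\<^sup>2 * Cp"
  \<comment> \<open>The square of the difference of volume and face coupling costs a factor 2;
    strain and jump forms are then bounded by the energy divided by mu and by
    \<open>\<kappa>\<close>.\<close>
  define CT where "CT = 2 * b\<^sup>2 * (Cd / mu D + Cp / \<kappa>)"
  define CL where "CL = Ck * (1 / mu D + 1 / \<kappa>)"
  have p: "b > 0" "\<kappa> > 0" "CT > 0" "CL > 0"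
    using D Cd(1) Cp(1) Ck(1) by (auto simp: b_def \<kappa>_def CT_def CL_def intro!: add_pos_pos mult_pos_pos divide_pos_pos)
  obtain \<delta>0 where \<delta>0: "\<delta>0 > 0" "\<And>\<delta> z. (\<forall>e\<in>int_faces X. \<delta> e \<ge> \<delta>0) \<Longrightarrow> z \<in> H_h X l \<Longrightarrow>
      mech_form D \<delta> \<beta> z z \<ge> mu D * E_form z z + \<kappa> * jump_form z z"
    using mech_form_coercive[OF D(1,2) p(2), of l \<beta>] by blast
  have "penalized_mechanics X D \<delta> \<beta> l s \<kappa> CT CL" if \<delta>: "\<forall>e\<in>int_faces X. \<delta> e \<ge> \<delta>0" for \<delta>
  proof (unfold_locales)
    show "mu D > 0" "coup D > 0" "modM D > 0" "\<kappa> > 0" "CT > 0" "CL > 0" using D p by auto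
    fix z assume z: "z \<in> H_h X l"
    have E: "E_form z z \<ge> 0" and j: "jump_form z z \<ge> 0"
      using psd_formD(3)[OF psd_E_form z] psd_formD(3)[OF psd_jump_form z] by auto
    show co: "mech_form D \<delta> \<beta> z z \<ge> mu D * E_form z z + \<kappa> * jump_form z z" by (rule \<delta>0(2)[OF \<delta> z])
    have "mu D * E_form z z \<le> mech_form D \<delta> \<beta> z z" "\<kappa> * jump_form z z \<le> mech_form D \<delta> \<beta> z z"
      using co mult_nonneg_nonneg[OF less_imp_le[OF p(2)] j] mult_nonneg_nonneg[OF less_imp_le[OF D(1)] E] by linarith+
    then have E': "E_form z z \<le> mech_form D \<delta> \<beta> z z / mu D" and j': "jump_form z z \<le> mech_form D \<delta> \<beta> z z / \<kappa>"
      using D(1) p(2) by (simp_all add: pos_le_divide_eq mult.commute)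
    have Ej: "x * E_form z z + y * jump_form z z \<le> (x / mu D + y / \<kappa>) * mech_form D \<delta> \<beta> z z"
      if "x \<ge> 0" "y \<ge> 0" for x y
      using add_mono[OF mult_left_mono[OF E' that(1)] mult_left_mono[OF j' that(2)]] by (simp add: distrib_right)
    have "ip (region X) z z \<le> Ck * (E_form z z + jump_form z z)" using Ck(2) z by blast
    also have "\<dots> \<le> Ck * ((1 / mu D + 1 / \<kappa>) * mech_form D \<delta> \<beta> z z)"
      using Ej[of 1 1] Ck(1) by (intro mult_left_mono) auto
    finally show "ip (region X) z z \<le> CL * mech_form D \<delta> \<beta> z z" by (simp add: CL_def)
    fix w assume w: "w \<in> W_h X s"
    have W: "ip (region X) w w \<ge> 0" by (rule psd_formD(3)[OF psd_ip_on(1) w])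
    have dv: "(div_form X z w)\<^sup>2 \<le> Cd * E_form z z * ip (region X) w w"
      and Jp: "(J_p X w z)\<^sup>2 \<le> Cp * jump_form z z * ip (region X) w w"
      using Cd(2) Cp(2) z w by blast+
    show "2 * \<bar>coup D * J_p X w z\<bar> \<le> ip (region X) w w / modM D + \<kappa> * jump_form z z"
    proof (rule power2_le_imp_le)
      have "(2 * \<bar>coup D * J_p X w z\<bar>)\<^sup>2 = 4 * b\<^sup>2 * (J_p X w z)\<^sup>2" by (simp add: b_def power_mult_distrib)
      also have "\<dots> \<le> 4 * b\<^sup>2 * (Cp * jump_form z z * ip (region X) w w)"
        using Jp by (intro mult_left_mono) auto
      also have "\<dots> = 4 * (ip (region X) w w / modM D) * (\<kappa> * jump_form z z)"
        using D(4) by (simp add: \<kappa>_def)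
      also have "4 * x * y \<le> (x + y)\<^sup>2" for x y :: real
        using sum_squares_bound[of x y] by (simp add: power2_sum)
      finally show "(2 * \<bar>coup D * J_p X w z\<bar>)\<^sup>2 \<le> (ip (region X) w w / modM D + \<kappa> * jump_form z z)\<^sup>2" .
    qed (use W D(4) j p(2) in simp)
    have "(coupling D z w)\<^sup>2 \<le> 2 * (b * div_form X z w)\<^sup>2 + 2 * (b * J_p X w z)\<^sup>2"
    proof -
      have "(x - y)\<^sup>2 \<le> 2 * x\<^sup>2 + 2 * y\<^sup>2" for x y :: real
        using zero_le_power2[of "x + y"] by (simp add: power2_sum power2_diff)
      then show ?thesis by (simp add: coupling_def b_def)
    qed
    also have "\<dots> = 2 * b\<^sup>2 * ((div_form X z w)\<^sup>2 + (J_p X w z)\<^sup>2)" by (simp add: power_mult_distrib distrib_left)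
    also have "\<dots> \<le> 2 * b\<^sup>2 * (Cd * E_form z z * ip (region X) w w + Cp * jump_form z z * ip (region X) w w)"
      using dv Jp by (intro mult_left_mono add_mono) auto
    also have "\<dots> = 2 * b\<^sup>2 * ((Cd * E_form z z + Cp * jump_form z z) * ip (region X) w w)" by (simp add: distrib_right)
    also have "\<dots> \<le> 2 * b\<^sup>2 * (((Cd / mu D + Cp / \<kappa>) * mech_form D \<delta> \<beta> z z) * ip (region X) w w)"
      using Ej[of Cd Cp] Cd(1) Cp(1) W by (intro mult_left_mono mult_right_mono) auto
    finally show "(coupling D z w)\<^sup>2 \<le> CT * mech_form D \<delta> \<beta> z z * ip (region X) w w" by (simp add: CT_def)
  qed
  then show ?thesis using \<delta>0(1) p(3) by blast
qed

context penalized_mechanics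
begin

abbreviation "a \<equiv> mech_form D \<delta> \<beta>"

lemma psd_a: "psd_form (H_h X l) a"
proof -
  have "a z z \<ge> 0" if z: "z \<in> H_h X l" for z
    using coercive[OF z] mult_nonneg_nonneg[OF less_imp_le[OF pos(1)] psd_formD(3)[OF psd_E_form z]]
      mult_nonneg_nonneg[OF less_imp_le[OF pos(4)] psd_formD(3)[OF psd_jump_form z]] by linarith
  then show ?thesis unfolding psd_form_def using bil_on_mech_form mech_form_sym by blast
qed

lemma a_jump:
  assumes z: "z \<in> H_h X l"
  shows "\<kappa> * jump_form z z \<le> a z z"
  using coercive[OF z] mult_nonneg_nonneg[OF less_imp_le[OF pos(1)] psd_formD(3)[OF psd_E_form z]] by linarith

text \<open>Substituting the identity into the coupling bound gives the squared energy on the left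
  and the energy to the first power on the right, so one factor cancels.\<close>

lemma displacement_bound:
  assumes "u \<in> H_h X l" "p \<in> W_h X s" "a u u = coupling D u p"
  shows "a u u \<le> CT * ip (region X) p p"
proof (cases "a u u = 0")
  case True
  then show ?thesis using psd_formD(3)[OF psd_ip_on(1) assms(2)] pos by simp
next
  case False
  then have p: "a u u > 0" using psd_formD(3)[OF psd_a assms(1)] by simp
  have "a u u * a u u \<le> CT * a u u * ip (region X) p p"
    using coupling_bound[OF assms(1,2)] assms(3) by (simp add: power2_eq_square)
  then show ?thesis using p by simp
qed

text \<open>Here c stands for the flux term. Polarization turns -2 a(u', u) into the energy of u' -
  u minus the two single energies, and 2 L (p' - p, p') into squares with L |p' - p|^2; the energy
  of the increment is at most this last square, so the mixed pressure terms cancel exactly. The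
  energy of u pays for the jumps in the face coupling.\<close>

lemma coupling_step:
  assumes u: "u \<in> H_h X l" "\<And>z. z \<in> H_h X l \<Longrightarrow> a u z = coupling D z p"
    and u': "u' \<in> H_h X l" "\<And>z. z \<in> H_h X l \<Longrightarrow> a u' z = coupling D z p'"
    and p: "p \<in> W_h X s" "p' \<in> W_h X s" and L: "L \<ge> CT"
    and flow: "1 / modM D * ip (region X) p' p' + L * ip (region X) (p' - p) p' + c = - coup D * div_form X u p'"
  shows "(1 / (2 * modM D) + L / 2) * ip (region X) p' p' + c \<le> L / 2 * ip (region X) p p"
proof -
  note I = psd_ip_on(1)[of s]
  have dp: "p' - p \<in> W_h X s" and du: "u' - u \<in> H_h X l"
    using p u u' subspace_diff subspace_W_h subspace_H_h by blast+
  \<comment> \<open>The increment of the displacement is driven by the increment of the pressure, so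
    the displacement bound applies to it.\<close>
  have "a (u' - u) (u' - u) = coupling D (u' - u) (p' - p)"
    using lin_on_diff[OF bil_on_left[OF bil_on_mech_form du] subspace_H_h u'(1) u(1)] u(2)[OF du] u'(2)[OF du]
      lin_on_diff[OF bil_on_right[OF bil_on_coupling du] subspace_W_h p(2,1)] by simp
  then have "a (u' - u) (u' - u) \<le> CT * ip (region X) (p' - p) (p' - p)"
    by (rule displacement_bound[OF du dp])
  also have "\<dots> \<le> L * ip (region X) (p' - p) (p' - p)"
    using L psd_formD(3)[OF I dp] by (intro mult_right_mono) auto
  finally have 1: "a u' u' - 2 * a u' u + a u u \<le> L * ip (region X) (p' - p) (p' - p)"
    using psd_form_diff[OF psd_a subspace_H_h u'(1) u(1)] by simp
  have 2: "ip (region X) (p' - p) (p' - p) = ip (region X) p' p' - 2 * ip (region X) p' p + ip (region X) p p"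
    by (rule psd_form_diff[OF I subspace_W_h p(2,1)])
  have 3: "ip (region X) (p' - p) p' = ip (region X) p' p' - ip (region X) p' p"
    using lin_on_diff[OF psd_formD(4)[OF I p(2)] subspace_W_h p(2,1)] psd_formD(2)[OF I p] by simp
  have 4: "a u' u = coup D * div_form X u p' - coup D * J_p X p' u"
    using u'(2)[OF u(1)] by (simp add: coupling_def)
  have 5: "2 * \<bar>coup D * J_p X p' u\<bar> \<le> ip (region X) p' p' / modM D + \<kappa> * jump_form u u"
    by (rule face_coupling[OF u(1) p(2)])
  have 6: "a u' u' \<ge> 0" "\<kappa> * jump_form u u \<le> a u u"
    using psd_formD(3)[OF psd_a u'(1)] a_jump[OF u(1)] by auto
  define P' P Q where "P' = ip (region X) p' p'" and "P = ip (region X) p p" and "Q = ip (region X) p' p"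
  define J where "J = coup D * J_p X p' u"
  have f: "P' / modM D + L * (P' - Q) + c = - (a u' u + J)"
    using flow 4 unfolding 3 P'_def Q_def J_def by simp
  have "- 2 * a u' u \<le> L * (P' - 2 * Q + P) - \<kappa> * jump_form u u"
    using 1 6 unfolding 2 P'_def P_def Q_def by linarith
  moreover have "- 2 * J \<le> P' / modM D + \<kappa> * jump_form u u"
    using 5 unfolding J_def P'_def by linarith
  moreover have "2 * (P' / modM D + L * (P' - Q) + c) = - 2 * a u' u - 2 * J"
    using f by simp
  ultimately have "2 * (P' / modM D + L * (P' - Q) + c) \<le> L * (P' - 2 * Q + P) + P' / modM D"
    by linarith
  moreover have "y + L * P' + 2 * c \<le> L * P" if "2 * (y + L * (P' - Q) + c) \<le> L * (P' - 2 * Q + P) + y" for y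
    using that by (simp add: algebra_simps)
  ultimately have "P' / modM D + L * P' + 2 * c \<le> L * P" by blast
  then show ?thesis using pos(3) by (simp add: P'_def P_def field_simps)
qed

end

text \<open>\<open>mech\<close> and \<open>darcy\<close> hold from index 1 on, since the starting
  coefficients are arbitrary elements of the spaces; \<open>mass\<close> couples the new pressure to
  the old displacement.\<close>

locale splitting_error = penalized_mechanics X D \<delta> \<beta> l s \<kappa> CT CL + time_interval G r n
  for X :: "('d::finite) mesh" and D :: "'d biot" and \<delta> \<beta> l s \<kappa> CT CL G r n +
  fixes L :: real and eP :: "nat \<Rightarrow> nat \<Rightarrow> real^'d \<Rightarrow> real" and eQ eU :: "nat \<Rightarrow> nat \<Rightarrow> real^'d \<Rightarrow> real^'d"
  assumes data: "biot_data X r G D" and L: "L \<ge> CT"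
    and in_spaces: "\<And>k i. i \<le> r \<Longrightarrow> eP k i \<in> W_h X s" "\<And>k i. i \<le> r \<Longrightarrow> eQ k i \<in> V_h X s" "\<And>k i. i \<le> r \<Longrightarrow> eU k i \<in> H_h X l"
    and mass: "\<And>k i w. i \<le> r \<Longrightarrow> w \<in> W_h X s \<Longrightarrow>
      1 / modM D * (\<Sum>j\<le>r. alpha G r n i j * ip (region X) (eP (Suc k) j) w)
      + L * (\<Sum>j\<le>r. alpha G r n i j * ip (region X) (eP (Suc k) j - eP k j) w)
      + tau G n * betaii G r n i * ip (region X) (wdiv (region X) (eQ (Suc k) i)) w
      = - coup D * (\<Sum>j\<le>r. alpha G r n i j * div_form X (eU k j) w)"
    and darcy: "\<And>k i v. i \<le> r \<Longrightarrow> v \<in> V_h X s \<Longrightarrow>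
      perm_form D (eQ (Suc k) i) v = ip (region X) (eP (Suc k) i) (wdiv (region X) v)"
    and mech: "\<And>k i z. i \<le> r \<Longrightarrow> z \<in> H_h X l \<Longrightarrow> mech_form D \<delta> \<beta> (eU (Suc k) i) z = coupling D z (eP (Suc k) i)"
begin

section \<open>Decay of the combined errors on one interval\<close>

definition SP :: "nat \<Rightarrow> nat \<Rightarrow> real^'d \<Rightarrow> real" where "SP k i = (\<Sum>j\<le>r. alpha G r n i j *\<^sub>R eP k j)"
definition SU :: "nat \<Rightarrow> nat \<Rightarrow> real^'d \<Rightarrow> real^'d" where "SU k i = (\<Sum>j\<le>r. alpha G r n i j *\<^sub>R eU k j)"
abbreviation wt :: "nat \<Rightarrow> real" where "wt i \<equiv> tau G n * betaii G r n i"

lemma SP_W: "SP k i \<in> W_h X s" and SU_H: "SU k i \<in> H_h X l"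
  unfolding SP_def SU_def using in_spaces
  by (auto intro!: subspace_sum subspace_scale subspace_W_h subspace_H_h)

lemma SP_lin: "lin_on (W_h X s) f \<Longrightarrow> f (SP k i) = (\<Sum>j\<le>r. alpha G r n i j * f (eP k j))"
  unfolding SP_def by (rule lin_on_sum[OF _ subspace_W_h]) (auto simp: in_spaces)

lemma SU_lin: "lin_on (H_h X l) f \<Longrightarrow> f (SU k i) = (\<Sum>j\<le>r. alpha G r n i j * f (eU k j))"
  unfolding SU_def by (rule lin_on_sum[OF _ subspace_H_h]) (auto simp: in_spaces)

lemma SU_mech:
  assumes "z \<in> H_h X l"
  shows "a (SU (Suc k) i) z = coupling D z (SP (Suc k) i)"
  using SU_lin[OF bil_on_left[OF bil_on_mech_form assms]] SP_lin[OF bil_on_right[OF bil_on_coupling assms]]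
    mech[OF _ assms] by (auto intro!: sum.cong)

lemma SP_mass:
  assumes i: "i \<le> r" and w: "w \<in> W_h X s"
  shows "1 / modM D * ip (region X) (SP (Suc k) i) w + L * ip (region X) (SP (Suc k) i - SP k i) w
     + wt i * ip (region X) (wdiv (region X) (eQ (Suc k) i)) w = - coup D * div_form X (SU k i) w"
proof -
  note lw = psd_formD(4)[OF psd_ip_on(1) w]
  have "ip (region X) (SP (Suc k) i - SP k i) w = (\<Sum>j\<le>r. alpha G r n i j * ip (region X) (eP (Suc k) j - eP k j) w)"
    unfolding lin_on_diff[OF lw subspace_W_h SP_W SP_W] SP_lin[OF lw] sum_subtractf[symmetric]
    by (intro sum.cong refl) (simp add: lin_on_diff[OF lw subspace_W_h] in_spaces right_diff_distrib)
  then show ?thesis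
    using mass[OF i w, of k] unfolding SP_lin[OF lw] SU_lin[OF bil_on_left[OF bil_on_div_form w]] by simp
qed

text \<open>Dividing by \<open>wt i\<close> puts the flux terms of all rows on the same scale; it is
  their unweighted sum that is nonnegative.\<close>

definition Y :: "nat \<Rightarrow> real" where "Y k = (\<Sum>i\<le>r. ip (region X) (SP k i) (SP k i) / wt i)"

text \<open>Darcy's law, tested with the flux of the i-th row, replaces the combination of pressures
  by the same combination of fluxes, and \<open>alpha_monotone\<close> applies to the permeability
  form.\<close>

lemma flux_sum_nonneg: "(\<Sum>i\<le>r. ip (region X) (wdiv (region X) (eQ (Suc k) i)) (SP (Suc k) i)) \<ge> 0"
proof -
  have "ip (region X) (wdiv (region X) (eQ (Suc k) i)) (SP (Suc k) i)
      = (\<Sum>j\<le>r. alpha G r n i j * perm_form D (eQ (Suc k) j) (eQ (Suc k) i))" if i: "i \<le> r" for i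
  proof -
    have sub: "W_h X s \<subseteq> L2 (region X)" using W_h_L2 by blast
    have "lin_on (W_h X s) (ip (region X) (wdiv (region X) (eQ (Suc k) i)))"
      using lin_on_subset[OF bil_on_right[OF bil_on_ip wdiv_L2[OF V_h_Hdiv[OF in_spaces(2)[OF i]]]] sub] .
    from SP_lin[OF this] show ?thesis
      using darcy[OF _ in_spaces(2)[OF i]] by (auto intro!: sum.cong simp: ip_def mult.commute)
  qed
  then have "(\<Sum>i\<le>r. ip (region X) (wdiv (region X) (eQ (Suc k) i)) (SP (Suc k) i))
     = (\<Sum>i\<le>r. \<Sum>j\<le>r. alpha G r n i j * perm_form D (eQ (Suc k) j) (eQ (Suc k) i))" by simp
  also have "\<dots> \<ge> 0"
    by (rule alpha_monotone[OF psd_perm_form[OF data] subspace_L2]) (use in_spaces V_h_L2 in blast)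
  finally show ?thesis .
qed

text \<open>The old iterate has index \<open>Suc k\<close>, because \<open>coupling_step\<close>
  uses the mechanics equation for the old displacement as well.\<close>

lemma Y_contraction: "(1 / (2 * modM D) + L / 2) * Y (Suc (Suc k)) \<le> L / 2 * Y (Suc k)"
proof -
  have "(1 / (2 * modM D) + L / 2) * (ip (region X) (SP (Suc (Suc k)) i) (SP (Suc (Suc k)) i) / wt i)
      + ip (region X) (wdiv (region X) (eQ (Suc (Suc k)) i)) (SP (Suc (Suc k)) i)
    \<le> L / 2 * (ip (region X) (SP (Suc k) i) (SP (Suc k) i) / wt i)" if i: "i \<le> r" for i
  proof -
    have "(1 / (2 * modM D) + L / 2) * ip (region X) (SP (Suc (Suc k)) i) (SP (Suc (Suc k)) i)
      + wt i * ip (region X) (wdiv (region X) (eQ (Suc (Suc k)) i)) (SP (Suc (Suc k)) i)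
      \<le> L / 2 * ip (region X) (SP (Suc k) i) (SP (Suc k) i)"
      by (rule coupling_step[OF SU_H SU_mech SU_H SU_mech SP_W SP_W L SP_mass[OF i SP_W]])
    moreover have "x * (y / w) + z \<le> v * (y' / w)" if "x * y + w * z \<le> v * y'" "w > 0" for v w x y z y' :: real
      using divide_right_mono[OF that(1), of w] that(2) by (simp add: add_divide_distrib)
    ultimately show ?thesis using weight_pos[OF i] by blast
  qed
  then have "(\<Sum>i\<le>r. (1 / (2 * modM D) + L / 2) * (ip (region X) (SP (Suc (Suc k)) i) (SP (Suc (Suc k)) i) / wt i)
      + ip (region X) (wdiv (region X) (eQ (Suc (Suc k)) i)) (SP (Suc (Suc k)) i))
    \<le> (\<Sum>i\<le>r. L / 2 * (ip (region X) (SP (Suc k) i) (SP (Suc k) i) / wt i))"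
    by (intro sum_mono) simp
  then show ?thesis
    using flux_sum_nonneg[of "Suc k"] unfolding Y_def sum.distrib sum_distrib_left by linarith
qed

lemma Y_tendsto_0: "Y \<longlonglongrightarrow> 0"
proof -
  define q where "q = (L / 2) / (1 / (2 * modM D) + L / 2)"
  have L0: "L > 0" using L pos by linarith
  have d: "1 / (2 * modM D) + L / 2 > 0" using L0 pos by (simp add: add_pos_pos)
  have q: "0 \<le> q" "q < 1" using d L0 pos by (auto simp: q_def)
  have nn: "Y k \<ge> 0" for k
    unfolding Y_def using weight_pos psd_formD(3)[OF psd_ip_on(1) SP_W]
    by (intro sum_nonneg divide_nonneg_nonneg) (auto simp: less_imp_le)
  have step: "Y (Suc (Suc k)) \<le> q * Y (Suc k)" for k
  proof -
    have "y \<le> x / d * z" if "d * y \<le> x * z" "d > 0" for d x y z :: real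
      using that by (simp add: field_simps)
    then show ?thesis using Y_contraction[of k] d unfolding q_def by blast
  qed
  have "Y (Suc k) \<le> q ^ k * Y 1" for k
  proof (induction k)
    case (Suc k)
    have "Y (Suc (Suc k)) \<le> q * (q ^ k * Y 1)"
      using step[of k] mult_left_mono[OF Suc q(1)] by linarith
    then show ?case by simp
  qed simp
  note bound = this
  note lim = tendsto_mult_left_zero[OF LIMSEQ_realpow_zero[OF q], of "Y 1"]
  have "(\<lambda>k. Y (Suc k)) \<longlonglongrightarrow> 0"
    by (rule tendsto_sandwich[OF _ _ tendsto_const lim]) (use nn bound in auto)
  then show ?thesis by (rule LIMSEQ_imp_Suc)
qed

lemma SP_tendsto_0:
  assumes i: "i \<le> r"
  shows "(\<lambda>k. ip (region X) (SP k i) (SP k i)) \<longlonglongrightarrow> 0"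
proof (rule tendsto_sandwich[OF _ _ tendsto_const tendsto_mult_right_zero[OF Y_tendsto_0, of "wt i"]])
  have nn: "ip (region X) (SP k i) (SP k i) \<ge> 0" for k i by (rule psd_formD(3)[OF psd_ip_on(1) SP_W])
  show "\<forall>\<^sub>F k in sequentially. 0 \<le> ip (region X) (SP k i) (SP k i)" using nn by simp
  have "ip (region X) (SP k i) (SP k i) / wt i \<le> Y k" for k
    unfolding Y_def using i weight_pos nn
    by (intro member_le_sum) (auto intro!: divide_nonneg_nonneg simp: less_imp_le)
  then show "\<forall>\<^sub>F k in sequentially. ip (region X) (SP k i) (SP k i) \<le> wt i * Y k"
    using weight_pos[OF i] by (simp add: pos_divide_le_eq mult.commute)
qed

text \<open>\<open>alpha_bound\<close> is applied pointwise, to the values of the pressure errors at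
  x, and then integrated over the region.\<close>

lemma eP_tendsto_0:
  assumes j: "j \<le> r"
  shows "(\<lambda>k. ip (region X) (eP k j) (eP k j)) \<longlonglongrightarrow> 0"
proof -
  obtain C where C: "C > 0" "\<And>c. (\<Sum>j\<le>r. (c j)\<^sup>2) \<le> C * (\<Sum>i\<le>r. (\<Sum>j\<le>r. alpha G r n i j * c j)\<^sup>2)"
    using alpha_bound by blast
  have bound: "ip (region X) (eP k j) (eP k j) \<le> C * (\<Sum>i\<le>r. ip (region X) (SP k i) (SP k i))" for k
  proof -
    have int: "integrable (lebesgue_on (region X)) (\<lambda>x. (SP k i x)\<^sup>2)" for i
      using L2_integrable_inner[OF W_h_L2[OF SP_W] W_h_L2[OF SP_W], of k i k i] by (simp add: power2_eq_square)
    have inte: "integrable (lebesgue_on (region X)) (\<lambda>x. (eP k j x)\<^sup>2)"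
      using L2_integrable_inner[OF W_h_L2[OF in_spaces(1)[OF j]] W_h_L2[OF in_spaces(1)[OF j]], of k k]
      by (simp add: power2_eq_square)
    have "ip (region X) (eP k j) (eP k j) = (LINT x|lebesgue_on (region X). (eP k j x)\<^sup>2)"
      by (simp add: ip_def power2_eq_square)
    also have "\<dots> \<le> (LINT x|lebesgue_on (region X). C * (\<Sum>i\<le>r. (SP k i x)\<^sup>2))"
    proof (rule integral_mono[OF inte])
      show "integrable (lebesgue_on (region X)) (\<lambda>x. C * (\<Sum>i\<le>r. (SP k i x)\<^sup>2))" using int by auto
      fix x
      have "(eP k j x)\<^sup>2 \<le> (\<Sum>j\<le>r. (eP k j x)\<^sup>2)" using j by (intro member_le_sum) auto
      also have "\<dots> \<le> C * (\<Sum>i\<le>r. (\<Sum>j\<le>r. alpha G r n i j * eP k j x)\<^sup>2)" by (rule C(2))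
      finally show "(eP k j x)\<^sup>2 \<le> C * (\<Sum>i\<le>r. (SP k i x)\<^sup>2)" by (simp add: SP_def sum_fun_apply)
    qed
    also have "\<dots> = C * (\<Sum>i\<le>r. LINT x|lebesgue_on (region X). (SP k i x)\<^sup>2)"
      using int by (simp add: Bochner_Integration.integral_sum)
    finally show ?thesis by (simp add: ip_def power2_eq_square)
  qed
  have "(\<lambda>k. C * (\<Sum>i\<le>r. ip (region X) (SP k i) (SP k i))) \<longlonglongrightarrow> C * (\<Sum>i\<le>r. 0)"
    using SP_tendsto_0 by (intro tendsto_intros) auto
  then have lim: "(\<lambda>k. C * (\<Sum>i\<le>r. ip (region X) (SP k i) (SP k i))) \<longlonglongrightarrow> 0" by simp
  show ?thesis
    by (rule tendsto_sandwich[OF _ _ tendsto_const lim])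
      (use bound psd_formD(3)[OF psd_ip_on(1) in_spaces(1)[OF j]] in auto)
qed

text \<open>Bounds by the pressure error are available only from index 1 on, hence the
  shift.\<close>

lemma tendsto_0_of_eP:
  assumes j: "j \<le> r" and "\<And>k. 0 \<le> f k" "\<And>k. f (Suc k) \<le> c * ip (region X) (eP (Suc k) j) (eP (Suc k) j)"
  shows "f \<longlonglongrightarrow> 0"
proof -
  note lim = tendsto_mult_right_zero[OF LIMSEQ_Suc[OF eP_tendsto_0[OF j]], of c]
  have "(\<lambda>k. f (Suc k)) \<longlonglongrightarrow> 0"
    by (rule tendsto_sandwich[OF _ _ tendsto_const lim]) (use assms in auto)
  then show ?thesis by (rule LIMSEQ_imp_Suc)
qed

lemma eU_tendsto_0:
  assumes j: "j \<le> r"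
  shows "(\<lambda>k. ip (region X) (eU k j) (eU k j)) \<longlonglongrightarrow> 0"
proof (rule tendsto_0_of_eP[OF j])
  show "0 \<le> ip (region X) (eU k j) (eU k j)" for k by (rule psd_formD(3)[OF psd_ip_on(3) in_spaces(3)[OF j]])
  fix k
  note u = in_spaces(3)[OF j, of "Suc k"]
  have "ip (region X) (eU (Suc k) j) (eU (Suc k) j) \<le> CL * a (eU (Suc k) j) (eU (Suc k) j)" by (rule L2_bound[OF u])
  also have "\<dots> \<le> CL * (CT * ip (region X) (eP (Suc k) j) (eP (Suc k) j))"
    using pos by (intro mult_left_mono displacement_bound[OF u in_spaces(1)[OF j] mech[OF j u]]) auto
  finally show "ip (region X) (eU (Suc k) j) (eU (Suc k) j) \<le> (CL * CT) * ip (region X) (eP (Suc k) j) (eP (Suc k) j)"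
    by simp
qed

text \<open>Darcy's law with the flux error as test field, Cauchy-Schwarz and the inverse inequality
  bound the square of the permeability form by a multiple of itself times the squared pressure
  error; one factor cancels.\<close>

lemma eQ_tendsto_0:
  assumes j: "j \<le> r"
  shows "(\<lambda>k. ip (region X) (eQ k j) (eQ k j)) \<longlonglongrightarrow> 0"
    "(\<lambda>k. ip (region X) (wdiv (region X) (eQ k j)) (wdiv (region X) (eQ k j))) \<longlonglongrightarrow> 0"
proof -
  obtain Cw where Cw: "Cw > 0" "\<forall>v\<in>V_h X s. ip (region X) (wdiv (region X) v) (wdiv (region X) v) \<le> Cw * ip (region X) v v"
    using wdiv_bound by blast
  obtain Ck where Ck: "Ck > 0" "\<forall>v\<in>V_h X s. ip (region X) v v \<le> Ck * perm_form D v v"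
    using perm_bound[OF data] by blast
  have nnQ: "0 \<le> ip (region X) (eQ k j) (eQ k j)" for k by (rule psd_formD(3)[OF psd_ip_on(2) in_spaces(2)[OF j]])
  have nnW: "0 \<le> ip (region X) (wdiv (region X) (eQ k j)) (wdiv (region X) (eQ k j))" for k
    by (rule psd_formD(3)[OF psd_form_ip wdiv_L2[OF V_h_Hdiv[OF in_spaces(2)[OF j]]]])
  have Q: "ip (region X) (eQ (Suc k) j) (eQ (Suc k) j) \<le> Ck * (Cw * Ck) * ip (region X) (eP (Suc k) j) (eP (Suc k) j)" for k
  proof -
    define v where "v = eQ (Suc k) j"
    define p where "p = eP (Suc k) j"
    have v: "v \<in> V_h X s" and p: "p \<in> W_h X s" using in_spaces j by (auto simp: v_def p_def)
    have pf: "perm_form D v v \<ge> 0" by (rule psd_formD(3)[OF psd_perm_form[OF data] V_h_L2[OF v]])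
    have pp: "ip (region X) p p \<ge> 0" by (rule psd_formD(3)[OF psd_ip_on(1) p])
    have "(perm_form D v v)\<^sup>2 \<le> ip (region X) p p * ip (region X) (wdiv (region X) v) (wdiv (region X) v)"
      using psd_form_Cauchy_Schwarz[where A = "ip (region X)", OF psd_form_ip subspace_L2 W_h_L2[OF p] wdiv_L2[OF V_h_Hdiv[OF v]]]
        darcy[OF j v, of k] by (simp add: v_def p_def)
    also have "\<dots> \<le> ip (region X) p p * (Cw * (Ck * perm_form D v v))"
    proof (rule mult_left_mono[OF _ pp])
      have "ip (region X) (wdiv (region X) v) (wdiv (region X) v) \<le> Cw * ip (region X) v v" using Cw(2) v by blast
      also have "\<dots> \<le> Cw * (Ck * perm_form D v v)" using Cw(1) Ck(2) v by (intro mult_left_mono) auto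
      finally show "ip (region X) (wdiv (region X) v) (wdiv (region X) v) \<le> Cw * (Ck * perm_form D v v)" .
    qed
    finally have "perm_form D v v * perm_form D v v \<le> (Cw * Ck * ip (region X) p p) * perm_form D v v"
      by (simp add: power2_eq_square mult_ac)
    then have "perm_form D v v \<le> Cw * Ck * ip (region X) p p"
      using pf pp Cw(1) Ck(1) by (cases "perm_form D v v = 0") auto
    then have "Ck * perm_form D v v \<le> Ck * (Cw * Ck * ip (region X) p p)" using Ck(1) by (intro mult_left_mono) auto
    then show ?thesis using Ck(2) v unfolding v_def p_def by force
  qed
  show "(\<lambda>k. ip (region X) (eQ k j) (eQ k j)) \<longlonglongrightarrow> 0" by (rule tendsto_0_of_eP[OF j nnQ Q])
  note lim = tendsto_mult_right_zero[OF this, of Cw]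
  show "(\<lambda>k. ip (region X) (wdiv (region X) (eQ k j)) (wdiv (region X) (eQ k j))) \<longlonglongrightarrow> 0"
    by (rule tendsto_sandwich[OF _ _ tendsto_const lim]) (use nnW Cw(2) in_spaces(2)[OF j] in auto)
qed

end

section \<open>Convergence of the iterates\<close>

lemma time_grid_intervalI:
  assumes "time_grid T r G" "n \<in> {1..steps G}"
  shows "time_interval G r n"
proof
  show "tn G (n - 1) < tn G n"
    using assms by (auto simp: time_grid_def intro!: strict_mono_onD[of "{..steps G}" "tn G"])
  show "inj_on (gnode G n) {..r}"
    using assms by (auto simp: time_grid_def gauss_nodes_def)
qed

lemma left_lim_expands:
  assumes "time_grid T r G" "expands G r w C" "n \<in> {1..steps G}"
  shows "left_lim w (tn G n) = (\<Sum>j\<le>r. phi G r n j (tn G n) *\<^sub>R C n j)"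
proof
  fix x
  have less: "tn G (n - 1) < tn G n" using time_interval.step[OF time_grid_intervalI[OF assms(1,3)]] .
  have "((\<lambda>t. \<Sum>j\<le>r. phi G r n j t *\<^sub>R C n j x) \<longlongrightarrow> (\<Sum>j\<le>r. phi G r n j (tn G n) *\<^sub>R C n j x)) (at_left (tn G n))"
    unfolding phi_eq_poly by (intro tendsto_intros)
  moreover have "\<forall>\<^sub>F t in at_left (tn G n). (\<Sum>j\<le>r. phi G r n j t *\<^sub>R C n j x) = w t x"
    using eventually_at_left_real[OF less] by eventually_elim (use assms in \<open>auto simp: expands_def I_n_def\<close>)
  ultimately have "((\<lambda>t. w t x) \<longlongrightarrow> (\<Sum>j\<le>r. phi G r n j (tn G n) *\<^sub>R C n j x)) (at_left (tn G n))"
    by (rule Lim_transform_eventually)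
  from tendsto_Lim[OF trivial_limit_at_left_real this]
  show "left_lim w (tn G n) x = (\<Sum>j\<le>r. phi G r n j (tn G n) *\<^sub>R C n j) x"
    by (simp add: left_lim_def sum_fun_apply scaleR_fun_apply)
qed

text \<open>The right limit belongs to the polynomial piece on the next interval, evaluated at the
  left end point of that interval.\<close>

lemma right_lim_expands:
  assumes "time_grid T r G" "expands G r w C" "n \<in> {1..<steps G}"
  shows "right_lim w (tn G n) = (\<Sum>j\<le>r. phi G r (Suc n) j (tn G n) *\<^sub>R C (Suc n) j)"
proof
  fix x
  have n: "Suc n \<in> {1..steps G}" using assms(3) by auto
  have less: "tn G n < tn G (Suc n)" using time_interval.step[OF time_grid_intervalI[OF assms(1) n]] by simp
  have "((\<lambda>t. \<Sum>j\<le>r. phi G r (Suc n) j t *\<^sub>R C (Suc n) j x) \<longlongrightarrow> (\<Sum>j\<le>r. phi G r (Suc n) j (tn G n) *\<^sub>R C (Suc n) j x)) (at_right (tn G n))"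
    unfolding phi_eq_poly by (intro tendsto_intros)
  moreover have "\<forall>\<^sub>F t in at_right (tn G n). (\<Sum>j\<le>r. phi G r (Suc n) j t *\<^sub>R C (Suc n) j x) = w t x"
    using eventually_at_right_real[OF less]
  proof eventually_elim
    fix t assume "t \<in> {tn G n<..<tn G (Suc n)}"
    then have "t \<in> I_n G (Suc n)" by (auto simp: I_n_def)
    then have "w t = (\<lambda>x. \<Sum>j\<le>r. phi G r (Suc n) j t *\<^sub>R C (Suc n) j x)"
      using assms(2) n unfolding expands_def by blast
    then show "(\<Sum>j\<le>r. phi G r (Suc n) j t *\<^sub>R C (Suc n) j x) = w t x" by simp
  qed
  ultimately have "((\<lambda>t. w t x) \<longlongrightarrow> (\<Sum>j\<le>r. phi G r (Suc n) j (tn G n) *\<^sub>R C (Suc n) j x)) (at_right (tn G n))"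
    by (rule Lim_transform_eventually)
  from tendsto_Lim[OF trivial_limit_at_right_real this]
  show "right_lim w (tn G n) x = (\<Sum>j\<le>r. phi G r (Suc n) j (tn G n) *\<^sub>R C (Suc n) j) x"
    by (simp add: right_lim_def sum_fun_apply scaleR_fun_apply)
qed

lemma subspace_combination:
  "subspace S \<Longrightarrow> (\<And>j. j \<le> (r::nat) \<Longrightarrow> C j \<in> S) \<Longrightarrow> (\<Sum>j\<le>r. c j *\<^sub>R C j) \<in> S"
  by (intro subspace_sum subspace_scale) auto

lemma psd_form_combination_tendsto_0:
  fixes r :: nat
  assumes A: "psd_form S A" "subspace S" and e: "\<And>k j. j \<le> r \<Longrightarrow> e k j \<in> S"
    and lim: "\<And>j. j \<le> r \<Longrightarrow> (\<lambda>k. A (e k j) (e k j)) \<longlonglongrightarrow> 0"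
  shows "(\<lambda>k::nat. A (\<Sum>j\<le>r. c j *\<^sub>R e k j) (\<Sum>j\<le>r. c j *\<^sub>R e k j)) \<longlonglongrightarrow> 0"
proof -
  have "(\<lambda>k. 2 ^ card {..r} * (\<Sum>j\<le>r. (c j)\<^sup>2 * A (e k j) (e k j))) \<longlonglongrightarrow> 2 ^ card {..r} * (\<Sum>j\<le>r. (c j)\<^sup>2 * 0)"
    using lim by (intro tendsto_intros) auto
  then have up: "(\<lambda>k. 2 ^ card {..r} * (\<Sum>j\<le>r. (c j)\<^sup>2 * A (e k j) (e k j))) \<longlonglongrightarrow> 0" by simp
  have "A (\<Sum>j\<le>r. c j *\<^sub>R e k j) (\<Sum>j\<le>r. c j *\<^sub>R e k j) \<le> 2 ^ card {..r} * (\<Sum>j\<le>r. (c j)\<^sup>2 * A (e k j) (e k j))" for k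
    by (rule psd_form_sum_bound[OF A finite_atMost]) (simp add: e)
  then show ?thesis
    by (intro tendsto_sandwich[OF _ _ tendsto_const up] always_eventually allI
        psd_formD(3)[OF A(1) subspace_combination[OF A(2) e]])
qed

lemma ip_self_nonneg: "ip A f f \<ge> 0"
  by (simp add: ip_def integral_nonneg_AE)

lemma L2_tendsto_iff: "L2_tendsto A f l \<longleftrightarrow> (\<lambda>k. ip A (f k - l) (f k - l)) \<longlonglongrightarrow> 0"
proof -
  have d: "(\<lambda>x. f k x - l x) = f k - l" for k by (simp add: fun_eq_iff)
  have "(\<lambda>k. sqrt (ip A (f k - l) (f k - l))) \<longlonglongrightarrow> 0 \<longleftrightarrow> (\<lambda>k. ip A (f k - l) (f k - l)) \<longlonglongrightarrow> 0"
    using tendsto_power[of "\<lambda>k. sqrt (ip A (f k - l) (f k - l))" 0 sequentially 2]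
      tendsto_real_sqrt[of "\<lambda>k. ip A (f k - l) (f k - l)" 0 sequentially]
    by (auto simp: ip_self_nonneg)
  then show ?thesis by (simp add: L2_tendsto_def L2norm_def d)
qed

lemma Hdiv_tendsto_iff:
  "Hdiv_tendsto A f l \<longleftrightarrow> (\<lambda>k. ip A (f k - l) (f k - l) + ip A (wdiv A (f k - l)) (wdiv A (f k - l))) \<longlonglongrightarrow> 0"
proof -
  let ?g = "\<lambda>k. ip A (f k - l) (f k - l) + ip A (wdiv A (f k - l)) (wdiv A (f k - l))"
  have d: "(\<lambda>x. f k x - l x) = f k - l" for k by (simp add: fun_eq_iff)
  have "(\<lambda>k. sqrt (?g k)) \<longlonglongrightarrow> 0 \<longleftrightarrow> ?g \<longlonglongrightarrow> 0"
    using tendsto_power[of "\<lambda>k. sqrt (?g k)" 0 sequentially 2] tendsto_real_sqrt[of ?g 0 sequentially]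
    by (auto simp: ip_self_nonneg)
  then show ?thesis by (simp add: Hdiv_tendsto_def Hdiv_norm_def L2norm_def d ip_self_nonneg)
qed

lemma combination_diff:
  "(\<Sum>j\<in>I. c j *\<^sub>R f j) - (\<Sum>j\<in>I. c j *\<^sub>R g j) = (\<Sum>j\<in>I. c j *\<^sub>R (f j - g j :: 'a::real_vector))"
  by (simp add: sum_subtractf scaleR_diff_right)

lemma L2_tendsto_combination:
  fixes r :: nat
  assumes "\<And>k j. j \<le> r \<Longrightarrow> f k j - g j \<in> L2 A"
    and "\<And>j. j \<le> r \<Longrightarrow> (\<lambda>k. ip A (f k j - g j) (f k j - g j)) \<longlonglongrightarrow> 0"
  shows "L2_tendsto A (\<lambda>k. \<Sum>j\<le>r. c j *\<^sub>R f k j) (\<Sum>j\<le>r. c j *\<^sub>R g j)"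
  unfolding L2_tendsto_iff combination_diff
  by (rule psd_form_combination_tendsto_0[where A = "ip A", OF psd_form_ip subspace_L2 assms])

lemma Hdiv_tendsto_combination:
  fixes r :: nat
  assumes A: "open A" and H: "\<And>k j. j \<le> r \<Longrightarrow> f k j - g j \<in> Hdiv A"
    and l: "\<And>j. j \<le> r \<Longrightarrow> (\<lambda>k. ip A (f k j - g j) (f k j - g j)) \<longlonglongrightarrow> 0"
      "\<And>j. j \<le> r \<Longrightarrow> (\<lambda>k. ip A (wdiv A (f k j - g j)) (wdiv A (f k j - g j))) \<longlonglongrightarrow> 0"
  shows "Hdiv_tendsto A (\<lambda>k. \<Sum>j\<le>r. c j *\<^sub>R f k j) (\<Sum>j\<le>r. c j *\<^sub>R g j)"
  unfolding Hdiv_tendsto_iff combination_diff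
  using tendsto_add[OF psd_form_combination_tendsto_0[where A = "ip A", OF psd_form_ip subspace_L2 Hdiv_L2[OF H] l(1), where c = c]
      psd_form_combination_tendsto_0[where A = "\<lambda>u v. ip A (wdiv A u) (wdiv A v)", OF psd_form_wdiv[OF A] subspace_Hdiv[OF A] H l(2), where c = c]]
  by simp

text \<open>At each time the squared error is dominated by squared basis functions times coefficient
  errors; integration in time turns the former into the fixed weights
  \<open>\<Phi> j\<close>.\<close>

lemma L2_time_tendsto_combination:
  fixes f :: "nat \<Rightarrow> nat \<Rightarrow> real^'d \<Rightarrow> 'b::euclidean_space"
  assumes e: "\<And>k j. j \<le> r \<Longrightarrow> f k j - g j \<in> L2 A"
    and l: "\<And>j. j \<le> r \<Longrightarrow> (\<lambda>k. ip A (f k j - g j) (f k j - g j)) \<longlonglongrightarrow> 0"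
    and w: "\<And>k t. t \<in> I_n G n \<Longrightarrow> wk k t = (\<lambda>x. \<Sum>j\<le>r. phi G r n j t *\<^sub>R f k j x)"
      "\<And>t. t \<in> I_n G n \<Longrightarrow> w t = (\<lambda>x. \<Sum>j\<le>r. phi G r n j t *\<^sub>R g j x)"
  shows "L2_time_tendsto A (I_n G n) wk w"
proof -
  define E where "E k j = ip A (f k j - g j) (f k j - g j)" for k j
  define B where "B k t = 2 ^ card {..r} * (\<Sum>j\<le>r. (phi G r n j t)\<^sup>2 * E k j)" for k t
  define \<Phi> where "\<Phi> j = (LINT t|lebesgue_on (I_n G n). (phi G r n j t)\<^sup>2)" for j
  have int: "integrable (lebesgue_on (I_n G n)) (\<lambda>t. (phi G r n j t)\<^sup>2)" for j
  proof -
    have "(\<lambda>t. (phi G r n j t)\<^sup>2) = poly ((lagrange_poly r (gnode G n) j)\<^sup>2)"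
      by (simp add: fun_eq_iff phi_eq_poly)
    then show ?thesis unfolding I_n_def by (simp only: poly_integrable)
  qed
  have intB: "integrable (lebesgue_on (I_n G n)) (B k)" for k
    unfolding B_def[abs_def] using int by (intro integrable_mult_right integrable_sum integrable_mult_left) auto
  have LB: "(LINT t|lebesgue_on (I_n G n). B k t) = 2 ^ card {..r} * (\<Sum>j\<le>r. \<Phi> j * E k j)" for k
    unfolding B_def \<Phi>_def using int by (simp add: Bochner_Integration.integral_sum)
  have "(\<lambda>k. 2 ^ card {..r} * (\<Sum>j\<le>r. \<Phi> j * E k j)) \<longlonglongrightarrow> 2 ^ card {..r} * (\<Sum>j\<le>r. \<Phi> j * 0)"
    unfolding E_def using l by (intro tendsto_intros) auto
  then have up: "(\<lambda>k. LINT t|lebesgue_on (I_n G n). B k t) \<longlonglongrightarrow> 0" by (simp add: LB)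
  have "(L2norm A (\<lambda>x. wk k t x - w t x))\<^sup>2 \<le> B k t" if t: "t \<in> I_n G n" for k t
  proof -
    have "(\<lambda>x. wk k t x - w t x) = (\<Sum>j\<le>r. phi G r n j t *\<^sub>R (f k j - g j))"
      by (simp add: fun_eq_iff w[OF t] sum_fun_apply scaleR_fun_apply sum_subtractf scaleR_diff_right)
    then have "(L2norm A (\<lambda>x. wk k t x - w t x))\<^sup>2 = ip A (\<Sum>j\<le>r. phi G r n j t *\<^sub>R (f k j - g j)) (\<Sum>j\<le>r. phi G r n j t *\<^sub>R (f k j - g j))"
      by (simp add: L2norm_def ip_self_nonneg)
    also have "\<dots> \<le> B k t"
      unfolding B_def E_def by (rule psd_form_sum_bound[where A = "ip A", OF psd_form_ip subspace_L2]) (auto intro: e)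
    finally show ?thesis .
  qed
  \<comment> \<open>\<open>integral_mono'\<close> asks only for the majorant to be integrable and
    nonnegative.\<close>
  then have le: "(LINT t|lebesgue_on (I_n G n). (L2norm A (\<lambda>x. wk k t x - w t x))\<^sup>2) \<le> (LINT t|lebesgue_on (I_n G n). B k t)" for k
    by (intro integral_mono' intB) (auto simp: B_def E_def ip_self_nonneg intro!: mult_nonneg_nonneg sum_nonneg)
  have "(\<lambda>k. LINT t|lebesgue_on (I_n G n). (L2norm A (\<lambda>x. wk k t x - w t x))\<^sup>2) \<longlonglongrightarrow> 0"
    by (rule tendsto_sandwich[OF _ _ tendsto_const up]) (use le in \<open>auto intro!: always_eventually integral_nonneg_AE\<close>)
  from tendsto_real_sqrt[OF this] show ?thesis
    by (simp add: L2_time_tendsto_def L2_time_norm_def)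
qed

lemma ip_diff_commute: "ip A (f - g) (f - g) = ip A (g - f) (g - f)"
  unfolding ip_def by (rule Bochner_Integration.integral_cong) (auto simp: inner_diff inner_commute)

text \<open>The triangle inequality through f k. The conclusion is a null difference rather than
  equality, as L2 limits are determined only almost everywhere.\<close>

lemma L2_tendsto_unique:
  assumes "L2_tendsto A f l" "L2_tendsto A f l'" "\<And>k. f k \<in> L2 A" "l \<in> L2 A" "l' \<in> L2 A"
  shows "ip A (l' - l) (l' - l) = 0"
proof -
  have "ip A (l' - l) (l' - l) \<le> 2 * ip A (f k - l) (f k - l) + 2 * ip A (f k - l') (f k - l')" for k
    using psd_form_triangle[where A = "ip A", OF psd_form_ip subspace_L2 subspace_diff[OF subspace_L2 assms(3,4)]
        subspace_diff[OF subspace_L2 assms(5,3)], of k k] ip_diff_commute[of A l' "f k"] by simp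
  moreover have "(\<lambda>k. 2 * ip A (f k - l) (f k - l) + 2 * ip A (f k - l') (f k - l')) \<longlonglongrightarrow> 2 * 0 + 2 * 0"
    using assms(1,2) unfolding L2_tendsto_iff by (intro tendsto_intros)
  ultimately have "ip A (l' - l) (l' - l) \<le> 2 * 0 + 2 * 0"
    by (intro LIMSEQ_le_const) auto
  then show ?thesis using ip_self_nonneg[of A "l' - l"] by simp
qed

lemma L2lim:
  assumes "l \<in> S" "L2_tendsto A f l"
  shows "L2lim A S f \<in> S" "L2_tendsto A f (L2lim A S f)"
proof -
  have "L2lim A S f \<in> S \<and> (\<lambda>k. L2norm A (\<lambda>x. f k x - L2lim A S f x)) \<longlonglongrightarrow> 0"
    unfolding L2lim_def by (rule someI[where x = l]) (use assms in \<open>simp add: L2_tendsto_def\<close>)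
  then show "L2lim A S f \<in> S" "L2_tendsto A f (L2lim A S f)" by (auto simp: L2_tendsto_def)
qed

section \<open>Homogeneous error equations\<close>

lemma monolithicD:
  assumes "monolithic X D G r s \<delta> \<beta> p q u P Q U"
  shows "expands G r p P" "expands G r q Q" "expands G r u U"
    and "\<And>n i. n \<in> {1..steps G} \<Longrightarrow> i \<le> r \<Longrightarrow> P n i \<in> W_h X s"
    and "\<And>n i. n \<in> {1..steps G} \<Longrightarrow> i \<le> r \<Longrightarrow> Q n i \<in> V_h X s"
    and "\<And>n i. n \<in> {1..steps G} \<Longrightarrow> i \<le> r \<Longrightarrow> U n i \<in> H_h X (s + 1)"
    and "\<And>n i w. n \<in> {1..steps G} \<Longrightarrow> i \<le> r \<Longrightarrow> w \<in> W_h X s \<Longrightarrow>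
      mass_eq X D G r 0 n i (if n = 1 then (\<lambda>_. 0) else left_lim p (tn G (n - 1)))
        (if n = 1 then (\<lambda>_. 0) else left_lim u (tn G (n - 1))) (P n) (P n) (Q n) (U n) w"
    and "\<And>n i v. n \<in> {1..steps G} \<Longrightarrow> i \<le> r \<Longrightarrow> v \<in> V_h X s \<Longrightarrow> darcy_eq X D (P n i) (Q n i) v"
    and "\<And>n i z. n \<in> {1..steps G} \<Longrightarrow> i \<le> r \<Longrightarrow> z \<in> H_h X (s + 1) \<Longrightarrow>
      mech_eq X D \<delta> \<beta> (gnode G n i) (P n i) (U n i) z"
  using assms unfolding monolithic_def Let_def by blast+

lemma splittingD:
  assumes "splitting X D G r s \<delta> \<beta> L pk qk uk Pk Qk Uk"
  shows "\<And>k. expands G r (pk k) (Pk k)" "\<And>k. expands G r (qk k) (Qk k)" "\<And>k. expands G r (uk k) (Uk k)"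
    and "\<And>k n i. n \<in> {1..steps G} \<Longrightarrow> i \<le> r \<Longrightarrow> Pk k n i \<in> W_h X s"
    and "\<And>k n i. n \<in> {1..steps G} \<Longrightarrow> i \<le> r \<Longrightarrow> Qk k n i \<in> V_h X s"
    and "\<And>k n i. n \<in> {1..steps G} \<Longrightarrow> i \<le> r \<Longrightarrow> Uk k n i \<in> H_h X (s + 1)"
    and "\<And>k n i w. n \<in> {1..steps G} \<Longrightarrow> i \<le> r \<Longrightarrow> w \<in> W_h X s \<Longrightarrow>
      mass_eq X D G r L n i (if n = 1 then (\<lambda>_. 0) else L2lim (region X) (W_h X s) (\<lambda>k. left_lim (pk k) (tn G (n - 1))))
        (if n = 1 then (\<lambda>_. 0) else L2lim (region X) (H_h X (s + 1)) (\<lambda>k. left_lim (uk k) (tn G (n - 1))))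
        (Pk (Suc k) n) (Pk k n) (Qk (Suc k) n) (Uk k n) w"
    and "\<And>k n i v. n \<in> {1..steps G} \<Longrightarrow> i \<le> r \<Longrightarrow> v \<in> V_h X s \<Longrightarrow>
      darcy_eq X D (Pk (Suc k) n i) (Qk (Suc k) n i) v"
    and "\<And>k n i z. n \<in> {1..steps G} \<Longrightarrow> i \<le> r \<Longrightarrow> z \<in> H_h X (s + 1) \<Longrightarrow>
      mech_eq X D \<delta> \<beta> (gnode G n i) (Pk (Suc k) n i) (Uk (Suc k) n i) z"
  using assms unfolding splitting_def Let_def by blast+

context mesh_geometry
begin

text \<open>The sources cancel in the difference, and the stabilization increment is unchanged when
  the monolithic coefficient is subtracted from both iterates.\<close>

lemma mass_eq_diff:
  assumes w: "w \<in> W_h X s" and i: "i \<le> r"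
    and P: "\<And>j. j \<le> r \<Longrightarrow> P j \<in> W_h X s" "\<And>j. j \<le> r \<Longrightarrow> P' j \<in> W_h X s" "\<And>j. j \<le> r \<Longrightarrow> P0 j \<in> W_h X s"
    and Q: "Q i \<in> V_h X s" "Q' i \<in> V_h X s"
    and U: "\<And>j. j \<le> r \<Longrightarrow> U j \<in> H_h X l" "\<And>j. j \<le> r \<Longrightarrow> U' j \<in> H_h X l"
    and split: "mass_eq X D G r L n i p0' u0' P' P0 Q' U' w"
    and mono: "mass_eq X D G r 0 n i p0 u0 P P Q U w"
    and start: "ip (region X) p0' w = ip (region X) p0 w" "div_form X u0' w = div_form X u0 w"
  shows "1 / modM D * (\<Sum>j\<le>r. alpha G r n i j * ip (region X) (P' j - P j) w)
      + L * (\<Sum>j\<le>r. alpha G r n i j * ip (region X) ((P' j - P j) - (P0 j - P j)) w)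
      + tau G n * betaii G r n i * ip (region X) (wdiv (region X) (Q' i - Q i)) w
      = - coup D * (\<Sum>j\<le>r. alpha G r n i j * div_form X (U' j - U j) w)"
proof -
  have "(P' j - P j) - (P0 j - P j) = (\<lambda>x. P' j x - P0 j x)" for j by (simp add: fun_eq_iff)
  moreover have "(\<Sum>j\<le>r. alpha G r n i j * ip (region X) (P' j - P j) w)
      = (\<Sum>j\<le>r. alpha G r n i j * ip (region X) (P' j) w) - (\<Sum>j\<le>r. alpha G r n i j * ip (region X) (P j) w)"
    unfolding sum_subtractf[symmetric]
    by (intro sum.cong refl) (simp add: lin_on_diff[OF psd_formD(4)[OF psd_ip_on(1) w] subspace_W_h] P right_diff_distrib)
  moreover have "(\<Sum>j\<le>r. alpha G r n i j * div_form X (U' j - U j) w)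
      = (\<Sum>j\<le>r. alpha G r n i j * div_form X (U' j) w) - (\<Sum>j\<le>r. alpha G r n i j * div_form X (U j) w)"
    unfolding sum_subtractf[symmetric]
    by (intro sum.cong refl) (simp add: lin_on_diff[OF bil_on_left[OF bil_on_div_form w] subspace_H_h[of l]] U right_diff_distrib)
  moreover have "ip (region X) (wdiv (region X) (Q' i - Q i)) w = ip (region X) (wdiv (region X) (Q' i)) w - ip (region X) (wdiv (region X) (Q i)) w"
    by (rule lin_on_diff[OF bil_on_left[OF bil_on_wdiv[OF open_region] W_h_L2[OF w]] subspace_Hdiv[OF open_region] V_h_Hdiv[OF Q(2)] V_h_Hdiv[OF Q(1)]])
  ultimately show ?thesis
    using split mono unfolding mass_eq_def start by (simp add: right_diff_distrib)
qed

lemma darcy_eq_diff: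
  assumes "biot_data X r G D" "v \<in> V_h X s" "P \<in> W_h X s" "P' \<in> W_h X s" "Q \<in> V_h X s" "Q' \<in> V_h X s"
    and "darcy_eq X D P Q v" "darcy_eq X D P' Q' v"
  shows "perm_form D (Q' - Q) v = ip (region X) (P' - P) (wdiv (region X) v)"
  using assms(7,8)
    lin_on_diff[OF psd_formD(4)[OF psd_perm_form[OF assms(1)] V_h_L2[OF assms(2)]] subspace_L2 V_h_L2[OF assms(6)] V_h_L2[OF assms(5)]]
    lin_on_diff[OF bil_on_left[OF bil_on_ip wdiv_L2[OF V_h_Hdiv[OF assms(2)]]] subspace_L2 W_h_L2[OF assms(4)] W_h_L2[OF assms(3)]]
  by (simp add: darcy_eq_def perm_form_def)

lemma mech_eq_diff:
  assumes z: "z \<in> H_h X l" and "P \<in> W_h X s" "P' \<in> W_h X s" "U \<in> H_h X l" "U' \<in> H_h X l"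
    and "mech_eq X D \<delta> \<beta> t P U z" "mech_eq X D \<delta> \<beta> t P' U' z"
  shows "mech_form D \<delta> \<beta> (U' - U) z = coupling D z (P' - P)"
proof -
  have "mech_form D \<delta> \<beta> y z = rho D * ip (region X) (grav D t) z + coupling D z w" if "mech_eq X D \<delta> \<beta> t w y z" for w y
    using that by (simp add: mech_eq_def mech_form_def elastic_form_def coupling_def)
  from this[OF assms(6)] this[OF assms(7)] show ?thesis
    using lin_on_diff[OF bil_on_left[OF bil_on_mech_form z] subspace_H_h assms(5,4)]
      lin_on_diff[OF bil_on_right[OF bil_on_coupling z] subspace_W_h assms(3,2)] by simp
qed

text \<open>\<open>L2lim\<close> is an arbitrary representative; it differs from l by a null vector,
  which no test function sees.\<close>

lemma L2lim_start:
  assumes "L2_tendsto (region X) f l" "\<And>k. f k \<in> W_h X s" "l \<in> W_h X s" "w \<in> W_h X s"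
  shows "ip (region X) (L2lim (region X) (W_h X s) f) w = ip (region X) l w"
proof -
  note l' = L2lim[OF assms(3,1)]
  have d: "L2lim (region X) (W_h X s) f - l \<in> W_h X s" by (rule subspace_diff[OF subspace_W_h l'(1) assms(3)])
  have "ip (region X) (L2lim (region X) (W_h X s) f - l) (L2lim (region X) (W_h X s) f - l) = 0"
    by (rule L2_tendsto_unique[OF assms(1) l'(2)]) (use assms(2,3) l'(1) W_h_L2 in blast)+
  from psd_form_null[where A = "ip (region X)", OF psd_ip_on(1) subspace_W_h d assms(4) this]
  show ?thesis using lin_on_diff[OF psd_formD(4)[OF psd_ip_on(1) assms(4)] subspace_W_h l'(1) assms(3)] by simp
qed

lemma L2lim_start_div:
  assumes "L2_tendsto (region X) f l" "\<And>k. f k \<in> H_h X m" "l \<in> H_h X m" "w \<in> W_h X s"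
  shows "div_form X (L2lim (region X) (H_h X m) f) w = div_form X l w"
proof -
  note l' = L2lim[OF assms(3,1)]
  have d: "L2lim (region X) (H_h X m) f - l \<in> H_h X m" by (rule subspace_diff[OF subspace_H_h l'(1) assms(3)])
  have "ip (region X) (L2lim (region X) (H_h X m) f - l) (L2lim (region X) (H_h X m) f - l) = 0"
    by (rule L2_tendsto_unique[OF assms(1) l'(2)]) (use assms(2,3) l'(1) H_h_L2 in blast)+
  from div_form_null_L2[OF d this, of w]
  show ?thesis using lin_on_diff[OF bil_on_left[OF bil_on_div_form assms(4)] subspace_H_h l'(1) assms(3)] by simp
qed

text \<open>The start values of an interval are limits of the iterates on the preceding one, so the
  error equations are homogeneous only after convergence there is known. This forces the induction
  on n.\<close>

lemma splitting_error_at: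
  assumes pm: "penalized_mechanics X D \<delta> \<beta> (s + 1) s \<kappa> CT CL" and tg: "time_grid T r G"
    and data: "biot_data X r G D" and L: "L \<ge> CT"
    and m: "monolithic X D G r s \<delta> \<beta> p q u P Q U" and sp: "splitting X D G r s \<delta> \<beta> L pk qk uk Pk Qk Uk"
  shows "n \<in> {1..steps G} \<Longrightarrow> splitting_error X D \<delta> \<beta> (s + 1) s \<kappa> CT CL G r n L
    (\<lambda>k j. Pk k n j - P n j) (\<lambda>k j. Qk k n j - Q n j) (\<lambda>k j. Uk k n j - U n j)"
proof (induction n)
  case 0
  then show ?case by simp
next
  case (Suc m')
  note n = Suc.prems and M = monolithicD[OF m] and S = splittingD[OF sp]
  let ?pm = "left_lim p (tn G (Suc m' - 1))" and ?um = "left_lim u (tn G (Suc m' - 1))"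
  let ?ps = "L2lim (region X) (W_h X s) (\<lambda>k. left_lim (pk k) (tn G (Suc m' - 1)))"
  let ?us = "L2lim (region X) (H_h X (s + 1)) (\<lambda>k. left_lim (uk k) (tn G (Suc m' - 1)))"
  \<comment> \<open>Agreement is claimed only for the two functionals through which start values
    enter; the functions themselves may differ on a null set.\<close>
  have start: "ip (region X) (if Suc m' = 1 then (\<lambda>_. 0) else ?ps) w = ip (region X) (if Suc m' = 1 then (\<lambda>_. 0) else ?pm) w"
    "div_form X (if Suc m' = 1 then (\<lambda>_. 0) else ?us) w = div_form X (if Suc m' = 1 then (\<lambda>_. 0) else ?um) w"
    if w: "w \<in> W_h X s" for w
  proof -
    have "ip (region X) ?ps w = ip (region X) ?pm w \<and> div_form X ?us w = div_form X ?um w" if "m' \<noteq> 0"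
    proof
      have m': "m' \<in> {1..steps G}" using n that by auto
      note E = Suc.IH[OF m']
      have Wp: "left_lim (pk k) (tn G m') \<in> W_h X s" "left_lim p (tn G m') \<in> W_h X s" for k
        unfolding left_lim_expands[OF tg S(1) m'] left_lim_expands[OF tg M(1) m']
        by (simp_all add: subspace_combination[OF subspace_W_h] S(4)[OF m'] M(4)[OF m'])
      have Hu: "left_lim (uk k) (tn G m') \<in> H_h X (s + 1)" "left_lim u (tn G m') \<in> H_h X (s + 1)" for k
        unfolding left_lim_expands[OF tg S(3) m'] left_lim_expands[OF tg M(3) m']
        by (simp_all add: subspace_combination[OF subspace_H_h] S(6)[OF m', simplified] M(6)[OF m', simplified])
      have tp: "L2_tendsto (region X) (\<lambda>k. left_lim (pk k) (tn G m')) (left_lim p (tn G m'))"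
        unfolding left_lim_expands[OF tg S(1) m'] left_lim_expands[OF tg M(1) m']
        by (rule L2_tendsto_combination[OF W_h_L2[OF splitting_error.in_spaces(1)[OF E]] splitting_error.eP_tendsto_0[OF E]])
      have tu: "L2_tendsto (region X) (\<lambda>k. left_lim (uk k) (tn G m')) (left_lim u (tn G m'))"
        unfolding left_lim_expands[OF tg S(3) m'] left_lim_expands[OF tg M(3) m']
        by (rule L2_tendsto_combination[OF H_h_L2[OF splitting_error.in_spaces(3)[OF E]] splitting_error.eU_tendsto_0[OF E]])
      show "ip (region X) ?ps w = ip (region X) ?pm w"
        unfolding diff_Suc_1 by (rule L2lim_start[OF tp Wp w])
      show "div_form X ?us w = div_form X ?um w"
        unfolding diff_Suc_1 by (rule L2lim_start_div[OF tu Hu w])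
    qed
    then show "ip (region X) (if Suc m' = 1 then (\<lambda>_. 0) else ?ps) w = ip (region X) (if Suc m' = 1 then (\<lambda>_. 0) else ?pm) w"
      "div_form X (if Suc m' = 1 then (\<lambda>_. 0) else ?us) w = div_form X (if Suc m' = 1 then (\<lambda>_. 0) else ?um) w"
      by auto
  qed
  show ?case
  proof (intro splitting_error.intro splitting_error_axioms.intro pm time_grid_intervalI[OF tg n] data L)
    fix k i assume i: "i \<le> r"
    show "Pk k (Suc m') i - P (Suc m') i \<in> W_h X s" by (rule subspace_diff[OF subspace_W_h S(4)[OF n i] M(4)[OF n i]])
    show "Qk k (Suc m') i - Q (Suc m') i \<in> V_h X s" by (rule subspace_diff[OF subspace_V_h S(5)[OF n i] M(5)[OF n i]])
    show "Uk k (Suc m') i - U (Suc m') i \<in> H_h X (s + 1)" by (rule subspace_diff[OF subspace_H_h S(6)[OF n i] M(6)[OF n i]])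
  next
    fix k i w assume i: "i \<le> r" and w: "w \<in> W_h X s"
    show "1 / modM D * (\<Sum>j\<le>r. alpha G r (Suc m') i j * ip (region X) (Pk (Suc k) (Suc m') j - P (Suc m') j) w)
      + L * (\<Sum>j\<le>r. alpha G r (Suc m') i j * ip (region X) (Pk (Suc k) (Suc m') j - P (Suc m') j - (Pk k (Suc m') j - P (Suc m') j)) w)
      + tau G (Suc m') * betaii G r (Suc m') i * ip (region X) (wdiv (region X) (Qk (Suc k) (Suc m') i - Q (Suc m') i)) w
      = - coup D * (\<Sum>j\<le>r. alpha G r (Suc m') i j * div_form X (Uk k (Suc m') j - U (Suc m') j) w)"
      by (rule mass_eq_diff[OF w i M(4)[OF n] S(4)[OF n] S(4)[OF n] M(5)[OF n i] S(5)[OF n i] M(6)[OF n] S(6)[OF n]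
            S(7)[OF n i w] M(7)[OF n i w] start[OF w]])
  next
    fix k i v assume i: "i \<le> r" and v: "v \<in> V_h X s"
    show "perm_form D (Qk (Suc k) (Suc m') i - Q (Suc m') i) v
        = ip (region X) (Pk (Suc k) (Suc m') i - P (Suc m') i) (wdiv (region X) v)"
      by (rule darcy_eq_diff[OF data v M(4)[OF n i] S(4)[OF n i] M(5)[OF n i] S(5)[OF n i] M(8)[OF n i v] S(8)[OF n i v]])
  next
    fix k i z assume i: "i \<le> r" and z: "z \<in> H_h X (s + 1)"
    show "mech_form D \<delta> \<beta> (Uk (Suc k) (Suc m') i - U (Suc m') i) z
        = coupling D z (Pk (Suc k) (Suc m') i - P (Suc m') i)"
      by (rule mech_eq_diff[OF z M(4)[OF n i] S(4)[OF n i] M(6)[OF n i] S(6)[OF n i] M(9)[OF n i z] S(9)[OF n i z]])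
  qed
qed

end

theorem theorem3p1:
  fixes X :: "('d::finite) mesh" and D :: "'d biot" and G :: tgrid
    and T \<beta> :: real and r s :: nat
  assumes "CARD('d) \<in> {2, 3}"
    and "lipschitz_domain (region X)" and "polyhedral (region X)"
    and "fe_mesh X"
    and "T > 0" and "time_grid T r G"
    and "biot_data X r G D"
    and "\<beta> > 0"
  shows "\<exists>L0>0. \<exists>\<delta>0>0. \<forall>L\<ge>L0. \<forall>\<delta>. (\<forall>e\<in>int_faces X. \<delta> e \<ge> \<delta>0) \<longrightarrow>
    (\<forall>p q u P Q U pk qk uk Pk Qk Uk.
       monolithic X D G r s \<delta> \<beta> p q u P Q U \<longrightarrow>
       splitting X D G r s \<delta> \<beta> L pk qk uk Pk Qk Uk \<longrightarrow>
       (\<forall>n\<in>{1..steps G}. \<forall>i\<le>r. \<exists>S\<in>W_h X s. L2_tendsto (region X) (S_p G r Pk P n i) S) \<and>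
       (\<forall>n\<in>{1..steps G}.
          L2_tendsto (region X) (\<lambda>k. left_lim (pk k) (tn G n)) (left_lim p (tn G n)) \<and>
          Hdiv_tendsto (region X) (\<lambda>k. left_lim (qk k) (tn G n)) (left_lim q (tn G n)) \<and>
          L2_tendsto (region X) (\<lambda>k. left_lim (uk k) (tn G n)) (left_lim u (tn G n))) \<and>
       (\<forall>n\<in>{1..<steps G}.
          L2_tendsto (region X) (\<lambda>k. right_lim (pk k) (tn G n)) (right_lim p (tn G n)) \<and>
          Hdiv_tendsto (region X) (\<lambda>k. right_lim (qk k) (tn G n)) (right_lim q (tn G n)) \<and>
          L2_tendsto (region X) (\<lambda>k. right_lim (uk k) (tn G n)) (right_lim u (tn G n))) \<and>
       (\<forall>n\<in>{1..steps G}.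
          L2_time_tendsto (region X) (I_n G n) pk p \<and>
          L2_time_tendsto (region X) (I_n G n) qk q \<and>
          L2_time_tendsto (region X) (I_n G n) uk u))"
proof -
  interpret mesh_geometry X using assms(2,4) by unfold_locales (auto simp: lipschitz_domain_def)
  have "mu D > 0" "lam D > 0" "coup D > 0" "modM D > 0" using assms(7) by (simp_all add: biot_data_def)
  from penalized_mechanics_exists[OF this, where \<beta> = \<beta> and l = "s + 1" and s = s]
  obtain \<delta>0 \<kappa> CT CL where \<delta>0: "\<delta>0 > 0" and CT: "CT > 0"
    and pm: "\<forall>\<delta>. (\<forall>e\<in>int_faces X. \<delta> e \<ge> \<delta>0) \<longrightarrow> penalized_mechanics X D \<delta> \<beta> (s + 1) s \<kappa> CT CL"
    by (elim exE conjE) (rule that)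
  note tg = assms(6)
  show ?thesis
  proof (rule exI[of _ CT], rule conjI[OF CT], rule exI[of _ \<delta>0], rule conjI[OF \<delta>0], intro allI impI)
    fix L \<delta> p q u P Q U pk qk uk Pk Qk Uk
    assume L: "CT \<le> L" and \<delta>: "\<forall>e\<in>int_faces X. \<delta>0 \<le> \<delta> e"
      and m: "monolithic X D G r s \<delta> \<beta> p q u P Q U" and sp: "splitting X D G r s \<delta> \<beta> L pk qk uk Pk Qk Uk"
    have E: "splitting_error X D \<delta> \<beta> (s + 1) s \<kappa> CT CL G r n L
      (\<lambda>k j. Pk k n j - P n j) (\<lambda>k j. Qk k n j - Q n j) (\<lambda>k j. Uk k n j - U n j)" if "n \<in> {1..steps G}" for n
      by (rule splitting_error_at[OF _ tg assms(7) L m sp that]) (use pm \<delta> in blast)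
    note M = monolithicD[OF m] and S = splittingD[OF sp]
    have limP: "L2_tendsto (region X) (\<lambda>k. \<Sum>j\<le>r. c j *\<^sub>R Pk k n j) (\<Sum>j\<le>r. c j *\<^sub>R P n j)"
      if n: "n \<in> {1..steps G}" for n c
      by (rule L2_tendsto_combination[OF W_h_L2[OF splitting_error.in_spaces(1)[OF E[OF n]]]
            splitting_error.eP_tendsto_0[OF E[OF n]]])
    have limU: "L2_tendsto (region X) (\<lambda>k. \<Sum>j\<le>r. c j *\<^sub>R Uk k n j) (\<Sum>j\<le>r. c j *\<^sub>R U n j)"
      if n: "n \<in> {1..steps G}" for n c
      by (rule L2_tendsto_combination[OF H_h_L2[OF splitting_error.in_spaces(3)[OF E[OF n]]]
            splitting_error.eU_tendsto_0[OF E[OF n]]])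
    have limQ: "Hdiv_tendsto (region X) (\<lambda>k. \<Sum>j\<le>r. c j *\<^sub>R Qk k n j) (\<Sum>j\<le>r. c j *\<^sub>R Q n j)"
      if n: "n \<in> {1..steps G}" for n c
      by (rule Hdiv_tendsto_combination[OF open_region V_h_Hdiv[OF splitting_error.in_spaces(2)[OF E[OF n]]]
            splitting_error.eQ_tendsto_0[OF E[OF n]]])
    have "\<exists>S\<in>W_h X s. L2_tendsto (region X) (S_p G r Pk P n i) S" if n: "n \<in> {1..steps G}" and i: "i \<le> r" for n i
    proof
      \<comment> \<open>The limit is the zero function, since \<open>S_p\<close> is the combined
        pressure error \<open>SP\<close> of the locale.\<close>
      show "0 \<in> W_h X s" by (rule subspace_0[OF subspace_W_h])
      have "S_p G r Pk P n i k = splitting_error.SP G r n (\<lambda>k j. Pk k n j - P n j) k i" for k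
        by (simp add: fun_eq_iff splitting_error.SP_def[OF E[OF n]] S_p_def sum_fun_apply)
      then show "L2_tendsto (region X) (S_p G r Pk P n i) 0"
        using splitting_error.SP_tendsto_0[OF E[OF n] i] by (simp add: L2_tendsto_iff)
    qed
    moreover have "L2_tendsto (region X) (\<lambda>k. left_lim (pk k) (tn G n)) (left_lim p (tn G n)) \<and>
        Hdiv_tendsto (region X) (\<lambda>k. left_lim (qk k) (tn G n)) (left_lim q (tn G n)) \<and>
        L2_tendsto (region X) (\<lambda>k. left_lim (uk k) (tn G n)) (left_lim u (tn G n))" if n: "n \<in> {1..steps G}" for n
      unfolding left_lim_expands[OF tg S(1) n] left_lim_expands[OF tg M(1) n] left_lim_expands[OF tg S(2) n]
        left_lim_expands[OF tg M(2) n] left_lim_expands[OF tg S(3) n] left_lim_expands[OF tg M(3) n]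
      by (intro conjI limP[OF n] limQ[OF n] limU[OF n])
    moreover have "L2_tendsto (region X) (\<lambda>k. right_lim (pk k) (tn G n)) (right_lim p (tn G n)) \<and>
        Hdiv_tendsto (region X) (\<lambda>k. right_lim (qk k) (tn G n)) (right_lim q (tn G n)) \<and>
        L2_tendsto (region X) (\<lambda>k. right_lim (uk k) (tn G n)) (right_lim u (tn G n))" if n: "n \<in> {1..<steps G}" for n
    proof -
      have n': "Suc n \<in> {1..steps G}" using n by auto
      show ?thesis
        unfolding right_lim_expands[OF tg S(1) n] right_lim_expands[OF tg M(1) n] right_lim_expands[OF tg S(2) n]
          right_lim_expands[OF tg M(2) n] right_lim_expands[OF tg S(3) n] right_lim_expands[OF tg M(3) n]
        by (intro conjI limP[OF n'] limQ[OF n'] limU[OF n'])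
    qed
    moreover have "L2_time_tendsto (region X) (I_n G n) pk p \<and> L2_time_tendsto (region X) (I_n G n) qk q \<and>
        L2_time_tendsto (region X) (I_n G n) uk u" if n: "n \<in> {1..steps G}" for n
    proof (intro conjI)
      note e = S(1-3)[unfolded expands_def, rule_format, OF n] M(1-3)[unfolded expands_def, rule_format, OF n]
      show "L2_time_tendsto (region X) (I_n G n) pk p"
        by (rule L2_time_tendsto_combination[OF W_h_L2[OF splitting_error.in_spaces(1)[OF E[OF n]]]
              splitting_error.eP_tendsto_0[OF E[OF n]] e(1,4)])
      show "L2_time_tendsto (region X) (I_n G n) qk q"
        by (rule L2_time_tendsto_combination[OF V_h_L2[OF splitting_error.in_spaces(2)[OF E[OF n]]]
              splitting_error.eQ_tendsto_0(1)[OF E[OF n]] e(2,5)])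
      show "L2_time_tendsto (region X) (I_n G n) uk u"
        by (rule L2_time_tendsto_combination[OF H_h_L2[OF splitting_error.in_spaces(3)[OF E[OF n]]]
              splitting_error.eU_tendsto_0[OF E[OF n]] e(3,6)])
    qed
    ultimately show "(\<forall>n\<in>{1..steps G}. \<forall>i\<le>r. \<exists>S\<in>W_h X s. L2_tendsto (region X) (S_p G r Pk P n i) S) \<and>
       (\<forall>n\<in>{1..steps G}.
          L2_tendsto (region X) (\<lambda>k. left_lim (pk k) (tn G n)) (left_lim p (tn G n)) \<and>
          Hdiv_tendsto (region X) (\<lambda>k. left_lim (qk k) (tn G n)) (left_lim q (tn G n)) \<and>
          L2_tendsto (region X) (\<lambda>k. left_lim (uk k) (tn G n)) (left_lim u (tn G n))) \<and>
       (\<forall>n\<in>{1..<steps G}.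
          L2_tendsto (region X) (\<lambda>k. right_lim (pk k) (tn G n)) (right_lim p (tn G n)) \<and>
          Hdiv_tendsto (region X) (\<lambda>k. right_lim (qk k) (tn G n)) (right_lim q (tn G n)) \<and>
          L2_tendsto (region X) (\<lambda>k. right_lim (uk k) (tn G n)) (right_lim u (tn G n))) \<and>
       (\<forall>n\<in>{1..steps G}.
          L2_time_tendsto (region X) (I_n G n) pk p \<and>
          L2_time_tendsto (region X) (I_n G n) qk q \<and>
          L2_time_tendsto (region X) (I_n G n) uk u)"
      by blast
  qed
qed

end
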